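(* Let $w = w_1\cdots w_n \in \mathfrak{S}_n$ avoid the pattern $312$ and define the sequence $(f(1),\dotsc,f(n))$ by $f(j)=\max\{w_1,\dotsc,w_j\}$. Then $$\psi_q^{(n)}\big(q^{\ell(w)/2}\, C'_w(q)\big) = [n]_q\,[f(1)-1]_q\,[f(2)-2]_q\cdots[f(n-1)-(n-1)]_q.$$
   Context: $w$ (in one-line notation) avoids $312$ if there are no $i<j<k$ with $w_j<w_k<w_i$. $[a]_q=1+q+\cdots+q^{a-1}$ for $a\ge 1$ and $[0]_q=0$. $H_n(q)$ is the $\mathbb{Z}[q^{1/2},q^{-1/2}]$-algebra with identity $T_e$, generators $T_{s_1},\dotsc,T_{s_{n-1}}$ and relations $T_{s_i}^2=(q-1)T_{s_i}+qT_e$, $T_{s_i}T_{s_j}T_{s_i}=T_{s_j}T_{s_i}T_{s_j}$ for $|i-j|=1$, $T_{s_i}T_{s_j}=T_{s_j}T_{s_i}$ for $|i-j|\ge 2$; $T_w=T_{s_{i_1}}\cdots T_{s_{i_\ell}}$ for a reduced expression $w=s_{i_1}\cdots s_{i_\ell}$, and $\ell(w)=\ell$ is the length (number of inversions) of $w$. The signless Kazhdan-Lusztig basis is $C'_w(q)=q^{-\ell(w)/2}\sum_{v\le w}P_{v,w}(q)T_v$, with $\le$ the Bruhat order and $P_{v,w}$ the Kazhdan-Lusztig polynomials (it is known that $P_{v,w}=1$ for all $v\le w$ when $w$ avoids $3412$ and $4231$, in particular when $w$ avoids $312$). $\chi_q^\lambda$ are the irreducible $H_n(q)$-characters, specializing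 at $q^{1/2}=1$ to the irreducible $\mathfrak{S}_n$-characters $\chi^\lambda$ (so $\chi_q^{(n)}(T_w)=q^{\ell(w)}$). The monomial traces are $\phi_q^\lambda=\sum_\mu K^{-1}_{\lambda,\mu}\chi_q^\mu$ (inverse Kostka numbers, $m_\lambda=\sum_\mu K^{-1}_{\lambda,\mu}s_\mu$), and the power sum traces are $\psi_q^\lambda=\sum_\mu L_{\lambda,\mu}\phi_q^\mu$, where $L_{\lambda,\mu}$ is the number of row-constant Young tableaux of shape $\lambda$ and content $\mu$ (so $p_\lambda=\sum_\mu L_{\lambda,\mu}m_\mu$; in particular $\psi_q^{(n)}=\phi_q^{(n)}$). *)

theory Defs
  imports
    "HOL-Algebra.QuotRing"
    "HOL-Library.Poly_Mapping"
    "HOL-Library.FuncSet"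
    "HOL-Computational_Algebra.Polynomial"
    "HOL-Computational_Algebra.Fraction_Field"
    "HOL-Combinatorics.Permutations"
    "Jordan_Normal_Form.Matrix"
begin

section \<open>The coefficient ring\<close>

text \<open>Elements of \<open>\<int>[q\<^sup>1\<^sup>/\<^sup>2, q\<^sup>-\<^sup>1\<^sup>/\<^sup>2]\<close> are finitely supported maps \<open>int \<Rightarrow>\<^sub>0 int\<close> with convolution
  product; the exponent \<open>k\<close> stands for the monomial \<open>q\<^sup>k\<^sup>/\<^sup>2\<close>.\<close>

type_synonym laurent = "int \<Rightarrow>\<^sub>0 int"

definition qhalf :: "int \<Rightarrow> laurent" where
  "qhalf k = Poly_Mapping.single k 1"

definition qvar :: laurent where
  "qvar = qhalf 2"

definition q_bracket :: "nat \<Rightarrow> laurent" where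
  "q_bracket a = (\<Sum>i<a. qvar ^ i)"

definition poly_in_q :: "int poly \<Rightarrow> laurent" where
  "poly_in_q p = (\<Sum>i\<le>degree p. of_int (coeff p i) * qvar ^ i)"

definition laurent_bar :: "laurent \<Rightarrow> laurent" where
  "laurent_bar r = Poly_Mapping.map_key uminus r"

text \<open>Specialization at \<open>q\<^sup>1\<^sup>/\<^sup>2 = 1\<close>.\<close>

definition eval_one :: "laurent \<Rightarrow> int" where
  "eval_one r = (\<Sum>k\<in>Poly_Mapping.keys r. Poly_Mapping.lookup r k)"


section \<open>Permutations\<close>

text \<open>Elements of \<open>\<SS>\<^sub>n\<close> are functions \<open>w\<close> with \<open>w permutes {1..n}\<close>; the one-line notation of \<open>w\<close> is
  \<open>w 1, \<dots>, w n\<close> and products are compositions of functions.\<close>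

definition avoids_312 :: "nat \<Rightarrow> (nat \<Rightarrow> nat) \<Rightarrow> bool" where
  "avoids_312 n w \<longleftrightarrow>
     \<not> (\<exists>i j k. 1 \<le> i \<and> i < j \<and> j < k \<and> k \<le> n \<and> w j < w k \<and> w k < w i)"

definition perm_len :: "nat \<Rightarrow> (nat \<Rightarrow> nat) \<Rightarrow> nat" where
  "perm_len n w = card {(i, j). 1 \<le> i \<and> i < j \<and> j \<le> n \<and> w j < w i}"

definition perm_of_word :: "nat list \<Rightarrow> nat \<Rightarrow> nat" where
  "perm_of_word is = foldr (\<lambda>i v. transpose i (Suc i) \<circ> v) is id"

definition reduced_word :: "nat \<Rightarrow> (nat \<Rightarrow> nat) \<Rightarrow> nat list \<Rightarrow> bool" where
  "reduced_word n w is \<longleftrightarrow>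
     set is \<subseteq> {1..<n} \<and> perm_of_word is = w \<and> length is = perm_len n w"

definition bruhat_step :: "nat \<Rightarrow> (nat \<Rightarrow> nat) \<Rightarrow> (nat \<Rightarrow> nat) \<Rightarrow> bool" where
  "bruhat_step n u v \<longleftrightarrow>
     (\<exists>i j. 1 \<le> i \<and> i < j \<and> j \<le> n \<and> v = u \<circ> transpose i j) \<and> perm_len n u < perm_len n v"

definition bruhat_le :: "nat \<Rightarrow> (nat \<Rightarrow> nat) \<Rightarrow> (nat \<Rightarrow> nat) \<Rightarrow> bool" where
  "bruhat_le n v w \<longleftrightarrow> v permutes {1..n} \<and> w permutes {1..n} \<and> (bruhat_step n)\<^sup>*\<^sup>* v w"


section \<open>The Hecke algebra, by generators and relations\<close>

text \<open>Wrapping lists makes the free monoid an instance of \<^class>\<open>monoid_add\<close> (with concatenation), so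
  that \<open>free_word \<Rightarrow>\<^sub>0 laurent\<close> is the free associative algebra on letters \<open>0, 1, 2, \<dots>\<close>.\<close>

datatype free_word = Word (letters: "nat list")

instantiation free_word :: monoid_add
begin

definition zero_free_word :: free_word where
  "zero_free_word = Word []"

definition plus_free_word :: "free_word \<Rightarrow> free_word \<Rightarrow> free_word" where
  "plus_free_word u v = Word (letters u @ letters v)"

instance
  by standard (simp_all add: zero_free_word_def plus_free_word_def)

end

type_synonym free_alg = "free_word \<Rightarrow>\<^sub>0 laurent"

definition free_alg_ring :: "nat \<Rightarrow> free_alg ring" where
  "free_alg_ring n =
     \<lparr>carrier = {x. \<forall>u \<in> Poly_Mapping.keys x. set (letters u) \<subseteq> {1..<n}},
      monoid.mult = (*), one = 1, zero = 0, add = (+)\<rparr>"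

definition free_gen :: "nat \<Rightarrow> free_alg" where
  "free_gen i = Poly_Mapping.single (Word [i]) 1"

definition free_const :: "laurent \<Rightarrow> free_alg" where
  "free_const r = Poly_Mapping.single 0 r"

definition hecke_relators :: "nat \<Rightarrow> free_alg set" where
  "hecke_relators n =
     {free_gen i * free_gen i - (free_const (qvar - 1) * free_gen i + free_const qvar)
        | i. i \<in> {1..<n}}
   \<union> {free_gen i * free_gen j * free_gen i - free_gen j * free_gen i * free_gen j
        | i j. i \<in> {1..<n} \<and> j \<in> {1..<n} \<and> \<bar>int i - int j\<bar> = 1}
   \<union> {free_gen i * free_gen j - free_gen j * free_gen i
        | i j. i \<in> {1..<n} \<and> j \<in> {1..<n} \<and> \<bar>int i - int j\<bar> \<ge> 2}"

definition hecke_ideal :: "nat \<Rightarrow> free_alg set" where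
  "hecke_ideal n = genideal (free_alg_ring n) (hecke_relators n)"

type_synonym hecke_elt = "free_alg set"

definition hecke :: "nat \<Rightarrow> hecke_elt ring" where
  "hecke n = free_alg_ring n Quot hecke_ideal n"

definition hecke_class :: "nat \<Rightarrow> free_alg \<Rightarrow> hecke_elt" where
  "hecke_class n x = hecke_ideal n +>\<^bsub>free_alg_ring n\<^esub> x"

definition hecke_smult :: "nat \<Rightarrow> laurent \<Rightarrow> hecke_elt \<Rightarrow> hecke_elt" where
  "hecke_smult n r h = hecke_class n (free_const r) \<otimes>\<^bsub>hecke n\<^esub> h"

definition T_gen :: "nat \<Rightarrow> nat \<Rightarrow> hecke_elt" where
  "T_gen n i = hecke_class n (free_gen i)"

text \<open>By Matsumoto's theorem the value does not depend on the reduced word that is chosen.\<close>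

definition T_basis :: "nat \<Rightarrow> (nat \<Rightarrow> nat) \<Rightarrow> hecke_elt" where
  "T_basis n w =
     foldr (\<lambda>i h. T_gen n i \<otimes>\<^bsub>hecke n\<^esub> h) (SOME is. reduced_word n w is) \<one>\<^bsub>hecke n\<^esub>"


section \<open>Kazhdan-Lusztig polynomials and the signless Kazhdan-Lusztig basis\<close>

definition is_bar_involution :: "nat \<Rightarrow> (hecke_elt \<Rightarrow> hecke_elt) \<Rightarrow> bool" where
  "is_bar_involution n \<beta> \<longleftrightarrow>
     \<beta> \<in> Ring.ring_hom (hecke n) (hecke n) \<and>
     (\<forall>r. \<forall>h \<in> carrier (hecke n). \<beta> (hecke_smult n r h) = hecke_smult n (laurent_bar r) (\<beta> h)) \<and>
     (\<forall>v. v permutes {1..n} \<longrightarrow> \<beta> (T_basis n v) = inv\<^bsub>hecke n\<^esub> (T_basis n (Hilbert_Choice.inv v)))"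

definition KL_sum :: "nat \<Rightarrow> (nat \<Rightarrow> nat) \<Rightarrow> ((nat \<Rightarrow> nat) \<Rightarrow> int poly) \<Rightarrow> hecke_elt" where
  "KL_sum n w P =
     hecke_smult n (qhalf (- int (perm_len n w)))
       (finsum (hecke n) (\<lambda>v. hecke_smult n (poly_in_q (P v)) (T_basis n v)) {v. bruhat_le n v w})"

text \<open>The degree bound below is \<open>deg P\<^sub>v\<^sub>,\<^sub>w \<le> (\<ell>(w) - \<ell>(v) - 1) / 2\<close> for \<open>v < w\<close>, without truncated subtraction.\<close>

definition is_KL_family :: "nat \<Rightarrow> (nat \<Rightarrow> nat) \<Rightarrow> ((nat \<Rightarrow> nat) \<Rightarrow> int poly) \<Rightarrow> bool" where
  "is_KL_family n w P \<longleftrightarrow>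
     P w = 1 \<and>
     (\<forall>v. \<not> bruhat_le n v w \<longrightarrow> P v = 0) \<and>
     (\<forall>v. bruhat_le n v w \<and> v \<noteq> w \<longrightarrow> 2 * degree (P v) + 1 + perm_len n v \<le> perm_len n w) \<and>
     (\<exists>\<beta>. is_bar_involution n \<beta> \<and> \<beta> (KL_sum n w P) = KL_sum n w P)"

definition KL_poly :: "nat \<Rightarrow> (nat \<Rightarrow> nat) \<Rightarrow> (nat \<Rightarrow> nat) \<Rightarrow> int poly" where
  "KL_poly n v w = (THE P. is_KL_family n w P) v"

definition KL_basis :: "nat \<Rightarrow> (nat \<Rightarrow> nat) \<Rightarrow> hecke_elt" where
  "KL_basis n w = KL_sum n w (\<lambda>v. KL_poly n v w)"


section \<open>Partitions and tableaux\<close>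

definition partitions_of :: "nat \<Rightarrow> nat list set" where
  "partitions_of n = {lam. sorted_wrt (\<ge>) lam \<and> 0 \<notin> set lam \<and> sum_list lam = n}"

definition diagram :: "nat list \<Rightarrow> (nat \<times> nat) set" where
  "diagram lam = {(i, j). i < length lam \<and> j < lam ! i}"

text \<open>Fillings of shape \<open>lam\<close> and content \<open>\<mu>\<close>; the entries are \<open>0, 1, \<dots>\<close> instead of \<open>1, 2, \<dots>\<close>.\<close>

definition fillings :: "nat list \<Rightarrow> nat list \<Rightarrow> (nat \<times> nat \<Rightarrow> nat) set" where
  "fillings lam \<mu> =
     {T \<in> diagram lam \<rightarrow>\<^sub>E {..<length \<mu>}. \<forall>k<length \<mu>. card {c \<in> diagram lam. T c = k} = \<mu> ! k}"

definition kostka :: "nat list \<Rightarrow> nat list \<Rightarrow> nat" where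
  "kostka lam \<mu> = card {T \<in> fillings lam \<mu>.
     (\<forall>i j j'. j < j' \<and> (i, j) \<in> diagram lam \<and> (i, j') \<in> diagram lam \<longrightarrow> T (i, j) \<le> T (i, j')) \<and>
     (\<forall>i i' j. i < i' \<and> (i, j) \<in> diagram lam \<and> (i', j) \<in> diagram lam \<longrightarrow> T (i, j) < T (i', j))}"

text \<open>Row \<open>lam\<close> of the inverse of the matrix \<open>(K\<^sub>\<mu>\<^sub>,\<^sub>\<nu>)\<close> with \<open>s\<^sub>\<mu> = \<Sum>\<^sub>\<nu> K\<^sub>\<mu>\<^sub>,\<^sub>\<nu> m\<^sub>\<nu>\<close>.\<close>

definition inv_kostka :: "nat \<Rightarrow> nat list \<Rightarrow> nat list \<Rightarrow> int" where
  "inv_kostka n lam = (THE c. (\<forall>\<mu>. \<mu> \<notin> partitions_of n \<longrightarrow> c \<mu> = 0) \<and>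
     (\<forall>\<nu> \<in> partitions_of n.
        (\<Sum>\<mu> \<in> partitions_of n. c \<mu> * int (kostka \<mu> \<nu>)) = (if lam = \<nu> then 1 else 0)))"

definition row_constant_count :: "nat list \<Rightarrow> nat list \<Rightarrow> nat" where
  "row_constant_count lam \<mu> = card {T \<in> fillings lam \<mu>.
     \<forall>i j j'. (i, j) \<in> diagram lam \<and> (i, j') \<in> diagram lam \<longrightarrow> T (i, j) = T (i, j')}"


section \<open>Irreducible characters of the symmetric group\<close>

text \<open>\<open>\<chi>\<^sup>\<lambda>\<close> is the character of the Specht module, spanned by polytabloids inside the permutation
  module on tabloids. A tableau of shape \<open>lam\<close> is encoded as the bijection \<open>t\<close> from the entries
  \<open>{1..n}\<close> to the cells of the diagram, so \<open>\<pi>\<close> sends \<open>t\<close> to \<open>t \<circ> \<pi>\<^sup>-\<^sup>1\<close>; its tabloid is the map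
  taking each entry to its row.\<close>

type_synonym tabloid_vec = "(nat \<Rightarrow> nat) \<Rightarrow>\<^sub>0 rat"

definition tabloid_scale :: "rat \<Rightarrow> tabloid_vec \<Rightarrow> tabloid_vec" where
  "tabloid_scale c x = Poly_Mapping.map ((*) c) x"

lemma lookup_tabloid_scale [simp]:
  "Poly_Mapping.lookup (tabloid_scale c x) r = c * Poly_Mapping.lookup x r"
  by (simp add: tabloid_scale_def Poly_Mapping.map.rep_eq when_def)

global_interpretation tabloid: vector_space tabloid_scale
  by standard (auto intro!: poly_mapping_eqI simp: lookup_add algebra_simps)

definition tableaux :: "nat \<Rightarrow> nat list \<Rightarrow> (nat \<Rightarrow> nat \<times> nat) set" where
  "tableaux n lam = {t. bij_betw t {1..n} (diagram lam)}"

definition tabloid_of :: "nat \<Rightarrow> (nat \<Rightarrow> nat \<times> nat) \<Rightarrow> nat \<Rightarrow> nat" where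
  "tabloid_of n t = restrict (\<lambda>x. fst (t x)) {1..n}"

definition column_group :: "nat \<Rightarrow> (nat \<Rightarrow> nat \<times> nat) \<Rightarrow> (nat \<Rightarrow> nat) set" where
  "column_group n t = {\<pi>. \<pi> permutes {1..n} \<and> (\<forall>x \<in> {1..n}. snd (t (\<pi> x)) = snd (t x))}"

definition polytabloid :: "nat \<Rightarrow> (nat \<Rightarrow> nat \<times> nat) \<Rightarrow> tabloid_vec" where
  "polytabloid n t =
     (\<Sum>\<pi> \<in> column_group n t.
        Poly_Mapping.single (tabloid_of n (t \<circ> Hilbert_Choice.inv \<pi>)) (of_int (sign \<pi>)))"

definition specht_module :: "nat \<Rightarrow> nat list \<Rightarrow> tabloid_vec set" where
  "specht_module n lam = tabloid.span (polytabloid n ` tableaux n lam)"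

text \<open>The action of \<open>\<sigma>\<close>: the coefficient of \<open>\<sigma>\<cdot>x\<close> at \<open>r\<close> is that of \<open>x\<close> at \<open>\<sigma>\<^sup>-\<^sup>1\<cdot>r = r \<circ> \<sigma>\<close>.\<close>

definition tabloid_act :: "(nat \<Rightarrow> nat) \<Rightarrow> tabloid_vec \<Rightarrow> tabloid_vec" where
  "tabloid_act \<sigma> x = Poly_Mapping.map_key (\<lambda>r. r \<circ> \<sigma>) x"

definition trace_on :: "tabloid_vec set \<Rightarrow> (tabloid_vec \<Rightarrow> tabloid_vec) \<Rightarrow> rat" where
  "trace_on V f =
     (let B = (SOME B. B \<subseteq> V \<and> tabloid.independent B \<and> V \<subseteq> tabloid.span B)
      in \<Sum>b\<in>B. tabloid.representation B (f b) b)"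

definition sym_char :: "nat \<Rightarrow> nat list \<Rightarrow> (nat \<Rightarrow> nat) \<Rightarrow> rat" where
  "sym_char n lam \<sigma> = trace_on (specht_module n lam) (tabloid_act \<sigma>)"


section \<open>Irreducible characters and traces of the Hecke algebra\<close>

text \<open>Representations are taken over the fraction field \<open>\<rat>(q\<^sup>1\<^sup>/\<^sup>2)\<close> of \<open>\<int>[q\<^sup>1\<^sup>/\<^sup>2, q\<^sup>-\<^sup>1\<^sup>/\<^sup>2]\<close>, which is a
  splitting field for \<open>H\<^sub>n(q)\<close>.\<close>

definition is_hecke_rep :: "nat \<Rightarrow> nat \<Rightarrow> (hecke_elt \<Rightarrow> laurent fract mat) \<Rightarrow> bool" where
  "is_hecke_rep n d \<rho> \<longleftrightarrow>
     \<rho> \<in> Ring.ring_hom (hecke n) (ring_mat TYPE(laurent fract) d ()) \<and>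
     (\<forall>r. \<forall>h \<in> carrier (hecke n).
        \<rho> (hecke_smult n r h) = Fraction_Field.Fract r 1 \<cdot>\<^sub>m \<rho> h)"

definition is_subspace :: "nat \<Rightarrow> 'a::field vec set \<Rightarrow> bool" where
  "is_subspace d W \<longleftrightarrow>
     W \<subseteq> carrier_vec d \<and> 0\<^sub>v d \<in> W \<and> (\<forall>x\<in>W. \<forall>y\<in>W. x + y \<in> W) \<and> (\<forall>c. \<forall>x\<in>W. c \<cdot>\<^sub>v x \<in> W)"

definition is_irreducible_hecke_rep ::
    "nat \<Rightarrow> nat \<Rightarrow> (hecke_elt \<Rightarrow> laurent fract mat) \<Rightarrow> bool" where
  "is_irreducible_hecke_rep n d \<rho> \<longleftrightarrow>
     is_hecke_rep n d \<rho> \<and> 0 < d \<and>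
     (\<forall>W. is_subspace d W \<and> (\<forall>h \<in> carrier (hecke n). \<forall>x\<in>W. \<rho> h *\<^sub>v x \<in> W) \<longrightarrow>
        W = {0\<^sub>v d} \<or> W = carrier_vec d)"

definition is_irreducible_hecke_char :: "nat \<Rightarrow> (hecke_elt \<Rightarrow> laurent) \<Rightarrow> bool" where
  "is_irreducible_hecke_char n \<chi> \<longleftrightarrow>
     (\<exists>d \<rho>. is_irreducible_hecke_rep n d \<rho> \<and>
        (\<forall>h \<in> carrier (hecke n). Fraction_Field.Fract (\<chi> h) 1 = (\<Sum>i<d. \<rho> h $$ (i, i))))"

text \<open>\<open>\<chi>\<^sub>q\<^sup>\<lambda>\<close>: the irreducible character that specializes to \<open>\<chi>\<^sup>\<lambda>\<close> at \<open>q\<^sup>1\<^sup>/\<^sup>2 = 1\<close>, made unique as a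
  function by being \<^const>\<open>undefined\<close> off the carrier.\<close>

definition hecke_char :: "nat \<Rightarrow> nat list \<Rightarrow> hecke_elt \<Rightarrow> laurent" where
  "hecke_char n lam = (THE \<chi>. \<chi> \<in> extensional (carrier (hecke n)) \<and>
     is_irreducible_hecke_char n \<chi> \<and>
     (\<forall>v. v permutes {1..n} \<longrightarrow> of_int (eval_one (\<chi> (T_basis n v))) = sym_char n lam v))"

definition monomial_trace :: "nat \<Rightarrow> nat list \<Rightarrow> hecke_elt \<Rightarrow> laurent" where
  "monomial_trace n lam h = (\<Sum>\<mu> \<in> partitions_of n. of_int (inv_kostka n lam \<mu>) * hecke_char n \<mu> h)"

definition power_sum_trace :: "nat \<Rightarrow> nat list \<Rightarrow> hecke_elt \<Rightarrow> laurent" where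
  "power_sum_trace n lam h =
     (\<Sum>\<mu> \<in> partitions_of n. of_nat (row_constant_count lam \<mu>) * monomial_trace n \<mu> h)"

end

(* If w avoids 312, the Bruhat interval below w is the box of all v with v i <= f i, and the sum N_f of
   the T_v over this box obeys a modular law in f. Hence N_f is bar invariant up to a power of q, and
   it equals q^(l(w)/2) C'_w.

   The power sum trace of (n) is the alternating sum Phi_n of the hook characters, because the
   semistandard hook tableaux of content nu with leg length r correspond to the r-subsets of the
   nonminimal entries. Young's seminormal form realizes the hook characters; a trace is determined by
   its values on increasing products of distinct generators, which identifies their specialization
   with the characters of the Specht modules, and Schur orthogonality shows that an irreducible
   character is determined by its specialization.

   On increasing products Phi_n is [n] for the full product and 0 otherwise, so Phi_n vanishes on
   H_(n-1) and [n-1] Phi_n(x T_(n-1)) = [n] Phi_(n-1)(x) for x in H_(n-1). With f' = min f (n-1) and a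
   minimal such that f a = n,
     N_f = N_f' (1 + T_(n-1) + T_(n-1) T_(n-2) + ... + T_(n-1) ... T_a),  N_f' T_i = q N_f' (a <= i < n-1),
   and the product formula follows by induction on n. *)

theory Submission
  imports Defs
begin


section \<open>The Hecke algebra from generators and relations, and its basis\<close>

section \<open>The free algebra\<close>

text \<open>Three notions in the statement are definite descriptions: the Kazhdan-Lusztig family,
  the row of the inverse Kostka matrix and the character \<open>hecke_char\<close>. Each needs a
  proof of uniqueness beside the construction, and this is what brings in triangularity of the bar
  involution, unitriangularity of the Kostka matrix and Schur orthogonality. The algebra itself is a
  quotient of a free algebra, about which nothing is known at first. Everything is therefore done
  with functions of words that respect the relations modulo a submodule \<open>M\<close>. One normal
  form argument for words then serves for several \<open>M\<close>: it yields the spanning set of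
  the \<open>T_w\<close>, the vanishing of traces, and the absence of denominators in character
  values. Linear independence of the \<open>T_w\<close> comes from the regular representation, whose
  coordinates also prove the congruences between box sums. Seminormal matrices have denominators
  [i]_q, so the hook characters live in the fraction field until their values are shown to be
  Laurent polynomials.\<close>

definition mon :: "nat list \<Rightarrow> free_alg" where
  "mon u = Poly_Mapping.single (Word u) 1"

abbreviation words :: "nat \<Rightarrow> nat list set" where
  "words n \<equiv> lists {1..<n}"

definition free_sub :: "nat \<Rightarrow> free_alg set" where
  "free_sub n = {x. \<forall>u \<in> Poly_Mapping.keys x. set (letters u) \<subseteq> {1..<n}}"

lemma plus_Word: "Word u + Word v = Word (u @ v)"
  by (simp add: plus_free_word_def)

lemma mon_append: "mon (u @ v) = mon u * mon v"
  by (simp add: mon_def mult_single plus_Word)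

lemma mon_Nil: "mon [] = 1"
  by (simp add: mon_def zero_free_word_def[symmetric])

lemma free_gen_mon: "free_gen i = mon [i]"
  by (simp add: free_gen_def mon_def)

lemma free_const_add: "free_const (r + s) = free_const r + free_const s"
  by (simp add: free_const_def single_add)

lemma free_const_mult: "free_const (r * s) = free_const r * free_const s"
  by (simp add: free_const_def mult_single)

lemma free_const_0 [simp]: "free_const 0 = 0"
  by (simp add: free_const_def)

lemma free_const_1 [simp]: "free_const 1 = 1"
  by (simp add: free_const_def)

lemma free_const_diff: "free_const (r - s) = free_const r - free_const s"
  by (simp add: free_const_def single_diff)

lemma free_const_mon: "free_const r * mon u = Poly_Mapping.single (Word u) r"
  by (simp add: free_const_def mon_def mult_single)

lemma free_alg_sum: "x = (\<Sum>u\<in>Poly_Mapping.keys x. free_const (Poly_Mapping.lookup x u) * mon (letters u))"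
proof -
  have "(\<Sum>u\<in>Poly_Mapping.keys x. Poly_Mapping.single u (Poly_Mapping.lookup x u)) = x"
    by (rule poly_mapping_eqI)
       (simp add: lookup_sum lookup_single when_def in_keys_iff sum.delta)
  then show ?thesis by (simp add: free_const_mon)
qed

lemma free_sub_induct [consumes 1, case_names zero scaled add]:
  assumes "x \<in> free_sub n"
    and "P 0"
    and "\<And>r u. u \<in> words n \<Longrightarrow> P (free_const r * mon u)"
    and "\<And>x y. x \<in> free_sub n \<Longrightarrow> y \<in> free_sub n \<Longrightarrow> P x \<Longrightarrow> P y \<Longrightarrow> P (x + y)"
  shows "P x"
proof -
  let ?g = "\<lambda>u. free_const (Poly_Mapping.lookup x u) * mon (letters u)"
  have "P (sum ?g A) \<and> sum ?g A \<in> free_sub n" if "finite A" "A \<subseteq> Poly_Mapping.keys x" for A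
    using that
  proof (induction A)
    case empty
    then show ?case using assms(2) by (simp add: free_sub_def)
  next
    case (insert a A)
    have a: "letters a \<in> words n"
      using insert.prems assms(1) by (auto simp: free_sub_def)
    have g: "?g a \<in> free_sub n" using a by (auto simp: free_sub_def free_const_mon)
    have s: "P (sum ?g A)" "sum ?g A \<in> free_sub n" using insert by auto
    have "?g a + sum ?g A \<in> free_sub n"
      using g s(2) keys_add[of "?g a" "sum ?g A"] unfolding free_sub_def by blast
    then show ?case
      using assms(4)[OF g s(2) assms(3)[OF a] s(1)] insert by simp
  qed
  from this[of "Poly_Mapping.keys x"] show ?thesis using free_alg_sum[of x] by simp
qed

lemma free_sub_zero: "0 \<in> free_sub n"
  by (simp add: free_sub_def)

lemma free_sub_mon: "u \<in> words n \<Longrightarrow> mon u \<in> free_sub n"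
  by (auto simp: free_sub_def mon_def)

lemma free_sub_const: "free_const r \<in> free_sub n"
  by (simp add: free_sub_def free_const_def zero_free_word_def)

lemma free_sub_one: "1 \<in> free_sub n"
  using free_sub_const[of 1] by simp

lemma free_sub_add: "x \<in> free_sub n \<Longrightarrow> y \<in> free_sub n \<Longrightarrow> x + y \<in> free_sub n"
  using keys_add[of x y] unfolding free_sub_def by blast

lemma free_sub_mult: "x \<in> free_sub n \<Longrightarrow> y \<in> free_sub n \<Longrightarrow> x * y \<in> free_sub n"
proof -
  assume a: "x \<in> free_sub n" "y \<in> free_sub n"
  have "set (letters u) \<subseteq> {1..<n}" if u: "u \<in> Poly_Mapping.keys (x * y)" for u
  proof -
    obtain v w where "u = v + w" "v \<in> Poly_Mapping.keys x" "w \<in> Poly_Mapping.keys y"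
      using keys_mult[of x y] u by blast
    then show ?thesis using a by (auto simp: free_sub_def plus_free_word_def)
  qed
  then show ?thesis by (auto simp: free_sub_def)
qed

lemma free_sub_uminus: "x \<in> free_sub n \<Longrightarrow> - x \<in> free_sub n"
  by (simp add: free_sub_def in_keys_iff)

lemma free_sub_diff: "x \<in> free_sub n \<Longrightarrow> y \<in> free_sub n \<Longrightarrow> x - y \<in> free_sub n"
  using free_sub_add[of x n "- y"] free_sub_uminus by simp

lemma free_sub_sum: "(\<And>i. i \<in> I \<Longrightarrow> f i \<in> free_sub n) \<Longrightarrow> sum f I \<in> free_sub n"
  by (induction I rule: infinite_finite_induct) (auto simp: free_sub_zero free_sub_add)

lemmas free_sub_closed = free_sub_zero free_sub_one free_sub_mon free_sub_const free_sub_add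
  free_sub_mult free_sub_uminus free_sub_diff

lemma free_const_central: "free_const r * x = x * free_const r"
proof -
  have "x \<in> free_sub (Suc (Max (insert 0 (\<Union>u\<in>Poly_Mapping.keys x. set (letters u)))) )
       \<or> True" by simp
  have "free_const r * (\<Sum>u\<in>A. free_const (Poly_Mapping.lookup x u) * mon (letters u)) =
        (\<Sum>u\<in>A. free_const (Poly_Mapping.lookup x u) * mon (letters u)) * free_const r" for A
    unfolding sum_distrib_left sum_distrib_right
    by (rule sum.cong)
       (simp_all add: free_const_def mon_def mult_single mult.commute)
  from this[of "Poly_Mapping.keys x"] show ?thesis using free_alg_sum[of x] by simp
qed

section \<open>Linear extension of functions on words\<close>

text \<open>The target may be noncommutative because \<open>free_const\<close> is one of the
  instances; others are the identity, \<open>laurent_bar\<close>, evaluation at one and the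
  embedding into the fraction field.\<close>

locale laurent_hom =
  fixes h :: "laurent \<Rightarrow> 'b::ring_1"
  assumes hom_add: "h (r + s) = h r + h s"
    and hom_mult: "h (r * s) = h r * h s"
    and hom_1: "h 1 = 1"
begin

lemma hom_0: "h 0 = 0"
  using hom_add[of 0 0] by simp

lemma hom_uminus: "h (- r) = - h r"
  using hom_add[of r "- r"] by (simp add: hom_0 eq_neg_iff_add_eq_0 add.commute)

lemma hom_diff: "h (r - s) = h r - h s"
  using hom_add[of r "- s"] by (simp add: hom_uminus)

lemma hom_sum: "h (sum f A) = (\<Sum>a\<in>A. h (f a))"
  by (induction A rule: infinite_finite_induct) (simp_all add: hom_0 hom_add)

lemma hom_power: "h (r ^ k) = h r ^ k"
  by (induction k) (simp_all add: hom_1 hom_mult)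

definition submod :: "'b set \<Rightarrow> bool" where
  "submod M \<longleftrightarrow> 0 \<in> M \<and> (\<forall>x\<in>M. \<forall>y\<in>M. x + y \<in> M) \<and> (\<forall>r. \<forall>x\<in>M. h r * x \<in> M)"

lemma submod_zero: "submod {0}"
  by (simp add: submod_def)

lemma submod_uminus: "submod M \<Longrightarrow> x \<in> M \<Longrightarrow> - x \<in> M"
  unfolding submod_def using hom_uminus[of 1] hom_1 by (metis mult_minus1)

lemma submod_diff: "submod M \<Longrightarrow> x \<in> M \<Longrightarrow> y \<in> M \<Longrightarrow> x - y \<in> M"
  using submod_uminus[of M y] unfolding submod_def by (metis uminus_add_conv_diff add.commute)

lemma submod_diff_iff: "submod M \<Longrightarrow> x - y \<in> M \<Longrightarrow> x \<in> M \<longleftrightarrow> y \<in> M"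
  using submod_diff[of M x "x - y"] unfolding submod_def
  by (metis add_diff_cancel_left' diff_add_cancel add_diff_cancel diff_diff_eq2)

definition lext :: "(nat list \<Rightarrow> 'b) \<Rightarrow> free_alg \<Rightarrow> 'b" where
  "lext \<phi> x = (\<Sum>u\<in>Poly_Mapping.keys x. h (Poly_Mapping.lookup x u) * \<phi> (letters u))"

lemma lext_zero [simp]: "lext \<phi> 0 = 0"
  by (simp add: lext_def)

lemma lext_add: "lext \<phi> (x + y) = lext \<phi> x + lext \<phi> y"
  unfolding lext_def
  by (rule setsum_keys_plus_distrib) (simp_all add: hom_0 hom_add distrib_right)

lemma lext_term: "lext \<phi> (free_const r * mon u) = h r * \<phi> u"
  by (simp add: lext_def free_const_mon hom_0)

lemma lext_mon: "lext \<phi> (mon u) = \<phi> u"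
  using lext_term[of \<phi> 1 u] by (simp add: hom_1)

lemma lext_uminus: "lext \<phi> (- x) = - lext \<phi> x"
  using lext_add[of \<phi> x "- x"] by (simp add: eq_neg_iff_add_eq_0 add.commute)

lemma lext_diff: "lext \<phi> (x - y) = lext \<phi> x - lext \<phi> y"
  using lext_add[of \<phi> x "- y"] by (simp add: lext_uminus)

lemma lext_sum: "lext \<phi> (sum f A) = (\<Sum>a\<in>A. lext \<phi> (f a))"
  by (induction A rule: infinite_finite_induct) (simp_all add: lext_add)

lemma lext_const_mult: "lext \<phi> (free_const r * x) = h r * lext \<phi> x"
proof -
  have "lext \<phi> (free_const r * (\<Sum>u\<in>A. free_const (Poly_Mapping.lookup x u) * mon (letters u))) =
     h r * lext \<phi> (\<Sum>u\<in>A. free_const (Poly_Mapping.lookup x u) * mon (letters u))" for A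
    unfolding sum_distrib_left lext_sum mult.assoc[symmetric] free_const_mult[symmetric] lext_term
    by (simp add: hom_mult mult.assoc sum_distrib_left)
  from this[of "Poly_Mapping.keys x"] show ?thesis using free_alg_sum[of x] by simp
qed

lemma lext_cong_words:
  "x \<in> free_sub n \<Longrightarrow> (\<And>u. u \<in> words n \<Longrightarrow> \<phi> u = \<psi> u) \<Longrightarrow> lext \<phi> x = lext \<psi> x"
  unfolding lext_def free_sub_def by (rule sum.cong) (auto simp: lists_eq_set)

lemma lext_mon_mult: "lext \<phi> (mon a * x * mon b) = lext (\<lambda>u. \<phi> (a @ u @ b)) x"
proof -
  have "lext \<phi> (mon a * (\<Sum>u\<in>A. free_const (Poly_Mapping.lookup x u) * mon (letters u)) * mon b) =
     lext (\<lambda>u. \<phi> (a @ u @ b)) (\<Sum>u\<in>A. free_const (Poly_Mapping.lookup x u) * mon (letters u))" for A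
  proof -
    have "lext \<phi> (mon a * (free_const r * mon u) * mon b) = lext (\<lambda>u. \<phi> (a @ u @ b)) (free_const r * mon u)" for r u
    proof -
      have "mon a * (free_const r * mon u) * mon b = free_const r * mon (a @ u @ b)"
        by (simp add: mon_append mult.assoc free_const_central[of r])
      then show ?thesis by (simp add: lext_term)
    qed
    then show ?thesis
      unfolding sum_distrib_left sum_distrib_right lext_sum by simp
  qed
  from this[of "Poly_Mapping.keys x"] show ?thesis using free_alg_sum[of x] by simp
qed

text \<open>Placing the relators between arbitrary words makes the condition two-sided. With
  \<open>M = {0}\<close> it says that \<open>\<phi>\<close> factors through the Hecke algebra.
  Larger \<open>M\<close> serve for spanning (combinations of normal forms modulo the ideal) and for
  integrality (the image of the Laurent ring in its fraction field).\<close>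

definition hecke_compat :: "nat \<Rightarrow> (nat list \<Rightarrow> 'b) \<Rightarrow> 'b set \<Rightarrow> bool" where
  "hecke_compat n \<phi> M \<longleftrightarrow> (\<forall>u\<in>words n. \<forall>v\<in>words n.
     (\<forall>i\<in>{1..<n}. \<phi> (u @ [i,i] @ v) - (h (qvar - 1) * \<phi> (u @ [i] @ v) + h qvar * \<phi> (u @ v)) \<in> M) \<and>
     (\<forall>i\<in>{1..<n}. Suc i < n \<longrightarrow> \<phi> (u @ [i, Suc i, i] @ v) - \<phi> (u @ [Suc i, i, Suc i] @ v) \<in> M) \<and>
     (\<forall>i\<in>{1..<n}. \<forall>j\<in>{1..<n}. Suc i < j \<longrightarrow> \<phi> (u @ [i, j] @ v) - \<phi> (u @ [j, i] @ v) \<in> M))"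

lemma hecke_compatI:
  assumes "\<And>u v i. u \<in> words n \<Longrightarrow> v \<in> words n \<Longrightarrow> i \<in> {1..<n} \<Longrightarrow>
       \<phi> (u @ [i,i] @ v) - (h (qvar - 1) * \<phi> (u @ [i] @ v) + h qvar * \<phi> (u @ v)) \<in> M"
    and "\<And>u v i. u \<in> words n \<Longrightarrow> v \<in> words n \<Longrightarrow> 1 \<le> i \<Longrightarrow> Suc i < n \<Longrightarrow>
       \<phi> (u @ [i, Suc i, i] @ v) - \<phi> (u @ [Suc i, i, Suc i] @ v) \<in> M"
    and "\<And>u v i j. u \<in> words n \<Longrightarrow> v \<in> words n \<Longrightarrow> 1 \<le> i \<Longrightarrow> Suc i < j \<Longrightarrow> j < n \<Longrightarrow>
       \<phi> (u @ [i, j] @ v) - \<phi> (u @ [j, i] @ v) \<in> M"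
  shows "hecke_compat n \<phi> M"
  unfolding hecke_compat_def using assms by (auto simp del: append.simps append_Cons)

lemma compat_quad: "hecke_compat n \<phi> M \<Longrightarrow> u \<in> words n \<Longrightarrow> v \<in> words n \<Longrightarrow> i \<in> {1..<n} \<Longrightarrow>
    \<phi> (u @ [i,i] @ v) - (h (qvar - 1) * \<phi> (u @ [i] @ v) + h qvar * \<phi> (u @ v)) \<in> M"
  unfolding hecke_compat_def by blast

lemma compat_braid: "hecke_compat n \<phi> M \<Longrightarrow> u \<in> words n \<Longrightarrow> v \<in> words n \<Longrightarrow> 1 \<le> i \<Longrightarrow> Suc i < n \<Longrightarrow>
    \<phi> (u @ [i, Suc i, i] @ v) - \<phi> (u @ [Suc i, i, Suc i] @ v) \<in> M"
  unfolding hecke_compat_def by auto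

lemma compat_comm: "submod M \<Longrightarrow> hecke_compat n \<phi> M \<Longrightarrow> u \<in> words n \<Longrightarrow> v \<in> words n \<Longrightarrow> i \<in> {1..<n} \<Longrightarrow>
    j \<in> {1..<n} \<Longrightarrow> Suc i < j \<or> Suc j < i \<Longrightarrow> \<phi> (u @ [i, j] @ v) - \<phi> (u @ [j, i] @ v) \<in> M"
  unfolding hecke_compat_def using submod_uminus by (metis minus_diff_eq)

lemma compat_mono: "hecke_compat n \<phi> M \<Longrightarrow> m \<le> n \<Longrightarrow> hecke_compat m \<phi> M"
proof -
  assume a: "hecke_compat n \<phi> M" "m \<le> n"
  have w: "words m \<subseteq> words n" using a(2) by (auto simp: lists_eq_set)
  show ?thesis
  proof (rule hecke_compatI)
    fix u v i j assume "u \<in> words m" "v \<in> words m" "1 \<le> i" "Suc i < j" "j < m"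
    then show "\<phi> (u @ [i, j] @ v) - \<phi> (u @ [j, i] @ v) \<in> M"
      using a w unfolding hecke_compat_def by (meson Suc_lessD atLeastLessThan_iff less_le_trans order.strict_trans subsetD le_trans less_imp_le)
  qed (use a w in \<open>auto intro!: compat_quad[OF a(1)] compat_braid[OF a(1)] simp del: append.simps append_Cons One_nat_def\<close>)
qed

text \<open>Prefix and suffix are absorbed into the contexts over which the definition quantifies.
  This permits inductions that rewrite only a middle segment of a word.\<close>

lemma compat_context:
  assumes "hecke_compat n \<phi> M" "a \<in> words n" "b \<in> words n"
  shows "hecke_compat n (\<lambda>u. \<phi> (a @ u @ b)) M"
proof -
  have 1: "\<phi> (a @ (u @ c @ v) @ b) = \<phi> ((a @ u) @ c @ (v @ b))" for u c v by simp
  have 2: "\<phi> (a @ (u @ v) @ b) = \<phi> ((a @ u) @ (v @ b))" for u v by simp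
  have w: "u \<in> words n \<Longrightarrow> a @ u \<in> words n" "u \<in> words n \<Longrightarrow> u @ b \<in> words n" for u
    using assms by auto
  show ?thesis
    unfolding hecke_compat_def 1 unfolding 2
    using assms(1) w unfolding hecke_compat_def by blast
qed

end

section \<open>The ideal of relations\<close>

lemma free_alg_ring_simps [simp]:
  "carrier (free_alg_ring n) = free_sub n"
  "x \<otimes>\<^bsub>free_alg_ring n\<^esub> y = x * y"
  "x \<oplus>\<^bsub>free_alg_ring n\<^esub> y = x + y"
  "\<one>\<^bsub>free_alg_ring n\<^esub> = 1" "\<zero>\<^bsub>free_alg_ring n\<^esub> = 0"
  by (simp_all add: free_alg_ring_def free_sub_def)

lemma ring_free_alg: "Ring.ring (free_alg_ring n)"
proof (rule Ring.ringI)
  show "abelian_group (free_alg_ring n)"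
  proof (rule abelian_groupI)
    fix x assume "x \<in> carrier (free_alg_ring n)"
    then show "\<exists>y\<in>carrier (free_alg_ring n). y \<oplus>\<^bsub>free_alg_ring n\<^esub> x = \<zero>\<^bsub>free_alg_ring n\<^esub>"
      by (intro bexI[of _ "- x"]) (simp_all add: free_sub_uminus)
  qed (simp_all add: free_sub_closed add_ac)
  show "Group.monoid (free_alg_ring n)"
    by unfold_locales (simp_all add: free_sub_closed mult.assoc)
qed (simp_all add: algebra_simps)

lemma relators_subset: "hecke_relators n \<subseteq> free_sub n"
  unfolding hecke_relators_def free_gen_mon
  by (auto intro!: free_sub_closed)

lemma ideal_hecke: "ideal (hecke_ideal n) (free_alg_ring n)"
  unfolding hecke_ideal_def
  by (rule ring.genideal_ideal[OF ring_free_alg]) (simp add: relators_subset)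

lemma relators_ideal: "hecke_relators n \<subseteq> hecke_ideal n"
  unfolding hecke_ideal_def
  by (rule ring.genideal_self[OF ring_free_alg]) (simp add: relators_subset)

lemma ideal_sub: "x \<in> hecke_ideal n \<Longrightarrow> x \<in> free_sub n"
  using ideal.Icarr[OF ideal_hecke] by simp

lemma ideal_add: "x \<in> hecke_ideal n \<Longrightarrow> y \<in> hecke_ideal n \<Longrightarrow> x + y \<in> hecke_ideal n"
  using additive_subgroup.a_closed[OF ideal.axioms(1)[OF ideal_hecke]] by simp

lemma ideal_zero: "0 \<in> hecke_ideal n"
  using additive_subgroup.zero_closed[OF ideal.axioms(1)[OF ideal_hecke]] by simp

lemma ideal_lmult: "x \<in> hecke_ideal n \<Longrightarrow> y \<in> free_sub n \<Longrightarrow> y * x \<in> hecke_ideal n"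
  using ideal.I_l_closed[OF ideal_hecke] by simp

lemma ideal_rmult: "x \<in> hecke_ideal n \<Longrightarrow> y \<in> free_sub n \<Longrightarrow> x * y \<in> hecke_ideal n"
  using ideal.I_r_closed[OF ideal_hecke] by simp

lemma ideal_uminus: "x \<in> hecke_ideal n \<Longrightarrow> - x \<in> hecke_ideal n"
  using ideal_lmult[of x n "- 1"] by (simp add: free_sub_uminus free_sub_one)

lemma ideal_diff: "x \<in> hecke_ideal n \<Longrightarrow> y \<in> hecke_ideal n \<Longrightarrow> x - y \<in> hecke_ideal n"
  using ideal_add[of x n "- y"] ideal_uminus by simp

text \<open>\<open>F\<close> is merely additive, so its preimage of \<open>M\<close> need not be an
  ideal. The elements whose products with words on both sides all land in \<open>M\<close> do form
  one, by expanding the outer factors into scaled words, and it contains the relators; minimality of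
  \<open>genideal\<close> then gives the claim.\<close>

lemma ideal_induct:
  assumes x: "x \<in> hecke_ideal n"
    and rel: "\<And>u v r. u \<in> words n \<Longrightarrow> v \<in> words n \<Longrightarrow> r \<in> hecke_relators n \<Longrightarrow> F (mon u * r * mon v) \<in> M"
    and zero: "0 \<in> M" and M_add: "\<And>x y. x \<in> M \<Longrightarrow> y \<in> M \<Longrightarrow> x + y \<in> M"
    and M_const: "\<And>r x. F x \<in> M \<Longrightarrow> F (free_const r * x) \<in> M"
    and F_zero: "F 0 = 0" and F_add: "\<And>x y. F (x + y) = F x + F y"
  shows "F x \<in> (M :: 'b::ab_group_add set)"
proof -
  let ?I = "{x \<in> free_sub n. \<forall>u\<in>words n. \<forall>v\<in>words n. F (mon u * x * mon v) \<in> M}"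
  have clos: "F (a * x * b) \<in> M" if x: "x \<in> ?I" and a: "a \<in> free_sub n" and b: "b \<in> free_sub n" for a b x
    using a
  proof (induction a rule: free_sub_induct)
    case (scaled r u)
    from b show ?case
    proof (induction b rule: free_sub_induct)
      case (scaled s v)
      have "free_const r * mon u * x * (free_const s * mon v) = free_const (r * s) * (mon u * x * mon v)"
        by (simp add: free_const_mult mult.assoc free_const_central[of s])
      moreover have "F (free_const (r * s) * (mon u * x * mon v)) \<in> M"
        using x \<open>u \<in> words n\<close> scaled by (intro M_const) blast
      ultimately show ?case by simp
    qed (simp_all add: zero F_zero distrib_left F_add M_add)
  qed (simp_all add: zero F_zero distrib_right F_add M_add)
  have I: "ideal ?I (free_alg_ring n)"
  proof (rule idealI[OF ring_free_alg])
    interpret free: Ring.ring "free_alg_ring n" by (rule ring_free_alg)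
    show "subgroup ?I (add_monoid (free_alg_ring n))"
    proof
      show "?I \<subseteq> carrier (add_monoid (free_alg_ring n))" by auto
      show "x \<otimes>\<^bsub>add_monoid (free_alg_ring n)\<^esub> y \<in> ?I" if "x \<in> ?I" "y \<in> ?I" for x y
        using that by (auto simp: free_sub_add distrib_left distrib_right F_add M_add)
      show "\<one>\<^bsub>add_monoid (free_alg_ring n)\<^esub> \<in> ?I" by (simp add: free_sub_zero zero F_zero)
      show "inv\<^bsub>add_monoid (free_alg_ring n)\<^esub> x \<in> ?I" if x: "x \<in> ?I" for x
      proof -
        have "\<ominus>\<^bsub>free_alg_ring n\<^esub> x = - x"
          using x by (intro free.minus_equality) (auto simp: free_sub_uminus)
        moreover have "- x \<in> ?I"
        proof -
          have "F (mon u * (- x) * mon v) \<in> M" if "u \<in> words n" "v \<in> words n" for u v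
            using clos[OF x, of "- mon u" "mon v"] that by (simp add: free_sub_closed)
          then show ?thesis using x by (auto simp: free_sub_uminus)
        qed
        ultimately show ?thesis by (simp add: a_inv_def)
      qed
    qed
    fix a x assume a: "a \<in> ?I" "x \<in> carrier (free_alg_ring n)"
    show "x \<otimes>\<^bsub>free_alg_ring n\<^esub> a \<in> ?I"
    proof -
      have "F (mon u * (x * a) * mon v) \<in> M" if "u \<in> words n" "v \<in> words n" for u v
        using clos[OF a(1), of "mon u * x" "mon v"] that a(2) by (simp add: free_sub_closed mult.assoc)
      then show ?thesis using a by (auto simp: free_sub_mult)
    qed
    show "a \<otimes>\<^bsub>free_alg_ring n\<^esub> x \<in> ?I"
    proof -
      have "F (mon u * (a * x) * mon v) \<in> M" if "u \<in> words n" "v \<in> words n" for u v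
        using clos[OF a(1), of "mon u" "x * mon v"] that a(2) by (simp add: free_sub_closed mult.assoc)
      then show ?thesis using a by (auto simp: free_sub_mult)
    qed
  qed
  have "hecke_ideal n \<subseteq> ?I"
    unfolding hecke_ideal_def
    by (rule ring.genideal_minimal[OF ring_free_alg I]) (use relators_subset rel in blast)
  then have "F (mon [] * x * mon []) \<in> M" using x by (auto simp del: append.simps)
  then show ?thesis by (simp add: mon_Nil)
qed

lemma (in laurent_hom) lext_ideal:
  assumes M: "submod M" and c: "hecke_compat n \<phi> M" and x: "x \<in> hecke_ideal n"
  shows "lext \<phi> x \<in> M"
proof (rule ideal_induct[OF x, where F = "lext \<phi>"])
  fix u v r assume u: "u \<in> words n" and v: "v \<in> words n" and r: "r \<in> hecke_relators n"
  consider (quad) i where "i \<in> {1..<n}"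
      "r = mon [i,i] - (free_const (qvar - 1) * mon [i] + free_const qvar * mon [])"
    | (braid) i j where "i \<in> {1..<n}" "j \<in> {1..<n}" "\<bar>int i - int j\<bar> = 1"
      "r = mon [i,j,i] - mon [j,i,j]"
    | (comm) i j where "i \<in> {1..<n}" "j \<in> {1..<n}" "\<bar>int i - int j\<bar> \<ge> 2"
      "r = mon [i,j] - mon [j,i]"
    using r unfolding hecke_relators_def free_gen_mon
    by (auto simp: mon_append[symmetric] mon_Nil)
  then show "lext \<phi> (mon u * r * mon v) \<in> M"
  proof cases
    case quad
    then show ?thesis using compat_quad[OF c u v quad(1)]
      by (simp add: lext_mon_mult lext_diff lext_add lext_term lext_mon)
  next
    case braid
    then have "j = Suc i \<or> i = Suc j" by auto
    then show ?thesis
    proof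
      assume "j = Suc i"
      then show ?thesis using compat_braid[OF c u v, of i] braid
        by (simp add: lext_mon_mult lext_diff lext_mon)
    next
      assume "i = Suc j"
      then show ?thesis using submod_uminus[OF M compat_braid[OF c u v, of j]] braid
        by (simp add: lext_mon_mult lext_diff lext_mon)
    qed
  next
    case comm
    then have "Suc i < j \<or> Suc j < i" by auto
    then show ?thesis using compat_comm[OF M c u v comm(1,2)] comm
      by (simp add: lext_mon_mult lext_diff lext_mon)
  qed
qed (use M in \<open>auto simp: submod_def lext_add lext_const_mult\<close>)


section \<open>Normal forms of words\<close>

lemma words_mono: "u \<in> words m \<Longrightarrow> m \<le> n \<Longrightarrow> u \<in> words n"
  by (auto simp: lists_eq_set)

lemma desc_words: "1 \<le> j \<Longrightarrow> k \<le> n \<Longrightarrow> rev [j..<k] \<in> words n"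
  by (auto simp: lists_eq_set)

context laurent_hom
begin

lemma comm_letter:
  assumes M: "submod M" and c: "hecke_compat n \<phi> M"
    and w: "a \<in> words n" "b \<in> words n" "i \<in> {1..<n}" and y: "y \<in> words n"
    and far: "\<And>j. j \<in> set y \<Longrightarrow> Suc i < j \<or> Suc j < i"
  shows "\<phi> (a @ y @ [i] @ b) - \<phi> (a @ [i] @ y @ b) \<in> M"
  using w(1) y far
proof (induction y arbitrary: a)
  case Nil
  then show ?case using M by (simp add: submod_def)
next
  case (Cons j y)
  have 1: "\<phi> ((a @ [j]) @ y @ [i] @ b) - \<phi> ((a @ [j]) @ [i] @ y @ b) \<in> M"
    using Cons.prems by (intro Cons.IH) auto
  have "\<phi> (a @ [i, j] @ (y @ b)) - \<phi> (a @ [j, i] @ (y @ b)) \<in> M"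
    using Cons.prems w by (intro compat_comm[OF M c]) auto
  from submod_diff[OF M 1 this] show ?case by simp
qed

lemma comm_words:
  assumes M: "submod M" and c: "hecke_compat n \<phi> M"
    and w: "a \<in> words n" "b \<in> words n" "z \<in> words n" and y: "y \<in> words n"
    and far: "\<And>i j. i \<in> set z \<Longrightarrow> j \<in> set y \<Longrightarrow> Suc i < j \<or> Suc j < i"
  shows "\<phi> (a @ y @ z @ b) - \<phi> (a @ z @ y @ b) \<in> M"
  using w(1,3) far
proof (induction z arbitrary: a)
  case Nil
  then show ?case using M by (simp add: submod_def)
next
  case (Cons i z)
  have 1: "\<phi> (a @ y @ [i] @ (z @ b)) - \<phi> (a @ [i] @ y @ (z @ b)) \<in> M"
    using Cons.prems w y by (intro comm_letter[OF M c]) auto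
  have 2: "\<phi> ((a @ [i]) @ y @ z @ b) - \<phi> ((a @ [i]) @ z @ y @ b) \<in> M"
    using Cons.prems by (intro Cons.IH) auto
  have "(\<phi> (a @ y @ [i] @ (z @ b)) - \<phi> (a @ [i] @ y @ (z @ b))) +
    (\<phi> ((a @ [i]) @ y @ z @ b) - \<phi> ((a @ [i]) @ z @ y @ b)) \<in> M"
    using 1 2 M unfolding submod_def by blast
  then show ?case by simp
qed

text \<open>The descending runs \<open>rev [j..<Suc k]\<close> stand for the coset representatives
  of S_k in S_(k+1). Induction on \<open>v\<close> feeds one letter at a time into the run: a letter
  below \<open>j - 1\<close> passes into \<open>x\<close>, \<open>j - 1\<close> extends the run,
  \<open>j\<close> is reduced by the quadratic relation, and a larger letter \<open>i\<close> passes
  through and comes out on the left as \<open>i - 1\<close>.\<close>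

lemma normal_form_aux:
  assumes M: "submod M" and c: "hecke_compat (Suc k) \<phi> M"
    and hyp: "\<And>x j. x \<in> words k \<Longrightarrow> 1 \<le> j \<Longrightarrow> j \<le> Suc k \<Longrightarrow> \<phi> (x @ rev [j..<Suc k]) \<in> M"
    and v: "v \<in> words (Suc k)"
  shows "x \<in> words k \<Longrightarrow> 1 \<le> j \<Longrightarrow> j \<le> Suc k \<Longrightarrow> \<phi> (x @ rev [j..<Suc k] @ v) \<in> M"
  using v
proof (induction v arbitrary: x j)
  case Nil
  then show ?case using hyp by simp
next
  case (Cons i v)
  have i: "1 \<le> i" "i \<le> k" and v: "v \<in> words (Suc k)" using Cons by auto
  have x: "x \<in> words (Suc k)" using Cons.prems words_mono by (metis le_SucI order_refl)
  consider "Suc i < j" | "Suc i = j" | "i = j" | "j < i" by linarith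
  then show ?case
  proof cases
    case 1
    have d: "\<phi> (x @ rev [j..<Suc k] @ [i] @ v) - \<phi> (x @ [i] @ rev [j..<Suc k] @ v) \<in> M"
    proof (rule comm_letter[OF M c x v])
      show "i \<in> {1..<Suc k}" using i by simp
      show "rev [j..<Suc k] \<in> words (Suc k)" using Cons.prems by (intro desc_words) auto
      fix l assume "l \<in> set (rev [j..<Suc k])"
      then show "Suc i < l \<or> Suc l < i" using 1 by (simp del: upt_Suc)
    qed
    have "\<phi> ((x @ [i]) @ rev [j..<Suc k] @ v) \<in> M"
      by (rule Cons.IH[of "x @ [i]" j]) (use Cons.prems i 1 in auto)
    then show ?thesis using submod_diff_iff[OF M d] by simp
  next
    case 2
    have "\<phi> (x @ rev [i..<Suc k] @ v) \<in> M"
      by (rule Cons.IH[of x i]) (use Cons.prems i in auto)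
    moreover have "[i..<Suc k] = i # [j..<Suc k]" using i 2 upt_conv_Cons by auto
    ultimately show ?thesis by simp
  next
    case 3
    let ?p = "x @ rev [Suc i..<Suc k]"
    have e: "[i..<Suc k] = i # [Suc i..<Suc k]" using i upt_conv_Cons by auto
    have p: "?p \<in> words (Suc k)"
      using x desc_words[of "Suc i" "Suc k" "Suc k"] by (simp del: upt_Suc)
    have 1: "\<phi> (?p @ [i,i] @ v) - (h (qvar - 1) * \<phi> (?p @ [i] @ v) + h qvar * \<phi> (?p @ v)) \<in> M"
      using i by (intro compat_quad[OF c p v]) simp
    have "\<phi> (x @ rev [i..<Suc k] @ v) \<in> M"
      by (rule Cons.IH[of x i]) (use Cons.prems i in auto)
    then have 2: "\<phi> (?p @ [i] @ v) \<in> M" unfolding e by simp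
    have "\<phi> (x @ rev [Suc i..<Suc k] @ v) \<in> M"
      by (rule Cons.IH[of x "Suc i"]) (use Cons.prems i in auto)
    then have three: "\<phi> (?p @ v) \<in> M" by simp
    have "\<phi> (?p @ [i,i] @ v) \<in> M"
      using submod_diff_iff[OF M 1] M 2 three unfolding submod_def by blast
    then show ?thesis using 3 e by simp
  next
    case 4
    \<comment> \<open>The word A i m B i becomes A i m i B, then A m i m B, then m A i m B: far
      commutation, the braid relation, far commutation.\<close>
    obtain m where m: "i = Suc m" using 4 by (cases i) auto
    let ?A = "rev [Suc i..<Suc k]" and ?B = "rev [j..<m]"
    have "[j..<Suc k] = [j..<m] @ [m..<Suc k]"
      using upt_add_eq_append[of j m "Suc k - m"] 4 i m by (simp del: upt_Suc)
    also have "[m..<Suc k] = m # i # [Suc i..<Suc k]"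
      using i m upt_conv_Cons[of m "Suc k"] upt_conv_Cons[of i "Suc k"] by simp
    finally have e: "rev [j..<Suc k] = ?A @ [i, m] @ ?B" by simp
    have A: "?A \<in> words (Suc k)" and B: "?B \<in> words (Suc k)"
      using i m Cons.prems by (auto intro: desc_words)
    have mi: "m \<in> {1..<Suc k}" "i \<in> {1..<Suc k}" using 4 m i Cons.prems by auto
    have s1: "\<phi> ((x @ ?A @ [i,m]) @ ?B @ [i] @ v) - \<phi> ((x @ ?A @ [i,m]) @ [i] @ ?B @ v) \<in> M"
      by (rule comm_letter[OF M c]) (use x v A B mi m in \<open>auto simp del: upt_Suc\<close>)
    have s2: "\<phi> ((x @ ?A) @ [m, Suc m, m] @ (?B @ v)) - \<phi> ((x @ ?A) @ [Suc m, m, Suc m] @ (?B @ v)) \<in> M"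
      by (rule compat_braid[OF c]) (use x v A B mi m in \<open>auto simp del: upt_Suc\<close>)
    have s3: "\<phi> (x @ ?A @ [m] @ ([i,m] @ ?B @ v)) - \<phi> (x @ [m] @ ?A @ ([i,m] @ ?B @ v)) \<in> M"
      by (rule comm_letter[OF M c]) (use x v A B mi m in \<open>auto simp del: upt_Suc\<close>)
    have "\<phi> ((x @ [m]) @ rev [j..<Suc k] @ v) \<in> M"
      by (rule Cons.IH[of "x @ [m]" j]) (use Cons.prems 4 m i in auto)
    then have "\<phi> (x @ [m] @ ?A @ ([i,m] @ ?B @ v)) \<in> M" unfolding e by simp
    then have "\<phi> (x @ ?A @ [m] @ ([i,m] @ ?B @ v)) \<in> M" using submod_diff_iff[OF M s3] by simp
    then have "\<phi> ((x @ ?A) @ [Suc m, m, Suc m] @ (?B @ v)) \<in> M" using submod_diff_iff[OF M s2] m by simp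
    then have "\<phi> ((x @ ?A @ [i,m]) @ ?B @ [i] @ v) \<in> M" using submod_diff_iff[OF M s1] m by simp
    then show ?thesis unfolding e by simp
  qed
qed

lemma normal_form:
  assumes "submod M" and "hecke_compat (Suc k) \<phi> M"
    and "\<And>x j. x \<in> words k \<Longrightarrow> 1 \<le> j \<Longrightarrow> j \<le> Suc k \<Longrightarrow> \<phi> (x @ rev [j..<Suc k]) \<in> M"
    and "v \<in> words (Suc k)"
  shows "\<phi> v \<in> M"
  using normal_form_aux[OF assms(1-4), of "[]" "Suc k"] by simp

text \<open>The trace property is only required for \<open>y \<in> words (n - 1)\<close>, so that the principle also covers
  \<open>\<lambda>u. \<tau> (u @ [n])\<close> for a trace \<open>\<tau>\<close> of the next larger algebra.\<close>

lemma trace_principle: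
  assumes M: "submod M" and c: "hecke_compat n \<phi> M"
    and tr: "\<And>v y. v \<in> words n \<Longrightarrow> y \<in> words (n - 1) \<Longrightarrow> \<phi> (v @ y) - \<phi> (y @ v) \<in> M"
    and k: "1 \<le> k" "k \<le> n" and x: "x \<in> words k"
    and js: "js \<in> lists {k..<n}"
    and base: "\<And>I. \<phi> (filter (\<lambda>i. i \<in> I) [1..<k] @ js) \<in> M"
  shows "\<phi> (x @ js) \<in> M"
  using k x js base
proof (induction k arbitrary: x js rule: dec_induct)
  case base
  then have "x = []" by simp
  then show ?case using base(4)[of "{}"] by simp
next
  case (step k)
  have js: "js \<in> words n" using step.prems(3) step.hyps by (auto simp: lists_eq_set)
  have c': "hecke_compat (Suc k) (\<lambda>u. \<phi> ([] @ u @ js)) M"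
    by (rule compat_mono[OF compat_context[OF c _ js, of "[]"] step.prems(1)]) simp
  have "\<phi> ([] @ x @ js) \<in> M"
  proof (rule normal_form[OF M c' _ step.prems(2)])
    fix y j assume y: "y \<in> words k" and j: "1 \<le> j" "j \<le> Suc k"
    have yn: "y \<in> words n" using y words_mono step.prems(1) Suc_leD by blast
    show "\<phi> ([] @ (y @ rev [j..<Suc k]) @ js) \<in> M"
    proof (cases "j = Suc k")
      case True
      have "\<phi> (y @ js) \<in> M"
      proof (rule step.IH[OF _ y])
        show "js \<in> lists {k..<n}" using step.prems(3) by (auto simp: lists_eq_set)
        fix I
        have "filter (\<lambda>i. i \<in> I) [1..<k] = filter (\<lambda>i. i \<in> I - {k}) [1..<Suc k]"
          using step.hyps by (auto intro: filter_cong)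
        then show "\<phi> (filter (\<lambda>i. i \<in> I) [1..<k] @ js) \<in> M"
          by (simp only: step.prems(4))
      qed (use step.prems in simp)
      then show ?thesis using True by simp
    next
      case False
      then have e: "rev [j..<Suc k] = [k] @ rev [j..<k]" using j by simp
      let ?z = "rev [j..<k]"
      have z: "?z \<in> words k" "?z \<in> words n" "?z \<in> words (n - 1)"
        using step.prems(1) j by (auto intro!: desc_words)
      have kn: "k \<in> {1..<n}" using step by auto
      have "\<phi> ((?z @ y) @ ([k] @ js)) \<in> M"
      proof (rule step.IH)
        show "[k] @ js \<in> lists {k..<n}" using step.prems(3) kn by (auto simp: lists_eq_set)
        fix I
        have "filter (\<lambda>i. i \<in> I) [1..<k] @ [k] = filter (\<lambda>i. i \<in> insert k I) [1..<Suc k]"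
          using step.hyps by (auto intro: filter_cong)
        then show "\<phi> (filter (\<lambda>i. i \<in> I) [1..<k] @ [k] @ js) \<in> M"
          using step.prems(4)[of "insert k I"] by (simp only: append_assoc[symmetric])
      qed (use step.prems y z in auto)
      moreover have d: "\<phi> ((y @ [k] @ js) @ ?z) - \<phi> (?z @ (y @ [k] @ js)) \<in> M"
        by (rule tr) (use z yn js kn in auto)
      ultimately have 1: "\<phi> ((y @ [k] @ js) @ ?z) \<in> M"
        using submod_diff_iff[OF M d] by simp
      have "\<phi> ((y @ [k]) @ ?z @ js @ []) - \<phi> ((y @ [k]) @ js @ ?z @ []) \<in> M"
      proof (rule comm_words[OF M c])
        fix a b assume "a \<in> set js" "b \<in> set ?z"
        then show "Suc a < b \<or> Suc b < a" using step.prems(3) by (auto simp: lists_eq_set)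
      qed (use z yn js kn in auto)
      from submod_diff_iff[OF M this] 1 show ?thesis unfolding e by simp
    qed
  qed
  then show ?case by simp
qed

end


section \<open>Permutations and reduced words\<close>

abbreviation adj :: "nat \<Rightarrow> nat \<Rightarrow> nat" where
  "adj i \<equiv> transpose i (Suc i)"

abbreviation perms :: "nat \<Rightarrow> (nat \<Rightarrow> nat) set" where
  "perms n \<equiv> {w. w permutes {1..n}}"

lemma adj_simps [simp]: "adj i i = Suc i" "adj i (Suc i) = i"
  "x \<noteq> i \<Longrightarrow> x \<noteq> Suc i \<Longrightarrow> adj i x = x"
  by (simp_all add: transpose_def)

lemma adj_adj [simp]: "w \<circ> adj i \<circ> adj i = w"
  by (simp add: comp_assoc)

lemma adj_braid: "w \<circ> adj i \<circ> adj (Suc i) \<circ> adj i = w \<circ> adj (Suc i) \<circ> adj i \<circ> adj (Suc i)"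
  by (auto simp: fun_eq_iff transpose_def)

lemma adj_comm: "Suc i < j \<Longrightarrow> w \<circ> adj i \<circ> adj j = w \<circ> adj j \<circ> adj i"
  by (auto simp: fun_eq_iff transpose_def)

lemma adj_permutes: "i \<in> {1..<n} \<Longrightarrow> adj i permutes {1..n}"
  by (rule permutes_swap_id) auto

lemma comp_adj_perms: "w \<in> perms n \<Longrightarrow> i \<in> {1..<n} \<Longrightarrow> w \<circ> adj i \<in> perms n"
  using permutes_compose[OF adj_permutes] by blast

lemma perm_of_word_Nil [simp]: "perm_of_word [] = id"
  by (simp add: perm_of_word_def)

lemma perm_of_word_Cons: "perm_of_word (i # u) = adj i \<circ> perm_of_word u"
  by (simp add: perm_of_word_def)

lemma perm_of_word_append: "perm_of_word (u @ v) = perm_of_word u \<circ> perm_of_word v"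
  by (induction u) (simp_all add: perm_of_word_Cons comp_assoc)

lemma perm_of_word_snoc: "perm_of_word (u @ [i]) = perm_of_word u \<circ> adj i"
  by (simp add: perm_of_word_append perm_of_word_Cons)

lemma perm_of_word_rev: "perm_of_word u \<circ> perm_of_word (rev u) = id"
proof (induction u)
  case (Cons i u)
  have "perm_of_word (i # u) \<circ> perm_of_word (rev (i # u)) =
     adj i \<circ> (perm_of_word u \<circ> perm_of_word (rev u)) \<circ> adj i"
    by (simp add: perm_of_word_Cons perm_of_word_snoc comp_assoc)
  then show ?case using Cons by (simp add: fun_eq_iff)
qed simp

lemma perm_of_word_inv: "Hilbert_Choice.inv (perm_of_word u) = perm_of_word (rev u)"
  using perm_of_word_rev[of u] perm_of_word_rev[of "rev u"]
  by (intro inv_unique_comp) auto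

lemma perm_of_word_perms: "u \<in> words n \<Longrightarrow> perm_of_word u \<in> perms n"
  by (induction u) (auto simp: perm_of_word_Cons permutes_id simp del: One_nat_def intro!: permutes_compose adj_permutes)

lemma finite_perms: "finite (perms n)"
  by (rule finite_permutations) simp

lemma perms_bounds: "w \<in> perms n \<Longrightarrow> 1 \<le> x \<Longrightarrow> x \<le> n \<Longrightarrow> 1 \<le> w x \<and> w x \<le> n"
  using permutes_in_image[of w "{1..n}" x] by auto

lemma perms_inj: "w \<in> perms n \<Longrightarrow> inj w"
  using permutes_inj by blast

lemma perms_mono: "w \<in> perms m \<Longrightarrow> m \<le> n \<Longrightarrow> w \<in> perms n"
  using permutes_subset[of w "{1..m}" "{1..n}"] by auto

definition invs :: "nat \<Rightarrow> (nat \<Rightarrow> nat) \<Rightarrow> (nat \<times> nat) set" where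
  "invs n w = {(i, j). 1 \<le> i \<and> i < j \<and> j \<le> n \<and> w j < w i}"

lemma perm_len_invs: "perm_len n w = card (invs n w)"
  by (simp add: perm_len_def invs_def)

lemma finite_invs: "finite (invs n w)"
  by (rule finite_subset[of _ "{..n} \<times> {..n}"]) (auto simp: invs_def)

text \<open>Relabelling both positions by \<open>adj i\<close> carries old inversions to new ones.
  The only pair of positions whose order it would reverse is (i, i+1), and that is the one inversion
  gained.\<close>

lemma perm_len_ascent:
  assumes i: "i \<in> {1..<n}" and a: "w i < w (Suc i)"
  shows "perm_len n (w \<circ> adj i) = Suc (perm_len n w)"
proof -
  let ?f = "\<lambda>(x, y). (adj i x, adj i y)"
  have eq: "invs n (w \<circ> adj i) = insert (i, Suc i) (?f ` invs n w)"
  proof (intro equalityI subsetI)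
    fix p assume "p \<in> invs n (w \<circ> adj i)"
    then obtain x y where p: "p = (x, y)" "1 \<le> x" "x < y" "y \<le> n" "w (adj i y) < w (adj i x)"
      by (auto simp: invs_def)
    show "p \<in> insert (i, Suc i) (?f ` invs n w)"
    proof (cases "x = i \<and> y = Suc i")
      case False
      then have "adj i x < adj i y" "1 \<le> adj i x" "adj i y \<le> n"
        using p i by (auto simp: transpose_def split: if_splits)
      then have "(adj i x, adj i y) \<in> invs n w" using p by (auto simp: invs_def)
      moreover have "p = ?f (adj i x, adj i y)" using p by simp
      ultimately show ?thesis by blast
    qed (use p in simp)
  next
    fix p assume "p \<in> insert (i, Suc i) (?f ` invs n w)"
    then consider "p = (i, Suc i)" | x y where "p = (adj i x, adj i y)" "(x, y) \<in> invs n w" by auto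
    then show "p \<in> invs n (w \<circ> adj i)"
    proof cases
      case 2
      then have "\<not> (x = i \<and> y = Suc i)" using a by (auto simp: invs_def)
      then have "adj i x < adj i y" "1 \<le> adj i x" "adj i y \<le> n"
        using 2 i by (auto simp: transpose_def invs_def split: if_splits)
      then show ?thesis using 2 by (auto simp: invs_def)
    qed (use i a in \<open>auto simp: invs_def\<close>)
  qed
  have "inj_on ?f (invs n w)"
    by (rule inj_onI) (auto dest: injD[OF bij_is_inj[OF bij_swap]] simp: transpose_eq_iff)
  moreover have "(i, Suc i) \<notin> ?f ` invs n w"
    by (auto simp: invs_def transpose_eq_iff transpose_def split: if_splits)
  ultimately show ?thesis
    unfolding perm_len_invs eq by (simp add: card_image finite_invs)
qed

lemma perm_len_descent:
  assumes "i \<in> {1..<n}" "w (Suc i) < w i"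
  shows "perm_len n w = Suc (perm_len n (w \<circ> adj i))"
  using perm_len_ascent[OF assms(1), of "w \<circ> adj i"] assms(2) by simp

lemma perm_len_comp_adj:
  assumes "i \<in> {1..<n}" "inj w"
  shows "perm_len n (w \<circ> adj i) = (if w i < w (Suc i) then Suc (perm_len n w) else perm_len n w - 1)"
    "\<not> w i < w (Suc i) \<Longrightarrow> perm_len n w > 0"
  using perm_len_ascent[OF assms(1), of w] perm_len_descent[OF assms(1), of w]
    injD[OF assms(2), of i "Suc i"] by (auto simp: linorder_not_less le_less)

lemma perm_len_id [simp]: "perm_len n id = 0"
proof -
  have "invs n id = {}" by (auto simp: invs_def)
  then show ?thesis by (simp add: perm_len_invs)
qed

lemma perm_len_word_le: "u \<in> words n \<Longrightarrow> perm_len n (perm_of_word u) \<le> length u"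
proof (induction u rule: rev_induct)
  case (snoc i u)
  then have "inj (perm_of_word u)" using perm_of_word_perms perms_inj by auto
  then show ?case
    using snoc perm_len_comp_adj(1)[of i n "perm_of_word u"] by (auto simp: perm_of_word_snoc o_def)
qed simp

lemma reduced_word_snocD:
  assumes "reduced_word n w (u @ [i])"
  shows "reduced_word n (perm_of_word u) u" "perm_of_word u i < perm_of_word u (Suc i)"
    "w = perm_of_word u \<circ> adj i" "i \<in> {1..<n}"
proof -
  have r: "u \<in> words n" "i \<in> {1..<n}" "perm_of_word u \<circ> adj i = w" "Suc (length u) = perm_len n w"
    using assms by (auto simp: reduced_word_def perm_of_word_snoc lists_eq_set)
  have "inj (perm_of_word u)" using perm_of_word_perms perms_inj r by auto
  then have *: "perm_len n w = (if perm_of_word u i < perm_of_word u (Suc i)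
      then Suc (perm_len n (perm_of_word u)) else perm_len n (perm_of_word u) - 1)"
    using perm_len_comp_adj(1)[OF r(2)] r(3) by auto
  then show 1: "perm_of_word u i < perm_of_word u (Suc i)"
    using r(4) perm_len_word_le[OF r(1)] by (auto split: if_splits)
  show "reduced_word n (perm_of_word u) u"
    using r * 1 by (auto simp: reduced_word_def lists_eq_set)
  show "w = perm_of_word u \<circ> adj i" "i \<in> {1..<n}" using r by auto
qed

lemma reduced_word_snoc:
  assumes "reduced_word n w u" "i \<in> {1..<n}" "w i < w (Suc i)"
  shows "reduced_word n (w \<circ> adj i) (u @ [i])"
  using assms perm_len_ascent[OF assms(2,3)] by (auto simp: reduced_word_def perm_of_word_snoc)

lemma reduced_word_Nil: "reduced_word n id []"
  by (simp add: reduced_word_def)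

lemma reduced_wordD: "reduced_word n w u \<Longrightarrow> u \<in> words n" "reduced_word n w u \<Longrightarrow> perm_of_word u = w"
  "reduced_word n w u \<Longrightarrow> length u = perm_len n w" "reduced_word n w u \<Longrightarrow> w \<in> perms n"
  using perm_of_word_perms by (auto simp: reduced_word_def lists_eq_set)

text \<open>This is the cycle s_k s_(k-1) ... s_j (see \<open>perm_of_word_desc\<close>), the
  shortest representative of its coset of S_k. Composing a permutation of \<open>{1..k}\<close> with
  it inserts the value \<open>Suc k\<close> at position \<open>j\<close> of the one-line
  notation.\<close>

definition cyc :: "nat \<Rightarrow> nat \<Rightarrow> nat \<Rightarrow> nat" where
  "cyc k j l = (if l = j then Suc k else if j < l \<and> l \<le> Suc k then l - 1 else l)"

lemma cyc_top: "cyc k (Suc k) = id"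
  by (auto simp: cyc_def fun_eq_iff)

lemma cyc_step: "j \<le> k \<Longrightarrow> cyc k j = cyc k (Suc j) \<circ> adj j"
  by (auto simp: cyc_def fun_eq_iff transpose_def)

lemma perm_of_word_desc: "j \<le> Suc k \<Longrightarrow> perm_of_word (rev [j..<Suc k]) = cyc k j"
proof (induction "Suc k - j" arbitrary: j)
  case 0
  then have "j = Suc k" by simp
  then show ?case by (simp add: cyc_top id_def)
next
  case (Suc m)
  then have "[j..<Suc k] = j # [Suc j..<Suc k]" using upt_conv_Cons by auto
  then have "perm_of_word (rev [j..<Suc k]) = perm_of_word (rev [Suc j..<Suc k]) \<circ> adj j"
    by (simp add: perm_of_word_snoc del: upt_Suc)
  also have "\<dots> = cyc k j" using Suc cyc_step[of j k] by (simp del: upt_Suc)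
  finally show ?case .
qed

lemma cyc_perms: "1 \<le> j \<Longrightarrow> j \<le> Suc k \<Longrightarrow> cyc k j \<in> perms (Suc k)"
  using perm_of_word_perms[OF desc_words[of j "Suc k" "Suc k"]] by (simp add: perm_of_word_desc del: upt_Suc)

lemma perm_len_Suc: "w \<in> perms k \<Longrightarrow> perm_len (Suc k) w = perm_len k w"
proof -
  assume w: "w \<in> perms k"
  have "invs (Suc k) w = invs k w"
  proof -
    have "w (Suc k) = Suc k" using w by (simp add: permutes_not_in)
    then have "w x < w (Suc k)" if "1 \<le> x" "x \<le> k" for x
      using that perms_bounds[OF w that] by simp
    then show ?thesis by (fastforce simp: invs_def le_Suc_eq)
  qed
  then show ?thesis by (simp add: perm_len_invs)
qed

text \<open>In \<open>v \<circ> cyc k (Suc j)\<close> the value \<open>Suc k\<close> stands at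
  position \<open>Suc j\<close>, hence position \<open>j\<close> is an ascent and the next letter of
  the run again lengthens the permutation.\<close>

lemma reduced_word_cyc:
  assumes "reduced_word k v u"
  shows "1 \<le> j \<Longrightarrow> j \<le> Suc k \<Longrightarrow> reduced_word (Suc k) (v \<circ> cyc k j) (u @ rev [j..<Suc k])"
proof (induction "Suc k - j" arbitrary: j)
  case 0
  have "reduced_word (Suc k) v u"
    using assms perm_len_Suc[OF reduced_wordD(4)[OF assms]] by (auto simp: reduced_word_def)
  moreover have "j = Suc k" using 0 by simp
  ultimately show ?case by (simp add: cyc_top o_def)
next
  case (Suc m)
  then have j: "j \<le> k" by simp
  have e: "[j..<Suc k] = j # [Suc j..<Suc k]" using j upt_conv_Cons by auto
  have v: "v \<in> perms k" using reduced_wordD(4)[OF assms] .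
  have "reduced_word (Suc k) (v \<circ> cyc k (Suc j) \<circ> adj j) ((u @ rev [Suc j..<Suc k]) @ [j])"
  proof (rule reduced_word_snoc)
    show "reduced_word (Suc k) (v \<circ> cyc k (Suc j)) (u @ rev [Suc j..<Suc k])"
      using Suc j by (intro Suc.hyps(1)) auto
    have "v (Suc k) = Suc k" using v by (simp add: permutes_not_in)
    then show "(v \<circ> cyc k (Suc j)) j < (v \<circ> cyc k (Suc j)) (Suc j)"
      using perms_bounds[OF v, of j] Suc.prems j by (simp add: cyc_def)
  qed (use Suc.prems j in auto)
  then show ?case using cyc_step[OF j] by (simp add: e comp_assoc del: upt_Suc)
qed

text \<open>The position of the value \<open>Suc k\<close> recovers \<open>j\<close>. Besides giving
  reduced words for all permutations, this is the decomposition along which box sums are evaluated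
  by induction.\<close>

lemma cyc_bij:
  "bij_betw (\<lambda>(v, j). v \<circ> cyc k j) (perms k \<times> {1..Suc k}) (perms (Suc k))"
proof (rule bij_betw_imageI)
  have val: "(v \<circ> cyc k j) l = Suc k \<longleftrightarrow> l = j" if v: "v \<in> perms k" and j: "j \<in> {1..Suc k}" for v j l
  proof -
    have "v (Suc k) = Suc k" using v by (simp add: permutes_not_in)
    then have "(v \<circ> cyc k j) j = Suc k" by (simp add: cyc_def)
    moreover have "inj (v \<circ> cyc k j)"
      using v j cyc_perms[of j k] by (intro inj_compose) (auto intro: permutes_inj)
    ultimately show ?thesis by (metis injD)
  qed
  show "inj_on (\<lambda>(v, j). v \<circ> cyc k j) (perms k \<times> {1..Suc k})"
  proof (rule inj_onI, clarify)
    fix v j v' j' assume a: "v permutes {1..k}" "v' permutes {1..k}" "j \<in> {1..Suc k}" "j' \<in> {1..Suc k}"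
      and e: "v \<circ> cyc k j = v' \<circ> cyc k j'"
    have j: "j = j'" using val[of v j j'] val[of v' j' j'] a e by auto
    have "surj (cyc k j)" using cyc_perms[of j k] a permutes_surj by auto
    then have "v = v'" using e j by (metis fun.map_comp surj_iff comp_assoc comp_id)
    then show "v = v' \<and> j = j'" using j by simp
  qed
  show "(\<lambda>(v, j). v \<circ> cyc k j) ` (perms k \<times> {1..Suc k}) = perms (Suc k)"
  proof (intro equalityI subsetI)
    fix w assume "w \<in> (\<lambda>(v, j). v \<circ> cyc k j) ` (perms k \<times> {1..Suc k})"
    then obtain v j where "w = v \<circ> cyc k j" "v \<in> perms k" "j \<in> {1..Suc k}" by auto
    then show "w \<in> perms (Suc k)"
      using cyc_perms[of j k] perms_mono[of v k "Suc k"] permutes_compose[of "cyc k j" _ v] by auto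
  next
    fix w assume w: "w \<in> perms (Suc k)"
    define j where "j = Hilbert_Choice.inv w (Suc k)"
    have wj: "w j = Suc k" using w permutes_inverses(1)[of w] by (simp add: j_def)
    have j: "j \<in> {1..Suc k}"
      using w permutes_in_image[OF permutes_inv, of w "{1..Suc k}" "Suc k"] by (simp add: j_def)
    have c: "cyc k j \<in> perms (Suc k)" using cyc_perms j by auto
    define v where "v = w \<circ> Hilbert_Choice.inv (cyc k j)"
    have vp: "v permutes {1..Suc k}"
      unfolding v_def using w c by (auto intro!: permutes_compose permutes_inv)
    have "Hilbert_Choice.inv (cyc k j) (Suc k) = j"
      using c permutes_inv_eq[of "cyc k j" "{1..Suc k}"] by (simp add: cyc_def)
    then have "v (Suc k) = Suc k" using wj by (simp add: v_def)
    then have "v permutes {1..k}"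
      by (intro permutes_superset[OF vp]) (auto simp: le_Suc_eq)
    moreover have "w = v \<circ> cyc k j"
      using permutes_inv_o(2)[of "cyc k j"] c by (auto simp: v_def comp_assoc)
    ultimately show "w \<in> (\<lambda>(v, j). v \<circ> cyc k j) ` (perms k \<times> {1..Suc k})"
      using j by auto
  qed
qed

lemma ex_reduced_word: "w \<in> perms n \<Longrightarrow> \<exists>u. reduced_word n w u"
proof (induction n arbitrary: w)
  case 0
  then have "reduced_word 0 w []" using reduced_word_Nil[of 0] by simp
  then show ?case by blast
next
  case (Suc k)
  then obtain v j where "w = v \<circ> cyc k j" "v \<in> perms k" "j \<in> {1..Suc k}"
  proof -
    have "w \<in> (\<lambda>(v, j). v \<circ> cyc k j) ` (perms k \<times> {1..Suc k})"
      using Suc.prems bij_betw_imp_surj_on[OF cyc_bij[of k]] by blast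
    then show ?thesis using that by auto
  qed
  moreover from this obtain u where "reduced_word k v u" using Suc.IH by blast
  ultimately have "reduced_word (Suc k) w (u @ rev [j..<Suc k])"
    using reduced_word_cyc[of k v u j] by (simp del: upt_Suc)
  then show ?case by blast
qed

definition rword :: "nat \<Rightarrow> (nat \<Rightarrow> nat) \<Rightarrow> nat list" where
  "rword n w = (SOME u. reduced_word n w u)"

lemma rword: "w \<in> perms n \<Longrightarrow> reduced_word n w (rword n w)"
  unfolding rword_def using ex_reduced_word by (rule someI_ex)

text \<open>These are the normal form words. They span modulo the ideal by the normal form argument,
  and their distinct permutations make them independent.\<close>

fun canon :: "nat \<Rightarrow> nat list set" where
  "canon 0 = {[]}"
| "canon (Suc k) = (\<lambda>(x, j). x @ rev [j..<Suc k]) ` (canon k \<times> {1..Suc k})"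

lemma finite_canon: "finite (canon k)"
  by (induction k) auto

lemma canon_reduced: "u \<in> canon k \<Longrightarrow> reduced_word k (perm_of_word u) u"
proof (induction k arbitrary: u)
  case 0
  then show ?case using reduced_word_Nil[of 0] by (simp add: id_def)
next
  case (Suc k)
  then obtain x j where x: "u = x @ rev [j..<Suc k]" "x \<in> canon k" "1 \<le> j" "j \<le> Suc k"
    by (auto simp del: upt_Suc)
  show ?case
    using reduced_word_cyc[OF Suc.IH[OF x(2)] x(3,4)] x
    by (simp add: perm_of_word_append perm_of_word_desc o_def del: upt_Suc)
qed

lemma canon_inj: "inj_on perm_of_word (canon k)"
proof (induction k)
  case (Suc k)
  show ?case
  proof (rule inj_onI)
    fix u u' assume u: "u \<in> canon (Suc k)" "u' \<in> canon (Suc k)" and e: "perm_of_word u = perm_of_word u'"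
    obtain x j x' j' where x: "u = x @ rev [j..<Suc k]" "x \<in> canon k" "1 \<le> j" "j \<le> Suc k"
      "u' = x' @ rev [j'..<Suc k]" "x' \<in> canon k" "1 \<le> j'" "j' \<le> Suc k"
      using u by (auto simp del: upt_Suc)
    have "perm_of_word x \<circ> cyc k j = perm_of_word x' \<circ> cyc k j'"
      using e x by (simp add: perm_of_word_append perm_of_word_desc del: upt_Suc)
    moreover have "perm_of_word x \<in> perms k" "perm_of_word x' \<in> perms k"
      using canon_reduced x reduced_wordD by blast+
    ultimately have "(perm_of_word x, j) = (perm_of_word x', j')"
      using inj_onD[OF bij_betw_imp_inj_on[OF cyc_bij[of k]], of "(perm_of_word x, j)" "(perm_of_word x', j')"] x
      by auto
    then show "u = u'" using inj_onD[OF Suc.IH] x by auto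
  qed
qed simp


section \<open>Right modules given by operators on functions\<close>

text \<open>Functions on states form a right module: a word acts by \<open>fold\<close>, its first
  letter first. The relations are demanded on \<open>D\<close> only, since for \<open>reg_op\<close>
  they need \<open>w\<close> injective, so that \<open>w i\<close> and \<open>w (Suc i)\<close> are
  distinct.\<close>

locale hecke_ops = laurent_hom h for h :: "laurent \<Rightarrow> 'b::comm_ring_1" +
  fixes T :: "nat \<Rightarrow> ('s \<Rightarrow> 'b) \<Rightarrow> 's \<Rightarrow> 'b" and D :: "'s set"
  assumes T_lin: "T i (\<lambda>s. a * g s + b * g' s) s = a * T i g s + b * T i g' s"
    and T_cong: "1 \<le> i \<Longrightarrow> (\<And>s. s \<in> D \<Longrightarrow> g s = g' s) \<Longrightarrow> s \<in> D \<Longrightarrow> T i g s = T i g' s"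
    and T_quad: "1 \<le> i \<Longrightarrow> s \<in> D \<Longrightarrow> T i (T i g) s = h (qvar - 1) * T i g s + h qvar * g s"
    and T_braid: "1 \<le> i \<Longrightarrow> s \<in> D \<Longrightarrow> T i (T (Suc i) (T i g)) s = T (Suc i) (T i (T (Suc i) g)) s"
    and T_comm: "1 \<le> i \<Longrightarrow> Suc i < j \<Longrightarrow> s \<in> D \<Longrightarrow> T i (T j g) s = T j (T i g) s"
begin

lemma fold_lin: "fold T u (\<lambda>s. a * g s + b * g' s) = (\<lambda>s. a * fold T u g s + b * fold T u g' s)"
proof (induction u arbitrary: g g')
  case (Cons i u)
  have "T i (\<lambda>s. a * g s + b * g' s) = (\<lambda>s. a * T i g s + b * T i g' s)"
    by (rule ext) (rule T_lin)
  then show ?case using Cons.IH[of "T i g" "T i g'"] by (simp add: o_def)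
qed simp

lemma fold_cong_on:
  "u \<in> words n \<Longrightarrow> (\<And>s. s \<in> D \<Longrightarrow> g s = g' s) \<Longrightarrow> s \<in> D \<Longrightarrow> fold T u g s = fold T u g' s"
proof (induction u arbitrary: g g')
  case (Cons i u)
  have "fold T u (T i g) s = fold T u (T i g') s"
    by (rule Cons.IH) (use Cons.prems T_cong[of i g g'] in auto)
  then show ?case by simp
qed simp

lemma ops_compat:
  assumes s: "s \<in> D"
  shows "hecke_compat n (\<lambda>u. fold T u g s) {0}"
proof (rule hecke_compatI)
  fix u v i assume u: "u \<in> words n" "v \<in> words n" "i \<in> {1..<n}"
  let ?g = "fold T u g"
  have "fold T v (T i (T i ?g)) s = fold T v (\<lambda>s. h (qvar - 1) * T i ?g s + h qvar * ?g s) s"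
    using u by (intro fold_cong_on[OF _ _ s, of v n] T_quad) auto
  then show "fold T (u @ [i,i] @ v) g s - (h (qvar - 1) * fold T (u @ [i] @ v) g s + h qvar * fold T (u @ v) g s) \<in> {0}"
    by (simp add: fold_lin)
next
  fix u v i assume u: "u \<in> words n" "v \<in> words n" "1 \<le> i" "Suc i < n"
  let ?g = "fold T u g"
  have "fold T v (T i (T (Suc i) (T i ?g))) s = fold T v (T (Suc i) (T i (T (Suc i) ?g))) s"
    using u by (intro fold_cong_on[OF _ _ s, of v n] T_braid) auto
  then show "fold T (u @ [i, Suc i, i] @ v) g s - fold T (u @ [Suc i, i, Suc i] @ v) g s \<in> {0}"
    by simp
next
  fix u v i j assume u: "u \<in> words n" "v \<in> words n" "1 \<le> i" "Suc i < j" "j < n"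
  let ?g = "fold T u g"
  have "fold T v (T i (T j ?g)) s = fold T v (T j (T i ?g)) s"
    using u by (intro fold_cong_on[OF _ _ s, of v n] T_comm) auto
  then show "fold T (u @ [i, j] @ v) g s - fold T (u @ [j, i] @ v) g s \<in> {0}"
    by simp
qed

definition act :: "('s \<Rightarrow> 'b) \<Rightarrow> free_alg \<Rightarrow> 's \<Rightarrow> 'b" where
  "act g x s = lext (\<lambda>u. fold T u g s) x"

lemma act_ideal: "x \<in> hecke_ideal n \<Longrightarrow> s \<in> D \<Longrightarrow> act g x s = 0"
  unfolding act_def using lext_ideal[OF submod_zero ops_compat] by blast

lemma act_add: "act g (x + y) s = act g x s + act g y s"
  by (simp add: act_def lext_add)

lemma act_diff: "act g (x - y) s = act g x s - act g y s"
  by (simp add: act_def lext_diff)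

lemma act_sum: "act g (sum f A) s = (\<Sum>a\<in>A. act g (f a) s)"
  by (simp add: act_def lext_sum)

lemma act_const: "act g (free_const r * x) s = h r * act g x s"
  by (simp add: act_def lext_const_mult)

lemma act_mon: "act g (mon u) = fold T u g"
  by (rule ext) (simp add: act_def lext_mon)

lemma act_one: "act g 1 = g"
  using act_mon[of g "[]"] by (simp add: mon_Nil)

lemma fold_T_sum: "fold T v (\<lambda>s. \<Sum>a\<in>A. c a * f a s) = (\<lambda>s. \<Sum>a\<in>A. c a * fold T v (f a) s)"
proof (induction A rule: infinite_finite_induct)
  case (insert a A)
  then show ?case using fold_lin[of v "c a" "f a" 1 "\<lambda>s. \<Sum>a\<in>A. c a * f a s"] by simp
qed (use fold_lin[of v 0 _ 0] in simp_all)

lemma act_mult_mon: "act g (x * mon v) s = fold T v (act g x) s"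
proof -
  have "act g (x * mon v) s = lext (\<lambda>u. fold T v (fold T u g) s) x"
    using lext_mon_mult[of "\<lambda>u. fold T u g s" "[]" x v] by (simp add: act_def mon_Nil)
  also have "\<dots> = fold T v (act g x) s"
    unfolding lext_def act_def[abs_def] by (simp add: fold_T_sum)
  finally show ?thesis .
qed

lemma act_mult: "act g (x * y) s = act (act g x) y s"
proof -
  have "act g (x * (\<Sum>u\<in>A. free_const (Poly_Mapping.lookup y u) * mon (letters u))) s =
     act (act g x) (\<Sum>u\<in>A. free_const (Poly_Mapping.lookup y u) * mon (letters u)) s" for A
  proof -
    have "act g (x * (free_const r * mon u)) s = act (act g x) (free_const r * mon u) s" for r u
    proof -
      have "x * (free_const r * mon u) = free_const r * (x * mon u)"
        by (metis free_const_central mult.assoc)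
      then have "act g (x * (free_const r * mon u)) s = h r * fold T u (act g x) s"
        by (simp only: act_const act_mult_mon)
      moreover have "act (act g x) (free_const r * mon u) s = h r * fold T u (act g x) s"
        by (simp only: act_const act_mon)
      ultimately show ?thesis by simp
    qed
    then show ?thesis by (simp add: sum_distrib_left act_sum)
  qed
  from this[of "Poly_Mapping.keys y"] show ?thesis using free_alg_sum[of y] by simp
qed

end

section \<open>The regular representation\<close>

text \<open>If \<open>g w\<close> is the coefficient of T_w, these are the coefficients after right
  multiplication by T_i: T_w is reached from a longer neighbour with factor q, or from a shorter
  neighbour with factor 1 and from itself with factor q - 1.\<close>

definition reg_op :: "nat \<Rightarrow> ((nat \<Rightarrow> nat) \<Rightarrow> laurent) \<Rightarrow> (nat \<Rightarrow> nat) \<Rightarrow> laurent" where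
  "reg_op i g w = (if w i < w (Suc i) then qvar * g (w \<circ> adj i)
                   else g (w \<circ> adj i) + (qvar - 1) * g w)"

text \<open>Both sides depend only on the relative order of three consecutive values of
  \<open>w\<close>; each of the six orders is a direct computation.\<close>

lemma reg_op_braid:
  assumes "inj w"
  shows "reg_op i (reg_op (Suc i) (reg_op i g)) w = reg_op (Suc i) (reg_op i (reg_op (Suc i) g)) w"
proof -
  define a b c where abc: "a = w i" "b = w (Suc i)" "c = w (Suc (Suc i))"
  have ne: "a \<noteq> b" "b \<noteq> c" "a \<noteq> c" using injD[OF assms] by (fastforce simp: abc)+
  have v: "adj i (Suc (Suc i)) = Suc (Suc i)" "adj (Suc i) i = i" by (auto simp: transpose_def)
  have e: "w \<circ> adj i \<circ> adj (Suc i) \<circ> adj i = w \<circ> adj (Suc i) \<circ> adj i \<circ> adj (Suc i)"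
    by (rule adj_braid)
  consider "a < b" "b < c" "a < c" | "a < b" "\<not> b < c" "a < c" | "a < b" "\<not> b < c" "\<not> a < c"
    | "\<not> a < b" "b < c" "a < c" | "\<not> a < b" "b < c" "\<not> a < c" | "\<not> a < b" "\<not> b < c" "\<not> a < c"
    using ne by linarith
  then show ?thesis
  proof cases
    case 1
    then show ?thesis using ne e by (simp add: reg_op_def v abc[symmetric] algebra_simps del: comp_assoc)
  next
    case 2
    then show ?thesis using ne e by (simp add: reg_op_def v abc[symmetric] algebra_simps)
  next
    case 3
    then show ?thesis using ne e by (simp add: reg_op_def v abc[symmetric] algebra_simps)
  next
    case 4
    then show ?thesis using ne e by (simp add: reg_op_def v abc[symmetric] algebra_simps)
  next
    case 5
    then show ?thesis using ne e by (simp add: reg_op_def v abc[symmetric] algebra_simps)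
  next
    case 6
    then show ?thesis using ne e by (simp add: reg_op_def v abc[symmetric] algebra_simps)
  qed
qed

lemma reg_op_comm:
  assumes "Suc i < j"
  shows "reg_op i (reg_op j g) w = reg_op j (reg_op i g) w"
proof -
  have v: "adj i j = j" "adj i (Suc j) = Suc j" "adj j i = i" "adj j (Suc i) = Suc i"
    using assms by (auto simp: transpose_def)
  have e: "w \<circ> adj i \<circ> adj j = w \<circ> adj j \<circ> adj i" by (rule adj_comm[OF assms])
  show ?thesis
    by (cases "w i < w (Suc i)"; cases "w j < w (Suc j)") (simp_all add: reg_op_def v e algebra_simps)
qed

interpretation lau: laurent_hom "\<lambda>r::laurent. r"
  by unfold_locales simp_all

interpretation reg: hecke_ops "\<lambda>r::laurent. r" reg_op "{w. inj w}"
proof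
  fix i :: nat and s :: "nat \<Rightarrow> nat" and g g' :: "(nat \<Rightarrow> nat) \<Rightarrow> laurent"
  assume c: "\<And>s. s \<in> {w. inj w} \<Longrightarrow> g s = g' s" and s: "s \<in> {w. inj w}"
  have "inj (s \<circ> adj i)" using s by (intro inj_compose) auto
  then show "reg_op i g s = reg_op i g' s" using c s by (simp add: reg_op_def)
next
  fix i :: nat and s :: "nat \<Rightarrow> nat" and g :: "(nat \<Rightarrow> nat) \<Rightarrow> laurent"
  assume "s \<in> {w. inj w}"
  then have "s i \<noteq> s (Suc i)" using injD[of s i "Suc i"] by auto
  then show "reg_op i (reg_op i g) s = (qvar - 1) * reg_op i g s + qvar * g s"
    by (auto simp: reg_op_def algebra_simps)
next
  fix i :: nat and s :: "nat \<Rightarrow> nat" and a b and g g' :: "(nat \<Rightarrow> nat) \<Rightarrow> laurent"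
  show "reg_op i (\<lambda>s. a * g s + b * g' s) s = a * reg_op i g s + b * reg_op i g' s"
    by (simp add: reg_op_def algebra_simps)
qed (auto intro: reg_op_comm reg_op_braid)

definition delta :: "'a \<Rightarrow> 'a \<Rightarrow> 'b::zero_neq_one" where
  "delta v w = (if w = v then 1 else 0)"

text \<open>Coordinates with respect to the \<open>T_w\<close>, before these are known to be a
  basis: the right regular action applied to the coordinate vector of 1.\<close>

definition psi :: "free_alg \<Rightarrow> (nat \<Rightarrow> nat) \<Rightarrow> laurent" where
  "psi = reg.act (delta id)"

lemma reg_op_delta: "v i < v (Suc i) \<Longrightarrow> reg_op i (delta v) = delta (v \<circ> adj i)"
proof
  fix w assume v: "v i < v (Suc i)"
  have *: "w \<circ> adj i = v \<longleftrightarrow> w = v \<circ> adj i" by (metis adj_adj)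
  have "w \<noteq> v" if "w = v \<circ> adj i" using that v by (metis adj_simps(1) comp_apply less_irrefl)
  then show "reg_op i (delta v) w = delta (v \<circ> adj i) w"
    using v by (auto simp: reg_op_def delta_def *)
qed

lemma psi_reduced: "reduced_word n w u \<Longrightarrow> psi (mon u) = delta w"
proof (induction u arbitrary: w rule: rev_induct)
  case Nil
  then have "w = id" by (simp add: reduced_word_def)
  then show ?case by (simp add: psi_def reg.act_mon id_def)
next
  case (snoc i u)
  note r = reduced_word_snocD[OF snoc.prems]
  have "psi (mon u) = delta (perm_of_word u)" using snoc.IH[OF r(1)] .
  then have "psi (mon (u @ [i])) = delta (perm_of_word u \<circ> adj i)"
    using reg_op_delta[OF r(2)] by (simp add: psi_def reg.act_mon)
  then show ?case using r(3) by (simp add: o_def)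
qed

interpretation fc: laurent_hom free_const
  by unfold_locales (simp_all add: free_const_add free_const_mult)

lemma canon_span:
  assumes M: "fc.submod M"
  shows "fc.hecke_compat k \<phi> M \<Longrightarrow> (\<And>c. c \<in> canon k \<Longrightarrow> \<phi> c \<in> M) \<Longrightarrow> u \<in> words k \<Longrightarrow> \<phi> u \<in> M"
proof (induction k arbitrary: \<phi> u)
  case 0
  then have "u = []" by simp
  then show ?case using 0 by simp
next
  case (Suc k)
  show ?case
  proof (rule fc.normal_form[OF M Suc.prems(1) _ Suc.prems(3)])
    fix x j assume x: "x \<in> words k" and j: "1 \<le> j" "j \<le> Suc k"
    have c: "fc.hecke_compat k (\<lambda>u. \<phi> ([] @ u @ rev [j..<Suc k])) M"
      by (rule fc.compat_mono[OF fc.compat_context[OF Suc.prems(1)], of "[]" "rev [j..<Suc k]"])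
        (use j desc_words[of j "Suc k" "Suc k"] in auto)
    have "\<phi> ([] @ x @ rev [j..<Suc k]) \<in> M"
    proof (rule Suc.IH[OF c _ x])
      fix c assume "c \<in> canon k"
      then have "c @ rev [j..<Suc k] \<in> canon (Suc k)" using j by (auto simp del: upt_Suc)
      then show "\<phi> ([] @ c @ rev [j..<Suc k]) \<in> M" using Suc.prems(2) by simp
    qed
    then show "\<phi> (x @ rev [j..<Suc k]) \<in> M" by simp
  qed
qed

lemma braid_relator:
  "1 \<le> i \<Longrightarrow> Suc i < n \<Longrightarrow> mon [i, Suc i, i] - mon [Suc i, i, Suc i] \<in> hecke_relators n"
proof -
  assume "1 \<le> i" "Suc i < n"
  then have "\<exists>a b. mon [i, Suc i, i] - mon [Suc i, i, Suc i] =
      free_gen a * free_gen b * free_gen a - free_gen b * free_gen a * free_gen b \<and>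
      a \<in> {1..<n} \<and> b \<in> {1..<n} \<and> \<bar>int a - int b\<bar> = 1"
    by (intro exI[of _ i] exI[of _ "Suc i"]) (simp add: free_gen_mon mon_append[symmetric])
  then show ?thesis unfolding hecke_relators_def by blast
qed

lemma comm_relator:
  "1 \<le> i \<Longrightarrow> Suc i < j \<Longrightarrow> j < n \<Longrightarrow> mon [i, j] - mon [j, i] \<in> hecke_relators n"
proof -
  assume "1 \<le> i" "Suc i < j" "j < n"
  then have "\<exists>a b. mon [i, j] - mon [j, i] = free_gen a * free_gen b - free_gen b * free_gen a \<and>
      a \<in> {1..<n} \<and> b \<in> {1..<n} \<and> \<bar>int a - int b\<bar> \<ge> 2"
    by (intro exI[of _ i] exI[of _ j]) (simp add: free_gen_mon mon_append[symmetric])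
  then show ?thesis unfolding hecke_relators_def by blast
qed

lemma free_span_canon:
  assumes x: "x \<in> free_sub n"
  shows "\<exists>c. x - (\<Sum>u\<in>canon n. free_const (c u) * mon u) \<in> hecke_ideal n"
proof -
  define M where "M = {x. \<exists>c. x - (\<Sum>u\<in>canon n. free_const (c u) * mon u) \<in> hecke_ideal n}"
  have JM: "hecke_ideal n \<subseteq> M"
  proof
    fix y assume "y \<in> hecke_ideal n"
    then have "y - (\<Sum>u\<in>canon n. free_const ((\<lambda>_. 0) u) * mon u) \<in> hecke_ideal n" by simp
    then show "y \<in> M" unfolding M_def by (intro CollectI exI[of _ "\<lambda>_. 0"])
  qed
  have M: "fc.submod M"
    unfolding fc.submod_def
  proof (intro conjI ballI allI)
    show "0 \<in> M" using JM ideal_zero by blast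
    fix x y assume "x \<in> M" "y \<in> M"
    then obtain c d where "x - (\<Sum>u\<in>canon n. free_const (c u) * mon u) \<in> hecke_ideal n"
      "y - (\<Sum>u\<in>canon n. free_const (d u) * mon u) \<in> hecke_ideal n" unfolding M_def by auto
    from ideal_add[OF this]
    have "(x + y) - (\<Sum>u\<in>canon n. free_const (c u + d u) * mon u) \<in> hecke_ideal n"
      by (simp add: free_const_add distrib_right sum.distrib algebra_simps)
    then show "x + y \<in> M" unfolding M_def by (intro CollectI exI[of _ "\<lambda>u. c u + d u"])
  next
    fix r x assume "x \<in> M"
    then obtain c where "x - (\<Sum>u\<in>canon n. free_const (c u) * mon u) \<in> hecke_ideal n"
      unfolding M_def by auto
    from ideal_lmult[OF this free_sub_const[of r]]
    have "free_const r * x - (\<Sum>u\<in>canon n. free_const (r * c u) * mon u) \<in> hecke_ideal n"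
      by (simp add: free_const_mult right_diff_distrib sum_distrib_left mult.assoc)
    then show "free_const r * x \<in> M" unfolding M_def by (intro CollectI exI[of _ "\<lambda>u. r * c u"])
  qed
  have rel: "mon u * r * mon v \<in> M" if "u \<in> words n" "v \<in> words n" "r \<in> hecke_relators n" for u v r
    using that JM relators_ideal[of n]
    by (meson free_sub_mon ideal_lmult ideal_rmult subsetD)
  \<comment> \<open>Here \<open>mon\<close> itself is the function of words, with values in the free
    algebra. Its relators in context lie in the ideal, and the ideal is contained in
    \<open>M\<close>.\<close>
  have comp: "fc.hecke_compat n mon M"
  proof (rule fc.hecke_compatI)
    fix u v i assume a: "u \<in> words n" "v \<in> words n" "i \<in> {1..<n}"
    have "free_gen i * free_gen i - (free_const (qvar - 1) * free_gen i + free_const qvar) \<in> hecke_relators n"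
      using a unfolding hecke_relators_def by blast
    then have "mon u * (mon [i,i] - (free_const (qvar - 1) * mon [i] + free_const qvar * mon [])) * mon v \<in> M"
      using rel[OF a(1,2)] mon_append[of "[i]" "[i]"] by (simp add: free_gen_mon mon_Nil)
    moreover have "mon u * (A - (B + C)) * mon v = mon u * A * mon v - (mon u * B * mon v + mon u * C * mon v)" for A B C
      by (simp only: right_diff_distrib left_diff_distrib distrib_left distrib_right)
    moreover have "mon u * (free_const r * mon z) * mon v = free_const r * mon (u @ z @ v)" for r z
    proof -
      have "mon u * (free_const r * mon z) * mon v = (mon u * free_const r) * (mon z * mon v)"
        by (simp only: mult.assoc)
      then show ?thesis by (simp only: free_const_central[of r, symmetric] mon_append mult.assoc)
    qed
    moreover have "mon u * mon z * mon v = mon (u @ z @ v)" for z by (simp only: mon_append mult.assoc)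
    ultimately show "mon (u @ [i, i] @ v) - (free_const (qvar - 1) * mon (u @ [i] @ v) + free_const qvar * mon (u @ v)) \<in> M"
      by (metis append_Nil)
  next
    fix u v i assume a: "u \<in> words n" "v \<in> words n" "1 \<le> i" "Suc i < n"
    from rel[OF a(1,2) braid_relator[OF a(3,4)]]
    show "mon (u @ [i, Suc i, i] @ v) - mon (u @ [Suc i, i, Suc i] @ v) \<in> M"
      by (simp only: right_diff_distrib left_diff_distrib mon_append[symmetric] append_assoc)
  next
    fix u v i j assume a: "u \<in> words n" "v \<in> words n" "1 \<le> i" "Suc i < j" "j < n"
    from rel[OF a(1,2) comm_relator[OF a(3-5)]]
    show "mon (u @ [i, j] @ v) - mon (u @ [j, i] @ v) \<in> M"
      by (simp only: right_diff_distrib left_diff_distrib mon_append[symmetric] append_assoc)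
  qed
  have cM: "mon c \<in> M" if "c \<in> canon n" for c
  proof -
    have "(\<Sum>u\<in>canon n. free_const (if u = c then 1 else 0) * mon u) = (\<Sum>u\<in>canon n. if u = c then mon u else 0)"
      by (rule sum.cong) auto
    also have "\<dots> = mon c" using that finite_canon[of n] by (simp add: sum.delta)
    finally have "mon c - (\<Sum>u\<in>canon n. free_const (if u = c then 1 else 0) * mon u) \<in> hecke_ideal n"
      by (simp add: ideal_zero)
    then show ?thesis unfolding M_def by (intro CollectI exI[of _ "\<lambda>u. if u = c then 1 else 0"])
  qed
  have w: "mon u \<in> M" if "u \<in> words n" for u
    using canon_span[OF M comp cM that] .
  from x have "x \<in> M"
    by (induction x rule: free_sub_induct) (use w M in \<open>auto simp: fc.submod_def\<close>)
  then show ?thesis by (simp add: M_def)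
qed

lemma psi_add: "psi (x + y) w = psi x w + psi y w"
  by (simp add: psi_def reg.act_add)

lemma psi_diff: "psi (x - y) w = psi x w - psi y w"
  by (simp add: psi_def reg.act_diff)

lemma psi_sum: "psi (sum f A) w = (\<Sum>a\<in>A. psi (f a) w)"
  by (simp add: psi_def reg.act_sum)

lemma psi_const: "psi (free_const r * x) w = r * psi x w"
  by (simp add: psi_def reg.act_const)

lemma psi_ideal: "x \<in> hecke_ideal n \<Longrightarrow> w \<in> perms m \<Longrightarrow> psi x w = 0"
  unfolding psi_def by (rule reg.act_ideal) (use perms_inj in auto)

lemma psi_mult_gen: "psi (x * mon [i]) = reg_op i (psi x)"
  by (rule ext) (simp add: psi_def reg.act_mult_mon)

text \<open>Modulo the ideal \<open>x\<close> is a combination of canonical words, and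
  \<open>psi\<close> reads off its coefficients because those words are reduced for distinct
  permutations. Together with \<open>psi_ideal\<close> this identifies the ideal with the kernel of
  the coordinates, that is, the \<open>T_w\<close> form a basis.\<close>

lemma psi_inj:
  assumes x: "x \<in> free_sub n" and z: "\<And>w. w \<in> perms n \<Longrightarrow> psi x w = 0"
  shows "x \<in> hecke_ideal n"
proof -
  obtain c where c: "x - (\<Sum>u\<in>canon n. free_const (c u) * mon u) \<in> hecke_ideal n"
    using free_span_canon[OF x] by auto
  have "c v = 0" if v: "v \<in> canon n" for v
  proof -
    have r: "reduced_word n (perm_of_word u) u" if "u \<in> canon n" for u
      using canon_reduced that .
    have p: "perm_of_word v \<in> perms n" using r v reduced_wordD by blast
    have "0 = psi (\<Sum>u\<in>canon n. free_const (c u) * mon u) (perm_of_word v)"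
      using psi_ideal[OF c p] z[OF p] by (simp add: psi_diff)
    also have "\<dots> = (\<Sum>u\<in>canon n. c u * delta (perm_of_word u) (perm_of_word v))"
      unfolding psi_sum psi_const using psi_reduced[OF r] by (intro sum.cong) auto
    also have "\<dots> = (\<Sum>u\<in>canon n. if u = v then c u else 0)"
      using inj_onD[OF canon_inj[of n]] v by (intro sum.cong) (auto simp: delta_def)
    also have "\<dots> = c v" using v finite_canon[of n] by (simp add: sum.delta)
    finally show ?thesis by simp
  qed
  then show ?thesis using c by simp
qed

lemma psi_cong_ideal:
  assumes "x \<in> free_sub n" "y \<in> free_sub n" "\<And>w. w \<in> perms n \<Longrightarrow> psi x w = psi y w"
  shows "x - y \<in> hecke_ideal n"
  using assms by (intro psi_inj free_sub_diff) (auto simp: psi_diff)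

lemma psi_basis_sum:
  assumes "w \<in> perms n" "A \<subseteq> perms n"
  shows "psi (\<Sum>v\<in>A. free_const (c v) * mon (rword n v)) w = (if w \<in> A then c w else 0)"
proof -
  have "psi (\<Sum>v\<in>A. free_const (c v) * mon (rword n v)) w = (\<Sum>v\<in>A. c v * delta v w)"
    unfolding psi_sum psi_const using assms psi_reduced[OF rword] by (intro sum.cong) auto
  also have "\<dots> = (\<Sum>v\<in>A. if w = v then c v else 0)" by (rule sum.cong) (auto simp: delta_def)
  finally show ?thesis using finite_subset[OF assms(2) finite_perms] by (simp add: sum.delta')
qed

lemma rword_words: "w \<in> perms n \<Longrightarrow> rword n w \<in> words n"
  using reduced_wordD(1)[OF rword] .

lemma basis_sum_sub: "A \<subseteq> perms n \<Longrightarrow> (\<Sum>v\<in>A. free_const (c v) * mon (rword n v)) \<in> free_sub n"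
  using rword_words by (intro free_sub_sum free_sub_mult free_sub_const free_sub_mon) blast

lemma expand_basis:
  assumes "x \<in> free_sub n"
  shows "x - (\<Sum>v\<in>perms n. free_const (psi x v) * mon (rword n v)) \<in> hecke_ideal n"
  using assms by (intro psi_cong_ideal) (auto simp: psi_basis_sum intro!: basis_sum_sub)

text \<open>Two reduced words of \<open>w\<close> have the same coordinates \<open>delta w\<close>.
  Faithfulness of the coordinates replaces the combinatorics of braid moves.\<close>

lemma matsumoto: "reduced_word n w u \<Longrightarrow> reduced_word n w v \<Longrightarrow> mon u - mon v \<in> hecke_ideal n"
  by (rule psi_cong_ideal) (auto simp: psi_reduced intro!: free_sub_mon dest: reduced_wordD(1))

section \<open>The Hecke algebra as a quotient\<close>

lemma hecke_class_image: "hecke_class n x = (\<lambda>j. j + x) ` hecke_ideal n"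
  by (auto simp: hecke_class_def a_r_coset_def r_coset_def)

lemma hecke_class_eq_iff:
  "hecke_class n x = hecke_class n y \<longleftrightarrow> x - y \<in> hecke_ideal n"
proof
  assume "hecke_class n x = hecke_class n y"
  moreover have "x \<in> hecke_class n x" unfolding hecke_class_image using ideal_zero by force
  ultimately show "x - y \<in> hecke_ideal n" unfolding hecke_class_image by auto
next
  assume a: "x - y \<in> hecke_ideal n"
  have "j + x \<in> (\<lambda>j. j + y) ` hecke_ideal n" if "j \<in> hecke_ideal n" for j
    by (rule image_eqI[of _ _ "j + (x - y)"]) (use that a ideal_add in auto)
  moreover have "j + y \<in> (\<lambda>j. j + x) ` hecke_ideal n" if "j \<in> hecke_ideal n" for j
    by (rule image_eqI[of _ _ "j - (x - y)"]) (use that a ideal_diff in auto)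
  ultimately show "hecke_class n x = hecke_class n y" unfolding hecke_class_image by blast
qed

lemma hecke_ring: "Ring.ring (hecke n)"
  unfolding hecke_def by (rule ideal.quotient_is_ring[OF ideal_hecke])

lemma hecke_carrier: "carrier (hecke n) = hecke_class n ` free_sub n"
  by (auto simp: hecke_def FactRing_def A_RCOSETS_def' hecke_class_def)

lemma hecke_class_carrier: "x \<in> free_sub n \<Longrightarrow> hecke_class n x \<in> carrier (hecke n)"
  by (simp add: hecke_carrier)

lemma hecke_mult: "x \<in> free_sub n \<Longrightarrow> y \<in> free_sub n \<Longrightarrow>
    hecke_class n x \<otimes>\<^bsub>hecke n\<^esub> hecke_class n y = hecke_class n (x * y)"
  using ideal.rcoset_mult_add[OF ideal_hecke, of x n y]
  by (simp add: hecke_def FactRing_def hecke_class_def)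

lemma hecke_add: "x \<in> free_sub n \<Longrightarrow> y \<in> free_sub n \<Longrightarrow>
    hecke_class n x \<oplus>\<^bsub>hecke n\<^esub> hecke_class n y = hecke_class n (x + y)"
  using abelian_subgroup.a_rcos_sum[OF abelian_subgroupI3[OF ideal.axioms(1)[OF ideal_hecke] ring.is_abelian_group[OF ring_free_alg]], of x n y]
  by (simp add: hecke_def FactRing_def hecke_class_def)

lemma hecke_one: "\<one>\<^bsub>hecke n\<^esub> = hecke_class n 1"
  by (simp add: hecke_def FactRing_def hecke_class_def)

lemma hecke_zero: "\<zero>\<^bsub>hecke n\<^esub> = hecke_class n 0"
  using ideal_zero by (simp add: hecke_def FactRing_def hecke_class_image)

lemma hecke_smult_class: "x \<in> free_sub n \<Longrightarrow> hecke_smult n r (hecke_class n x) = hecke_class n (free_const r * x)"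
  by (simp add: hecke_smult_def hecke_mult free_sub_const)

lemma hecke_finsum:
  assumes "finite A" "\<And>a. a \<in> A \<Longrightarrow> f a \<in> free_sub n"
  shows "finsum (hecke n) (\<lambda>a. hecke_class n (f a)) A = hecke_class n (sum f A)"
  using assms
proof (induction A)
  case empty
  interpret Ring.ring "hecke n" by (rule hecke_ring)
  show ?case by (simp add: hecke_zero)
next
  case (insert a A)
  interpret Ring.ring "hecke n" by (rule hecke_ring)
  show ?case
    using insert by (subst finsum_insert) (auto simp: hecke_class_carrier hecke_add free_sub_sum)
qed

lemma T_gen_class: "T_gen n i = hecke_class n (mon [i])"
  by (simp add: T_gen_def free_gen_mon)

lemma T_basis_class: "w \<in> perms n \<Longrightarrow> T_basis n w = hecke_class n (mon (rword n w))"
proof -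
  assume w: "w \<in> perms n"
  have "foldr (\<lambda>i h. T_gen n i \<otimes>\<^bsub>hecke n\<^esub> h) u \<one>\<^bsub>hecke n\<^esub> = hecke_class n (mon u)" if "u \<in> words n" for u
    using that
  proof (induction u)
    case (Cons i u)
    then have "foldr (\<lambda>i h. T_gen n i \<otimes>\<^bsub>hecke n\<^esub> h) (i # u) \<one>\<^bsub>hecke n\<^esub> = hecke_class n (mon [i] * mon u)"
      by (subst hecke_mult[symmetric]) (auto simp: T_gen_class intro!: free_sub_mon)
    then show ?case using mon_append[of "[i]" u] by simp
  qed (simp add: hecke_one mon_Nil)
  then show ?thesis using rword_words[OF w] by (simp add: T_basis_def rword_def)
qed

lemma T_basis_reduced: "reduced_word n w u \<Longrightarrow> T_basis n w = hecke_class n (mon u)"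
  using T_basis_class[of w n] reduced_wordD(4)[of n w u] matsumoto[OF rword, of w n u]
  by (simp add: hecke_class_eq_iff)


section \<open>The Kazhdan-Lusztig element of a 312-avoiding permutation\<close>

section \<open>The bar involution and uniqueness of Kazhdan-Lusztig families\<close>

lemma sum_single_lookup: "(\<Sum>k\<in>Poly_Mapping.keys r. Poly_Mapping.single k (Poly_Mapping.lookup r k)) = r"
  by (rule poly_mapping_eqI) (simp add: lookup_sum lookup_single when_def in_keys_iff sum.delta)

lemma mult_hom_from_singles:
  fixes F :: "laurent \<Rightarrow> 'b::ring_1"
  assumes add: "\<And>x y. F (x + y) = F x + F y"
    and sing: "\<And>a b c d. F (Poly_Mapping.single a c * Poly_Mapping.single b d) =
        F (Poly_Mapping.single a c) * F (Poly_Mapping.single b d)"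
  shows "F (x * y) = F x * F y"
proof -
  have F0: "F 0 = 0" using add[of 0 0] by simp
  have sum: "F (sum g A) = (\<Sum>a\<in>A. F (g a))" for g :: "int \<Rightarrow> laurent" and A
    by (induction A rule: infinite_finite_induct) (simp_all add: F0 add)
  let ?s = "\<lambda>x k. Poly_Mapping.single k (Poly_Mapping.lookup x k) :: laurent"
  have "F ((\<Sum>k\<in>A. ?s x k) * (\<Sum>l\<in>B. ?s y l)) = F (\<Sum>k\<in>A. ?s x k) * F (\<Sum>l\<in>B. ?s y l)" for A B
    unfolding sum_product sum sing ..
  from this[of "Poly_Mapping.keys x" "Poly_Mapping.keys y"] show ?thesis
    by (simp only: sum_single_lookup)
qed

lemma qhalf_mult: "qhalf a * qhalf b = qhalf (a + b)"
  by (simp add: qhalf_def mult_single)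

lemma qhalf_0 [simp]: "qhalf 0 = 1"
  by (simp add: qhalf_def)

lemma qhalf_power: "qhalf a ^ k = qhalf (int k * a)"
  by (induction k) (simp_all add: qhalf_mult algebra_simps)

lemma lookup_qhalf_mult: "Poly_Mapping.lookup (qhalf a * x) k = Poly_Mapping.lookup x (k - a)"
proof -
  have "Poly_Mapping.lookup (qhalf a * (\<Sum>l\<in>A. Poly_Mapping.single l (Poly_Mapping.lookup x l))) k =
    Poly_Mapping.lookup (\<Sum>l\<in>A. Poly_Mapping.single l (Poly_Mapping.lookup x l)) (k - a)" for A
    unfolding sum_distrib_left qhalf_def mult_single lookup_sum
    by (rule sum.cong) (auto simp: lookup_single when_def)
  from this[of "Poly_Mapping.keys x"] show ?thesis by (simp only: sum_single_lookup)
qed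

lemma lookup_bar [simp]: "Poly_Mapping.lookup (laurent_bar r) k = Poly_Mapping.lookup r (- k)"
  by (simp add: laurent_bar_def map_key.rep_eq)

lemma bar_add: "laurent_bar (r + s) = laurent_bar r + laurent_bar s"
  by (rule poly_mapping_eqI) (simp add: lookup_add)

lemma bar_single: "laurent_bar (Poly_Mapping.single a c) = Poly_Mapping.single (- a) c"
  by (rule poly_mapping_eqI) (auto simp: lookup_single when_def)

lemma bar_mult: "laurent_bar (r * s) = laurent_bar r * laurent_bar s"
  by (rule mult_hom_from_singles) (simp_all add: bar_add bar_single mult_single)

lemma bar_qhalf: "laurent_bar (qhalf a) = qhalf (- a)"
  by (simp add: qhalf_def bar_single)

lemma bar_1: "laurent_bar 1 = 1"
  using bar_qhalf[of 0] by simp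

abbreviation qinv :: laurent where
  "qinv \<equiv> qhalf (- 2)"

lemma qvar_qinv: "qvar * qinv = 1" "qinv * qvar = 1"
  by (simp_all add: qvar_def qhalf_mult)

lemma qinv_qvar_mult: "qinv * (qvar * x) = x" "qvar * (qinv * x) = x"
  "qvar * (x * qinv) = x" "qvar * (x * (qinv * y)) = x * y"
  using qvar_qinv by (simp_all add: mult.assoc[symmetric])

interpretation lb: laurent_hom laurent_bar
  by unfold_locales (simp_all add: bar_add bar_mult bar_1)

lemma bar_qvar: "laurent_bar qvar = qinv"
  by (simp add: qvar_def bar_qhalf)

lemma mult_free_const: "x * (free_const r * y) = free_const r * (x * y)"
proof -
  have "x * (free_const r * y) = (free_const r * x) * y"
    by (simp only: free_const_central[of r x] mult.assoc)
  then show ?thesis by (simp only: mult.assoc)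
qed

text \<open>Right multiplication by the inverse of T_i, which is q^(-1) T_i + q^(-1) - 1 by the
  quadratic relation.\<close>

definition bar_op :: "nat \<Rightarrow> ((nat \<Rightarrow> nat) \<Rightarrow> laurent) \<Rightarrow> (nat \<Rightarrow> nat) \<Rightarrow> laurent" where
  "bar_op i g w = qinv * reg_op i g w + (qinv - 1) * g w"

lemma reg_op_lin: "reg_op i (\<lambda>s. a * g s + b * g' s) = (\<lambda>s. a * reg_op i g s + b * reg_op i g' s)"
  by (rule ext) (rule reg.T_lin)

lemma bar_op_fun: "bar_op i g = (\<lambda>w. qinv * reg_op i g w + (qinv - 1) * g w)"
  by (rule ext) (rule bar_op_def)

text \<open>The inverses of the generators satisfy the Hecke relations with q replaced by its
  inverse. With \<open>laurent_bar\<close> as coefficient map this is a further instance, and it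
  makes the bar map on the free algebra descend to the quotient.\<close>

interpretation regbar: hecke_ops laurent_bar bar_op "{w. inj w}"
proof
  fix i :: nat and s :: "nat \<Rightarrow> nat" and a b and g g' :: "(nat \<Rightarrow> nat) \<Rightarrow> laurent"
  show "bar_op i (\<lambda>s. a * g s + b * g' s) s = a * bar_op i g s + b * bar_op i g' s"
    by (simp add: bar_op_def reg_op_lin algebra_simps)
next
  fix i :: nat and s :: "nat \<Rightarrow> nat" and g g' :: "(nat \<Rightarrow> nat) \<Rightarrow> laurent"
  assume "1 \<le> i" "\<And>s. s \<in> {w. inj w} \<Longrightarrow> g s = g' s" "s \<in> {w. inj w}"
  then show "bar_op i g s = bar_op i g' s" using reg.T_cong[of i g g' s] by (simp add: bar_op_def)
next
  fix i :: nat and s :: "nat \<Rightarrow> nat" and g :: "(nat \<Rightarrow> nat) \<Rightarrow> laurent"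
  assume i: "1 \<le> i" "s \<in> {w. inj w}"
  have q: "reg_op i (reg_op i g) s = (qvar - 1) * reg_op i g s + qvar * g s"
    using reg.T_quad[OF i] .
  have "bar_op i (bar_op i g) s = qinv * (qinv * reg_op i (reg_op i g) s + (qinv - 1) * reg_op i g s)
      + (qinv - 1) * (qinv * reg_op i g s + (qinv - 1) * g s)"
    unfolding bar_op_fun reg_op_lin ..
  also have "\<dots> = (laurent_bar (qvar - 1)) * bar_op i g s + laurent_bar qvar * g s"
    unfolding q lb.hom_diff bar_qvar bar_1 bar_op_def
    by (simp add: algebra_simps qinv_qvar_mult)
  finally show "bar_op i (bar_op i g) s = (laurent_bar (qvar - 1)) * bar_op i g s + laurent_bar qvar * g s" .
next
  fix i :: nat and s :: "nat \<Rightarrow> nat" and g :: "(nat \<Rightarrow> nat) \<Rightarrow> laurent"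
  assume i: "1 \<le> i" "s \<in> {w. inj w}"
  have q: "reg_op i (reg_op i g) s = (qvar - 1) * reg_op i g s + qvar * g s"
    "reg_op (Suc i) (reg_op (Suc i) g) s = (qvar - 1) * reg_op (Suc i) g s + qvar * g s"
    using reg.T_quad[OF i] reg.T_quad[of "Suc i" s] i by auto
  show "bar_op i (bar_op (Suc i) (bar_op i g)) s = bar_op (Suc i) (bar_op i (bar_op (Suc i) g)) s"
    unfolding bar_op_fun reg_op_lin q reg.T_braid[OF i]
    by (simp add: algebra_simps qinv_qvar_mult)
next
  fix i j :: nat and s :: "nat \<Rightarrow> nat" and g :: "(nat \<Rightarrow> nat) \<Rightarrow> laurent"
  assume i: "1 \<le> i" "Suc i < j" "s \<in> {w. inj w}"
  show "bar_op i (bar_op j g) s = bar_op j (bar_op i g) s"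
    unfolding bar_op_fun reg_op_lin reg.T_comm[OF i] by (simp add: algebra_simps)
qed

interpretation bb: laurent_hom "\<lambda>r. free_const (laurent_bar r)"
  by unfold_locales (simp_all add: free_const_add free_const_mult bar_add bar_mult bar_1)

definition bar_gen :: "nat \<Rightarrow> free_alg" where
  "bar_gen i = free_const qinv * mon [i] + free_const (qinv - 1)"

definition bar_word :: "nat list \<Rightarrow> free_alg" where
  "bar_word u = prod_list (map bar_gen u)"

definition bar :: "free_alg \<Rightarrow> free_alg" where
  "bar = bb.lext bar_word"

lemma bar_word_append: "bar_word (u @ v) = bar_word u * bar_word v"
  by (simp add: bar_word_def)

lemma bar_mon: "bar (mon u) = bar_word u"
  by (simp add: bar_def bb.lext_mon)

lemma bar_const: "bar (free_const r * x) = free_const (laurent_bar r) * bar x"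
  by (simp add: bar_def bb.lext_const_mult)

lemma bar_plus: "bar (x + y) = bar x + bar y"
  by (simp add: bar_def bb.lext_add)

lemma bar_minus: "bar (x - y) = bar x - bar y"
  by (simp add: bar_def bb.lext_diff)

lemma bar_sum: "bar (sum f A) = (\<Sum>a\<in>A. bar (f a))"
  by (simp add: bar_def bb.lext_sum)

lemma bar_one: "bar 1 = 1"
  using bar_mon[of "[]"] by (simp add: mon_Nil bar_word_def)

lemma bar_times: "bar (x * y) = bar x * bar y"
proof -
  have 1: "bar (x * mon v) = bar x * bar_word v" for v
    using bb.lext_mon_mult[of bar_word "[]" x v]
    by (simp add: bar_def mon_Nil bb.lext_def bar_word_append sum_distrib_right mult.assoc)
  have "bar (x * (free_const r * mon v)) = bar x * bar (free_const r * mon v)" for r v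
  proof -
    have "x * (free_const r * mon v) = free_const r * (x * mon v)"
      by (rule mult_free_const)
    then have "bar (x * (free_const r * mon v)) = free_const (laurent_bar r) * (bar x * bar_word v)"
      by (simp add: bar_const 1)
    also have "\<dots> = bar x * (free_const (laurent_bar r) * bar_word v)"
      by (simp only: mult_free_const)
    finally show ?thesis by (simp add: bar_const bar_mon)
  qed
  then have "bar (x * (\<Sum>u\<in>A. free_const (Poly_Mapping.lookup y u) * mon (letters u))) =
     bar x * bar (\<Sum>u\<in>A. free_const (Poly_Mapping.lookup y u) * mon (letters u))" for A
    by (simp add: sum_distrib_left bar_sum)
  from this[of "Poly_Mapping.keys y"] show ?thesis using free_alg_sum[of y] by simp
qed

lemma bar_word_sub: "u \<in> words n \<Longrightarrow> bar_word u \<in> free_sub n"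
proof (induction u)
  case (Cons i u)
  have "mon [i] \<in> free_sub n" using Cons.prems by (intro free_sub_mon) auto
  then have "bar_gen i \<in> free_sub n" by (simp add: bar_gen_def free_sub_closed)
  then show ?case using Cons by (simp add: bar_word_def free_sub_mult)
qed (simp add: bar_word_def free_sub_one)

lemma bar_sub: "x \<in> free_sub n \<Longrightarrow> bar x \<in> free_sub n"
proof (induction x rule: free_sub_induct)
  case zero
  then show ?case by (simp add: bar_def free_sub_zero)
next
  case (scaled r u)
  then show ?case by (simp add: bar_const bar_mon bar_word_sub free_sub_closed)
next
  case (add x y)
  then show ?case by (simp add: bar_plus free_sub_add)
qed

lemma psi_bar_gen: "psi (x * bar_gen i) = bar_op i (psi x)"
proof
  fix w
  have "psi (x * bar_gen i) w = psi (free_const qinv * (x * mon [i]) + free_const (qinv - 1) * x) w"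
    unfolding bar_gen_def distrib_left mult_free_const
    by (simp only: free_const_central[of _ x])
  then show "psi (x * bar_gen i) w = bar_op i (psi x) w"
    by (simp add: psi_add psi_const psi_mult_gen bar_op_def)
qed

lemma psi_bar_word: "psi (bar_word u) = fold bar_op u (delta id)"
proof (induction u rule: rev_induct)
  case Nil
  then show ?case by (simp add: bar_word_def psi_def reg.act_one id_def)
next
  case (snoc i u)
  have "bar_word (u @ [i]) = bar_word u * bar_gen i"
    by (simp add: bar_word_append) (simp add: bar_word_def)
  then show ?case using snoc psi_bar_gen[of "bar_word u" i] by simp
qed

lemma psi_bar: "psi (bar x) = regbar.act (delta id) x"
proof
  fix w
  have "psi (bar x) w = (\<Sum>u\<in>Poly_Mapping.keys x. psi (free_const (laurent_bar (Poly_Mapping.lookup x u)) * bar_word (letters u)) w)"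
    by (simp add: bar_def bb.lext_def psi_sum)
  then show "psi (bar x) w = regbar.act (delta id) x w"
    by (simp add: psi_const psi_bar_word regbar.act_def lb.lext_def)
qed

text \<open>The coordinates of \<open>bar x\<close> are obtained by letting \<open>x\<close> act
  through the barred operators, and these annihilate the ideal.\<close>

lemma bar_ideal: "x \<in> hecke_ideal n \<Longrightarrow> bar x \<in> hecke_ideal n"
  by (rule psi_inj[OF bar_sub[OF ideal_sub]])
     (auto simp: psi_bar intro!: regbar.act_ideal dest: permutes_inj)

abbreviation hcong :: "nat \<Rightarrow> free_alg \<Rightarrow> free_alg \<Rightarrow> bool" where
  "hcong n x y \<equiv> x - y \<in> hecke_ideal n"

lemma hcong_refl: "hcong n x x"
  by (simp add: ideal_zero)

lemma hcong_sym: "hcong n x y \<Longrightarrow> hcong n y x"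
  using ideal_uminus[of "x - y" n] by simp

lemma hcong_trans [trans]: "hcong n x y \<Longrightarrow> hcong n y z \<Longrightarrow> hcong n x z"
  using ideal_add[of "x - y" n "y - z"] by simp

lemma hcong_add: "hcong n x y \<Longrightarrow> hcong n x' y' \<Longrightarrow> hcong n (x + x') (y + y')"
  using ideal_add[of "x - y" n "x' - y'"] by (simp add: algebra_simps)

lemma hcong_diff: "hcong n x y \<Longrightarrow> hcong n x' y' \<Longrightarrow> hcong n (x - x') (y - y')"
  using ideal_diff[of "x - y" n "x' - y'"] by (simp add: algebra_simps)

lemma hcong_lmult: "hcong n x y \<Longrightarrow> z \<in> free_sub n \<Longrightarrow> hcong n (z * x) (z * y)"
  using ideal_lmult[of "x - y" n z] by (simp add: algebra_simps)

lemma hcong_rmult: "hcong n x y \<Longrightarrow> z \<in> free_sub n \<Longrightarrow> hcong n (x * z) (y * z)"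
  using ideal_rmult[of "x - y" n z] by (simp add: algebra_simps)

lemma hcong_bar: "hcong n x y \<Longrightarrow> hcong n (bar x) (bar y)"
  using bar_ideal[of "x - y" n] by (simp add: bar_minus)

lemma quad_hcong: "i \<in> {1..<n} \<Longrightarrow>
    hcong n (mon [i] * mon [i]) (free_const (qvar - 1) * mon [i] + free_const qvar)"
  using relators_ideal[of n] unfolding hecke_relators_def free_gen_mon by blast

lemma bar_gen_inv:
  assumes "i \<in> {1..<n}"
  shows "hcong n (bar_gen i * mon [i]) 1" "hcong n (mon [i] * bar_gen i) 1"
proof -
  have "free_const qinv * (free_const (qvar - 1) * mon [i] + free_const qvar) + free_const (qinv - 1) * mon [i]
     = free_const (qinv * (qvar - 1) + (qinv - 1)) * mon [i] + free_const (qinv * qvar)"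
    by (simp only: free_const_mult free_const_add distrib_left distrib_right mult.assoc add_ac)
  also have "qinv * (qvar - 1) + (qinv - 1) = 0" by (simp add: qvar_qinv algebra_simps)
  also have "qinv * qvar = 1" by (rule qvar_qinv)
  also have "free_const 0 * mon [i] + free_const 1 = 1" by simp
  finally have e: "free_const qinv * (free_const (qvar - 1) * mon [i] + free_const qvar) + free_const (qinv - 1) * mon [i] = 1" .
  have "hcong n (free_const qinv * (mon [i] * mon [i]) + free_const (qinv - 1) * mon [i])
    (free_const qinv * (free_const (qvar - 1) * mon [i] + free_const qvar) + free_const (qinv - 1) * mon [i])"
    by (intro hcong_add hcong_lmult quad_hcong assms hcong_refl free_sub_const)
  then have *: "hcong n (free_const qinv * (mon [i] * mon [i]) + free_const (qinv - 1) * mon [i]) 1"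
    unfolding e .
  show "hcong n (bar_gen i * mon [i]) 1"
    using * by (simp add: bar_gen_def distrib_right mult.assoc)
  have "mon [i] * bar_gen i = free_const qinv * (mon [i] * mon [i]) + free_const (qinv - 1) * mon [i]"
    unfolding bar_gen_def distrib_left mult_free_const by (simp only: free_const_central[of _ "mon [i]"])
  then show "hcong n (mon [i] * bar_gen i) 1" using * by simp
qed

lemma bar_word_inv:
  "u \<in> words n \<Longrightarrow> hcong n (bar_word u * mon (rev u)) 1 \<and> hcong n (mon (rev u) * bar_word u) 1"
proof (induction u)
  case Nil
  then show ?case by (simp add: bar_word_def mon_Nil ideal_zero)
next
  case (Cons i u)
  then have i: "i \<in> {1..<n}" and u: "u \<in> words n" by auto
  note IH = Cons.IH[OF u]
  have s: "mon [i] \<in> free_sub n" "bar_gen i \<in> free_sub n" "bar_word u \<in> free_sub n" "mon (rev u) \<in> free_sub n"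
    using bar_word_sub[of "[i]" n] bar_word_sub[OF u] i u
    by (auto simp: bar_word_def intro!: free_sub_mon)
  have "hcong n (bar_gen i * (bar_word u * mon (rev u)) * mon [i]) (bar_gen i * 1 * mon [i])"
    using IH s by (intro hcong_rmult hcong_lmult) auto
  also have "hcong n (bar_gen i * 1 * mon [i]) 1" using bar_gen_inv[OF i] by simp
  finally have 1: "hcong n (bar_gen i * (bar_word u * mon (rev u)) * mon [i]) 1" .
  have "hcong n (mon (rev u) * (mon [i] * bar_gen i) * bar_word u) (mon (rev u) * 1 * bar_word u)"
    using bar_gen_inv[OF i] s by (intro hcong_rmult hcong_lmult) auto
  also have "hcong n (mon (rev u) * 1 * bar_word u) 1" using IH by simp
  finally have 2: "hcong n (mon (rev u) * (mon [i] * bar_gen i) * bar_word u) 1" .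
  show ?case using 1 2 by (simp add: bar_word_def mon_append mult.assoc)
qed

lemma perm_len_inv:
  assumes w: "w \<in> perms n"
  shows "perm_len n (Hilbert_Choice.inv w) = perm_len n w"
proof -
  have le: "perm_len n v \<le> perm_len n (Hilbert_Choice.inv v)" if v: "v \<in> perms n" for v
  proof -
    let ?f = "\<lambda>(i, j). (v j, v i)"
    have "inj_on ?f (invs n v)"
      using perms_inj[OF v] by (auto simp: inj_on_def)
    moreover have "?f ` invs n v \<subseteq> invs n (Hilbert_Choice.inv v)"
    proof
      fix p assume "p \<in> ?f ` invs n v"
      then obtain i j where p: "p = (v j, v i)" "1 \<le> i" "i < j" "j \<le> n" "v j < v i"
        by (auto simp: invs_def)
      then show "p \<in> invs n (Hilbert_Choice.inv v)"
        using perms_bounds[OF v, of i] perms_bounds[OF v, of j] perms_inj[OF v] by (auto simp: invs_def)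
    qed
    ultimately show ?thesis
      unfolding perm_len_invs by (metis card_inj_on_le finite_invs)
  qed
  have "Hilbert_Choice.inv w \<in> perms n" using w by (auto intro: permutes_inv)
  moreover have "Hilbert_Choice.inv (Hilbert_Choice.inv w) = w" using w permutes_inv_inv by blast
  ultimately show ?thesis using le[OF w] le[of "Hilbert_Choice.inv w"] by simp
qed

lemma reduced_word_rev: "reduced_word n w u \<Longrightarrow> reduced_word n (Hilbert_Choice.inv w) (rev u)"
  using perm_len_inv[of w n] reduced_wordD(4)[of n w u] perm_of_word_inv[of u]
  by (auto simp: reduced_word_def)

lemma T_basis_inverse:
  assumes v: "v \<in> perms n"
  shows "inv\<^bsub>hecke n\<^esub> (T_basis n (Hilbert_Choice.inv v)) = hecke_class n (bar_word (rword n v))"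
proof -
  let ?u = "rword n v"
  have u: "?u \<in> words n" "rev ?u \<in> words n" using rword_words[OF v] by auto
  have T: "T_basis n (Hilbert_Choice.inv v) = hecke_class n (mon (rev ?u))"
    using T_basis_reduced[OF reduced_word_rev[OF rword[OF v]]] .
  interpret Ring.ring "hecke n" by (rule hecke_ring)
  have "hecke_class n (bar_word ?u) = inv\<^bsub>hecke n\<^esub> hecke_class n (mon (rev ?u))"
  proof (rule inv_unique'[symmetric, OF _ _, THEN sym])
    show "hecke_class n (mon (rev ?u)) \<in> carrier (hecke n)" "hecke_class n (bar_word ?u) \<in> carrier (hecke n)"
      using u by (auto intro!: hecke_class_carrier bar_word_sub free_sub_mon)
    show "hecke_class n (mon (rev ?u)) \<otimes>\<^bsub>hecke n\<^esub> hecke_class n (bar_word ?u) = \<one>\<^bsub>hecke n\<^esub>"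
      "hecke_class n (bar_word ?u) \<otimes>\<^bsub>hecke n\<^esub> hecke_class n (mon (rev ?u)) = \<one>\<^bsub>hecke n\<^esub>"
      using u bar_word_inv[OF u(1)]
      by (simp_all add: hecke_mult free_sub_mon bar_word_sub hecke_one hecke_class_eq_iff del: in_lists_conv_set)
  qed
  then show ?thesis using T by simp
qed

definition hecke_rep :: "nat \<Rightarrow> hecke_elt \<Rightarrow> free_alg" where
  "hecke_rep n h = (SOME x. x \<in> free_sub n \<and> hecke_class n x = h)"

lemma hecke_rep:
  "h \<in> carrier (hecke n) \<Longrightarrow> hecke_rep n h \<in> free_sub n \<and> hecke_class n (hecke_rep n h) = h"
  unfolding hecke_rep_def by (rule someI_ex) (auto simp: hecke_carrier)

lemma hecke_rep_class: "x \<in> free_sub n \<Longrightarrow> hecke_rep n (hecke_class n x) \<in> free_sub n"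
  "x \<in> free_sub n \<Longrightarrow> hcong n (hecke_rep n (hecke_class n x)) x"
  using hecke_rep[OF hecke_class_carrier, of x n] by (auto simp: hecke_class_eq_iff)

definition hecke_bar :: "nat \<Rightarrow> hecke_elt \<Rightarrow> hecke_elt" where
  "hecke_bar n h = hecke_class n (bar (hecke_rep n h))"

lemma hecke_bar_class: "x \<in> free_sub n \<Longrightarrow> hecke_bar n (hecke_class n x) = hecke_class n (bar x)"
  using hcong_bar[OF hecke_rep_class(2)] by (simp add: hecke_bar_def hecke_class_eq_iff)

lemma hecke_bar_involution: "is_bar_involution n (hecke_bar n)"
  unfolding is_bar_involution_def
proof (intro conjI allI ballI impI)
  show "hecke_bar n \<in> Ring.ring_hom (hecke n) (hecke n)"
  proof (rule ring_hom_memI)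
    fix x y assume "x \<in> carrier (hecke n)" "y \<in> carrier (hecke n)"
    then obtain a b where "a \<in> free_sub n" "b \<in> free_sub n" "x = hecke_class n a" "y = hecke_class n b"
      by (auto simp: hecke_carrier)
    then show "hecke_bar n x \<in> carrier (hecke n)"
      "hecke_bar n (x \<otimes>\<^bsub>hecke n\<^esub> y) = hecke_bar n x \<otimes>\<^bsub>hecke n\<^esub> hecke_bar n y"
      "hecke_bar n (x \<oplus>\<^bsub>hecke n\<^esub> y) = hecke_bar n x \<oplus>\<^bsub>hecke n\<^esub> hecke_bar n y"
      by (simp_all add: hecke_mult hecke_add hecke_bar_class free_sub_closed bar_sub bar_times bar_plus hecke_class_carrier)
  qed (simp add: hecke_one hecke_bar_class free_sub_one bar_one)
  fix r h assume "h \<in> carrier (hecke n)"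
  then obtain a where "a \<in> free_sub n" "h = hecke_class n a" by (auto simp: hecke_carrier)
  then show "hecke_bar n (hecke_smult n r h) = hecke_smult n (laurent_bar r) (hecke_bar n h)"
    by (simp add: hecke_smult_class hecke_bar_class free_sub_closed bar_sub bar_const)
next
  fix v assume v: "v permutes {1..n}"
  then show "hecke_bar n (T_basis n v) = inv\<^bsub>hecke n\<^esub> (T_basis n (Hilbert_Choice.inv v))"
    using T_basis_inverse[of v n] T_basis_class[of v n] rword_words[of v n]
    by (simp add: hecke_bar_class free_sub_mon bar_mon)
qed

text \<open>Semilinearity and the prescribed values on the spanning elements T_v determine the map.
  The existential quantifier over \<open>\<beta>\<close> in the definition of a Kazhdan-Lusztig
  family can therefore be replaced by the concrete \<open>bar\<close>.\<close>

lemma bar_involution_unique: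
  assumes b: "is_bar_involution n \<beta>" and x: "x \<in> free_sub n"
  shows "\<beta> (hecke_class n x) = hecke_class n (bar x)"
proof -
  let ?b = "\<lambda>c A. \<Sum>v\<in>A. free_const (c v) * mon (rword n v)"
  have hom: "\<beta> \<in> Ring.ring_hom (hecke n) (hecke n)"
    and sm: "\<And>r h. h \<in> carrier (hecke n) \<Longrightarrow> \<beta> (hecke_smult n r h) = hecke_smult n (laurent_bar r) (\<beta> h)"
    and T: "\<And>v. v permutes {1..n} \<Longrightarrow> \<beta> (T_basis n v) = inv\<^bsub>hecke n\<^esub> (T_basis n (Hilbert_Choice.inv v))"
    using b unfolding is_bar_involution_def by auto
  interpret hh: ring_hom_ring "hecke n" "hecke n" \<beta>
    by (intro ring_hom_ringI2 hecke_ring hom)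
  have basis: "\<beta> (hecke_class n (free_const r * mon (rword n v))) = hecke_class n (bar (free_const r * mon (rword n v)))"
    if v: "v \<in> perms n" for r v
  proof -
    have s: "mon (rword n v) \<in> free_sub n" "bar_word (rword n v) \<in> free_sub n"
      using rword_words[OF v] by (auto intro: free_sub_mon bar_word_sub)
    have "\<beta> (hecke_class n (mon (rword n v))) = hecke_class n (bar_word (rword n v))"
      using T[of v] v T_basis_inverse[OF v] T_basis_class[OF v] by simp
    then show ?thesis
      using sm[of "hecke_class n (mon (rword n v))" r] s
      by (simp add: hecke_smult_class hecke_class_carrier bar_const bar_mon)
  qed
  have "\<beta> (hecke_class n (?b c A)) = hecke_class n (bar (?b c A))" if "finite A" "A \<subseteq> perms n" for c A
    using that
  proof (induction A)
    case empty
    have "\<beta> (hecke_class n 0) = hecke_class n 0" using hh.hom_zero by (simp add: hecke_zero)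
    then show ?case by (simp add: bar_def)
  next
    case (insert v A)
    have s: "free_const (c v) * mon (rword n v) \<in> free_sub n" "?b c A \<in> free_sub n"
      using insert.prems rword_words[of v n] basis_sum_sub[of A n]
      by (auto intro!: free_sub_mult free_sub_const free_sub_mon)
    have "\<beta> (hecke_class n (?b c (insert v A))) =
      \<beta> (hecke_class n (free_const (c v) * mon (rword n v))) \<oplus>\<^bsub>hecke n\<^esub> \<beta> (hecke_class n (?b c A))"
      using insert.hyps s hh.hom_add[of "hecke_class n (free_const (c v) * mon (rword n v))" "hecke_class n (?b c A)"]
      by (simp add: hecke_add hecke_class_carrier)
    also have "\<dots> = hecke_class n (bar (free_const (c v) * mon (rword n v))) \<oplus>\<^bsub>hecke n\<^esub> hecke_class n (bar (?b c A))"
      using insert basis by simp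
    also have "\<dots> = hecke_class n (bar (?b c (insert v A)))"
      using insert.hyps s by (simp add: hecke_add bar_sub bar_plus)
    finally show ?case .
  qed
  from this[OF finite_perms order_refl]
  have 1: "\<beta> (hecke_class n (?b (psi x) (perms n))) = hecke_class n (bar (?b (psi x) (perms n)))" .
  have 2: "hcong n x (?b (psi x) (perms n))" by (rule expand_basis[OF x])
  have "hecke_class n x = hecke_class n (?b (psi x) (perms n))" using 2 by (simp only: hecke_class_eq_iff)
  moreover have "hecke_class n (bar x) = hecke_class n (bar (?b (psi x) (perms n)))"
    using hcong_bar[OF 2] by (simp only: hecke_class_eq_iff)
  ultimately show ?thesis using 1 by simp
qed

text \<open>The bar image of T_v is q^(-l(v)) T_v plus terms of smaller length. In the product of
  the factors q^(-1) T_i + (q^(-1) - 1), only the choice of q^(-1) T_i everywhere reaches length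
  l(v).\<close>

lemma psi_bar_triangular:
  "reduced_word n v u \<Longrightarrow> w \<in> perms n \<Longrightarrow> perm_len n v \<le> perm_len n w \<Longrightarrow>
     psi (bar_word u) w = (if w = v then qinv ^ perm_len n v else 0)"
proof (induction u arbitrary: v w rule: rev_induct)
  case Nil
  then show ?case by (auto simp: reduced_word_def psi_bar_word delta_def)
next
  case (snoc i u)
  note r = reduced_word_snocD[OF snoc.prems(1)]
  let ?p = "perm_of_word u"
  have len: "perm_len n v = Suc (perm_len n ?p)"
    using snoc.prems(1) r(1) by (auto simp: reduced_word_def)
  have IH: "psi (bar_word u) x = (if x = ?p then qinv ^ perm_len n ?p else 0)"
    if "x \<in> perms n" "perm_len n ?p \<le> perm_len n x" for x
    using snoc.IH[OF r(1) that] .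
  have ws: "w \<circ> adj i \<in> perms n" using comp_adj_perms snoc.prems(2) r(4) .
  have wp: "w \<noteq> ?p" using len snoc.prems(3) by auto
  have gw: "psi (bar_word u) w = 0" using IH[OF snoc.prems(2)] len snoc.prems(3) wp by auto
  have e: "psi (bar_word (u @ [i])) w = qinv * reg_op i (psi (bar_word u)) w"
    using gw psi_bar_gen[of "bar_word u" i] by (simp add: bar_word_append) (simp add: bar_word_def bar_op_def)
  have L: "perm_len n (w \<circ> adj i) = (if w i < w (Suc i) then Suc (perm_len n w) else perm_len n w - 1)"
    using perm_len_comp_adj(1)[OF r(4) perms_inj[OF snoc.prems(2)]] .
  show ?case
  proof (cases "w i < w (Suc i)")
    case True
    have "w \<noteq> v" using True r(2,3) by auto
    moreover have "psi (bar_word u) (w \<circ> adj i) = 0"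
    proof -
      have "w \<circ> adj i \<noteq> ?p" using L True len snoc.prems(3) by auto
      then show ?thesis using IH[OF ws] L True len snoc.prems(3) by auto
    qed
    ultimately show ?thesis using e True by (simp add: reg_op_def)
  next
    case False
    have "psi (bar_word u) (w \<circ> adj i) = (if w \<circ> adj i = ?p then qinv ^ perm_len n ?p else 0)"
      using IH[OF ws] L False len snoc.prems(3) by auto
    moreover have "w \<circ> adj i = ?p \<longleftrightarrow> w = v" using r(3) by (metis adj_adj)
    ultimately show ?thesis using e False gw len by (simp add: reg_op_def)
  qed
qed

lemma lookup_poly_in_q:
  "Poly_Mapping.lookup (poly_in_q p) k = (if 0 \<le> k \<and> even k then coeff p (nat (k div 2)) else 0)"
proof -
  have "of_int c * qvar ^ i = Poly_Mapping.single (2 * int i) c" for c i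
  proof -
    have "of_int c = (Poly_Mapping.single 0 c :: laurent)"
      by (metis single_of_int of_int_eq_id id_apply)
    then show ?thesis by (simp only: qvar_def qhalf_power) (simp add: qhalf_def mult_single mult.commute)
  qed
  then have "Poly_Mapping.lookup (poly_in_q p) k = (\<Sum>i\<le>degree p. if 2 * int i = k then coeff p i else 0)"
    by (simp add: poly_in_q_def lookup_sum lookup_single when_def)
  also have "\<dots> = (if 0 \<le> k \<and> even k then coeff p (nat (k div 2)) else 0)"
  proof (cases "0 \<le> k \<and> even k")
    case True
    then have "2 * int i = k \<longleftrightarrow> i = nat (k div 2)" for i by auto
    then show ?thesis using True by (simp add: sum.delta' coeff_eq_0 not_le)
  next
    case False
    then have "2 * int i \<noteq> k" for i by auto
    then show ?thesis using False by (auto intro!: sum.neutral)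
  qed
  finally show ?thesis .
qed

lemma poly_in_q_inj: "poly_in_q p = poly_in_q p' \<Longrightarrow> p = p'"
proof (rule poly_eqI)
  fix i assume "poly_in_q p = poly_in_q p'"
  then have "Poly_Mapping.lookup (poly_in_q p) (2 * int i) = Poly_Mapping.lookup (poly_in_q p') (2 * int i)" by simp
  then show "coeff p i = coeff p' i" by (simp add: lookup_poly_in_q)
qed

lemma bruhat_le_perms: "bruhat_le n v w \<Longrightarrow> v \<in> perms n"
  by (simp add: bruhat_le_def)

lemma finite_bruhat: "finite {v. bruhat_le n v w}"
  by (rule finite_subset[OF _ finite_perms[of n]]) (auto simp: bruhat_le_def)

definition kl_elem :: "nat \<Rightarrow> (nat \<Rightarrow> nat) \<Rightarrow> ((nat \<Rightarrow> nat) \<Rightarrow> int poly) \<Rightarrow> free_alg" where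
  "kl_elem n w P = free_const (qhalf (- int (perm_len n w))) *
     (\<Sum>v\<in>{v. bruhat_le n v w}. free_const (poly_in_q (P v)) * mon (rword n v))"

lemma kl_elem_sub: "kl_elem n w P \<in> free_sub n"
  unfolding kl_elem_def
  by (intro free_sub_mult free_sub_const basis_sum_sub) (auto simp: bruhat_le_def)

lemma KL_sum_class: "KL_sum n w P = hecke_class n (kl_elem n w P)"
proof -
  have b: "mon (rword n v) \<in> free_sub n" if "bruhat_le n v w" for v
    using rword_words[OF bruhat_le_perms[OF that]] by (rule free_sub_mon)
  interpret Ring.ring "hecke n" by (rule hecke_ring)
  have "finsum (hecke n) (\<lambda>v. hecke_smult n (poly_in_q (P v)) (T_basis n v)) {v. bruhat_le n v w} =
    finsum (hecke n) (\<lambda>v. hecke_class n (free_const (poly_in_q (P v)) * mon (rword n v))) {v. bruhat_le n v w}"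
    by (rule finsum_cong')
       (use b in \<open>auto simp: T_basis_class[OF bruhat_le_perms] hecke_smult_class hecke_class_carrier free_sub_closed\<close>)
  also have "\<dots> = hecke_class n (\<Sum>v\<in>{v. bruhat_le n v w}. free_const (poly_in_q (P v)) * mon (rword n v))"
    using b by (intro hecke_finsum finite_bruhat free_sub_mult free_sub_const) auto
  finally have fin: "finsum (hecke n) (\<lambda>v. hecke_smult n (poly_in_q (P v)) (T_basis n v)) {v. bruhat_le n v w} =
    hecke_class n (\<Sum>v\<in>{v. bruhat_le n v w}. free_const (poly_in_q (P v)) * mon (rword n v))" .
  have "{v. bruhat_le n v w} \<subseteq> perms n" by (auto simp: bruhat_le_def)
  then show ?thesis
    by (simp only: KL_sum_def kl_elem_def fin hecke_smult_class[OF basis_sum_sub])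
qed

lemma is_KL_family_iff:
  "is_KL_family n w P \<longleftrightarrow> P w = 1 \<and> (\<forall>v. \<not> bruhat_le n v w \<longrightarrow> P v = 0) \<and>
     (\<forall>v. bruhat_le n v w \<and> v \<noteq> w \<longrightarrow> 2 * degree (P v) + 1 + perm_len n v \<le> perm_len n w) \<and>
     hcong n (bar (kl_elem n w P)) (kl_elem n w P)"
proof -
  have "(\<exists>\<beta>. is_bar_involution n \<beta> \<and> \<beta> (KL_sum n w P) = KL_sum n w P) \<longleftrightarrow>
      hcong n (bar (kl_elem n w P)) (kl_elem n w P)"
    using bar_involution_unique[OF _ kl_elem_sub] hecke_bar_involution[of n]
    unfolding KL_sum_class hecke_class_eq_iff[symmetric] by metis
  then show ?thesis by (simp add: is_KL_family_def)
qed

text \<open>In the application \<open>a\<close> and \<open>b\<close> are the lengths of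
  \<open>v\<close> and \<open>w\<close>, and \<open>k\<close> counts half powers of q. The equation
  reflects exponents at b - a, sending k to 2b - 2a - k. All exponents of \<open>c\<close> lie
  strictly below b - a, so none of them has its mirror image.\<close>

lemma bar_invariant_negative:
  assumes e: "qhalf (- int b) * c = qinv ^ a * laurent_bar (qhalf (- int b) * c)"
    and deg: "\<And>k. Poly_Mapping.lookup c k \<noteq> 0 \<Longrightarrow> k + int a < int b"
  shows "c = 0"
proof (rule poly_mapping_eqI)
  fix k
  have 1: "Poly_Mapping.lookup (qhalf (- int b) * c) (k - int b) = Poly_Mapping.lookup c k"
    by (simp add: lookup_qhalf_mult)
  have "qinv ^ a = qhalf (- 2 * int a)" by (simp add: qhalf_power mult.commute)
  then have 2: "Poly_Mapping.lookup (qinv ^ a * laurent_bar (qhalf (- int b) * c)) (k - int b) =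
     Poly_Mapping.lookup c (2 * int b - k - 2 * int a)"
    unfolding lookup_qhalf_mult lookup_bar \<open>qinv ^ a = qhalf (- 2 * int a)\<close>
    by (simp add: algebra_simps)
  have "Poly_Mapping.lookup c k = Poly_Mapping.lookup c (2 * int b - k - 2 * int a)"
    using 1 2 e by simp
  then have "Poly_Mapping.lookup c k = 0"
    using deg[of k] deg[of "2 * int b - k - 2 * int a"] by (rule_tac ccontr) linarith
  then show "Poly_Mapping.lookup c k = Poly_Mapping.lookup 0 k" by simp
qed

text \<open>The difference of two families gives a bar invariant combination of the T_v. By
  triangularity its coefficient at \<open>v\<close> only meets those at longer \<open>u\<close>, so
  descending induction on the length leaves at each \<open>v\<close> a single term that bar fixes up
  to a power of q; the strict degree bound forces it to vanish.\<close>

lemma KL_family_unique: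
  assumes P: "is_KL_family n w P" and P': "is_KL_family n w P'" and w: "w \<in> perms n"
  shows "P = P'"
proof -
  note P = P[unfolded is_KL_family_iff] and P' = P'[unfolded is_KL_family_iff]
  let ?I = "{v. bruhat_le n v w}" and ?s = "qhalf (- int (perm_len n w))"
  define d where "d v = poly_in_q (P v) - poly_in_q (P' v)" for v
  define X where "X = kl_elem n w P - kl_elem n w P'"
  have Ip: "?I \<subseteq> perms n" by (auto simp: bruhat_le_def)
  have X: "X = (\<Sum>v\<in>?I. free_const (?s * d v) * mon (rword n v))"
    by (simp add: X_def kl_elem_def d_def free_const_mult free_const_diff right_diff_distrib[symmetric]
        sum_subtractf[symmetric] left_diff_distrib[symmetric] sum_distrib_left mult.assoc)
  have inv: "hcong n (bar X) X"
    using hcong_diff[of "bar (kl_elem n w P)" "kl_elem n w P" n] P P' by (simp add: X_def bar_minus)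
  have "d v = 0" if "v \<in> ?I" for v
    using that
  proof (induction "perm_len n w - perm_len n v" arbitrary: v rule: less_induct)
    case less
    show ?case
    proof (cases "v = w")
      case True
      then show ?thesis using P P' by (simp add: d_def)
    next
      case False
      have v: "v \<in> perms n" using less.prems Ip by blast
      have bound: "2 * degree (P v) + 1 + perm_len n v \<le> perm_len n w"
        "2 * degree (P' v) + 1 + perm_len n v \<le> perm_len n w"
        using P P' less.prems False by auto
      have "psi X v = ?s * d v" unfolding X using psi_basis_sum[OF v Ip] less.prems by simp
      moreover have "psi (bar X) v = psi X v"
        using psi_ideal[OF inv v] by (simp add: psi_diff)
      moreover have "psi (bar X) v = laurent_bar (?s * d v) * qinv ^ perm_len n v"
      proof -
        have "psi (bar X) v = (\<Sum>u\<in>?I. laurent_bar (?s * d u) * psi (bar_word (rword n u)) v)"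
          unfolding X by (simp add: bar_sum bar_const bar_mon psi_sum psi_const)
        also have "\<dots> = (\<Sum>u\<in>?I. if u = v then laurent_bar (?s * d v) * qinv ^ perm_len n v else 0)"
        proof (rule sum.cong[OF refl])
          fix u assume u: "u \<in> ?I"
          show "laurent_bar (?s * d u) * psi (bar_word (rword n u)) v =
            (if u = v then laurent_bar (?s * d v) * qinv ^ perm_len n v else 0)"
          proof (cases "perm_len n u \<le> perm_len n v")
            case True
            then show ?thesis
              using psi_bar_triangular[OF rword v, of u] u Ip by (cases "u = v") auto
          next
            case f: False
            have "d u = 0" by (rule less.hyps) (use f bound u in auto)
            then show ?thesis using f by (auto simp: lb.hom_0)
          qed
        qed
        also have "\<dots> = laurent_bar (?s * d v) * qinv ^ perm_len n v"
          using less.prems finite_bruhat by (simp add: sum.delta)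
        finally show ?thesis .
      qed
      ultimately have "?s * d v = qinv ^ perm_len n v * laurent_bar (?s * d v)" by (simp add: mult.commute)
      then show ?thesis
      proof (rule bar_invariant_negative)
        fix k assume "Poly_Mapping.lookup (d v) k \<noteq> 0"
        then have k: "0 \<le> k" "even k" "coeff (P v) (nat (k div 2)) \<noteq> 0 \<or> coeff (P' v) (nat (k div 2)) \<noteq> 0"
          by (auto simp: d_def lookup_minus lookup_poly_in_q split: if_splits)
        then have "nat (k div 2) \<le> degree (P v) \<or> nat (k div 2) \<le> degree (P' v)"
          using le_degree by blast
        then show "k + int (perm_len n v) < int (perm_len n w)" using bound k by auto
      qed
    qed
  qed
  then have "P v = P' v" if "bruhat_le n v w" for v
    using that poly_in_q_inj[of "P v" "P' v"] by (simp add: d_def)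
  moreover have "P v = P' v" if "\<not> bruhat_le n v w" for v using that P P' by simp
  ultimately show ?thesis by blast
qed


section \<open>Sums over lower intervals of 312-avoiding permutations\<close>

definition box :: "nat \<Rightarrow> (nat \<Rightarrow> nat) \<Rightarrow> (nat \<Rightarrow> nat) set" where
  "box n f = {v \<in> perms n. \<forall>i\<in>{1..n}. v i \<le> f i}"

definition box_sum :: "nat \<Rightarrow> (nat \<Rightarrow> nat) \<Rightarrow> free_alg" where
  "box_sum n f = (\<Sum>v\<in>box n f. mon (rword n v))"

text \<open>Hessenberg functions, the monotone paths above the diagonal; values outside
  \<open>{1..n}\<close> are arbitrary.\<close>

definition hess :: "nat \<Rightarrow> (nat \<Rightarrow> nat) \<Rightarrow> bool" where
  "hess n f \<longleftrightarrow> (\<forall>i\<in>{1..n}. i \<le> f i \<and> f i \<le> n) \<and> (\<forall>i j. 1 \<le> i \<and> i \<le> j \<and> j \<le> n \<longrightarrow> f i \<le> f j)"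

text \<open>The number of cells between the path of \<open>f\<close> and the diagonal. For
  \<open>f\<close> coming from a 312-avoiding permutation it is the length
  (\<open>perm_len_area\<close>).\<close>

definition area :: "nat \<Rightarrow> (nat \<Rightarrow> nat) \<Rightarrow> nat" where
  "area n f = (\<Sum>i\<in>{1..n}. f i - i)"

lemma perms_preimage: "v \<in> perms n \<Longrightarrow> x \<in> {1..n} \<Longrightarrow> \<exists>k\<in>{1..n}. v k = x"
  using permutes_image[of v "{1..n}"] by (metis imageE mem_Collect_eq)

lemma box_perms: "box n f \<subseteq> perms n"
  by (auto simp: box_def)

lemma box_sum_basis: "box_sum n f = (\<Sum>v\<in>box n f. free_const 1 * mon (rword n v))"
  by (simp add: box_sum_def)

lemma box_sum_sub: "box_sum n f \<in> free_sub n"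
  unfolding box_sum_basis by (rule basis_sum_sub[OF box_perms])

lemma psi_box_sum: "w \<in> perms n \<Longrightarrow> psi (box_sum n f) w = (if w \<in> box n f then 1 else 0)"
  unfolding box_sum_basis by (rule psi_basis_sum[OF _ box_perms])

text \<open>The box is stable under exchanging the values at positions i and i+1. The sum thus
  consists of pairs T_v + T_v T_i, and T_i acts on 1 + T_i from the right as q.\<close>

lemma box_sum_absorb:
  assumes i: "i \<in> {1..<n}" and f: "f i = f (Suc i)"
  shows "hcong n (box_sum n f * mon [i]) (free_const qvar * box_sum n f)"
proof (rule psi_cong_ideal)
  show "box_sum n f * mon [i] \<in> free_sub n"
    using i by (intro free_sub_mult box_sum_sub free_sub_mon) auto
  show "free_const qvar * box_sum n f \<in> free_sub n"
    by (intro free_sub_mult box_sum_sub free_sub_const)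
  fix w assume w: "w \<in> perms n"
  have ws: "w \<circ> adj i \<in> perms n" using comp_adj_perms[OF w i] .
  have "(\<forall>k\<in>{1..n}. (w \<circ> adj i) k \<le> f k) \<longleftrightarrow> (\<forall>k\<in>{1..n}. w k \<le> f k)"
  proof -
    have "(\<forall>k\<in>{1..n}. w (adj i k) \<le> f k) \<longleftrightarrow> (\<forall>k\<in>{1..n}. w k \<le> f (adj i k))"
      using permutes_in_image[OF adj_permutes[OF i]] by (metis transpose_involutory)
    moreover have "f (adj i k) = f k" for k using f by (auto simp: transpose_def)
    ultimately show ?thesis by simp
  qed
  then have "w \<circ> adj i \<in> box n f \<longleftrightarrow> w \<in> box n f" using w ws by (simp add: box_def)
  then show "psi (box_sum n f * mon [i]) w = psi (free_const qvar * box_sum n f) w"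
    using w ws by (simp add: psi_mult_gen psi_const reg_op_def psi_box_sum)
qed

text \<open>All the boxes involved impose the same condition \<open>c\<close> away from the
  positions i and i+1. What remains is a comparison of coefficients according to the two distinct
  values at these positions.\<close>

lemma modular_law:
  assumes i: "i \<in> {1..<n}" and f: "f (Suc i) = Suc (f i)"
  shows "hcong n (box_sum n f * (1 + mon [i]))
     (box_sum n (f(i := Suc (f i))) + free_const qvar * box_sum n (f(Suc i := f i)))"
proof (rule psi_cong_ideal)
  show "box_sum n f * (1 + mon [i]) \<in> free_sub n"
    using i by (intro free_sub_mult box_sum_sub free_sub_mon free_sub_add free_sub_one) auto
  show "box_sum n (f(i := Suc (f i))) + free_const qvar * box_sum n (f(Suc i := f i)) \<in> free_sub n"
    by (intro free_sub_mult box_sum_sub free_sub_const free_sub_add)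
  fix w assume w: "w \<in> perms n"
  have ws: "w \<circ> adj i \<in> perms n" using comp_adj_perms[OF w i] .
  define c where "c \<longleftrightarrow> (\<forall>k\<in>{1..n} - {i, Suc i}. w k \<le> f k)"
  have split: "(\<forall>k\<in>{1..n}. P k) \<longleftrightarrow> (\<forall>k\<in>{1..n} - {i, Suc i}. P k) \<and> P i \<and> P (Suc i)" for P
    using i by auto
  have k: "(\<forall>k\<in>{1..n} - {i, Suc i}. w (adj i k) \<le> f k) \<longleftrightarrow> c" by (auto simp: c_def)
  have b: "w \<in> box n f \<longleftrightarrow> c \<and> w i \<le> f i \<and> w (Suc i) \<le> Suc (f i)"
    "w \<circ> adj i \<in> box n f \<longleftrightarrow> c \<and> w (Suc i) \<le> f i \<and> w i \<le> Suc (f i)"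
    "w \<in> box n (f(i := Suc (f i))) \<longleftrightarrow> c \<and> w i \<le> Suc (f i) \<and> w (Suc i) \<le> Suc (f i)"
    "w \<in> box n (f(Suc i := f i)) \<longleftrightarrow> c \<and> w i \<le> f i \<and> w (Suc i) \<le> f i"
    using w ws k unfolding box_def mem_Collect_eq split by (auto simp: f c_def)
  have ne: "w i \<noteq> w (Suc i)" using injD[OF perms_inj[OF w], of i "Suc i"] by auto
  show "psi (box_sum n f * (1 + mon [i])) w =
    psi (box_sum n (f(i := Suc (f i))) + free_const qvar * box_sum n (f(Suc i := f i))) w"
    using w ws ne by (simp add: distrib_left psi_add psi_mult_gen psi_const reg_op_def psi_box_sum b)
qed

text \<open>The positions 1, ..., i+1 would carry i+1 distinct values that are at most i. This
  disposes of the last term of the modular law when the lowered function falls below the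
  diagonal.\<close>

lemma box_empty:
  assumes "1 \<le> i" "Suc i \<le> n" "f i = i" "f (Suc i) = i" "\<And>k. 1 \<le> k \<Longrightarrow> k < i \<Longrightarrow> f k \<le> i"
  shows "box n f = {}"
proof (rule ccontr)
  assume "box n f \<noteq> {}"
  then obtain v where v: "v \<in> perms n" and le: "\<forall>k\<in>{1..n}. v k \<le> f k" by (auto simp: box_def)
  have "v ` {1..Suc i} \<subseteq> {1..i}"
  proof
    fix x assume "x \<in> v ` {1..Suc i}"
    then obtain k where k: "x = v k" "1 \<le> k" "k \<le> Suc i" by auto
    then have "f k \<le> i" using assms(3-5) by (cases "k < i") (auto simp: le_Suc_eq)
    then show "x \<in> {1..i}" using le k assms(2) perms_bounds[OF v, of k] by force
  qed
  then have "card (v ` {1..Suc i}) \<le> i" using card_mono[of "{1..i}" "v ` {1..Suc i}"] by simp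
  moreover have "card (v ` {1..Suc i}) = Suc i"
    using card_image[of v "{1..Suc i}"] perms_inj[OF v] by (auto simp: inj_on_subset)
  ultimately show False by simp
qed

lemma rword_id: "rword n id = []"
  using reduced_wordD(3)[OF rword[of id n]] by (simp add: permutes_id)

lemma box_trivial: "(\<And>i. i \<in> {1..n} \<Longrightarrow> f i = i) \<Longrightarrow> box n f = {id}"
proof (intro equalityI subsetI)
  fix v assume f: "\<And>i. i \<in> {1..n} \<Longrightarrow> f i = i" and v: "v \<in> box n f"
  then have vp: "v \<in> perms n" and le: "\<And>k. k \<in> {1..n} \<Longrightarrow> v k \<le> k" by (auto simp: box_def)
  have "v k = k" for k
  proof (induction k rule: less_induct)
    case (less k)
    show ?case
    proof (cases "k \<in> {1..n}")
      case True
      have "\<not> v k < k"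
      proof
        assume "v k < k"
        then have "v (v k) = v k" using less by blast
        then show False using \<open>v k < k\<close> injD[OF perms_inj[OF vp], of "v k" k] by simp
      qed
      then show ?thesis using le[OF True] by simp
    qed (use vp in \<open>auto simp: permutes_not_in\<close>)
  qed
  then show "v \<in> {id}" by auto
next
  fix v :: "nat \<Rightarrow> nat" assume "\<And>i. i \<in> {1..n} \<Longrightarrow> f i = i" "v \<in> {id}"
  then show "v \<in> box n f" by (auto simp: box_def permutes_id)
qed

text \<open>Writing \<open>X\<^sub>f\<close> for the normalized sum, the modular law reads
  \<open>X\<^sub>g = q\<^sup>-\<^sup>1\<^sup>/\<^sup>2 X\<^sub>f (1 + T\<^sub>i) - X\<^sub>h\<close> with \<open>f\<close> and \<open>h\<close> of area smaller by one and by two.\<close>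

lemma box_sum_bar:
  "hess n f \<Longrightarrow> hcong n (bar (free_const (qhalf (- int (area n f))) * box_sum n f))
     (free_const (qhalf (- int (area n f))) * box_sum n f)"
proof (induction "area n f" arbitrary: f rule: less_induct)
  case less
  define X where "X f = free_const (qhalf (- int (area n f))) * box_sum n f" for f
  have Xs: "X f \<in> free_sub n" for f unfolding X_def by (intro free_sub_mult free_sub_const box_sum_sub)
  note hf = less.prems[unfolded hess_def]
  have "hcong n (bar (X f)) (X f)"
  proof (cases "\<exists>i\<in>{1..n}. i < f i")
    case False
    then have fi: "f i = i" if "i \<in> {1..n}" for i using hf that by (meson le_antisym not_less)
    then have "X f = free_const (qhalf (- int (area n f)))"
      using box_trivial[of n f] by (simp add: X_def box_sum_def rword_id mon_Nil)
    moreover have "area n f = 0" using fi by (simp add: area_def)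
    ultimately show ?thesis by (simp add: bar_one ideal_zero)
  next
    case True
    \<comment> \<open>The last position strictly above the diagonal. Beyond it \<open>f\<close> is
      the identity, so monotonicity forces \<open>f m = Suc m\<close>.\<close>
    define m where "m = Max {i\<in>{1..n}. i < f i}"
    have fin: "finite {i\<in>{1..n}. i < f i}" "{i\<in>{1..n}. i < f i} \<noteq> {}" using True by auto
    have m: "m \<in> {1..n}" "m < f m" using Max_in[OF fin] by (auto simp: m_def)
    have mmax: "i \<le> m" if "i \<in> {1..n}" "i < f i" for i
      using Max_ge[OF fin(1)] that by (auto simp: m_def)
    have mn: "m < n" using m hf by (metis atLeastAtMost_iff le_less_trans not_le le_neq_implies_less)
    have fm1: "f (Suc m) = Suc m"
      using mmax[of "Suc m"] hf mn by (metis Suc_leI Suc_n_not_le_n atLeastAtMost_iff le_SucI le_neq_implies_less m(1))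
    have fm: "f m = Suc m"
    proof -
      have "f m \<le> f (Suc m)" using hf m mn by auto
      then show ?thesis using fm1 m by simp
    qed
    \<comment> \<open>The first position with value \<open>Suc m\<close>: lowering \<open>f\<close>
      there preserves monotonicity, and the lowered function jumps by exactly one between
      \<open>i\<close> and \<open>Suc i\<close>, as the modular law requires.\<close>
    define i where "i = (LEAST i. 1 \<le> i \<and> f i = Suc m)"
    have i: "1 \<le> i" "f i = Suc m" using LeastI[of "\<lambda>i. 1 \<le> i \<and> f i = Suc m" m] fm m by (auto simp: i_def)
    have im: "i \<le> m" unfolding i_def using fm m by (intro Least_le) auto
    have ilow: "f k \<le> m" if k: "1 \<le> k" "k < i" for k
    proof -
      have "f k \<noteq> Suc m" using not_less_Least[of k "\<lambda>i. 1 \<le> i \<and> f i = Suc m"] k by (auto simp: i_def)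
      moreover have "f k \<le> f i" using hf k im mn by auto
      ultimately show ?thesis using i by simp
    qed
    have fi1: "f (Suc i) = Suc m"
    proof -
      have "f i \<le> f (Suc i)" using hf[THEN conjunct2, rule_format, of i "Suc i"] i im mn by simp
      moreover have "f (Suc i) \<le> f (Suc m)" using hf[THEN conjunct2, rule_format, of "Suc i" "Suc m"] i im mn by simp
      moreover note i
      ultimately show ?thesis using fm1 by simp
    qed
    have iN: "i \<in> {1..<n}" using i im mn by auto
    let ?f1 = "f(i := m)" and ?f2 = "f(i := m, Suc i := m)"
    have h1: "hess n ?f1"
      unfolding hess_def
    proof (intro conjI ballI allI impI)
      fix j k assume jk: "1 \<le> j \<and> j \<le> k \<and> k \<le> n"
      show "?f1 j \<le> ?f1 k"
      proof (cases "j = i")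
        case True
        moreover have "f i \<le> f k" using hf jk True by auto
        ultimately show ?thesis using i by auto
      next
        case False
        have "f j \<le> f k" using hf jk by auto
        then show ?thesis using False jk ilow[of j] by (cases "k = i") auto
      qed
    qed (use hf im mn in auto)
    have a1: "area n f = Suc (area n ?f1)"
    proof -
      have "area n f = (f i - i) + (\<Sum>k\<in>{1..n} - {i}. f k - k)"
        unfolding area_def using iN by (intro sum.remove) auto
      moreover have "area n ?f1 = (m - i) + (\<Sum>k\<in>{1..n} - {i}. ?f1 k - k)"
        unfolding area_def using iN sum.remove[of "{1..n}" i "\<lambda>k. ?f1 k - k"] by simp
      moreover have "(\<Sum>k\<in>{1..n} - {i}. ?f1 k - k) = (\<Sum>k\<in>{1..n} - {i}. f k - k)"
        by (rule sum.cong) auto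
      ultimately show ?thesis using i im by simp
    qed
    have IH1: "hcong n (bar (X ?f1)) (X ?f1)" using less.hyps[OF _ h1] a1 by (simp add: X_def)
    have mod: "hcong n (box_sum n ?f1 * (1 + mon [i])) (box_sum n f + free_const qvar * box_sum n ?f2)"
    proof -
      have "?f1(i := Suc (?f1 i)) = f" using i by auto
      moreover have "?f1(Suc i := ?f1 i) = ?f2" by auto
      ultimately show ?thesis using modular_law[OF iN, of ?f1] fi1 by simp
    qed
    let ?T = "1 + mon [i]"
    have Ts: "?T \<in> free_sub n" using iN by (intro free_sub_add free_sub_one free_sub_mon) auto
    \<comment> \<open>In half powers the factor q shifts the exponent by 2, so \<open>Y\<close> is
      the normalized sum of \<open>?f2\<close>, whose area is smaller by two, if
      \<open>i < m\<close>. For \<open>i = m\<close> the box of \<open>?f2\<close> is empty and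
      \<open>Y\<close> vanishes.\<close>
    define Y where "Y = free_const (qhalf (2 - int (area n f))) * box_sum n ?f2"
    have Xf: "hcong n (X f) (free_const (qhalf (- 1)) * (X ?f1 * ?T) - Y)"
    proof -
      have "hcong n (free_const (qhalf (- int (area n f))) * (box_sum n f + free_const qvar * box_sum n ?f2))
        (free_const (qhalf (- int (area n f))) * (box_sum n ?f1 * ?T))"
        by (intro hcong_lmult hcong_sym[OF mod] free_sub_const)
      moreover have "free_const (qhalf (- int (area n f))) * (box_sum n f + free_const qvar * box_sum n ?f2) = X f + Y"
        by (simp add: distrib_left X_def Y_def mult.assoc[symmetric] free_const_mult[symmetric] qvar_def qhalf_mult add.commute)
      moreover have "free_const (qhalf (- int (area n f))) * (box_sum n ?f1 * ?T) = free_const (qhalf (- 1)) * (X ?f1 * ?T)"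
        by (simp add: X_def a1 mult.assoc[symmetric] free_const_mult[symmetric] qhalf_mult)
      ultimately show ?thesis by (simp add: algebra_simps)
    qed
    have Y: "hcong n (bar Y) Y"
    proof (cases "i = m")
      case True
      have "box n ?f2 = {}"
        using True iN ilow by (intro box_empty[of m]) auto
      then show ?thesis by (simp add: Y_def box_sum_def bar_def ideal_zero)
    next
      case False
      then have im': "Suc i \<le> m" using im by simp
      have h2: "hess n ?f2"
        unfolding hess_def
      proof (intro conjI ballI allI impI)
        fix j k assume jk: "1 \<le> j \<and> j \<le> k \<and> k \<le> n"
        have "f j \<le> f k" using hf jk by auto
        moreover have "f i \<le> f k" if "i \<le> k" using hf i(1) jk that by auto
        ultimately show "?f2 j \<le> ?f2 k"
          using jk ilow[of j] i by (auto simp: less_Suc_eq)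
      qed (use hf im' mn in auto)
      have a2: "area n ?f1 = Suc (area n ?f2)"
      proof -
        have "area n ?f1 = (?f1 (Suc i) - Suc i) + (\<Sum>k\<in>{1..n} - {Suc i}. ?f1 k - k)"
          unfolding area_def using iN by (intro sum.remove) auto
        moreover have "area n ?f2 = (m - Suc i) + (\<Sum>k\<in>{1..n} - {Suc i}. ?f2 k - k)"
          unfolding area_def using iN sum.remove[of "{1..n}" "Suc i" "\<lambda>k. ?f2 k - k"] by simp
        moreover have "(\<Sum>k\<in>{1..n} - {Suc i}. ?f2 k - k) = (\<Sum>k\<in>{1..n} - {Suc i}. ?f1 k - k)"
          by (rule sum.cong) auto
        ultimately show ?thesis using fi1 im' by simp
      qed
      have "Y = X ?f2" using a1 a2 by (simp add: Y_def X_def)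
      then show ?thesis using less.hyps[OF _ h2] a1 a2 by (simp add: X_def)
    qed
    \<comment> \<open>Consequently q^(-1/2) (1 + T_i) is bar invariant, and with it both terms on
      the right of the normalized modular law.\<close>
    have bT: "bar ?T = free_const qinv * ?T"
      by (simp add: bar_plus bar_one bar_mon bar_word_def bar_gen_def distrib_left free_const_diff)
    have "hcong n (bar (X f)) (bar (free_const (qhalf (- 1)) * (X ?f1 * ?T) - Y))"
      by (rule hcong_bar[OF Xf])
    also have "bar (free_const (qhalf (- 1)) * (X ?f1 * ?T) - Y) =
      free_const (qhalf 1) * (bar (X ?f1) * (free_const qinv * ?T)) - bar Y"
      by (simp only: bar_minus bar_const[of "qhalf (- 1)"] bar_times[of "X ?f1"] bT bar_qhalf minus_minus)
    also have "hcong n \<dots> (free_const (qhalf 1) * (X ?f1 * (free_const qinv * ?T)) - Y)"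
      by (intro hcong_diff hcong_lmult hcong_rmult IH1 Y free_sub_const free_sub_mult Ts)
    also have "free_const (qhalf 1) * (X ?f1 * (free_const qinv * ?T)) - Y = free_const (qhalf (- 1)) * (X ?f1 * ?T) - Y"
    proof -
      have "free_const (qhalf 1) * free_const qinv = free_const (qhalf (- 1))"
        by (simp add: free_const_mult[symmetric] qhalf_mult)
      then show ?thesis unfolding mult_free_const[of "X ?f1"] by (metis mult.assoc)
    qed
    also have "hcong n \<dots> (X f)" by (rule hcong_sym[OF Xf])
    finally show ?thesis .
  qed
  then show ?case by (simp add: X_def)
qed

text \<open>\<open>F\<close> carries the inversions of \<open>u\<close> injectively to those of the
  product: it transposes the two positions whenever this keeps them in order and otherwise leaves
  the pair alone. The pair (i, j) is a new inversion outside the image.\<close>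

lemma transpose_lengthens:
  assumes ij: "1 \<le> i" "i < j" "j \<le> n" and u: "u i < u j"
  shows "perm_len n u < perm_len n (u \<circ> transpose i j)"
proof -
  let ?t = "transpose i j" and ?v = "u \<circ> transpose i j"
  define F where "F = (\<lambda>(a, b). if ?t a < ?t b then (?t a, ?t b) else (a, b))"
  have tb: "1 \<le> a \<Longrightarrow> a \<le> n \<Longrightarrow> 1 \<le> ?t a \<and> ?t a \<le> n" for a using ij by (auto simp: transpose_def)
  have img: "F ` invs n u \<subseteq> invs n ?v - {(i, j)}"
  proof
    fix p assume "p \<in> F ` invs n u"
    then obtain a b where ab: "p = F (a, b)" "1 \<le> a" "a < b" "b \<le> n" "u b < u a" by (auto simp: invs_def)
    show "p \<in> invs n ?v - {(i, j)}"
    proof (cases "?t a < ?t b")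
      case True
      have "(?t a, ?t b) \<noteq> (i, j)" using ab ij by (auto simp: transpose_def split: if_splits)
      then show ?thesis using True ab tb[of a] tb[of b] by (auto simp: F_def invs_def)
    next
      case False
      have "(a, b) \<noteq> (i, j)" using ab u by auto
      moreover have "u (?t b) < u (?t a)" using False ab ij u by (auto simp: transpose_def split: if_splits)
      ultimately show ?thesis using False ab by (auto simp: F_def invs_def)
    qed
  qed
  have inj: "inj_on F (invs n u)"
  proof (rule inj_onI)
    fix p p' assume p: "p \<in> invs n u" "p' \<in> invs n u" and e: "F p = F p'"
    obtain a b a' b' where ab: "p = (a, b)" "p' = (a', b')" "a < b" "a' < b'"
      using p by (auto simp: invs_def)
    have "a = a' \<and> b = b'"
      using e ab by (auto simp: F_def transpose_eq_iff split: if_splits)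
    then show "p = p'" using ab by simp
  qed
  have "(i, j) \<in> invs n ?v" using ij u by (auto simp: invs_def)
  then have "card (invs n ?v - {(i, j)}) < card (invs n ?v)" by (intro psubset_card_mono finite_invs) auto
  moreover have "card (invs n u) \<le> card (invs n ?v - {(i, j)})"
    using card_inj_on_le[OF inj img] finite_invs by blast
  ultimately show ?thesis unfolding perm_len_invs by simp
qed

lemma bruhat_step_iff:
  assumes "inj u"
  shows "bruhat_step n u v \<longleftrightarrow> (\<exists>i j. 1 \<le> i \<and> i < j \<and> j \<le> n \<and> v = u \<circ> transpose i j \<and> u i < u j)"
proof
  assume "bruhat_step n u v"
  then obtain i j where ij: "1 \<le> i" "i < j" "j \<le> n" "v = u \<circ> transpose i j" and l: "perm_len n u < perm_len n v"
    by (auto simp: bruhat_step_def)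
  have "u i < u j"
  proof (rule ccontr)
    assume "\<not> u i < u j"
    moreover have "u i \<noteq> u j" using ij injD[OF assms, of i j] by auto
    ultimately have "v i < v j" using ij by simp
    moreover have "v \<circ> transpose i j = u" using ij(4) by (auto simp: fun_eq_iff)
    ultimately show False using transpose_lengthens[OF ij(1-3), of v] l by simp
  qed
  then show "\<exists>i j. 1 \<le> i \<and> i < j \<and> j \<le> n \<and> v = u \<circ> transpose i j \<and> u i < u j" using ij by blast
qed (auto simp: bruhat_step_def intro: transpose_lengthens)

locale avoiding =
  fixes n :: nat and w f :: "nat \<Rightarrow> nat"
  assumes w: "w \<in> perms n" and av: "avoids_312 n w"
    and f: "\<And>j. j \<in> {1..n} \<Longrightarrow> f j = Max (w ` {1..j})"
begin

lemma f_ge: "1 \<le> i \<Longrightarrow> i \<le> j \<Longrightarrow> j \<le> n \<Longrightarrow> w i \<le> f j"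
  using f[of j] by (auto intro!: Max_ge)

lemma f_attained: "1 \<le> j \<Longrightarrow> j \<le> n \<Longrightarrow> \<exists>i. 1 \<le> i \<and> i \<le> j \<and> f j = w i"
  using f[of j] Max_in[of "w ` {1..j}"] by (auto simp: image_iff)

lemma hess_f: "hess n f"
  unfolding hess_def
proof (intro conjI ballI allI impI)
  fix j assume j: "j \<in> {1..n}"
  show "f j \<le> n" using f_attained[of j] j perms_bounds[OF w] by fastforce
  have "w ` {1..j} \<subseteq> {1..f j}"
    using f_ge[of _ j] j perms_bounds[OF w] by auto
  then have "card (w ` {1..j}) \<le> f j" using card_mono[of "{1..f j}" "w ` {1..j}"] by simp
  moreover have "card (w ` {1..j}) = j"
    using card_image[of w "{1..j}"] perms_inj[OF w] by (auto simp: inj_on_subset)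
  ultimately show "j \<le> f j" by simp
next
  fix i j assume ij: "1 \<le> i \<and> i \<le> j \<and> j \<le> n"
  then obtain k where "1 \<le> k" "k \<le> i" "f i = w k" using f_attained[of i] by auto
  then show "f i \<le> f j" using f_ge[of k j] ij by simp
qed

text \<open>This is the form in which 312-avoidance is used. If w i < w j <= f i with i < j, then
  the maximum \<open>f i\<close> is attained at some p < i, and the positions p, i, j form the
  pattern.\<close>

lemma w_max: "1 \<le> i \<Longrightarrow> i \<le> j \<Longrightarrow> j \<le> n \<Longrightarrow> w j \<le> f i \<Longrightarrow> w j \<le> w i"
proof (rule ccontr)
  assume a: "1 \<le> i" "i \<le> j" "j \<le> n" "w j \<le> f i" "\<not> w j \<le> w i"
  obtain p where p: "1 \<le> p" "p \<le> i" "f i = w p" using f_attained[of i] a by auto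
  have "p \<noteq> i" using a p by auto
  then have "p < i" "i < j" using p a by (auto simp: le_less)
  moreover have "w j < w p"
    using a p \<open>p < i\<close> \<open>i < j\<close> injD[OF perms_inj[OF w], of j p] by (auto simp: le_less)
  ultimately show False using av p a unfolding avoids_312_def by (metis not_le)
qed

lemma perm_len_area: "perm_len n w = area n f"
proof -
  have "card {j. i < j \<and> j \<le> n \<and> w j < w i} = f i - i" if i: "i \<in> {1..n}" for i
  proof -
    have e: "w ` {j. i < j \<and> j \<le> n \<and> w j < w i} = {1..f i} - w ` {1..i}"
    proof (intro equalityI subsetI)
      fix x assume "x \<in> w ` {j. i < j \<and> j \<le> n \<and> w j < w i}"
      then obtain j where j: "x = w j" "i < j" "j \<le> n" "w j < w i" by auto
      then show "x \<in> {1..f i} - w ` {1..i}"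
        using i f_ge[of i i] perms_bounds[OF w, of j] injD[OF perms_inj[OF w], of j] by force
    next
      fix x assume x: "x \<in> {1..f i} - w ` {1..i}"
      have "f i \<le> n" using hess_f i by (auto simp: hess_def)
      then have "x \<in> w ` {1..n}" using x permutes_image[of w "{1..n}"] w by auto
      then obtain j where j: "x = w j" "1 \<le> j" "j \<le> n" by auto
      have "i < j" using j x i by (auto simp: not_le[symmetric])
      moreover have "w j \<le> w i" using w_max[of i j] j x i \<open>i < j\<close> by auto
      moreover have "w j \<noteq> w i" using j x i by auto
      ultimately show "x \<in> w ` {j. i < j \<and> j \<le> n \<and> w j < w i}" using j by auto
    qed
    have "w ` {1..i} \<subseteq> {1..f i}" using f_ge[of _ i] i perms_bounds[OF w] by auto
    moreover have "card (w ` {1..i}) = i"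
      using card_image[of w "{1..i}"] perms_inj[OF w] by (auto simp: inj_on_subset)
    ultimately have "card ({1..f i} - w ` {1..i}) = f i - i" by (simp add: card_Diff_subset)
    then show ?thesis
      using e card_image[of w "{j. i < j \<and> j \<le> n \<and> w j < w i}"] perms_inj[OF w] by (auto simp: inj_on_subset)
  qed
  moreover have "invs n w = (SIGMA i:{1..n}. {j. i < j \<and> j \<le> n \<and> w j < w i})"
    by (auto simp: invs_def)
  moreover have "finite {j. i < j \<and> j \<le> n \<and> w j < w i}" for i by (rule finite_subset[of _ "{..n}"]) auto
  ultimately show ?thesis by (simp add: perm_len_invs area_def card_SigmaI)
qed

text \<open>Downwards, undoing a step that exchanged two increasing values stays in the box because
  \<open>f\<close> is nondecreasing. Upwards, a \<open>v\<close> in the box other than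
  \<open>w\<close> satisfies v i < w i at the first difference \<open>i\<close>; exchanging v i with
  the value w i, which stands later in \<open>v\<close>, is a Bruhat step that stays in the
  box.\<close>

lemma bruhat_le_box: "bruhat_le n v w \<longleftrightarrow> v \<in> box n f"
proof
  assume b: "bruhat_le n v w"
  then have v: "v \<in> perms n" and r: "(bruhat_step n)\<^sup>*\<^sup>* v w" by (auto simp: bruhat_le_def)
  from r v show "v \<in> box n f"
  proof (induction rule: converse_rtranclp_induct)
    case base
    then show ?case using w f_ge by (auto simp: box_def)
  next
    case (step u u')
    then obtain i j where ij: "1 \<le> i" "i < j" "j \<le> n" "u' = u \<circ> transpose i j" "u i < u j"
      using bruhat_step_iff[OF perms_inj[OF step.prems]] by blast
    have "transpose i j permutes {1..n}" using ij by (intro permutes_swap_id) auto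
    then have "u' \<in> perms n" using step.prems ij(4) permutes_compose by auto
    then have u': "\<And>k. k \<in> {1..n} \<Longrightarrow> u' k \<le> f k" using step.IH by (auto simp: box_def)
    have "u k \<le> f k" if k: "k \<in> {1..n}" for k
    proof -
      have "u j \<le> f i" "u i \<le> f j" using u'[of i] u'[of j] ij by auto
      moreover have "f i \<le> f j" using hess_f ij by (auto simp: hess_def)
      ultimately have "u i \<le> f i" "u j \<le> f j" using ij(5) by auto
      moreover have "u k \<le> f k" if "k \<noteq> i" "k \<noteq> j" using u'[OF k] ij(4) that by simp
      ultimately show ?thesis by metis
    qed
    then show ?case using step.prems by (simp add: box_def)
  qed
next
  assume v: "v \<in> box n f"
  have "(bruhat_step n)\<^sup>*\<^sup>* v w" using v
  proof (induction "n * n - perm_len n v" arbitrary: v rule: less_induct)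
    case less
    have vp: "v \<in> perms n" and le: "\<And>k. k \<in> {1..n} \<Longrightarrow> v k \<le> f k" using less.prems by (auto simp: box_def)
    show ?case
    proof (cases "v = w")
      case False
      define i where "i = (LEAST i. v i \<noteq> w i)"
      have ne: "v i \<noteq> w i" unfolding i_def using False by (intro LeastI_ex[of "\<lambda>i. v i \<noteq> w i"]) auto
      have agree: "v k = w k" if "k < i" for k using not_less_Least[of k] that by (auto simp: i_def)
      have i: "i \<in> {1..n}" using ne vp w permutes_not_in by (metis mem_Collect_eq)
      \<comment> \<open>\<open>w_max\<close> applies at the position \<open>k\<close> of the value
        \<open>v i\<close> in \<open>w\<close>: it does not come before \<open>i\<close>, where the
        two permutations agree, and \<open>v i\<close> is at most \<open>f i\<close>.\<close>
      obtain k where k: "w k = v i" "k \<in> {1..n}"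
        using perms_bounds[OF vp, of i] perms_preimage[OF w, of "v i"] i by auto
      have "\<not> k < i" using agree[of k] k ne injD[OF perms_inj[OF vp], of k i] by auto
      then have "v i \<le> w i" using w_max[of i k] k i le[OF i] by auto
      then have lt: "v i < w i" using ne by simp
      obtain j where j: "v j = w i" "j \<in> {1..n}"
        using perms_bounds[OF w, of i] perms_preimage[OF vp, of "w i"] i by auto
      have "\<not> j < i" using agree[of j] j ne injD[OF perms_inj[OF w], of j i] by auto
      then have ij: "i < j" using j ne by (cases "i = j") auto
      let ?v = "v \<circ> transpose i j"
      have "transpose i j permutes {1..n}" using i j by (intro permutes_swap_id) auto
      then have v': "?v \<in> perms n" using vp permutes_compose by auto
      have "?v \<in> box n f"
      proof -
        have "?v l \<le> f l" if l: "l \<in> {1..n}" for l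
        proof -
          have "?v i \<le> f i" using j f_ge[of i i] i by simp
          moreover have "?v j \<le> f j" using le[OF j(2)] lt j by simp
          moreover have "?v l \<le> f l" if "l \<noteq> i" "l \<noteq> j" using le[OF l] that by simp
          ultimately show ?thesis by metis
        qed
        then show ?thesis using v' by (simp add: box_def)
      qed
      moreover have longer: "perm_len n v < perm_len n ?v"
        using i j ij lt by (intro transpose_lengthens) auto
      moreover have bound: "perm_len n ?v \<le> n * n"
      proof -
        have "invs n ?v \<subseteq> {1..n} \<times> {1..n}" by (auto simp: invs_def)
        from card_mono[OF _ this] show ?thesis by (simp add: perm_len_invs)
      qed
      ultimately have "(bruhat_step n)\<^sup>*\<^sup>* ?v w" using less.hyps[of ?v] by simp
      moreover have "bruhat_step n v ?v"
        unfolding bruhat_step_def using longer i j ij by auto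
      ultimately show ?thesis by (meson converse_rtranclp_into_rtranclp)
    qed simp
  qed
  then show "bruhat_le n v w" using v w by (simp add: bruhat_le_def box_def)
qed

lemma KL_basis_box:
  "hecke_smult n (qhalf (int (perm_len n w))) (KL_basis n w) = hecke_class n (box_sum n f)"
proof -
  \<comment> \<open>All Kazhdan-Lusztig polynomials in the interval are 1, so the degree bound
    reduces to the fact that Bruhat steps increase the length.\<close>
  define P :: "(nat \<Rightarrow> nat) \<Rightarrow> int poly" where "P v = (if v \<in> box n f then 1 else 0)" for v
  have set: "{v. bruhat_le n v w} = box n f" by (simp add: bruhat_le_box)
  have p1: "poly_in_q 1 = 1" by (simp add: poly_in_q_def)
  have elem: "kl_elem n w P = free_const (qhalf (- int (perm_len n w))) * box_sum n f"
    unfolding kl_elem_def set box_sum_def by (intro arg_cong2[of _ _ _ _ "(*)"] sum.cong) (auto simp: P_def p1)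
  have wb: "w \<in> box n f" using w f_ge by (auto simp: box_def)
  have len: "perm_len n v < perm_len n w" if v: "v \<in> box n f" "v \<noteq> w" for v
  proof -
    have "(bruhat_step n)\<^sup>*\<^sup>* v w" using v bruhat_le_box[of v] unfolding bruhat_le_def by blast
    then have "v = w \<or> perm_len n v < perm_len n w"
      by (induction rule: rtranclp_induct) (auto simp: bruhat_step_def)
    then show ?thesis using v by simp
  qed
  have fam: "is_KL_family n w P"
    unfolding is_KL_family_iff
  proof (intro conjI allI impI)
    show "hcong n (bar (kl_elem n w P)) (kl_elem n w P)"
      unfolding elem perm_len_area by (rule box_sum_bar[OF hess_f])
    fix v assume "bruhat_le n v w \<and> v \<noteq> w"
    then show "2 * degree (P v) + 1 + perm_len n v \<le> perm_len n w"
      using len[of v] by (simp add: bruhat_le_box P_def)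
  qed (use wb in \<open>auto simp: P_def bruhat_le_box\<close>)
  have "(THE P. is_KL_family n w P) = P"
    using fam KL_family_unique[OF _ _ w] by (intro the_equality) auto
  then have "KL_basis n w = hecke_class n (kl_elem n w P)"
    by (simp add: KL_basis_def KL_poly_def KL_sum_class)
  then have "hecke_smult n (qhalf (int (perm_len n w))) (KL_basis n w) =
      hecke_class n (free_const (qhalf (int (perm_len n w))) * kl_elem n w P)"
    by (simp add: hecke_smult_class kl_elem_sub)
  also have "free_const (qhalf (int (perm_len n w))) * kl_elem n w P = box_sum n f"
    by (simp add: elem mult.assoc[symmetric] free_const_mult[symmetric] qhalf_mult)
  finally show ?thesis .
qed

end


section \<open>Hook characters of the Hecke algebra\<close>

section \<open>Seminormal hook representations\<close>

definition sw :: "nat \<Rightarrow> nat set \<Rightarrow> nat set" where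
  "sw i B = {j. adj i j \<in> B}"

lemma mem_sw: "j \<in> sw i B \<longleftrightarrow> adj i j \<in> B"
  by (simp add: sw_def)

lemma sw_sw [simp]: "sw i (sw i B) = B"
  by (auto simp: sw_def)

lemma sw_same: "(i \<in> B \<longleftrightarrow> Suc i \<in> B) \<Longrightarrow> sw i B = B"
  by (auto simp: sw_def transpose_def)

lemma sw_comm: "Suc i < j \<Longrightarrow> sw i (sw j B) = sw j (sw i B)"
  by (auto simp: sw_def transpose_def)

lemma sw_image: "sw i B = adj i ` B"
  by (auto simp: sw_def image_iff) (metis transpose_involutory)

lemma card_sw: "card (sw i B) = card B"
  unfolding sw_image by (rule card_image) (auto intro: inj_on_subset[OF bij_is_inj[OF bij_swap]])

lemma sw_insert: "Suc i < N \<Longrightarrow> sw i (insert N B) = insert N (sw i B)"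
  by (auto simp: sw_def transpose_def)

lemma words_rev [simp]: "rev u \<in> lists X \<longleftrightarrow> u \<in> lists X"
  by (simp add: lists_eq_set)

abbreviation subword :: "nat set \<Rightarrow> nat \<Rightarrow> nat list" where
  "subword I n \<equiv> filter (\<lambda>i. i \<in> I) [1..<n]"

lemma subword_words: "subword I n \<in> words n"
  by (auto simp: lists_eq_set)

text \<open>The leg entries of the standard tableaux of shape (n-r, 1^r): the entry 1 always
  occupies the corner, and each r-subset of the other entries gives one tableau.\<close>

definition hooks :: "nat \<Rightarrow> nat \<Rightarrow> nat set set" where
  "hooks n r = {A. A \<subseteq> {2..n} \<and> card A = r}"

lemma finite_hooks: "finite (hooks n r)"
  by (rule finite_subset[of _ "Pow {2..n}"]) (auto simp: hooks_def)

text \<open>A state is the set \<open>A\<close> of leg entries of a standard hook tableau. Since the axial distance of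
  \<open>i\<close> and \<open>i + 1\<close> is \<open>i\<close> whenever exactly one of them lies in the leg, Young's seminormal form acts
  locally; \<open>x\<close> below stands for \<open>[i]\<^sub>q\<close>.\<close>

locale seminormal = laurent_hom h for h :: "laurent \<Rightarrow> 'k::field" +
  assumes bracket_nz: "i \<ge> 1 \<Longrightarrow> h (q_bracket i) \<noteq> 0"
begin

definition q :: 'k where "q = h qvar"

definition br :: "nat \<Rightarrow> 'k" where "br i = h (q_bracket i)"

lemma br_0 [simp]: "br 0 = 0"
  by (simp add: br_def q_bracket_def hom_0)

lemma br_Suc: "br (Suc i) = 1 + q * br i"
  by (simp add: br_def q_bracket_def q_def sum.lessThan_Suc_shift hom_add hom_1 hom_sum hom_mult sum_distrib_left
      del: sum.lessThan_Suc)

lemma br_1 [simp]: "br (Suc 0) = 1"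
  by (simp add: br_Suc)

lemma br_nz: "1 \<le> i \<Longrightarrow> br i \<noteq> 0"
  by (simp add: br_def bracket_nz)

lemma br_Suc_nz: "1 + q * br i \<noteq> 0"
  using br_nz[of "Suc i"] by (simp add: br_Suc)

text \<open>Because 1 + (q - 1) [i] = q^i, the entry for \<open>i\<close> in the leg and
  \<open>Suc i\<close> outside is q^i / [i]. Writing everything in q and [i] alone turns the
  relations into identities of rational functions.\<close>

definition dg :: "nat \<Rightarrow> nat set \<Rightarrow> 'k" where
  "dg i B = (if i \<in> B then if Suc i \<in> B then - 1 else (1 + (q - 1) * br i) / br i
             else if Suc i \<in> B then - 1 / br i else q)"

text \<open>The numerators are q [i-1] and [i+1]. This unsymmetric normalization of the seminormal
  basis avoids square roots.\<close>

definition off :: "nat \<Rightarrow> nat set \<Rightarrow> 'k" where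
  "off i B = (if i \<in> B then if Suc i \<in> B then 0 else (br i - 1) / br i
              else if Suc i \<in> B then (1 + q * br i) / br i else 0)"

definition hop :: "nat \<Rightarrow> (nat set \<Rightarrow> 'k) \<Rightarrow> nat set \<Rightarrow> 'k" where
  "hop i g B = dg i B * g B + off i B * g (sw i B)"

lemma hop_quad:
  assumes "1 \<le> i"
  shows "hop i (hop i g) B = (q - 1) * hop i g B + q * g B"
proof -
  note nz = br_nz[OF assms]
  show ?thesis
    using nz by (cases "i \<in> B"; cases "Suc i \<in> B")
      (simp_all add: hop_def dg_def off_def mem_sw sw_same field_simps)
qed

lemma hop_comm:
  assumes "Suc i < j"
  shows "hop i (hop j g) B = hop j (hop i g) B"
proof -
  have v: "adj i j = j" "adj i (Suc j) = Suc j" "adj j i = i" "adj j (Suc i) = Suc i"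
    using assms by (auto simp: transpose_def)
  have "dg i (sw j B) = dg i B" "off i (sw j B) = off i B" "dg j (sw i B) = dg j B" "off j (sw i B) = off j B"
    by (simp_all add: dg_def off_def mem_sw v)
  then show ?thesis by (simp add: hop_def sw_comm[OF assms] algebra_simps)
qed

lemma hop_braid:
  assumes "1 \<le> i"
  shows "hop i (hop (Suc i) (hop i g)) B = hop (Suc i) (hop i (hop (Suc i) g)) B"
proof -
  define x where "x = br i"
  have nz: "x \<noteq> 0" "1 + q * x \<noteq> 0" using br_nz[OF assms] br_Suc_nz by (auto simp: x_def)
  have v: "adj i (Suc (Suc i)) = Suc (Suc i)" "adj (Suc i) i = i" by (auto simp: transpose_def)
  show ?thesis
    using nz by (cases "i \<in> B"; cases "Suc i \<in> B"; cases "Suc (Suc i) \<in> B")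
      (simp_all add: hop_def dg_def off_def mem_sw sw_same v br_Suc x_def[symmetric] divide_simps,
       simp_all add: algebra_simps)
qed

sublocale hk: hecke_ops h hop UNIV
proof
  fix i :: nat and s and a b :: 'k and g g' :: "nat set \<Rightarrow> 'k"
  show "hop i (\<lambda>s. a * g s + b * g' s) s = a * hop i g s + b * hop i g' s"
    by (simp add: hop_def algebra_simps)
next
  fix i :: nat and s and g g' :: "nat set \<Rightarrow> 'k"
  assume "\<And>s. s \<in> UNIV \<Longrightarrow> g s = g' s"
  then show "hop i g s = hop i g' s" by (simp add: hop_def)
next
  fix i :: nat and s and g :: "nat set \<Rightarrow> 'k"
  assume "1 \<le> i"
  then show "hop i (hop i g) s = h (qvar - 1) * hop i g s + h qvar * g s"
    using hop_quad[of i g s] by (simp add: hom_diff hom_1 q_def)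
qed (auto intro: hop_comm hop_braid)

text \<open>The only way for a leg set to leave \<open>{2..n}\<close> is to trade 2 for 1 by the
  generator with \<open>i = 1\<close>, and the coefficient [1] - 1 of this move vanishes.\<close>

lemma hop_support:
  assumes g: "\<And>B. B \<notin> hooks n r \<Longrightarrow> g B = 0" and i: "i \<in> {1..<n}" and B: "B \<notin> hooks n r"
  shows "hop i g B = 0"
proof -
  have "off i B * g (sw i B) = 0"
  proof (cases "sw i B \<in> hooks n r")
    case True
    have card: "card B = r" using True card_sw[of i B] by (simp add: hooks_def)
    have sub: "adj i j \<in> {2..n}" if "j \<in> B" for j
    proof -
      have "adj i j \<in> sw i B" using that by (simp add: mem_sw)
      then show ?thesis using True by (auto simp: hooks_def)
    qed
    have "j \<in> {2..n} \<or> j = 1 \<and> i = 1" if "j \<in> B" for j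
      using sub[OF that] i by (auto simp: transpose_def split: if_splits)
    moreover obtain x where "x \<in> B" "x \<notin> {2..n}" using B card unfolding hooks_def by blast
    ultimately have "1 \<in> B \<and> i = 1" by blast
    then show ?thesis by (auto simp: off_def)
  qed (simp add: g)
  then show ?thesis using g[OF B] by (simp add: hop_def)
qed

lemma fold_support:
  "(\<And>B. B \<notin> hooks n r \<Longrightarrow> g B = 0) \<Longrightarrow> u \<in> words n \<Longrightarrow> B \<notin> hooks n r \<Longrightarrow> fold hop u g B = 0"
proof (induction u arbitrary: g)
  case (Cons i u)
  have "fold hop u (hop i g) B = 0"
    by (rule Cons.IH) (use Cons.prems hop_support[of n r g i] in auto)
  then show ?case by simp
qed simp

definition mcoef :: "nat list \<Rightarrow> nat set \<Rightarrow> nat set \<Rightarrow> 'k" where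
  "mcoef u A B = fold hop u (delta A) B"

lemma mcoef_support: "A \<in> hooks n r \<Longrightarrow> u \<in> words n \<Longrightarrow> B \<notin> hooks n r \<Longrightarrow> mcoef u A B = 0"
  unfolding mcoef_def by (rule fold_support[of n r]) (auto simp: delta_def)

lemma expand_delta:
  fixes g :: "nat set \<Rightarrow> 'k"
  assumes "\<And>B. B \<notin> hooks n r \<Longrightarrow> g B = 0"
  shows "g = (\<lambda>B. \<Sum>C\<in>hooks n r. g C * delta C B)"
proof
  fix B
  have "(\<Sum>C\<in>hooks n r. g C * delta C B) = (\<Sum>C\<in>hooks n r. if B = C then g C else 0)"
    by (rule sum.cong) (auto simp: delta_def)
  then show "g B = (\<Sum>C\<in>hooks n r. g C * delta C B)"
    using assms[of B] finite_hooks by (simp add: sum.delta')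
qed

lemma mcoef_append:
  assumes "A \<in> hooks n r" "u \<in> words n"
  shows "mcoef (u @ v) A B = (\<Sum>C\<in>hooks n r. mcoef u A C * mcoef v C B)"
proof -
  have "fold hop u (delta A) = (\<lambda>B. \<Sum>C\<in>hooks n r. mcoef u A C * delta C B)"
    using expand_delta[of n r "fold hop u (delta A)"] mcoef_support[OF assms] by (simp add: mcoef_def)
  then have "mcoef (u @ v) A B = fold hop v (\<lambda>B. \<Sum>C\<in>hooks n r. mcoef u A C * delta C B) B"
    by (simp add: mcoef_def)
  then show ?thesis by (simp add: hk.fold_T_sum mcoef_def)
qed

definition htrace :: "nat \<Rightarrow> nat \<Rightarrow> nat list \<Rightarrow> 'k" where
  "htrace n r u = (\<Sum>A\<in>hooks n r. mcoef u A A)"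

lemma htrace_commute:
  assumes "u \<in> words n" "v \<in> words n"
  shows "htrace n r (u @ v) = htrace n r (v @ u)"
proof -
  have "htrace n r (u @ v) = (\<Sum>A\<in>hooks n r. \<Sum>C\<in>hooks n r. mcoef u A C * mcoef v C A)"
    unfolding htrace_def using mcoef_append[OF _ assms(1)] by (intro sum.cong) auto
  also have "\<dots> = (\<Sum>C\<in>hooks n r. \<Sum>A\<in>hooks n r. mcoef v C A * mcoef u A C)"
    by (subst sum.swap) (simp add: mult.commute)
  also have "\<dots> = htrace n r (v @ u)"
    unfolding htrace_def using mcoef_append[OF _ assms(2)] by (intro sum.cong) auto
  finally show ?thesis .
qed

lemma hecke_compat_lin:
  assumes "hecke_compat n \<phi> {0}" "hecke_compat n \<psi> {0}"
  shows "hecke_compat n (\<lambda>u. a * \<phi> u + b * \<psi> u) {0}"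
proof (rule hecke_compatI)
  fix u v i assume u: "u \<in> words n" "v \<in> words n" "i \<in> {1..<n}"
  show "a * \<phi> (u @ [i, i] @ v) + b * \<psi> (u @ [i, i] @ v) - (h (qvar - 1) * (a * \<phi> (u @ [i] @ v) + b * \<psi> (u @ [i] @ v)) +
      h qvar * (a * \<phi> (u @ v) + b * \<psi> (u @ v))) \<in> {0}"
    using compat_quad[OF assms(1) u] compat_quad[OF assms(2) u] by (simp add: algebra_simps)
next
  fix u v i assume u: "u \<in> words n" "v \<in> words n" "1 \<le> i" "Suc i < n"
  show "a * \<phi> (u @ [i, Suc i, i] @ v) + b * \<psi> (u @ [i, Suc i, i] @ v) -
      (a * \<phi> (u @ [Suc i, i, Suc i] @ v) + b * \<psi> (u @ [Suc i, i, Suc i] @ v)) \<in> {0}"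
    using compat_braid[OF assms(1) u] compat_braid[OF assms(2) u] by simp
next
  fix u v i j assume u: "u \<in> words n" "v \<in> words n" "1 \<le> i" "Suc i < j" "j < n"
  then have "i \<in> {1..<n}" "j \<in> {1..<n}" "Suc i < j \<or> Suc j < i" by auto
  note c = compat_comm[OF submod_zero _ u(1,2) this]
  show "a * \<phi> (u @ [i, j] @ v) + b * \<psi> (u @ [i, j] @ v) - (a * \<phi> (u @ [j, i] @ v) + b * \<psi> (u @ [j, i] @ v)) \<in> {0}"
    using c[OF assms(1)] c[OF assms(2)] by simp
qed

lemma hecke_compat_sum:
  assumes "\<And>A. A \<in> S \<Longrightarrow> hecke_compat n (\<phi> A) {0}"
  shows "hecke_compat n (\<lambda>u. \<Sum>A\<in>S. c A * \<phi> A u) {0}"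
  using assms
proof (induction S rule: infinite_finite_induct)
  case (insert A S)
  then show ?case
    using hecke_compat_lin[of n "\<phi> A" "\<lambda>u. \<Sum>A\<in>S. c A * \<phi> A u" "c A" 1] by simp
qed (simp_all add: hecke_compat_def)

lemma htrace_compat: "hecke_compat m (htrace n r) {0}"
proof -
  have "hecke_compat m (\<lambda>u. \<Sum>A\<in>hooks n r. 1 * mcoef u A A) {0}"
    unfolding mcoef_def by (intro hecke_compat_sum hk.ops_compat) simp
  then show ?thesis by (simp add: htrace_def[abs_def])
qed

lemma fold_insert:
  "u \<in> words n \<Longrightarrow> n < N \<Longrightarrow> fold hop u g (insert N B) = fold hop u (\<lambda>B. g (insert N B)) B"
proof (induction u arbitrary: g)
  case (Cons i u)
  have i: "Suc i < N" using Cons.prems by auto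
  have "hop i g (insert N C) = hop i (\<lambda>B. g (insert N B)) C" for C
    using i by (simp add: hop_def dg_def off_def sw_insert)
  then show ?case using Cons by simp
qed simp

lemma fold_cong_avoid:
  "u \<in> words n \<Longrightarrow> n < N \<Longrightarrow> (\<And>B. N \<notin> B \<Longrightarrow> g B = g' B) \<Longrightarrow> N \<notin> B \<Longrightarrow> fold hop u g B = fold hop u g' B"
proof (induction u arbitrary: g g')
  case (Cons i u)
  have "adj i N = N" using Cons.prems by (auto simp: transpose_def)
  then have *: "hop i g C = hop i g' C" if "N \<notin> C" for C
    using that Cons.prems(3) by (simp add: hop_def mem_sw)
  have "fold hop u (hop i g) B = fold hop u (hop i g') B"
    by (rule Cons.IH[OF _ Cons.prems(2) *]) (use Cons.prems in auto)
  then show ?case by simp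
qed simp

lemma fold_zero: "fold hop u (\<lambda>B. 0) = (\<lambda>B. 0)"
  using hk.fold_lin[of u 0 "\<lambda>_. 0" 0 "\<lambda>_. 0"] by simp

text \<open>Generators with index below \<open>n\<close> neither move an entry \<open>N > n\<close>
  nor see it, so their matrices are block diagonal with respect to membership of \<open>N\<close>.
  This is the branching rule for hooks.\<close>

lemma mcoef_top:
  assumes u: "u \<in> words n" and N: "n < N"
  shows "N \<notin> A \<Longrightarrow> N \<notin> B \<Longrightarrow> mcoef u (insert N A) (insert N B) = mcoef u A B"
    "(N \<in> A) \<noteq> (N \<in> B) \<Longrightarrow> mcoef u A B = 0"
proof -
  assume N': "N \<notin> A" "N \<notin> B"
  have "fold hop u (delta (insert N A)) (insert N B) = fold hop u (\<lambda>B. delta (insert N A) (insert N B)) B"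
    by (rule fold_insert[OF u N])
  also have "\<dots> = fold hop u (delta A) B"
    by (rule fold_cong_avoid[OF u N _ N'(2)]) (use N' in \<open>auto simp: delta_def\<close>)
  finally show "mcoef u (insert N A) (insert N B) = mcoef u A B" by (simp add: mcoef_def)
next
  assume ne: "(N \<in> A) \<noteq> (N \<in> B)"
  show "mcoef u A B = 0"
  proof (cases "N \<in> B")
    case True
    have "fold hop u (delta A) (insert N B) = fold hop u (\<lambda>B. delta A (insert N B)) B"
      by (rule fold_insert[OF u N])
    also have "(\<lambda>B. delta A (insert N B)) = (\<lambda>B. 0 :: 'k)" using ne True by (auto simp: delta_def)
    finally show ?thesis using True by (simp add: mcoef_def fold_zero insert_absorb)
  next
    case False
    have "fold hop u (delta A) B = fold hop u (\<lambda>B. 0) B"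
      by (rule fold_cong_avoid[OF u N _ False]) (use ne False in \<open>auto simp: delta_def\<close>)
    then show ?thesis by (simp add: mcoef_def fold_zero)
  qed
qed

lemma sw_ne: "(i \<in> A) \<noteq> (Suc i \<in> A) \<Longrightarrow> Suc i \<in> sw i A \<longleftrightarrow> Suc i \<notin> A"
  by (auto simp: mem_sw)

text \<open>Since \<open>u\<close> does not move the entry \<open>Suc n\<close>, a swap performed by
  T_n cannot be undone by \<open>u\<close>. Diagonal entries of increasing products are therefore
  products of diagonal entries of the generators.\<close>

lemma mcoef_snoc_diag:
  assumes "u \<in> words n"
  shows "mcoef (u @ [n]) A A = dg n A * mcoef u A A"
proof -
  have "off n A * mcoef u A (sw n A) = 0"
  proof (cases "(n \<in> A) = (Suc n \<in> A)")
    case False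
    then have "mcoef u A (sw n A) = 0"
      using mcoef_top(2)[OF assms, of "Suc n" A "sw n A"] sw_ne[OF False] by auto
    then show ?thesis by simp
  qed (simp add: off_def)
  then show ?thesis by (simp add: mcoef_def hop_def)
qed

lemma mcoef_Cons_diag:
  assumes "u \<in> words n"
  shows "mcoef (n # u) A A = dg n A * mcoef u A A"
proof -
  have "hop n (delta A) = (\<lambda>B. dg n A * delta A B + off n (sw n A) * (if sw n A = A then 0 else delta (sw n A) B))"
  proof
    fix B
    have *: "sw n B = A \<longleftrightarrow> B = sw n A" by (metis sw_sw)
    have "off n A = 0" if "sw n A = A"
      using that mem_sw[of n n A] by (auto simp: off_def)
    then show "hop n (delta A) B = dg n A * delta A B + off n (sw n A) * (if sw n A = A then 0 else delta (sw n A) B)"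
      by (auto simp: hop_def delta_def *)
  qed
  also have "\<dots> = (\<lambda>B. dg n A * delta A B + (if sw n A = A then 0 else off n (sw n A)) * delta (sw n A) B)"
    by (auto simp: fun_eq_iff)
  finally have "mcoef (n # u) A A = dg n A * mcoef u A A + (if sw n A = A then 0 else off n (sw n A)) * mcoef u (sw n A) A"
    by (simp add: mcoef_def hk.fold_lin)
  moreover have "mcoef u (sw n A) A = 0" if "sw n A \<noteq> A"
  proof -
    have ne: "(n \<in> A) \<noteq> (Suc n \<in> A)" using that sw_same by blast
    then show ?thesis using mcoef_top(2)[OF assms, of "Suc n" "sw n A" A] sw_ne[OF ne] by auto
  qed
  ultimately show ?thesis by auto
qed

lemma mcoef_rev_subword: "mcoef (rev (subword I n)) A A = mcoef (subword I n) A A"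
proof (induction n)
  case (Suc n)
  have w: "subword I n \<in> words n" "rev (subword I n) \<in> words n"
    using subword_words[of I n] by auto
  show ?case
  proof (cases "1 \<le> n \<and> n \<in> I")
    case True
    then have "subword I (Suc n) = subword I n @ [n]" by simp
    then show ?thesis using mcoef_snoc_diag[OF w(1)] mcoef_Cons_diag[OF w(2)] Suc by simp
  next
    case False
    then have "subword I (Suc n) = subword I n" by auto
    then show ?thesis using Suc by simp
  qed
qed simp

lemma compat_rev:
  assumes "hecke_compat n \<phi> {0}"
  shows "hecke_compat n (\<lambda>u. \<phi> (rev u)) {0}"
proof (rule hecke_compatI)
  fix u v i assume u: "u \<in> words n" "v \<in> words n" "i \<in> {1..<n}"
  then show "\<phi> (rev (u @ [i, i] @ v)) - (h (qvar - 1) * \<phi> (rev (u @ [i] @ v)) + h qvar * \<phi> (rev (u @ v))) \<in> {0}"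
    using compat_quad[OF assms, of "rev v" "rev u" i] by simp
next
  fix u v i assume u: "u \<in> words n" "v \<in> words n" "1 \<le> i" "Suc i < n"
  then show "\<phi> (rev (u @ [i, Suc i, i] @ v)) - \<phi> (rev (u @ [Suc i, i, Suc i] @ v)) \<in> {0}"
    using compat_braid[OF assms, of "rev v" "rev u" i] by simp
next
  fix u v i j assume u: "u \<in> words n" "v \<in> words n" "1 \<le> i" "Suc i < j" "j < n"
  then show "\<phi> (rev (u @ [i, j] @ v)) - \<phi> (rev (u @ [j, i] @ v)) \<in> {0}"
    using compat_comm[OF submod_zero assms, of "rev v" "rev u" i j] by simp
qed

text \<open>Reversal of words gives another trace, and by the trace principle it suffices to compare
  increasing products, where even the diagonal entries agree. At q = 1 this becomes the equality of
  the character values at \<open>w\<close> and at its inverse.\<close>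

lemma htrace_rev:
  assumes "1 \<le> n" "u \<in> words n"
  shows "htrace n r (rev u) = htrace n r u"
proof -
  have c: "hecke_compat n (\<lambda>u. 1 * htrace n r (rev u) + (- 1) * htrace n r u) {0}"
    by (intro hecke_compat_lin compat_rev htrace_compat)
  have "1 * htrace n r (rev (u @ [])) + (- 1) * htrace n r (u @ []) \<in> {0}"
  proof (rule trace_principle[OF submod_zero c _ assms(1) order_refl assms(2)])
    fix v y assume v: "v \<in> words n" "y \<in> words (n - 1)"
    then have "y \<in> words n" using words_mono diff_le_self by blast
    then show "1 * htrace n r (rev (v @ y)) + (- 1) * htrace n r (v @ y) -
        (1 * htrace n r (rev (y @ v)) + (- 1) * htrace n r (y @ v)) \<in> {0}"
      using htrace_commute[of v n y r] htrace_commute[of "rev v" n "rev y" r] v by simp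
  next
    fix I
    show "1 * htrace n r (rev (subword I n @ [])) + (- 1) * htrace n r (subword I n @ []) \<in> {0}"
      unfolding htrace_def using mcoef_rev_subword by simp
  qed simp
  then show ?thesis by simp
qed

end

section \<open>The generating function of hook characters\<close>

text \<open>\<open>se q I m = (S, E)\<close>: the coefficient of \<open>t\<^sup>r\<close> in \<open>S\<close> will be the value of the hook character with
  leg length \<open>r\<close> of \<open>H\<^sub>m\<^sub>+\<^sub>1\<close> at the increasing product of the generators \<open>T\<^sub>i\<close>, \<open>i \<in> I\<close>.
  If the last block of consecutive letters involves \<open>b\<close> points and \<open>P\<close> is the product over the other
  blocks, then \<open>E = P (-t)\<^sup>b\<close> is what has to be added to \<open>q S\<close> when that block grows.\<close>

primrec se :: "'a::comm_ring_1 \<Rightarrow> nat set \<Rightarrow> nat \<Rightarrow> 'a poly \<times> 'a poly" where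
  "se q I 0 = (1, - [:0, 1:])"
| "se q I (Suc m) = (let S = fst (se q I m); E = snd (se q I m) in
     if Suc m \<in> I then (Polynomial.smult q S + E, - pCons 0 E)
     else (S + pCons 0 S, - pCons 0 (S + pCons 0 S)))"

text \<open>The recursion uses ring operations only. The lemma is applied to the embedding into the
  fraction field and to evaluation at one.\<close>

lemma coeff_se_hom:
  fixes h :: "'a::comm_ring_1 \<Rightarrow> 'b::comm_ring_1"
  assumes add: "\<And>x y. h (x + y) = h x + h y" and mult: "\<And>x y. h (x * y) = h x * h y" and one: "h 1 = 1"
  shows "coeff (fst (se (h q) I m)) r = h (coeff (fst (se q I m)) r) \<and>
         coeff (snd (se (h q) I m)) r = h (coeff (snd (se q I m)) r)"
proof -
  have z: "h 0 = 0" using add[of 0 0] by simp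
  have m: "h (- x) = - h x" for x using add[of x "- x"] z by (simp add: eq_neg_iff_add_eq_0 add.commute)
  have d: "h (x - y) = h x - h y" for x y using add[of x "- y"] by (simp add: m)
  show ?thesis
    by (induction m arbitrary: r)
       (auto simp: Let_def coeff_pCons one z m d add mult coeff_1 split: nat.splits)
qed

lemma (in seminormal) sum_hooks_poly:
  "coeff (\<Sum>A\<in>Pow {2..n}. monom (c A) (card A)) r = (\<Sum>A\<in>hooks n r. c A)"
proof -
  have "coeff (\<Sum>A\<in>Pow {2..n}. monom (c A) (card A)) r = (\<Sum>A\<in>Pow {2..n}. if card A = r then c A else 0)"
    by (simp add: coeff_sum)
  also have "\<dots> = (\<Sum>A\<in>{A \<in> Pow {2..n}. card A = r}. c A)"
    by (rule sum.inter_filter[symmetric]) simp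
  also have "{A \<in> Pow {2..n}. card A = r} = hooks n r" by (auto simp: hooks_def)
  finally show ?thesis .
qed

lemma Pow_Suc_split:
  assumes "1 \<le> n"
  shows "(\<Sum>A\<in>Pow {2..Suc n}. F A) = (\<Sum>A\<in>Pow {2..n}. F A) + (\<Sum>A\<in>Pow {2..n}. F (insert (Suc n) A))"
proof -
  have "{2..Suc n} = insert (Suc n) {2..n}" using assms by auto
  then have "Pow {2..Suc n} = Pow {2..n} \<union> insert (Suc n) ` Pow {2..n}" by (simp add: Pow_insert)
  moreover have "Pow {2..n} \<inter> insert (Suc n) ` Pow {2..n} = {}" by auto
  moreover have "inj_on (insert (Suc n)) (Pow {2..n})"
    by (rule inj_on_inverseI[of _ "\<lambda>A. A - {Suc n}"]) auto
  ultimately show ?thesis by (simp add: sum.union_disjoint sum.reindex)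
qed

context seminormal
begin

text \<open>Here \<open>o'\<close> and \<open>i\<close> are the parts of the generating function
  with n outside and inside the leg, \<open>x\<close> is [n], \<open>y\<close> its inverse and
  \<open>t\<close> the variable. The third hypothesis is an invariant of the recursion: it ties
  \<open>E\<close> to \<open>i\<close> and \<open>S\<close> and so removes the denominator.\<close>

lemma gf_step_algebra:
  fixes x y t S E i o' Q :: "'k poly"
  assumes "x * y = 1" and "o' + i = S" and "(1 + t) * ((x - 1) * i) + t * S + x * E = 0"
  shows "Q * o' + (1 + (Q - 1) * x) * y * i + - t * (y * o' + i) = Q * S + E"
    "(1 + t) * ((1 + Q * x - 1) * (- t * (y * o' + i))) + t * (Q * S + E) + (1 + Q * x) * (- (t * E)) = 0"
proof -
  have o: "o' = S - i" using assms(2) by (simp add: algebra_simps)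
  have xE: "x * E = - ((1 + t) * ((x - 1) * i) + t * S)"
    using assms(3) unfolding eq_neg_iff_add_eq_0 by (simp only: add_ac)
  have x0: "x \<noteq> 0" using assms(1) by auto
  \<comment> \<open>After multiplication by \<open>x\<close> every \<open>y\<close> meets an
    \<open>x\<close> and disappears, and \<open>x * E\<close> can be replaced by means of the
    invariant.\<close>
  have "x * (Q * o' + (1 + (Q - 1) * x) * y * i + - t * (y * o' + i)) =
      Q * x * o' + (1 + (Q - 1) * x) * (x * y) * i - t * ((x * y) * o' + x * i)"
    by (simp add: algebra_simps)
  also have "\<dots> = x * (Q * S) + x * E" unfolding assms(1) o xE by (simp add: algebra_simps)
  finally show "Q * o' + (1 + (Q - 1) * x) * y * i + - t * (y * o' + i) = Q * S + E"
    using x0 by (simp add: distrib_left[symmetric])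
  have "(1 + t) * ((1 + Q * x - 1) * (- t * (y * o' + i))) + t * (Q * S + E) + (1 + Q * x) * (- (t * E)) =
      Q * t * (S - (1 + t) * ((x * y) * o' + x * i) - x * E)"
    by (simp add: algebra_simps)
  also have "\<dots> = 0" unfolding assms(1) o xE by (simp add: algebra_simps)
  finally show "(1 + t) * ((1 + Q * x - 1) * (- t * (y * o' + i))) + t * (Q * S + E) + (1 + Q * x) * (- (t * E)) = 0" .
qed

text \<open>The sum is split by whether \<open>n\<close> lies in the leg, since this is what the
  diagonal entry of the next generator depends on.\<close>

definition gfo :: "nat set \<Rightarrow> nat \<Rightarrow> 'k poly" where
  "gfo I n = (\<Sum>A\<in>Pow {2..n}. if n \<in> A then 0 else monom (mcoef (subword I n) A A) (card A))"

definition gfi :: "nat set \<Rightarrow> nat \<Rightarrow> 'k poly" where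
  "gfi I n = (\<Sum>A\<in>Pow {2..n}. if n \<in> A then monom (mcoef (subword I n) A A) (card A) else 0)"

lemma gf_sum: "gfo I n + gfi I n = (\<Sum>A\<in>Pow {2..n}. monom (mcoef (subword I n) A A) (card A))"
  unfolding gfo_def gfi_def by (subst sum.distrib[symmetric]) (auto intro!: sum.cong)

lemma gf_Suc_other:
  assumes n: "1 \<le> n" and I: "n \<notin> I"
  shows "gfo I (Suc n) = gfo I n + gfi I n" "gfi I (Suc n) = pCons 0 (gfo I n + gfi I n)"
proof -
  have w: "subword I (Suc n) = subword I n" using I by simp
  have top: "mcoef (subword I n) (insert (Suc n) A) (insert (Suc n) A) = mcoef (subword I n) A A"
    if "A \<in> Pow {2..n}" for A
  proof -
    have "Suc n \<notin> A" using that by auto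
    then show ?thesis using mcoef_top(1)[OF subword_words lessI] by blast
  qed
  have nin: "Suc n \<notin> A" "card (insert (Suc n) A) = Suc (card A)" if "A \<in> Pow {2..n}" for A
  proof -
    show *: "Suc n \<notin> A" using that by auto
    have "finite A" using that finite_subset[of A "{2..n}"] by auto
    then show "card (insert (Suc n) A) = Suc (card A)" using * by simp
  qed
  show "gfo I (Suc n) = gfo I n + gfi I n"
    unfolding gf_sum unfolding gfo_def Pow_Suc_split[OF n] w
    using nin by (simp add: sum.neutral)
  show "gfi I (Suc n) = pCons 0 (gfo I n + gfi I n)"
  proof -
    have "gfi I (Suc n) = (\<Sum>A\<in>Pow {2..n}. monom (mcoef (subword I n) A A) (Suc (card A)))"
      unfolding gfi_def Pow_Suc_split[OF n] w using nin top by (simp add: sum.neutral)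
    also have "\<dots> = (\<Sum>A\<in>Pow {2..n}. [:0, 1:] * monom (mcoef (subword I n) A A) (card A))"
      by (simp add: monom_Suc)
    also have "\<dots> = [:0, 1:] * (gfo I n + gfi I n)" unfolding gf_sum by (simp only: sum_distrib_left)
    finally show ?thesis by simp
  qed
qed

lemma gf_Suc_in:
  assumes n: "1 \<le> n" and I: "n \<in> I"
  shows "gfo I (Suc n) = [:q:] * gfo I n + [:(1 + (q - 1) * br n) / br n:] * gfi I n"
    "gfi I (Suc n) = - [:0, 1:] * ([:1 / br n:] * gfo I n + gfi I n)"
proof -
  have w: "subword I (Suc n) = subword I n @ [n]" using n I by simp
  have top: "mcoef (subword I n) (insert (Suc n) A) (insert (Suc n) A) = mcoef (subword I n) A A"
    if "A \<in> Pow {2..n}" for A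
  proof -
    have "Suc n \<notin> A" using that by auto
    then show ?thesis using mcoef_top(1)[OF subword_words lessI] by blast
  qed
  have nin: "Suc n \<notin> A" "card (insert (Suc n) A) = Suc (card A)" if "A \<in> Pow {2..n}" for A
  proof -
    show *: "Suc n \<notin> A" using that by auto
    have "finite A" using that finite_subset[of A "{2..n}"] by auto
    then show "card (insert (Suc n) A) = Suc (card A)" using * by simp
  qed
  note diag = mcoef_snoc_diag[OF subword_words[of I n]]
  have "gfo I (Suc n) = (\<Sum>A\<in>Pow {2..n}. monom (dg n A * mcoef (subword I n) A A) (card A))"
    unfolding gfo_def Pow_Suc_split[OF n] w diag using nin by (simp add: sum.neutral)
  also have "\<dots> = (\<Sum>A\<in>Pow {2..n}. [:q:] * (if n \<in> A then 0 else monom (mcoef (subword I n) A A) (card A)) +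
      [:(1 + (q - 1) * br n) / br n:] * (if n \<in> A then monom (mcoef (subword I n) A A) (card A) else 0))"
    using nin by (intro sum.cong) (auto simp: smult_monom dg_def)
  also have "\<dots> = [:q:] * gfo I n + [:(1 + (q - 1) * br n) / br n:] * gfi I n"
    unfolding gfo_def gfi_def by (simp only: sum.distrib sum_distrib_left)
  finally show "gfo I (Suc n) = [:q:] * gfo I n + [:(1 + (q - 1) * br n) / br n:] * gfi I n" .
  have "gfi I (Suc n) = (\<Sum>A\<in>Pow {2..n}. monom (dg n (insert (Suc n) A) * mcoef (subword I n) A A) (Suc (card A)))"
    unfolding gfi_def Pow_Suc_split[OF n] w diag using nin top by (simp add: sum.neutral)
  also have "\<dots> = (\<Sum>A\<in>Pow {2..n}. - [:0, 1:] * ([:1 / br n:] * (if n \<in> A then 0 else monom (mcoef (subword I n) A A) (card A)) +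
      (if n \<in> A then monom (mcoef (subword I n) A A) (card A) else 0)))"
    using nin by (intro sum.cong) (auto simp: dg_def monom_Suc minus_monom smult_monom)
  also have "\<dots> = - [:0, 1:] * ([:1 / br n:] * gfo I n + gfi I n)"
    unfolding gfo_def gfi_def by (simp only: sum_distrib_left sum.distrib distrib_left)
  finally show "gfi I (Suc n) = - [:0, 1:] * ([:1 / br n:] * gfo I n + gfi I n)" .
qed

text \<open>The second identity closes the recursion: it expresses [m+1] E through S and the part
  with \<open>Suc m\<close> in the leg, so that the denominators of the seminormal form cancel in S
  and E.\<close>

lemma gf_se_aux:
  "gfo I (Suc m) + gfi I (Suc m) = fst (se q I m) \<and>
   (1 + [:0, 1:]) * ([:br (Suc m) - 1:] * gfi I (Suc m)) + [:0, 1:] * fst (se q I m) + [:br (Suc m):] * snd (se q I m) = 0"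
proof (induction m)
  case 0
  have "gfo I (Suc 0) = 1" "gfi I (Suc 0) = 0" by (simp_all add: gfo_def gfi_def mcoef_def delta_def)
  then show ?case by simp
next
  case (Suc m)
  let ?n = "Suc m"
  define t :: "'k poly" where "t = [:0, 1:]"
  define S where "S = fst (se q I m)"
  define E where "E = snd (se q I m)"
  define x where "x = [:br ?n:]"
  define y where "y = [:1 / br ?n:]"
  define Q where "Q = [:q:]"
  have nz: "br ?n \<noteq> 0" by (rule br_nz) simp
  have xy: "x * y = 1" using nz by (simp add: x_def y_def one_pCons)
  have one: "[:br k - 1:] = [:br k:] - 1" for k by (simp add: one_pCons)
  have IH1: "gfo I ?n + gfi I ?n = S" using Suc by (simp add: S_def)
  have IH2: "(1 + t) * ((x - 1) * gfi I ?n) + t * S + x * E = 0"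
    using Suc unfolding one t_def S_def E_def x_def by simp
  have xS: "[:br (Suc ?n):] = 1 + Q * x" by (simp add: Q_def x_def br_Suc[of ?n] one_pCons)
  show ?case
  proof (cases "?n \<in> I")
    case True
    have f: "fst (se q I ?n) = Q * S + E" "snd (se q I ?n) = - (t * E)"
      using True by (simp_all add: Let_def S_def E_def Q_def t_def)
    have d: "[:(1 + (q - 1) * br ?n) / br ?n:] = (1 + (Q - 1) * x) * y"
      by (simp add: Q_def x_def y_def one_pCons algebra_simps add_divide_distrib diff_divide_distrib)
    have o: "gfo I (Suc ?n) = Q * gfo I ?n + (1 + (Q - 1) * x) * y * gfi I ?n"
      using gf_Suc_in(1)[OF _ True] unfolding d Q_def by simp
    have i: "gfi I (Suc ?n) = - t * (y * gfo I ?n + gfi I ?n)"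
      using gf_Suc_in(2)[OF _ True] unfolding t_def y_def by simp
    have 1: "gfo I (Suc ?n) + gfi I (Suc ?n) = Q * S + E"
      unfolding o i by (rule gf_step_algebra[OF xy IH1 IH2])
    have 2: "(1 + t) * ((1 + Q * x - 1) * gfi I (Suc ?n)) + t * (Q * S + E) + (1 + Q * x) * (- (t * E)) = 0"
      unfolding i by (rule gf_step_algebra[OF xy IH1 IH2])
    show ?thesis unfolding f one xS using 1 2 by (simp add: t_def)
  next
    case False
    have f: "fst (se q I ?n) = S + t * S" "snd (se q I ?n) = - (t * (S + t * S))"
      using False by (simp_all add: Let_def S_def E_def Q_def t_def)
    have o: "gfo I (Suc ?n) = S" "gfi I (Suc ?n) = t * S"
      using gf_Suc_other[OF _ False] IH1 by (simp_all add: t_def)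
    have 2: "(1 + t) * ((1 + Q * x - 1) * (t * S)) + t * (S + t * S) + (1 + Q * x) * (- (t * (S + t * S))) = 0"
      by (simp add: algebra_simps)
    show ?thesis unfolding f one xS o using 2 by (simp add: t_def)
  qed
qed

lemma htrace_subword:
  assumes "1 \<le> n"
  shows "htrace n r (subword I n) = coeff (fst (se q I (n - 1))) r"
proof -
  obtain m where m: "n = Suc m" using assms by (cases n) auto
  have "htrace n r (subword I n) = coeff (\<Sum>A\<in>Pow {2..n}. monom (mcoef (subword I n) A A) (card A)) r"
    unfolding htrace_def sum_hooks_poly ..
  also have "\<dots> = coeff (fst (se q I m)) r"
    using gf_se_aux[of I m] unfolding gf_sum m by simp
  finally show ?thesis using m by simp
qed

end


section \<open>Irreducibility of the seminormal hook representations\<close>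

lemma hooks_sw:
  assumes k: "2 \<le> k" "k < n" and B: "B \<in> hooks n r"
  shows "sw k B \<in> hooks n r"
proof -
  have "sw k B \<subseteq> {2..n}"
  proof
    fix j assume "j \<in> sw k B"
    then have "adj k j \<in> {2..n}" using B by (auto simp: hooks_def mem_sw)
    then show "j \<in> {2..n}" using k by (auto simp: transpose_def split: if_splits)
  qed
  then show ?thesis using B card_sw[of k B] by (simp add: hooks_def)
qed

lemma (in laurent_hom) compat_weaken:
  assumes "submod M" "hecke_compat n \<phi> {0}"
  shows "hecke_compat n \<phi> M"
proof -
  have M: "x \<in> M" if "x \<in> {0}" for x using assms(1) that by (simp add: submod_def)
  show ?thesis
    by (rule hecke_compatI; rule M)
       (rule compat_quad[OF assms(2)] compat_braid[OF assms(2)] compat_comm[OF submod_zero assms(2)]; simp)+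
qed

context seminormal
begin

text \<open>The matrices of the right action, applied to column vectors as irreducibility is
  formulated there. Compared with \<open>hop\<close> this is the transposed operator, and the
  coefficient \<open>off\<close> is taken at the swapped set.\<close>

definition lop :: "nat \<Rightarrow> nat \<Rightarrow> free_alg \<Rightarrow> (nat set \<Rightarrow> 'k) \<Rightarrow> nat set \<Rightarrow> 'k" where
  "lop n r x f A = (if A \<in> hooks n r then \<Sum>B\<in>hooks n r. hk.act (delta A) x B * f B else 0)"

lemma lop_gen:
  assumes f: "\<And>B. B \<notin> hooks n r \<Longrightarrow> f B = 0" and A: "A \<in> hooks n r"
  shows "lop n r (mon [i]) f A = dg i A * f A + off i (sw i A) * f (sw i A)"
proof -
  have *: "sw i B = A \<longleftrightarrow> B = sw i A" for B by (metis sw_sw)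
  have "lop n r (mon [i]) f A = (\<Sum>B\<in>hooks n r. (if B = A then dg i A * f A else 0) + (if B = sw i A then off i (sw i A) * f (sw i A) else 0))"
    unfolding lop_def using A by (auto simp: hk.act_mon hop_def delta_def * algebra_simps intro!: sum.cong)
  also have "\<dots> = dg i A * f A + off i (sw i A) * f (sw i A)"
    using A f[of "sw i A"] finite_hooks by (simp add: sum.distrib sum.delta)
  finally show ?thesis .
qed

lemma q_plus_1: "q + 1 \<noteq> 0"
  using br_Suc_nz[of "Suc 0"] by (simp add: add.commute)

text \<open>Replacing \<open>Suc k\<close> in the leg by \<open>k\<close> lowers the sum of the
  entries, and only the initial segment admits no such move. An equivalence along each move thus
  connects all leg sets.\<close>

lemma hooks_to_initial:
  assumes step: "\<And>k A. 2 \<le> k \<Longrightarrow> k < n \<Longrightarrow> A \<in> hooks n r \<Longrightarrow> k \<notin> A \<Longrightarrow> Suc k \<in> A \<Longrightarrow> P A \<longleftrightarrow> P (sw k A)"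
  shows "A \<in> hooks n r \<Longrightarrow> P A \<longleftrightarrow> P {2..<r + 2}"
proof (induction "\<Sum>A" arbitrary: A rule: less_induct)
  case less
  have fin: "finite A" using less.prems finite_subset by (auto simp: hooks_def)
  show ?case
  proof (cases "\<exists>k. 2 \<le> k \<and> k \<notin> A \<and> Suc k \<in> A")
    case True
    then obtain k where k: "2 \<le> k" "k \<notin> A" "Suc k \<in> A" by auto
    have kn: "k < n" using k less.prems by (auto simp: hooks_def)
    have sA: "sw k A = insert k (A - {Suc k})"
      using k by (auto simp: sw_def transpose_def split: if_splits)
    have h: "sw k A \<in> hooks n r"
      using less.prems k kn card_sw[of k A] unfolding hooks_def by (auto simp: sA)
    have "\<Sum>A = Suc k + \<Sum>(A - {Suc k})" using fin k by (intro sum.remove) auto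
    moreover have "\<Sum>(sw k A) = k + \<Sum>(A - {Suc k})" unfolding sA using fin k by simp
    ultimately have "P (sw k A) \<longleftrightarrow> P {2..<r + 2}" using less.hyps[OF _ h] by simp
    then show ?thesis using step[OF k(1) kn less.prems k(2,3)] by simp
  next
    case False
    have F: "k \<in> A" if "2 \<le> k" "Suc k \<in> A" for k using False that by blast
    have down: "j \<in> A" if "k \<in> A" "2 \<le> j" "j \<le> k" for j k
      using that(3,1,2) by (induction rule: inc_induct) (auto intro: F)
    have sub: "A \<subseteq> {2..}" using less.prems by (auto simp: hooks_def)
    have "A = {2..<r + 2}"
    proof (cases "A = {}")
      case True
      then show ?thesis using less.prems by (auto simp: hooks_def)
    next
      case ne: False
      have "A = {2..Max A}"
        using down[OF Max_in[OF fin ne]] Max_ge[OF fin] sub by force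
      moreover have "card A = r" using less.prems by (simp add: hooks_def)
      ultimately have "Max A + 1 - 2 = r" by (metis card_atLeastAtMost Suc_eq_plus1)
      moreover have "2 \<le> Max A" using Max_in[OF fin ne] sub by auto
      ultimately have "{2..Max A} = {2..<r + 2}" by auto
      then show ?thesis using \<open>A = {2..Max A}\<close> by simp
    qed
    then show ?thesis by simp
  qed
qed

text \<open>The functions in \<open>Dg\<close> form an algebra of diagonal operators preserving
  \<open>W\<close>. It contains the indicator of \<open>k\<close> in the leg for every
  \<open>k\<close>, by induction on \<open>k\<close>, and so isolates each leg set. A nonzero
  invariant subspace therefore contains a unit vector, and the nonzero off-diagonal coefficients
  lead from it to all others.\<close>

lemma hook_irreducible:
  assumes supp: "\<And>f B. f \<in> W \<Longrightarrow> B \<notin> hooks n r \<Longrightarrow> f B = 0"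
    and add: "\<And>f g. f \<in> W \<Longrightarrow> g \<in> W \<Longrightarrow> (\<lambda>B. f B + g B) \<in> W"
    and scale: "\<And>c f. f \<in> W \<Longrightarrow> (\<lambda>B. c * f B) \<in> W"
    and gen: "\<And>i f. i \<in> {1..<n} \<Longrightarrow> f \<in> W \<Longrightarrow> lop n r (mon [i]) f \<in> W"
    and nz: "e \<in> W" "e E \<noteq> 0"
    and A: "A \<in> hooks n r"
  shows "delta A \<in> W"
proof -
  define Dg where "Dg = {c. \<forall>f\<in>W. (\<lambda>B. c B * f B) \<in> W}"
  have Dg: "(\<lambda>B. c B * f B) \<in> W" if "c \<in> Dg" "f \<in> W" for c f using that by (simp add: Dg_def)
  have Dadd: "(\<lambda>B. a * c B + b * d B) \<in> Dg" if "c \<in> Dg" "d \<in> Dg" for a b c d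
    unfolding Dg_def
  proof (intro CollectI ballI)
    fix f assume "f \<in> W"
    then have "(\<lambda>B. a * (c B * f B) + b * (d B * f B)) \<in> W" using add scale Dg that by blast
    then show "(\<lambda>B. (a * c B + b * d B) * f B) \<in> W" by (simp add: algebra_simps)
  qed
  have Dmult: "(\<lambda>B. c B * d B) \<in> Dg" if "c \<in> Dg" "d \<in> Dg" for c d
    using Dg[OF that(1) Dg[OF that(2)]] by (simp add: Dg_def mult.assoc)
  have Done: "(\<lambda>B. 1) \<in> Dg" by (simp add: Dg_def)
  have Dcong: "c \<in> Dg" if "d \<in> Dg" "\<And>B. B \<in> hooks n r \<Longrightarrow> c B = d B" for c d
    unfolding Dg_def
  proof (intro CollectI ballI)
    fix f assume f: "f \<in> W"
    have "(\<lambda>B. c B * f B) = (\<lambda>B. d B * f B)"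
      using that(2) supp[OF f] by (metis mult_zero_right)
    then show "(\<lambda>B. c B * f B) \<in> W" using Dg[OF that(1) f] by simp
  qed
  define P where "P k = (\<lambda>B. of_bool (k \<in> B) :: 'k)" for k :: nat
  have not1: "Suc 0 \<notin> B" if "B \<in> hooks n r" for B using that by (auto simp: hooks_def)
  have P: "P k \<in> Dg" if "2 \<le> k" "k \<le> n" for k
    using that
  proof (induction k rule: dec_induct)
    case base
    have "(\<lambda>B. dg 1 B) \<in> Dg"
      unfolding Dg_def
    proof (intro CollectI ballI)
      fix f assume f: "f \<in> W"
      have "lop n r (mon [1]) f = (\<lambda>B. dg 1 B * f B)"
      proof
        fix B
        show "lop n r (mon [1]) f B = dg 1 B * f B"
        proof (cases "B \<in> hooks n r")
          case True
          have "off 1 (sw 1 B) = 0" using not1[OF True] by (simp add: off_def mem_sw)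
          then show ?thesis using lop_gen[OF supp[OF f] True, where i = 1] by simp
        qed (use supp[OF f] in \<open>simp add: lop_def\<close>)
      qed
      moreover have "1 \<in> {1..<n}" using base by simp
      ultimately show "(\<lambda>B. dg 1 B * f B) \<in> W" using gen[OF _ f, of 1] by simp
    qed
    \<comment> \<open>On leg sets \<open>dg 1\<close> takes the value -1 if 2 is in the leg and q
      otherwise, because 1 never is. Hence (q - dg 1) / (q + 1) is the indicator for 2.\<close>
    from Dadd[OF this Done, where a = "- 1 / (q + 1)" and b = "q / (q + 1)"]
    show ?case
      by (rule Dcong) (use q_plus_1 not1 in \<open>auto simp: P_def dg_def numeral_2_eq_2 add_divide_distrib[symmetric]\<close>)
  next
    case (step k)
    define a where "a = (1 + (q - 1) * br k) / br k"
    define d where "d = - 1 / br k"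
    have brk: "br k \<noteq> 0" "1 + q * br k \<noteq> 0" using br_nz[of k] br_Suc_nz step.hyps by auto
    have nza: "a + 1 \<noteq> 0"
    proof -
      have "a + 1 = (1 + q * br k) / br k" using brk by (simp add: a_def field_simps)
      then show ?thesis using brk by simp
    qed
    have nzd: "q - d \<noteq> 0"
    proof -
      have "q - d = (1 + q * br k) / br k" using brk by (simp add: d_def field_simps)
      then show ?thesis using brk by simp
    qed
    have kn: "k \<in> {1..<n}" using step by auto
    have Pk: "P k \<in> Dg" using step by simp
    from Dadd[OF Pk Done, where a = "- 1" and b = 1] have Qk: "(\<lambda>B. of_bool (k \<notin> B)) \<in> Dg"
      by (rule Dcong) (auto simp: P_def)
    \<comment> \<open>Compressing T_k to the functions with fixed status of \<open>k\<close> leaves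
      only its diagonal: a swap that changes the set also changes the status of \<open>k\<close>,
      and otherwise \<open>off\<close> vanishes.\<close>
    have cut: "(\<lambda>B. of_bool (p (k \<in> B)) * dg k B) \<in> Dg" if Rk: "(\<lambda>B. of_bool (p (k \<in> B))) \<in> Dg"
      and p: "p = (\<lambda>b. b) \<or> p = Not" for p :: "bool \<Rightarrow> bool"
      unfolding Dg_def
    proof (intro CollectI ballI)
      fix f assume f: "f \<in> W"
      define g where "g = (\<lambda>B. of_bool (p (k \<in> B)) * f B)"
      have g: "g \<in> W" using Dg[OF Rk f] by (simp add: g_def)
      have "(\<lambda>B. of_bool (p (k \<in> B)) * lop n r (mon [k]) g B) = (\<lambda>B. of_bool (p (k \<in> B)) * dg k B * f B)"
      proof
        fix B
        show "of_bool (p (k \<in> B)) * lop n r (mon [k]) g B = of_bool (p (k \<in> B)) * dg k B * f B"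
        proof (cases "B \<in> hooks n r")
          case True
          have "off k (sw k B) = 0" if "p (k \<in> B)" "p (Suc k \<in> B)"
            using that p by (auto simp: off_def mem_sw)
          then show ?thesis
            using lop_gen[OF supp[OF g] True, where i = k] by (auto simp: g_def mem_sw algebra_simps)
        qed (use supp[OF f] in \<open>simp add: lop_def\<close>)
      qed
      then show "(\<lambda>B. of_bool (p (k \<in> B)) * dg k B * f B) \<in> W"
        using Dg[OF Rk gen[OF kn g]] by simp
    qed
    have c1: "(\<lambda>B. of_bool (k \<in> B) * dg k B) \<in> Dg" using cut[of "\<lambda>b. b"] Pk by (simp add: P_def)
    have c2: "(\<lambda>B. of_bool (k \<notin> B) * dg k B) \<in> Dg" using cut[of Not] Qk by simp
    \<comment> \<open>On each half the diagonal of T_k takes two distinct values, -1 and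
      \<open>a\<close>, or \<open>d\<close> and \<open>q\<close>, according to whether
      \<open>Suc k\<close> is in the leg. Linear interpolation between them gives the
      indicator.\<close>
    have "(\<lambda>B. 1 * (a / (a + 1) * P k B + - 1 / (a + 1) * (of_bool (k \<in> B) * dg k B)) +
        1 * (q / (q - d) * of_bool (k \<notin> B) + - 1 / (q - d) * (of_bool (k \<notin> B) * dg k B))) \<in> Dg"
      by (rule Dadd[OF Dadd[OF Pk c1] Dadd[OF Qk c2]])
    then show ?case
    proof (rule Dcong)
      fix B
      have "k \<in> B \<Longrightarrow> Suc k \<in> B \<Longrightarrow> dg k B = - 1" "k \<in> B \<Longrightarrow> Suc k \<notin> B \<Longrightarrow> dg k B = a"
        "k \<notin> B \<Longrightarrow> Suc k \<in> B \<Longrightarrow> dg k B = d" "k \<notin> B \<Longrightarrow> Suc k \<notin> B \<Longrightarrow> dg k B = q"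
        by (simp_all add: dg_def a_def d_def)
      moreover have "a / (a + 1) + 1 / (a + 1) = 1" "q / (q - d) - d / (q - d) = 1"
        using nza nzd by (simp_all add: add_divide_distrib[symmetric] diff_divide_distrib[symmetric])
      ultimately show "P (Suc k) B = 1 * (a / (a + 1) * P k B + - 1 / (a + 1) * (of_bool (k \<in> B) * dg k B)) +
        1 * (q / (q - d) * of_bool (k \<notin> B) + - 1 / (q - d) * (of_bool (k \<notin> B) * dg k B))"
        by (cases "k \<in> B"; cases "Suc k \<in> B") (simp_all add: P_def)
    qed
  qed
  have prefix: "(\<lambda>B. of_bool (\<forall>k\<in>{2..m}. k \<in> B \<longleftrightarrow> k \<in> A)) \<in> Dg" if "m \<le> n" for m A
    using that
  proof (induction m)
    case 0
    then show ?case using Done by simp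
  next
    case (Suc m)
    show ?case
    proof (cases "2 \<le> Suc m")
      case True
      have "(\<lambda>B. (if Suc m \<in> A then 1 else - 1) * P (Suc m) B + (if Suc m \<in> A then 0 else 1) * 1) \<in> Dg"
        using Dadd[OF P[OF True Suc.prems] Done] by simp
      note prod = Dmult[OF Suc.IH this]
      have set: "{2..Suc m} = insert (Suc m) {2..m}" using True by auto
      show ?thesis
        by (rule Dcong[OF prod]) (use Suc.prems in \<open>auto simp: P_def set\<close>)
    next
      case False
      then have "{2..Suc m} = {}" by simp
      then show ?thesis using Done by simp
    qed
  qed
  have isolate: "delta A \<in> W" if f: "f \<in> W" and nzf: "f A \<noteq> 0" for f A
  proof -
    have A: "A \<in> hooks n r" using supp[OF f] nzf by blast
    have "(\<lambda>B. of_bool (\<forall>k\<in>{2..n}. k \<in> B \<longleftrightarrow> k \<in> A) * f B) = (\<lambda>B. f A * delta A B)"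
    proof
      fix B
      have "B = A" if "B \<in> hooks n r" "\<forall>k\<in>{2..n}. k \<in> B \<longleftrightarrow> k \<in> A"
        using that A unfolding hooks_def by blast
      then show "of_bool (\<forall>k\<in>{2..n}. k \<in> B \<longleftrightarrow> k \<in> A) * f B = f A * delta A B"
        using supp[OF f, of B] by (cases "B = A") (auto simp: delta_def)
    qed
    then have "(\<lambda>B. f A * delta A B) \<in> W" using Dg[OF prefix[OF order_refl, of A] f] by simp
    from scale[OF this, of "1 / f A"] nzf have "(\<lambda>B. delta A B) \<in> W" by simp
    then show ?thesis by simp
  qed
  have hop: "delta (sw k B) \<in> W" if k: "2 \<le> k" "k < n" and B: "delta B \<in> W" "B \<in> hooks n r" and ne: "(k \<in> B) \<noteq> (Suc k \<in> B)" for k B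
  proof -
    have kn: "k \<in> {1..<n}" using k by auto
    have s: "sw k B \<in> hooks n r"
      by (rule hooks_sw[OF k B(2)])
    \<comment> \<open>This number is q [k-1], which is nonzero because k >= 2.\<close>
    have bk: "br k - 1 \<noteq> 0"
    proof -
      have "br k = 1 + q * br (k - 1)" using br_Suc[of "k - 1"] k by simp
      moreover have "q * br (k - 1) \<noteq> 0"
      proof -
        have "q * br (k - 1) \<noteq> 0" if "q \<noteq> 0" using that br_nz[of "k - 1"] k by simp
        moreover have "q \<noteq> 0"
        proof
          assume "q = 0"
          then show False using hom_mult[of qvar qinv] qvar_qinv(1) hom_1 by (simp add: q_def)
        qed
        ultimately show ?thesis by blast
      qed
      ultimately show ?thesis by simp
    qed
    have ne': "sw k B \<noteq> B" using ne mem_sw[of k k B] by auto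
    have "lop n r (mon [k]) (delta B) (sw k B) = off k B"
      using lop_gen[of n r "delta B", OF supp[OF B(1)] s, where i = k] ne' by (simp add: delta_def)
    moreover have "off k B \<noteq> 0" using ne bk br_nz[of k] br_Suc_nz[of k] k by (auto simp: off_def)
    ultimately show ?thesis using isolate[OF gen[OF kn B(1)], of "sw k B"] by simp
  qed
  have iff: "delta B \<in> W \<longleftrightarrow> delta {2..<r + 2} \<in> W" if "B \<in> hooks n r" for B
  proof (rule hooks_to_initial[OF _ that, where P = "\<lambda>B. delta B \<in> W"])
    fix k B assume k: "2 \<le> k" "k < n" and B: "B \<in> hooks n r" "k \<notin> B" "Suc k \<in> B"
    have s: "sw k B \<in> hooks n r"
      by (rule hooks_sw[OF k B(1)])
    show "delta B \<in> W \<longleftrightarrow> delta (sw k B) \<in> W"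
      using hop[OF k _ B(1)] hop[OF k _ s] B by (auto simp: mem_sw)
  qed
  have "delta E \<in> W" "E \<in> hooks n r" using isolate[OF nz] supp[OF nz(1)] nz(2) by auto
  then show ?thesis using iff A by blast
qed

lemma act_expand:
  assumes A: "A \<in> hooks n r" and x: "x \<in> free_sub n"
  shows "hk.act (delta A) x = (\<lambda>B. \<Sum>C\<in>hooks n r. hk.act (delta A) x C * delta C B)"
proof (rule expand_delta)
  fix B assume B: "B \<notin> hooks n r"
  have "lext (\<lambda>u. fold hop u (delta A) B) x = lext (\<lambda>u. 0) x"
    using mcoef_support[OF A _ B] by (intro lext_cong_words[OF x]) (simp add: mcoef_def)
  then show "hk.act (delta A) x B = 0" by (simp add: hk.act_def lext_def)
qed

lemma act_mult_entries:
  assumes A: "A \<in> hooks n r" and x: "x \<in> free_sub n"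
  shows "hk.act (delta A) (x * y) B = (\<Sum>C\<in>hooks n r. hk.act (delta A) x C * hk.act (delta C) y B)"
proof -
  have sum: "hk.act (\<lambda>B. \<Sum>C\<in>S. c C * delta C B) y B = (\<Sum>C\<in>S. c C * hk.act (delta C) y B)" for S c
    unfolding hk.act_def lext_def hk.fold_T_sum
    by (simp add: sum_distrib_left mult.left_commute) (rule sum.swap)
  have "hk.act (delta A) (x * y) B = hk.act (\<lambda>B. \<Sum>C\<in>hooks n r. hk.act (delta A) x C * delta C B) y B"
    using hk.act_mult[of "delta A" x y B] act_expand[OF A x] by simp
  then show ?thesis by (simp add: sum)
qed

lemma act_cong: "x - y \<in> hecke_ideal n \<Longrightarrow> hk.act g x B = hk.act g y B"
  using hk.act_ideal[of "x - y" n B g] by (simp add: hk.act_diff)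

definition htr :: "nat \<Rightarrow> nat \<Rightarrow> free_alg \<Rightarrow> 'k" where
  "htr n r x = (\<Sum>A\<in>hooks n r. hk.act (delta A) x A)"

lemma htr_mon: "htr n r (mon u) = htrace n r u"
  by (simp add: htr_def htrace_def mcoef_def hk.act_mon)

lemma htr_lext: "htr n r x = lext (htrace n r) x"
proof -
  have "htr n r x = (\<Sum>u\<in>Poly_Mapping.keys x. \<Sum>A\<in>hooks n r. h (Poly_Mapping.lookup x u) * fold hop (letters u) (delta A) A)"
    unfolding htr_def hk.act_def lext_def by (rule sum.swap)
  then show ?thesis by (simp add: lext_def htrace_def mcoef_def sum_distrib_left)
qed

end

section \<open>Specialization at \<open>q = 1\<close> and the fraction field\<close>

lemma eval_one_add: "eval_one (x + y) = eval_one x + eval_one y"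
  unfolding eval_one_def by (rule setsum_keys_plus_distrib) simp_all

lemma eval_one_single: "eval_one (Poly_Mapping.single a c) = c"
  by (simp add: eval_one_def)

lemma eval_one_mult: "eval_one (x * y) = eval_one x * eval_one y"
  by (rule mult_hom_from_singles[where F = eval_one]) (simp_all add: eval_one_add eval_one_single mult_single)

lemma eval_one_qhalf: "eval_one (qhalf a) = 1"
  by (simp add: qhalf_def eval_one_single)

lemma eval_one_1: "eval_one 1 = 1"
  using eval_one_qhalf[of 0] by simp

lemma eval_one_qvar: "eval_one qvar = 1"
  by (simp add: qvar_def eval_one_qhalf)

interpretation ev: laurent_hom eval_one
  by unfold_locales (simp_all add: eval_one_add eval_one_mult eval_one_1)

lemma eval_one_bracket: "eval_one (q_bracket i) = int i"
  by (simp add: q_bracket_def ev.hom_sum ev.hom_power eval_one_qvar)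

abbreviation frac :: "laurent \<Rightarrow> laurent fract" where
  "frac r \<equiv> Fraction_Field.Fract r 1"

lemma frac_eq_iff: "frac r = frac s \<longleftrightarrow> r = s"
  by (simp add: eq_fract)

text \<open>The bracket [i] is nonzero because it specializes to i at q = 1.\<close>

interpretation sn: seminormal frac
proof
  fix i :: nat assume "1 \<le> i"
  then have "q_bracket i \<noteq> 0" using eval_one_bracket[of i] ev.hom_0 by auto
  then show "frac (q_bracket i) \<noteq> 0" using frac_eq_iff[of "q_bracket i" 0] by (simp add: Zero_fract_def)
qed (simp_all add: One_fract_def)

lemma frac_coeff_se: "coeff (fst (se sn.q I m)) r = frac (coeff (fst (se qvar I m)) r)"
  unfolding sn.q_def by (rule coeff_se_hom[THEN conjunct1]) (rule sn.hom_add sn.hom_mult sn.hom_1)+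

text \<open>The individual matrix entries have denominators. The trace, however, is determined
  modulo the submodule of integral elements by its values on increasing products, and these are
  coefficients of \<open>se\<close>, computed without division.\<close>

lemma htrace_integral:
  assumes n: "1 \<le> n" and u: "u \<in> words n"
  shows "sn.htrace n r u \<in> range frac"
proof -
  have M: "sn.submod (range frac)"
    unfolding sn.submod_def
    using sn.hom_0[symmetric] sn.hom_add[symmetric] sn.hom_mult[symmetric] by auto
  have c: "sn.hecke_compat n (sn.htrace n r) (range frac)"
    by (rule sn.compat_weaken[OF M sn.htrace_compat])
  have "sn.htrace n r (u @ []) \<in> range frac"
  proof (rule sn.trace_principle[OF M c _ n order_refl u])
    fix v y assume v: "v \<in> words n" "y \<in> words (n - 1)"
    then have "y \<in> words n" using words_mono diff_le_self by blast
    then show "sn.htrace n r (v @ y) - sn.htrace n r (y @ v) \<in> range frac"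
      using sn.htrace_commute[OF v(1), of y r] sn.hom_0[symmetric] by simp
  next
    fix I
    show "sn.htrace n r (subword I n @ []) \<in> range frac"
      using sn.htrace_subword[OF n, of r I] frac_coeff_se by simp
  qed simp
  then show ?thesis by simp
qed

lemma htr_integral:
  assumes n: "1 \<le> n" and x: "x \<in> free_sub n"
  shows "sn.htr n r x \<in> range frac"
  using x
proof (induction x rule: free_sub_induct)
  case zero
  then show ?case using sn.hom_0[symmetric] by (simp add: sn.htr_lext)
next
  case (scaled c u)
  then obtain s where "sn.htrace n r u = frac s" using htrace_integral[OF n] by blast
  then have "sn.htr n r (free_const c * mon u) = frac (c * s)"
    by (simp only: sn.htr_lext sn.lext_term sn.hom_mult)
  then show ?case by simp
next
  case (add x y)
  then obtain s t where "sn.htr n r x = frac s" "sn.htr n r y = frac t" by auto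
  then have "sn.htr n r (x + y) = frac (s + t)" by (simp only: sn.htr_lext sn.lext_add sn.hom_add)
  then show ?case by simp
qed

definition hook_list :: "nat \<Rightarrow> nat \<Rightarrow> nat set list" where
  "hook_list n r = (SOME xs. set xs = hooks n r \<and> distinct xs)"

lemma hook_list: "set (hook_list n r) = hooks n r" "distinct (hook_list n r)"
  using someI_ex[OF finite_distinct_list[OF finite_hooks[of n r]]] by (auto simp: hook_list_def)

lemma length_hook_list: "length (hook_list n r) = card (hooks n r)"
  using hook_list[of n r] distinct_card[of "hook_list n r"] by simp

lemma hook_list_nth: "a < card (hooks n r) \<Longrightarrow> hook_list n r ! a \<in> hooks n r"
  using hook_list(1)[of n r] length_hook_list[of n r] by (metis nth_mem)

lemma sum_hook_list: "(\<Sum>a<card (hooks n r). F (hook_list n r ! a)) = (\<Sum>A\<in>hooks n r. F A)"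
proof -
  have "bij_betw (\<lambda>a. hook_list n r ! a) {..<card (hooks n r)} (hooks n r)"
    using bij_betw_nth[OF hook_list(2)] length_hook_list hook_list(1) by metis
  then show ?thesis by (rule sum.reindex_bij_betw)
qed

definition hook_mat :: "nat \<Rightarrow> nat \<Rightarrow> free_alg \<Rightarrow> laurent fract mat" where
  "hook_mat n r x = mat (card (hooks n r)) (card (hooks n r))
     (\<lambda>(a, b). sn.hk.act (delta (hook_list n r ! a)) x (hook_list n r ! b))"

definition hook_rep :: "nat \<Rightarrow> nat \<Rightarrow> hecke_elt \<Rightarrow> laurent fract mat" where
  "hook_rep n r h = hook_mat n r (hecke_rep n h)"

lemma hook_rep_class: "x \<in> free_sub n \<Longrightarrow> hook_rep n r (hecke_class n x) = hook_mat n r x"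
  using sn.act_cong[OF hecke_rep_class(2)] by (simp add: hook_rep_def hook_mat_def)

lemma hook_mat_mult:
  assumes x: "x \<in> free_sub n"
  shows "hook_mat n r (x * y) = hook_mat n r x * hook_mat n r y"
proof (rule eq_matI)
  fix a b assume "a < dim_row (hook_mat n r x * hook_mat n r y)" "b < dim_col (hook_mat n r x * hook_mat n r y)"
  then have ab: "a < card (hooks n r)" "b < card (hooks n r)" by (simp_all add: hook_mat_def)
  show "hook_mat n r (x * y) $$ (a, b) = (hook_mat n r x * hook_mat n r y) $$ (a, b)"
    using ab sn.act_mult_entries[OF hook_list_nth[OF ab(1)] x]
    by (simp add: hook_mat_def scalar_prod_def atLeast0LessThan sum_hook_list[symmetric])
qed (simp_all add: hook_mat_def)

lemma hook_rep_hom: "is_hecke_rep n (card (hooks n r)) (hook_rep n r)"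
  unfolding is_hecke_rep_def
proof (intro conjI allI ballI)
  let ?d = "card (hooks n r)"
  show "hook_rep n r \<in> Ring.ring_hom (hecke n) (ring_mat TYPE(laurent fract) ?d ())"
  proof (rule ring_hom_memI)
    fix x y assume "x \<in> carrier (hecke n)" "y \<in> carrier (hecke n)"
    then obtain a b where ab: "a \<in> free_sub n" "b \<in> free_sub n" "x = hecke_class n a" "y = hecke_class n b"
      by (auto simp: hecke_carrier)
    show "hook_rep n r x \<in> carrier (ring_mat TYPE(laurent fract) ?d ())"
      by (simp add: hook_rep_def hook_mat_def ring_mat_def)
    show "hook_rep n r (x \<otimes>\<^bsub>hecke n\<^esub> y) = hook_rep n r x \<otimes>\<^bsub>ring_mat TYPE(laurent fract) ?d ()\<^esub> hook_rep n r y"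
      using ab by (simp add: hecke_mult hook_rep_class free_sub_mult hook_mat_mult ring_mat_def)
    show "hook_rep n r (x \<oplus>\<^bsub>hecke n\<^esub> y) = hook_rep n r x \<oplus>\<^bsub>ring_mat TYPE(laurent fract) ?d ()\<^esub> hook_rep n r y"
      using ab by (auto simp: hecke_add hook_rep_class free_sub_add hook_mat_def sn.hk.act_add ring_mat_def intro!: eq_matI)
  next
    have "hook_mat n r 1 = 1\<^sub>m ?d"
      using hook_list(2)[of n r] length_hook_list[of n r]
      by (intro eq_matI) (auto simp: hook_mat_def sn.hk.act_one delta_def nth_eq_iff_index_eq)
    then show "hook_rep n r \<one>\<^bsub>hecke n\<^esub> = \<one>\<^bsub>ring_mat TYPE(laurent fract) ?d ()\<^esub>"
      by (simp add: hecke_one hook_rep_class free_sub_one ring_mat_def)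
  qed
  fix c x assume "x \<in> carrier (hecke n)"
  then obtain a where a: "a \<in> free_sub n" "x = hecke_class n a" by (auto simp: hecke_carrier)
  then show "hook_rep n r (hecke_smult n c x) = frac c \<cdot>\<^sub>m hook_rep n r x"
    by (auto simp: hecke_smult_class hook_rep_class free_sub_mult free_sub_const hook_mat_def sn.hk.act_const intro!: eq_matI)
qed

lemma hook_rep_irreducible:
  assumes n: "1 \<le> n" and r: "r < n"
  shows "is_irreducible_hecke_rep n (card (hooks n r)) (hook_rep n r)"
  unfolding is_irreducible_hecke_rep_def
proof (intro conjI allI impI)
  let ?d = "card (hooks n r)" and ?e = "\<lambda>a. hook_list n r ! a"
  show "is_hecke_rep n ?d (hook_rep n r)" by (rule hook_rep_hom)
  have "{2..<r + 2} \<in> hooks n r" using r by (auto simp: hooks_def)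
  then show "0 < ?d" using finite_hooks card_gt_0_iff by blast
  fix W :: "laurent fract vec set"
  assume "is_subspace ?d W \<and> (\<forall>h\<in>carrier (hecke n). \<forall>x\<in>W. hook_rep n r h *\<^sub>v x \<in> W)"
  then have W: "W \<subseteq> carrier_vec ?d" "0\<^sub>v ?d \<in> W" "\<And>x y. x \<in> W \<Longrightarrow> y \<in> W \<Longrightarrow> x + y \<in> W"
    "\<And>c x. x \<in> W \<Longrightarrow> c \<cdot>\<^sub>v x \<in> W"
    and inv: "\<And>h x. h \<in> carrier (hecke n) \<Longrightarrow> x \<in> W \<Longrightarrow> hook_rep n r h *\<^sub>v x \<in> W"
    by (auto simp: is_subspace_def)
  define ve where "ve f = vec ?d (\<lambda>a. f (?e a))" for f :: "nat set \<Rightarrow> laurent fract"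
  \<comment> \<open>Column vectors are translated into functions supported on leg sets, the setting
    of \<open>hook_irreducible\<close>.\<close>
  define W' where "W' = {f. (\<forall>B. B \<notin> hooks n r \<longrightarrow> f B = 0) \<and> ve f \<in> W}"
  have inj: "?e a = ?e b \<longleftrightarrow> a = b" if "a < ?d" "b < ?d" for a b
    using that hook_list(2)[of n r] length_hook_list[of n r] by (simp add: nth_eq_iff_index_eq)
  have lift: "\<exists>f. (\<forall>B. B \<notin> hooks n r \<longrightarrow> f B = 0) \<and> ve f = x" if x: "x \<in> carrier_vec ?d" for x
  proof -
    define f where "f B = (\<Sum>a<?d. if ?e a = B then x $ a else 0)" for B
    have "f B = 0" if "B \<notin> hooks n r" for B
      unfolding f_def using that hook_list_nth[of _ n r] by (intro sum.neutral) auto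
    moreover have "ve f = x"
    proof (rule eq_vecI)
      fix b assume "b < dim_vec x"
      then have b: "b < ?d" using x by simp
      have "f (?e b) = (\<Sum>a<?d. if a = b then x $ a else 0)"
        unfolding f_def using inj b by (intro sum.cong) auto
      then show "ve f $ b = x $ b" using b by (simp add: ve_def sum.delta)
    qed (use x in \<open>simp add: ve_def\<close>)
    ultimately show ?thesis by blast
  qed
  show "W = {0\<^sub>v ?d} \<or> W = carrier_vec ?d"
  proof (cases "W = {0\<^sub>v ?d}")
    case False
    then obtain x where x: "x \<in> W" "x \<noteq> 0\<^sub>v ?d" using W(2) by blast
    obtain f0 where f0: "\<forall>B. B \<notin> hooks n r \<longrightarrow> f0 B = 0" "ve f0 = x" using lift[of x] x W(1) by blast
    have "\<exists>A0. f0 A0 \<noteq> 0"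
    proof (rule ccontr)
      assume "\<nexists>A0. f0 A0 \<noteq> 0"
      then have "ve f0 = 0\<^sub>v ?d" by (auto simp: ve_def)
      then show False using f0 x by simp
    qed
    then obtain A0 where A0: "f0 A0 \<noteq> 0" by auto
    have dl: "delta A \<in> W'" if A: "A \<in> hooks n r" for A
    proof (rule sn.hook_irreducible[where W = W' and n = n and r = r and e = f0 and E = A0])
      show "f0 A0 \<noteq> 0" "A \<in> hooks n r" by (rule A0, rule A)
      show "f0 \<in> W'" using f0 x by (simp add: W'_def)
      show "f B = 0" if "f \<in> W'" "B \<notin> hooks n r" for f B using that by (simp add: W'_def)
      show "(\<lambda>B. f B + g B) \<in> W'" if "f \<in> W'" "g \<in> W'" for f g
      proof -
        have "ve (\<lambda>B. f B + g B) = ve f + ve g" by (auto simp: ve_def)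
        then show ?thesis using that W(3) by (simp add: W'_def)
      qed
      show "(\<lambda>B. c * f B) \<in> W'" if "f \<in> W'" for c f
      proof -
        have "ve (\<lambda>B. c * f B) = c \<cdot>\<^sub>v ve f" by (auto simp: ve_def)
        then show ?thesis using that W(4) by (simp add: W'_def)
      qed
      show "sn.lop n r (mon [i]) f \<in> W'" if i: "i \<in> {1..<n}" and f: "f \<in> W'" for i f
      proof -
        have m: "mon [i] \<in> free_sub n" using i by (intro free_sub_mon) auto
        have "ve (sn.lop n r (mon [i]) f) = hook_rep n r (hecke_class n (mon [i])) *\<^sub>v ve f"
        proof (rule eq_vecI)
          fix a assume "a < dim_vec (hook_rep n r (hecke_class n (mon [i])) *\<^sub>v ve f)"
          then have a: "a < ?d" by (simp add: hook_rep_def hook_mat_def)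
          show "ve (sn.lop n r (mon [i]) f) $ a = (hook_rep n r (hecke_class n (mon [i])) *\<^sub>v ve f) $ a"
            using a hook_list_nth[OF a]
            by (simp add: ve_def hook_rep_class[OF m] hook_mat_def sn.lop_def scalar_prod_def
                atLeast0LessThan sum_hook_list[symmetric])
        qed (simp add: ve_def hook_rep_def hook_mat_def)
        then show ?thesis
          using inv[OF hecke_class_carrier[OF m], of "ve f"] f by (simp add: W'_def sn.lop_def)
      qed
    qed
    have "y \<in> W" if y: "y \<in> carrier_vec ?d" for y
    proof -
      have unit: "unit_vec ?d a \<in> W" if a: "a < ?d" for a
      proof -
        have "ve (delta (?e a)) = unit_vec ?d a"
          using inj a by (intro eq_vecI) (auto simp: ve_def delta_def)
        then show ?thesis using dl[OF hook_list_nth[OF a]] by (simp add: W'_def)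
      qed
      have "vec ?d (\<lambda>a. if a < m then y $ a else 0) \<in> W" if "m \<le> ?d" for m
        using that
      proof (induction m)
        case 0
        have "vec ?d (\<lambda>a. if a < 0 then y $ a else 0) = 0\<^sub>v ?d" by auto
        then show ?case using W(2) by simp
      next
        case (Suc m)
        have "vec ?d (\<lambda>a. if a < Suc m then y $ a else 0) =
          vec ?d (\<lambda>a. if a < m then y $ a else 0) + (y $ m) \<cdot>\<^sub>v unit_vec ?d m"
          using Suc.prems by (intro eq_vecI) (auto simp: less_Suc_eq)
        then show ?case using Suc W(3,4) unit[of m] by simp
      qed
      from this[of ?d] have "vec ?d (\<lambda>a. if a < ?d then y $ a else 0) \<in> W" by simp
      moreover have "vec ?d (\<lambda>a. if a < ?d then y $ a else 0) = y" using y by auto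
      ultimately show ?thesis by simp
    qed
    then show ?thesis using W(1) by blast
  qed simp
qed

text \<open>The chosen value exists by integrality and is unique because \<open>frac\<close> is
  injective. The convention off the carrier is the one made for \<open>hecke_char\<close>.\<close>

definition hook_char :: "nat \<Rightarrow> nat \<Rightarrow> hecke_elt \<Rightarrow> laurent" where
  "hook_char n r h = (if h \<in> carrier (hecke n)
     then SOME c. frac c = sn.htr n r (hecke_rep n h) else undefined)"

lemma frac_hook_char:
  assumes "1 \<le> n" "x \<in> free_sub n"
  shows "frac (hook_char n r (hecke_class n x)) = sn.htr n r x"
proof -
  have "sn.htr n r (hecke_rep n (hecke_class n x)) = sn.htr n r x"
    using sn.act_cong[OF hecke_rep_class(2)[OF assms(2)]] by (simp add: sn.htr_def)
  moreover have "frac (SOME c. frac c = sn.htr n r x) = sn.htr n r x"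
    by (rule someI_ex) (metis htr_integral[OF assms] imageE)
  ultimately show ?thesis using hecke_class_carrier[OF assms(2)] by (simp add: hook_char_def)
qed

lemma hook_char_irreducible:
  assumes n: "1 \<le> n" and r: "r < n"
  shows "is_irreducible_hecke_char n (hook_char n r)"
  unfolding is_irreducible_hecke_char_def
proof (intro exI conjI ballI)
  show "is_irreducible_hecke_rep n (card (hooks n r)) (hook_rep n r)" by (rule hook_rep_irreducible[OF assms])
  fix h assume "h \<in> carrier (hecke n)"
  then obtain x where x: "x \<in> free_sub n" "h = hecke_class n x" by (auto simp: hecke_carrier)
  show "frac (hook_char n r h) = (\<Sum>i<card (hooks n r). hook_rep n r h $$ (i, i))"
    using x frac_hook_char[OF n x(1), of r] sum_hook_list[where F = "\<lambda>A. sn.hk.act (delta A) x A" and n = n and r = r]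
    by (simp add: hook_rep_class hook_mat_def sn.htr_def)
qed

lemma eval_hook_char_subword:
  assumes n: "1 \<le> n"
  shows "eval_one (hook_char n r (hecke_class n (mon (subword I n)))) = coeff (fst (se (1::int) I (n - 1))) r"
proof -
  have "frac (hook_char n r (hecke_class n (mon (subword I n)))) = frac (coeff (fst (se qvar I (n - 1))) r)"
    using frac_hook_char[OF n free_sub_mon[OF subword_words]] sn.htrace_subword[OF n]
    by (simp add: sn.htr_mon frac_coeff_se)
  then have "hook_char n r (hecke_class n (mon (subword I n))) = coeff (fst (se qvar I (n - 1))) r"
    by (simp only: frac_eq_iff)
  then show ?thesis
    using coeff_se_hom[of eval_one qvar I "n - 1" r] by (simp add: eval_one_add eval_one_mult eval_one_1 eval_one_qvar)
qed


section \<open>Hook characters of the symmetric group\<close>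

section \<open>Traces on finite-dimensional spaces\<close>

definition basis_trace :: "tabloid_vec set \<Rightarrow> (tabloid_vec \<Rightarrow> tabloid_vec) \<Rightarrow> rat" where
  "basis_trace B f = (\<Sum>b\<in>B. tabloid.representation B (f b) b)"

lemma linear_rep_sum:
  assumes B: "finite B" "tabloid.independent B" and C: "finite C" "tabloid.independent C" "tabloid.span C = tabloid.span B"
    and f: "\<And>x. x \<in> tabloid.span B \<Longrightarrow> f x \<in> tabloid.span B"
    and add: "\<And>x y. f (x + y) = f x + f y" and sc: "\<And>c x. f (tabloid_scale c x) = tabloid_scale c (f x)"
    and x: "x \<in> tabloid.span B"
  shows "tabloid.representation B (f x) b = (\<Sum>c\<in>C. tabloid.representation C x c * tabloid.representation B (f c) b)"
proof -
  have f0: "f 0 = 0" using add[of 0 0] by simp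
  have fsum: "f (\<Sum>c\<in>C. tabloid_scale (g c) c) = (\<Sum>c\<in>C. tabloid_scale (g c) (f c))" for g
    using C(1) by (induction C) (simp_all add: f0 add sc)
  have "(\<Sum>c\<in>C. tabloid_scale (tabloid.representation C x c) c) = x"
    using x C(3) by (intro tabloid.sum_representation_eq[OF C(2) _ C(1)]) auto
  then have "f x = (\<Sum>c\<in>C. tabloid_scale (tabloid.representation C x c) (f c))"
    using fsum[of "tabloid.representation C x"] by simp
  moreover have "f c \<in> tabloid.span B" if "c \<in> C" for c using f[of c] tabloid.span_base[of c C] C(3) that by simp
  ultimately show ?thesis
    using tabloid.representation_sum[OF B(2), of C "\<lambda>c. tabloid_scale (tabloid.representation C x c) (f c)"]
    by (simp add: tabloid.representation_scale[OF B(2)] tabloid.span_scale)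
qed

lemma basis_trace_cong:
  assumes B: "finite B" "tabloid.independent B" and C: "finite C" "tabloid.independent C" "tabloid.span C = tabloid.span B"
    and f: "\<And>x. x \<in> tabloid.span B \<Longrightarrow> f x \<in> tabloid.span B"
    and add: "\<And>x y. f (x + y) = f x + f y" and sc: "\<And>c x. f (tabloid_scale c x) = tabloid_scale c (f x)"
  shows "basis_trace B f = basis_trace C f"
proof -
  have id: "tabloid.representation C x c = (\<Sum>b\<in>B. tabloid.representation B x b * tabloid.representation C b c)" if "x \<in> tabloid.span B" for x c
    using linear_rep_sum[OF C(1,2) B C(3)[symmetric], of "\<lambda>x. x" x c] that C(3) by simp
  have "basis_trace B f = (\<Sum>b\<in>B. \<Sum>c\<in>C. tabloid.representation C b c * tabloid.representation B (f c) b)"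
    unfolding basis_trace_def
    by (intro sum.cong refl linear_rep_sum[OF B C f add sc tabloid.span_base])
  also have "\<dots> = (\<Sum>c\<in>C. \<Sum>b\<in>B. tabloid.representation B (f c) b * tabloid.representation C b c)"
    by (subst sum.swap) (simp add: mult.commute)
  also have "\<dots> = basis_trace C f"
    unfolding basis_trace_def
  proof (rule sum.cong[OF refl])
    fix c assume "c \<in> C"
    then have "f c \<in> tabloid.span B" using f[of c] C(3) tabloid.span_base[of c C] by simp
    from id[OF this, of c, symmetric]
    show "(\<Sum>b\<in>B. tabloid.representation B (f c) b * tabloid.representation C b c) = tabloid.representation C (f c) c" .
  qed
  finally show ?thesis .
qed

lemma basis_trace_commute:
  assumes B: "finite B" "tabloid.independent B"
    and f: "\<And>x. x \<in> tabloid.span B \<Longrightarrow> f x \<in> tabloid.span B" and g: "\<And>x. x \<in> tabloid.span B \<Longrightarrow> g x \<in> tabloid.span B"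
    and f_add: "\<And>x y. f (x + y) = f x + f y" and f_sc: "\<And>c x. f (tabloid_scale c x) = tabloid_scale c (f x)"
    and g_add: "\<And>x y. g (x + y) = g x + g y" and g_sc: "\<And>c x. g (tabloid_scale c x) = tabloid_scale c (g x)"
  shows "basis_trace B (\<lambda>x. f (g x)) = basis_trace B (\<lambda>x. g (f x))"
proof -
  note lf = linear_rep_sum[OF B B refl f f_add f_sc]
  note lg = linear_rep_sum[OF B B refl g g_add g_sc]
  have "basis_trace B (\<lambda>x. f (g x)) = (\<Sum>b\<in>B. \<Sum>c\<in>B. tabloid.representation B (g b) c * tabloid.representation B (f c) b)"
    unfolding basis_trace_def using lf[OF _ g[OF tabloid.span_base]] by (intro sum.cong refl) simp
  also have "\<dots> = (\<Sum>c\<in>B. \<Sum>b\<in>B. tabloid.representation B (f c) b * tabloid.representation B (g b) c)"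
    by (subst sum.swap) (simp add: mult.commute)
  also have "\<dots> = basis_trace B (\<lambda>x. g (f x))"
    unfolding basis_trace_def using lg[OF _ f[OF tabloid.span_base]] by (intro sum.cong refl) simp
  finally show ?thesis .
qed

text \<open>Nothing is known of the basis that \<open>trace_on\<close> chooses. Comparison with
  \<open>C\<close> shows it to be finite, and the trace does not depend on the basis.\<close>

lemma trace_on_basis:
  assumes C: "finite C" "tabloid.independent C" "tabloid.span C = V"
    and f: "\<And>x. x \<in> V \<Longrightarrow> f x \<in> V"
    and add: "\<And>x y. f (x + y) = f x + f y" and sc: "\<And>c x. f (tabloid_scale c x) = tabloid_scale c (f x)"
  shows "trace_on V f = basis_trace C f"
proof -
  define B where "B = (SOME B. B \<subseteq> V \<and> tabloid.independent B \<and> V \<subseteq> tabloid.span B)"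
  have "\<exists>B. B \<subseteq> V \<and> tabloid.independent B \<and> V \<subseteq> tabloid.span B"
    by (rule tabloid.maximal_independent_subset[of V]) blast
  then have B: "B \<subseteq> V" "tabloid.independent B" "V \<subseteq> tabloid.span B"
    unfolding B_def using someI_ex[of "\<lambda>B. B \<subseteq> V \<and> tabloid.independent B \<and> V \<subseteq> tabloid.span B"] by blast+
  have "tabloid.span B \<subseteq> V" using tabloid.span_minimal[OF B(1)] C(3) tabloid.subspace_span by blast
  then have sB: "tabloid.span B = V" using B(3) by blast
  have fB: "finite B" using tabloid.independent_span_bound[OF C(1) B(2)] B(1) C(3) by blast
  have "trace_on V f = basis_trace B f"
    by (simp add: trace_on_def basis_trace_def B_def Let_def)
  also have "\<dots> = basis_trace C f"
    by (rule basis_trace_cong[OF fB B(2) C(1,2)]) (use C(3) sB f add sc in auto)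
  finally show ?thesis .
qed

section \<open>Specht modules of hook shape\<close>

definition hook_shape :: "nat \<Rightarrow> nat \<Rightarrow> nat list" where
  "hook_shape n r = (n - r) # replicate r 1"

abbreviation iperm :: "(nat \<Rightarrow> nat) \<Rightarrow> nat \<Rightarrow> nat" where
  "iperm \<equiv> Hilbert_Choice.inv"

lemma lookup_tabloid_act:
  "bij w \<Longrightarrow> Poly_Mapping.lookup (tabloid_act w x) \<rho> = Poly_Mapping.lookup x (\<rho> \<circ> w)"
proof -
  assume "bij w"
  then have "inj (\<lambda>r :: nat \<Rightarrow> nat. r \<circ> w)"
    by (intro injI) (metis bij_is_surj comp_assoc comp_id surj_iff)
  then show ?thesis by (simp add: tabloid_act_def map_key.rep_eq)
qed

lemma tabloid_act_add: "bij w \<Longrightarrow> tabloid_act w (x + y) = tabloid_act w x + tabloid_act w y"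
  by (rule poly_mapping_eqI) (simp add: lookup_tabloid_act lookup_add)

lemma tabloid_act_scale: "bij w \<Longrightarrow> tabloid_act w (tabloid_scale c x) = tabloid_scale c (tabloid_act w x)"
  by (rule poly_mapping_eqI) (simp add: lookup_tabloid_act)

lemma tabloid_act_comp: "bij v \<Longrightarrow> bij w \<Longrightarrow> tabloid_act (v \<circ> w) x = tabloid_act v (tabloid_act w x)"
  by (rule poly_mapping_eqI) (simp add: lookup_tabloid_act bij_comp comp_assoc)

lemma perms_bij: "w \<in> perms n \<Longrightarrow> bij w"
  by (auto intro: permutes_bij)

lemma iperm_perms: "w \<in> perms n \<Longrightarrow> iperm w \<in> perms n"
  by (auto intro: permutes_inv)

lemma iperm_cancel: "w \<in> perms n \<Longrightarrow> iperm w (w x) = x" "w \<in> perms n \<Longrightarrow> w (iperm w x) = x"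
  by (auto simp: permutes_inverses)

lemma perms_permutation: "w \<in> perms n \<Longrightarrow> permutation w"
  by (auto intro: permutes_imp_permutation[of "{1..n}"])

lemma lookup_polytabloid:
  "Poly_Mapping.lookup (polytabloid n t) \<rho> =
     (\<Sum>\<pi>\<in>column_group n t. if tabloid_of n (t \<circ> iperm \<pi>) = \<rho> then of_int (sign \<pi>) else 0)"
  by (simp add: polytabloid_def lookup_sum lookup_single when_def)

lemma tabloid_of_comp: "w \<in> perms n \<Longrightarrow> tabloid_of n (t \<circ> w) = tabloid_of n t \<circ> w"
proof
  fix x assume w: "w \<in> perms n"
  show "tabloid_of n (t \<circ> w) x = (tabloid_of n t \<circ> w) x"
  proof (cases "x \<in> {1..n}")
    case True
    then have "w x \<in> {1..n}" using perms_bounds[OF w, of x] by simp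
    then show ?thesis using True by (simp add: tabloid_of_def)
  next
    case False
    then have "w x = x" using w by (simp add: permutes_not_in)
    then show ?thesis using False by (auto simp: tabloid_of_def)
  qed
qed

text \<open>Conjugation by \<open>w\<close> carries the column group of \<open>t\<close> to that of
  the moved tableau and preserves signs.\<close>

lemma polytabloid_act:
  assumes w: "w \<in> perms n"
  shows "tabloid_act w (polytabloid n t) = polytabloid n (t \<circ> iperm w)"
proof (rule poly_mapping_eqI)
  fix \<rho>
  let ?c = "\<lambda>\<pi>. w \<circ> \<pi> \<circ> iperm w"
  have perm: "\<pi> \<in> perms n" if "\<pi> \<in> column_group n s" for \<pi> s using that by (simp add: column_group_def)
  have cp: "?c \<pi> \<in> perms n" if "\<pi> \<in> perms n" for \<pi>
    using that w iperm_perms[OF w] by (auto intro!: permutes_compose)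
  have "Poly_Mapping.lookup (polytabloid n (t \<circ> iperm w)) \<rho> =
    (\<Sum>\<pi>\<in>column_group n t. if tabloid_of n (t \<circ> iperm w \<circ> iperm (?c \<pi>)) = \<rho> then of_int (sign (?c \<pi>)) else 0)"
    unfolding lookup_polytabloid
  proof (rule sum.reindex_bij_witness[of _ ?c "\<lambda>\<pi>. iperm w \<circ> \<pi> \<circ> w"])
    fix \<pi> assume a: "\<pi> \<in> column_group n (t \<circ> iperm w)"
    show c1: "w \<circ> (iperm w \<circ> \<pi> \<circ> w) \<circ> iperm w = \<pi>"
      using iperm_cancel[OF w] by (auto simp: fun_eq_iff)
    show "(if tabloid_of n (t \<circ> iperm w \<circ> iperm (?c (iperm w \<circ> \<pi> \<circ> w))) = \<rho> then of_int (sign (?c (iperm w \<circ> \<pi> \<circ> w))) else 0) =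
      (if tabloid_of n (t \<circ> iperm w \<circ> iperm \<pi>) = \<rho> then of_int (sign \<pi>) else (0 :: rat))"
      unfolding c1 ..
    have p: "iperm w \<circ> \<pi> \<circ> w \<in> perms n"
      using perm[OF a] w iperm_perms[OF w] by (auto intro!: permutes_compose)
    have "snd (t ((iperm w \<circ> \<pi> \<circ> w) x)) = snd (t x)" if "x \<in> {1..n}" for x
    proof -
      have "w x \<in> {1..n}" using perms_bounds[OF w, of x] that by simp
      then show ?thesis using a iperm_cancel[OF w] by (simp add: column_group_def)
    qed
    then show "iperm w \<circ> \<pi> \<circ> w \<in> column_group n t" using p by (simp add: column_group_def)
  next
    fix \<pi> assume a: "\<pi> \<in> column_group n t"
    show "iperm w \<circ> ?c \<pi> \<circ> w = \<pi>" using iperm_cancel[OF w] by (auto simp: fun_eq_iff)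
    have "snd ((t \<circ> iperm w) (?c \<pi> x)) = snd ((t \<circ> iperm w) x)" if "x \<in> {1..n}" for x
    proof -
      have "iperm w x \<in> {1..n}" using perms_bounds[OF iperm_perms[OF w], of x] that by simp
      then show ?thesis using a iperm_cancel[OF w] by (simp add: column_group_def)
    qed
    then show "?c \<pi> \<in> column_group n (t \<circ> iperm w)" using cp[OF perm[OF a]] by (simp add: column_group_def)
  qed
  also have "\<dots> = (\<Sum>\<pi>\<in>column_group n t. if tabloid_of n (t \<circ> iperm \<pi>) = \<rho> \<circ> w then of_int (sign \<pi>) else 0)"
  proof (rule sum.cong[OF refl])
    fix \<pi> assume a: "\<pi> \<in> column_group n t"
    note p = perm[OF a]
    have "sign (?c \<pi>) = sign w * sign \<pi> * sign (iperm w)"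
      using perms_permutation[OF w] perms_permutation[OF p] perms_permutation[OF iperm_perms[OF w]]
      by (simp add: sign_compose permutation_compose)
    then have s: "sign (?c \<pi>) = sign \<pi>"
      using sign_inverse[OF perms_permutation[OF w]] by (simp add: sign_idempotent mult.commute mult.left_commute)
    have "iperm (?c \<pi>) = w \<circ> iperm \<pi> \<circ> iperm w"
      using w p iperm_perms[OF w] by (intro inv_unique_comp) (auto simp: fun_eq_iff iperm_cancel[OF w] iperm_cancel[OF p])
    then have "t \<circ> iperm w \<circ> iperm (?c \<pi>) = (t \<circ> iperm \<pi>) \<circ> iperm w"
      by (auto simp: fun_eq_iff iperm_cancel[OF w])
    then have "tabloid_of n (t \<circ> iperm w \<circ> iperm (?c \<pi>)) = tabloid_of n (t \<circ> iperm \<pi>) \<circ> iperm w"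
      using tabloid_of_comp[OF iperm_perms[OF w]] by simp
    moreover have "f \<circ> iperm w = \<rho> \<longleftrightarrow> f = \<rho> \<circ> w" for f :: "nat \<Rightarrow> nat"
      using iperm_cancel[OF w] by (auto simp: fun_eq_iff) metis
    ultimately show "(if tabloid_of n (t \<circ> iperm w \<circ> iperm (?c \<pi>)) = \<rho> then of_int (sign (?c \<pi>)) else 0) =
      (if tabloid_of n (t \<circ> iperm \<pi>) = \<rho> \<circ> w then of_int (sign \<pi>) else (0 :: rat))"
      using s by simp
  qed
  finally show "Poly_Mapping.lookup (tabloid_act w (polytabloid n t)) \<rho> = Poly_Mapping.lookup (polytabloid n (t \<circ> iperm w)) \<rho>"
    by (simp add: lookup_tabloid_act[OF perms_bij[OF w]] lookup_polytabloid)
qed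

lemma specht_invariant:
  assumes w: "w \<in> perms n" and x: "x \<in> specht_module n lam"
  shows "tabloid_act w x \<in> specht_module n lam"
  using x unfolding specht_module_def
proof (induction rule: tabloid.span_induct)
  case base
  show ?case
    unfolding tabloid.subspace_def using perms_bij[OF w]
    by (auto simp: tabloid_act_add tabloid_act_scale tabloid.span_add tabloid.span_scale)
       (metis tabloid.span_zero tabloid.scale_zero_left tabloid_act_scale)
next
  case (step x)
  then obtain t where t: "x = polytabloid n t" "t \<in> tableaux n lam" by auto
  have "bij_betw (iperm w) {1..n} {1..n}" using iperm_perms[OF w] permutes_imp_bij by blast
  then have "t \<circ> iperm w \<in> tableaux n lam"
    using t(2) unfolding tableaux_def by (auto intro: bij_betw_trans)
  then show ?case using t polytabloid_act[OF w] by (auto intro: tabloid.span_base)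
qed

locale hook =
  fixes n r :: nat
  assumes rn: "r < n"
begin

definition leg :: "(nat \<times> nat) set" where "leg = (\<lambda>i. (i, 0)) ` {1..r}"

definition arm :: "(nat \<times> nat) set" where "arm = (\<lambda>j. (0, j)) ` {1..<n - r}"

lemma diagram_hook: "diagram (hook_shape n r) = insert (0, 0) (leg \<union> arm)"
proof -
  have "(i, j) \<in> diagram (hook_shape n r) \<longleftrightarrow> i = 0 \<and> j < n - r \<or> 1 \<le> i \<and> i \<le> r \<and> j = 0" for i j
    by (cases i) (auto simp: diagram_def hook_shape_def)
  moreover have "(i, j) \<in> insert (0, 0) (leg \<union> arm) \<longleftrightarrow> i = 0 \<and> j < n - r \<or> 1 \<le> i \<and> i \<le> r \<and> j = 0" for i j
    using rn by (cases "j = 0") (auto simp: leg_def arm_def)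
  ultimately have "p \<in> diagram (hook_shape n r) \<longleftrightarrow> p \<in> insert (0, 0) (leg \<union> arm)" for p
    by (cases p) (simp only:)
  then show ?thesis by blast
qed

lemma card_leg: "card leg = r" "finite leg"
  by (simp_all add: leg_def card_image inj_on_def)

lemma card_arm: "card arm = n - r - 1" "finite arm"
  by (simp_all add: arm_def card_image inj_on_def)

lemma ex_std: "A \<in> hooks n r \<Longrightarrow> \<exists>t. t \<in> tableaux n (hook_shape n r) \<and> t 1 = (0, 0) \<and> t ` A = leg"
proof -
  assume A: "A \<in> hooks n r"
  then have A': "A \<subseteq> {2..n}" "card A = r" by (auto simp: hooks_def)
  then have fA: "finite A" using finite_subset by blast
  obtain f where f: "bij_betw f A leg"
    using finite_same_card_bij[OF fA card_leg(2)] A' card_leg by auto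
  have "card ({2..n} - A) = card arm" using A' fA by (simp add: card_Diff_subset card_arm)
  then obtain g where g: "bij_betw g ({2..n} - A) arm"
    using finite_same_card_bij[of "{2..n} - A" arm] card_arm by auto
  define t where "t x = (if x = 1 then (0, 0) else if x \<in> A then f x else g x)" for x
  have 1: "bij_betw t {1} {(0, 0)}" by (simp add: t_def bij_betw_def)
  have 2: "bij_betw t A leg"
    using f by (rule bij_betw_cong[THEN iffD1, rotated]) (use A' in \<open>auto simp: t_def\<close>)
  have 3: "bij_betw t ({2..n} - A) arm"
    using g by (rule bij_betw_cong[THEN iffD1, rotated]) (auto simp: t_def)
  have "bij_betw t ({1} \<union> (A \<union> ({2..n} - A))) ({(0, 0)} \<union> (leg \<union> arm))"
    by (intro bij_betw_combine 1 2 3) (auto simp: leg_def arm_def)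
  moreover have "{1} \<union> (A \<union> ({2..n} - A)) = {1..n}" using A' rn by auto
  ultimately have "t \<in> tableaux n (hook_shape n r)" by (simp add: tableaux_def diagram_hook)
  then show ?thesis using 2 by (intro exI[of _ t]) (auto simp: t_def bij_betw_def)
qed

text \<open>The order of the entries within leg and arm is left open. Another order in the arm gives
  the same polytabloid, and another order in the leg changes it at most by a sign.\<close>

definition std :: "nat set \<Rightarrow> nat \<Rightarrow> nat \<times> nat" where
  "std A = (SOME t. t \<in> tableaux n (hook_shape n r) \<and> t 1 = (0, 0) \<and> t ` A = leg)"

lemma std:
  assumes "A \<in> hooks n r"
  shows "std A \<in> tableaux n (hook_shape n r)" "std A 1 = (0, 0)" "std A ` A = leg"
  using someI_ex[OF ex_std[OF assms]] by (auto simp: std_def)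

lemma tableau_row:
  assumes t: "t \<in> tableaux n (hook_shape n r)" and x: "x \<in> {1..n}"
  shows "fst (t x) \<le> r" "1 \<le> fst (t x) \<Longrightarrow> t x = (fst (t x), 0)"
    "snd (t x) = 0 \<longleftrightarrow> t x = (0, 0) \<or> 1 \<le> fst (t x)"
proof -
  have "t x \<in> insert (0, 0) (leg \<union> arm)"
    using t x unfolding tableaux_def diagram_hook by (auto simp: bij_betw_def)
  then show "fst (t x) \<le> r" "1 \<le> fst (t x) \<Longrightarrow> t x = (fst (t x), 0)"
    "snd (t x) = 0 \<longleftrightarrow> t x = (0, 0) \<or> 1 \<le> fst (t x)"
    by (auto simp: leg_def arm_def)
qed

lemma tableau_inj: "t \<in> tableaux n (hook_shape n r) \<Longrightarrow> x \<in> {1..n} \<Longrightarrow> y \<in> {1..n} \<Longrightarrow> t x = t y \<Longrightarrow> x = y"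
  unfolding tableaux_def bij_betw_def inj_on_def by blast

lemma tableau_row_unique:
  "t \<in> tableaux n (hook_shape n r) \<Longrightarrow> i \<in> {1..r} \<Longrightarrow> \<exists>!x. x \<in> {1..n} \<and> fst (t x) = i"
proof -
  assume t: "t \<in> tableaux n (hook_shape n r)" and i: "i \<in> {1..r}"
  have "(i, 0) \<in> diagram (hook_shape n r)" using i by (auto simp: diagram_hook leg_def)
  then have "(i, 0) \<in> t ` {1..n}" using t by (simp add: tableaux_def bij_betw_def)
  then obtain x where x: "x \<in> {1..n}" "t x = (i, 0)"
    by (auto elim!: imageE dest: sym)
  show ?thesis
  proof (rule ex1I[of _ x])
    fix y assume y: "y \<in> {1..n} \<and> fst (t y) = i"
    then have "t y = (i, 0)" using tableau_row(2)[OF t, of y] i by auto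
    then show "y = x" using tableau_inj[OF t] x y by auto
  qed (use x in simp)
qed

lemma tableau_row_eq:
  assumes "t \<in> tableaux n (hook_shape n r)" "i \<in> {1..r}" "x \<in> {1..n}" "y \<in> {1..n}" "fst (t x) = i" "fst (t y) = i"
  shows "x = y"
proof -
  have "t x = t y" using tableau_row(2)[OF assms(1,3)] tableau_row(2)[OF assms(1,4)] assms by auto
  then show ?thesis by (rule tableau_inj[OF assms(1,3,4)])
qed

lemma std_row:
  assumes A: "A \<in> hooks n r" and x: "x \<in> {1..n}"
  shows "1 \<le> fst (std A x) \<longleftrightarrow> x \<in> A"
proof
  assume "x \<in> A"
  then have "std A x \<in> leg" using std(3)[OF A] by blast
  then show "1 \<le> fst (std A x)" by (auto simp: leg_def)
next
  assume l: "1 \<le> fst (std A x)"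
  note row = tableau_row[OF std(1)[OF A] x]
  have "std A x \<in> leg" using row(1) row(2)[OF l] l by (force simp: leg_def)
  then obtain a where "a \<in> A" "std A x = std A a" using std(3)[OF A] by auto
  moreover have "a \<in> {1..n}" using A \<open>a \<in> A\<close> by (auto simp: hooks_def)
  ultimately show "x \<in> A" using tableau_inj[OF std(1)[OF A] x] by auto
qed

text \<open>The first column consists of the corner and the leg, and every other column is a single
  cell.\<close>

lemma column_group_std:
  assumes A: "A \<in> hooks n r"
  shows "column_group n (std A) = {\<pi>. \<pi> permutes insert 1 A}"
proof -
  have sub: "insert 1 A \<subseteq> {1..n}" using A rn by (auto simp: hooks_def)
  note row = tableau_row[OF std(1)[OF A]]
  have col: "snd (std A x) = 0 \<longleftrightarrow> x \<in> insert 1 A" if x: "x \<in> {1..n}" for x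
    using row(3)[OF x] std_row[OF A x] std(2)[OF A] tableau_inj[OF std(1)[OF A] x, of 1] rn by force
  show ?thesis
  proof (intro equalityI subsetI)
    fix \<pi> assume "\<pi> \<in> column_group n (std A)"
    then have p: "\<pi> permutes {1..n}" and c: "\<And>x. x \<in> {1..n} \<Longrightarrow> snd (std A (\<pi> x)) = snd (std A x)"
      by (auto simp: column_group_def)
    have "\<pi> x = x" if x: "x \<in> {1..n} - insert 1 A" for x
    proof -
      have px: "\<pi> x \<in> {1..n}" using p x permutes_in_image by fastforce
      have ne: "snd (std A x) \<noteq> 0" using col x by auto
      then have "snd (std A (\<pi> x)) \<noteq> 0" using c x by auto
      then have "\<pi> x \<notin> A" using col[OF px] by simp
      then have "\<not> 1 \<le> fst (std A (\<pi> x))" using std_row[OF A px] by simp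
      moreover have "\<not> 1 \<le> fst (std A x)" using std_row[OF A, of x] x by auto
      ultimately have "std A (\<pi> x) = std A x" using c[of x] x by (auto simp: prod_eq_iff)
      then show ?thesis using tableau_inj[OF std(1)[OF A] px] x by auto
    qed
    then show "\<pi> \<in> {\<pi>. \<pi> permutes insert 1 A}" using permutes_superset[OF p] by blast
  next
    fix \<pi> assume "\<pi> \<in> {\<pi>. \<pi> permutes insert 1 A}"
    then have p: "\<pi> permutes insert 1 A" by simp
    have pn: "\<pi> permutes {1..n}" using permutes_subset[OF p sub] .
    have "snd (std A (\<pi> x)) = snd (std A x)" if x: "x \<in> {1..n}" for x
    proof (cases "x \<in> insert 1 A")
      case True
      then have "\<pi> x \<in> insert 1 A" using permutes_in_image[OF p] by simp
      then show ?thesis using col True sub by (metis subsetD)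
    qed (use p in \<open>simp add: permutes_not_in\<close>)
    then show "\<pi> \<in> column_group n (std A)" using pn by (simp add: column_group_def)
  qed
qed

definition stab :: "nat set \<Rightarrow> nat \<Rightarrow> nat" where "stab A = tabloid_of n (std A)"

definition ptab :: "nat set \<Rightarrow> tabloid_vec" where "ptab A = polytabloid n (std A)"

text \<open>A hook tabloid is determined by the entries in its leg rows. The terms of the
  polytabloid at \<open>stab A \<circ> w\<close> are therefore those permutations that agree with
  the inverse of \<open>w\<close> on \<open>A\<close>; there is at most one.\<close>

lemma lookup_ptab:
  assumes A: "A \<in> hooks n r" and w: "w \<in> perms n"
  shows "Poly_Mapping.lookup (ptab A) (stab A \<circ> w) =
    (\<Sum>\<tau> | \<tau> permutes insert 1 A \<and> (\<forall>a\<in>A. \<tau> a = iperm w a). of_int (sign \<tau>))"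
proof -
  have sub: "insert 1 A \<subseteq> {1..n}" using A rn by (auto simp: hooks_def)
  have fin: "finite {\<pi>. \<pi> permutes insert 1 A}"
    using finite_subset[OF sub] by (intro finite_permutations) simp
  have eq: "tabloid_of n (std A \<circ> iperm \<pi>) = stab A \<circ> w \<longleftrightarrow> (\<forall>a\<in>A. \<pi> a = iperm w a)"
    if p: "\<pi> permutes insert 1 A" for \<pi>
  proof -
    have pn: "\<pi> \<in> perms n" using permutes_subset[OF p sub] by simp
    note ip = iperm_perms[OF pn]
    have rows: "tabloid_of n (std A \<circ> iperm \<pi>) = stab A \<circ> w \<longleftrightarrow>
       (\<forall>x\<in>{1..n}. fst (std A (iperm \<pi> x)) = fst (std A (w x)))"
      unfolding stab_def tabloid_of_comp[OF w, symmetric] by (auto simp: tabloid_of_def fun_eq_iff restrict_def)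
    show ?thesis
      unfolding rows
    proof (intro iffI ballI)
      fix a assume h: "\<forall>x\<in>{1..n}. fst (std A (iperm \<pi> x)) = fst (std A (w x))" and a: "a \<in> A"
      have an: "a \<in> {1..n}" using a sub by auto
      have px: "\<pi> a \<in> {1..n}" using perms_bounds[OF pn, of a] an by simp
      have wx: "w (\<pi> a) \<in> {1..n}" using perms_bounds[OF w, of "\<pi> a"] px by simp
      have e: "fst (std A a) = fst (std A (w (\<pi> a)))" using h px iperm_cancel(1)[OF pn] by fastforce
      have l: "1 \<le> fst (std A a)" using std_row[OF A an] a by simp
      have "std A a = std A (w (\<pi> a))"
        using tableau_row(2)[OF std(1)[OF A] an l] tableau_row(2)[OF std(1)[OF A] wx] e l by simp
      then have "a = w (\<pi> a)" using tableau_inj[OF std(1)[OF A] an wx] by simp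
      then show "\<pi> a = iperm w a" using iperm_cancel(1)[OF w, of "\<pi> a"] by simp
    next
      fix x assume h: "\<forall>a\<in>A. \<pi> a = iperm w a" and x: "x \<in> {1..n}"
      have ipx: "iperm \<pi> x \<in> {1..n}" using perms_bounds[OF ip, of x] x by simp
      have wx: "w x \<in> {1..n}" using perms_bounds[OF w, of x] x by simp
      show "fst (std A (iperm \<pi> x)) = fst (std A (w x))"
      proof (cases "iperm \<pi> x \<in> A")
        case True
        then have "x = iperm w (iperm \<pi> x)" using h iperm_cancel(2)[OF pn, of x] by auto
        then have "w x = iperm \<pi> x" using iperm_cancel(2)[OF w] by metis
        then show ?thesis by simp
      next
        case False
        have "w x \<notin> A"
        proof
          assume "w x \<in> A"
          then have "\<pi> (w x) = x" using h iperm_cancel(1)[OF w] by simp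
          then have "iperm \<pi> x = w x" using iperm_cancel(1)[OF pn, of "w x"] by simp
          then show False using False \<open>w x \<in> A\<close> by simp
        qed
        then show ?thesis using std_row[OF A ipx] std_row[OF A wx] False by simp
      qed
    qed
  qed
  have "Poly_Mapping.lookup (ptab A) (stab A \<circ> w) =
     (\<Sum>\<pi>\<in>{\<pi>. \<pi> permutes insert 1 A}. if \<forall>a\<in>A. \<pi> a = iperm w a then of_int (sign \<pi>) else 0)"
    unfolding ptab_def lookup_polytabloid column_group_std[OF A] using eq by (intro sum.cong) auto
  also have "\<dots> = (\<Sum>\<pi>\<in>{\<pi> \<in> {\<pi>. \<pi> permutes insert 1 A}. \<forall>a\<in>A. \<pi> a = iperm w a}. of_int (sign \<pi>))"
    using fin by (rule sum.inter_filter[symmetric])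
  finally show ?thesis by simp
qed

text \<open>A column permutation can change the set of leg entries only by bringing 1 into the leg,
  while \<open>stab B\<close> has 1 in row 0. The tabloids \<open>stab B\<close> thus serve as dual
  coordinates to the polytabloids: they give independence and read off coefficients.\<close>

lemma lookup_ptab_stab:
  assumes A: "A \<in> hooks n r" and B: "B \<in> hooks n r"
  shows "Poly_Mapping.lookup (ptab A) (stab B) = (if A = B then 1 else 0)"
proof (cases "A = B")
  case True
  have fA: "finite A" using A finite_subset by (auto simp: hooks_def)
  have "{\<tau>. \<tau> permutes insert 1 A \<and> (\<forall>a\<in>A. \<tau> a = iperm id a)} = {id}"
  proof (intro equalityI subsetI)
    fix \<tau> assume "\<tau> \<in> {\<tau>. \<tau> permutes insert 1 A \<and> (\<forall>a\<in>A. \<tau> a = iperm id a)}"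
    then have p: "\<tau> permutes insert 1 A" and f: "\<And>a. a \<in> A \<Longrightarrow> \<tau> a = a" by auto
    have "\<tau> permutes {1}" by (rule permutes_superset[OF p]) (use f in auto)
    then show "\<tau> \<in> {id}" using permutes_sing by auto
  qed (auto simp: permutes_id)
  then show ?thesis using lookup_ptab[OF A, of id] True by (simp add: permutes_id)
next
  case False
  have "tabloid_of n (std A \<circ> iperm \<pi>) \<noteq> stab B" if p: "\<pi> permutes insert 1 A" for \<pi>
  proof
    assume e: "tabloid_of n (std A \<circ> iperm \<pi>) = stab B"
    have sub: "insert 1 A \<subseteq> {1..n}" using A rn by (auto simp: hooks_def)
    have pn: "\<pi> \<in> perms n" using permutes_subset[OF p sub] by simp
    have "B \<subseteq> A"
    proof
      fix b assume b: "b \<in> B"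
      have bn: "b \<in> {1..n}" "b \<noteq> 1" using b B by (auto simp: hooks_def)
      have ib: "iperm \<pi> b \<in> {1..n}" using perms_bounds[OF iperm_perms[OF pn], of b] bn by simp
      have "fst (std A (iperm \<pi> b)) = fst (std B b)"
        using fun_cong[OF e, of b] bn by (simp add: tabloid_of_def stab_def)
      then have "iperm \<pi> b \<in> A" using std_row[OF B bn(1)] std_row[OF A ib] b by simp
      then have "\<pi> (iperm \<pi> b) \<in> insert 1 A" using permutes_in_image[OF p] by blast
      then show "b \<in> A" using iperm_cancel(2)[OF pn] bn by simp
    qed
    moreover have "finite A" "card A = card B" using A B finite_subset by (auto simp: hooks_def)
    ultimately have "B = A" using card_subset_eq by metis
    then show False using False by simp
  qed
  then show ?thesis
    unfolding ptab_def lookup_polytabloid column_group_std[OF A] using False by (auto intro!: sum.neutral)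
qed

abbreviation "V \<equiv> specht_module n (hook_shape n r)"

lemma ptab_V: "A \<in> hooks n r \<Longrightarrow> ptab A \<in> V"
  unfolding ptab_def specht_module_def using std(1) by (auto intro: tabloid.span_base)

lemma V_induct [consumes 1, case_names tab zero add scale]:
  assumes x: "x \<in> V" and t: "\<And>t. t \<in> tableaux n (hook_shape n r) \<Longrightarrow> P (polytabloid n t)"
    and z: "P 0" and a: "\<And>x y. P x \<Longrightarrow> P y \<Longrightarrow> P (x + y)" and s: "\<And>c x. P x \<Longrightarrow> P (tabloid_scale c x)"
  shows "P x"
  using x unfolding specht_module_def
proof (induction rule: tabloid.span_induct)
  case base
  then show ?case unfolding tabloid.subspace_def using z a s by auto
next
  case (step x)
  then show ?case using t by auto
qed

definition TB :: "(nat \<Rightarrow> nat) set" where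
  "TB = {\<rho> \<in> {1..n} \<rightarrow>\<^sub>E {..r}. \<forall>i\<in>{1..r}. \<exists>!x. x \<in> {1..n} \<and> \<rho> x = i}"

lemma finite_TB: "finite TB"
  unfolding TB_def by (rule finite_subset[of _ "{1..n} \<rightarrow>\<^sub>E {..r}"]) (auto intro: finite_PiE)

lemma tableau_comp:
  "t \<in> tableaux n (hook_shape n r) \<Longrightarrow> w \<in> perms n \<Longrightarrow> t \<circ> w \<in> tableaux n (hook_shape n r)"
  unfolding tableaux_def using permutes_imp_bij by (auto intro: bij_betw_trans)

lemma tabloid_TB: "t \<in> tableaux n (hook_shape n r) \<Longrightarrow> tabloid_of n t \<in> TB"
proof -
  assume t: "t \<in> tableaux n (hook_shape n r)"
  have "\<exists>!x. x \<in> {1..n} \<and> tabloid_of n t x = i" if "i \<in> {1..r}" for i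
    using tableau_row_unique[OF t that] by (auto simp: tabloid_of_def)
  then show ?thesis using tableau_row(1)[OF t] by (auto simp: TB_def tabloid_of_def)
qed

lemma V_support: "x \<in> V \<Longrightarrow> \<rho> \<notin> TB \<Longrightarrow> Poly_Mapping.lookup x \<rho> = 0"
proof (induction rule: V_induct)
  case (tab t)
  have "tabloid_of n (t \<circ> iperm \<pi>) \<in> TB" if "\<pi> \<in> column_group n t" for \<pi>
    using that tabloid_TB[OF tableau_comp[OF tab(1) iperm_perms]] by (auto simp: column_group_def)
  then show ?case using tab(2) unfolding lookup_polytabloid by (intro sum.neutral) auto
qed (simp_all add: lookup_add)

lemma swap_column_group:
  assumes t: "t \<in> tableaux n (hook_shape n r)" and x: "x \<in> {1..n}" "y \<in> {1..n}"
    and c: "snd (t x) = snd (t y)" "x \<noteq> y"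
  shows "transpose x y \<in> perms n" "\<pi> \<in> column_group n t \<Longrightarrow> \<pi> \<circ> transpose x y \<in> column_group n t"
    "\<pi> \<in> column_group n t \<Longrightarrow> sign (\<pi> \<circ> transpose x y) = - sign \<pi>"
    "\<pi> \<in> column_group n t \<Longrightarrow> iperm (\<pi> \<circ> transpose x y) = transpose x y \<circ> iperm \<pi>"
proof -
  show k: "transpose x y \<in> perms n" using permutes_swap_id[OF x] by simp
  assume p: "\<pi> \<in> column_group n t"
  then have pn: "\<pi> \<in> perms n" by (simp add: column_group_def)
  have "\<pi> \<circ> transpose x y \<in> perms n" using k pn permutes_compose by auto
  moreover have "snd (t ((\<pi> \<circ> transpose x y) z)) = snd (t z)" if z: "z \<in> {1..n}" for z
  proof -
    have "transpose x y z \<in> {1..n}" using perms_bounds[OF k, of z] z by simp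
    then have "snd (t (\<pi> (transpose x y z))) = snd (t (transpose x y z))" using p by (auto simp: column_group_def)
    also have "\<dots> = snd (t z)" using c by (auto simp: transpose_def)
    finally show ?thesis by simp
  qed
  ultimately show "\<pi> \<circ> transpose x y \<in> column_group n t" by (simp add: column_group_def)
  show "sign (\<pi> \<circ> transpose x y) = - sign \<pi>"
    using perms_permutation[OF pn] perms_permutation[OF k] c by (simp add: sign_compose sign_swap_id)
  show "iperm (\<pi> \<circ> transpose x y) = transpose x y \<circ> iperm \<pi>"
    using perms_bij[OF pn] perms_bij[OF k] by (simp add: o_inv_distrib)
qed

lemma swap_involution:
  fixes F :: "(nat \<Rightarrow> nat) \<Rightarrow> rat"
  assumes t: "t \<in> tableaux n (hook_shape n r)" and x: "x \<in> {1..n}" "y \<in> {1..n}"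
    and c: "snd (t x) = snd (t y)" "x \<noteq> y"
  shows "(\<Sum>\<pi>\<in>column_group n t. F \<pi>) = (\<Sum>\<pi>\<in>column_group n t. F (\<pi> \<circ> transpose x y))"
proof (rule sum.reindex_bij_witness[of _ "\<lambda>\<pi>. \<pi> \<circ> transpose x y" "\<lambda>\<pi>. \<pi> \<circ> transpose x y"])
  fix \<pi> assume p: "\<pi> \<in> column_group n t"
  show "\<pi> \<circ> transpose x y \<circ> transpose x y = \<pi>" by (simp add: comp_assoc)
  then show "\<pi> \<circ> transpose x y \<circ> transpose x y = \<pi>" "F (\<pi> \<circ> transpose x y \<circ> transpose x y) = F \<pi>" by simp_all
  show "\<pi> \<circ> transpose x y \<in> column_group n t" using swap_column_group(2)[OF t x c p] .
qed (use swap_column_group(2)[OF t x c] in auto)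

end


context hook
begin

definition rswap :: "nat \<Rightarrow> nat \<Rightarrow> (nat \<Rightarrow> nat) \<Rightarrow> nat \<Rightarrow> nat" where
  "rswap i j \<rho> = restrict (transpose i j \<circ> \<rho>) {1..n}"

text \<open>Interchanging two leg rows of a tabloid amounts to interchanging the two entries there.
  This is a column transposition, under which a polytabloid changes sign.\<close>

lemma V_alternating:
  assumes ij: "i \<in> {1..r}" "j \<in> {1..r}" "i \<noteq> j"
  shows "x \<in> V \<Longrightarrow> \<rho> \<in> extensional {1..n} \<Longrightarrow> Poly_Mapping.lookup x (rswap i j \<rho>) = - Poly_Mapping.lookup x \<rho>"
proof (induction rule: V_induct)
  case (tab t)
  note t = tab(1)
  obtain a where a: "a \<in> {1..n}" "fst (t a) = i" using tableau_row_unique[OF t ij(1)] by blast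
  obtain b where b: "b \<in> {1..n}" "fst (t b) = j" using tableau_row_unique[OF t ij(2)] by blast
  have ta: "t a = (i, 0)" "t b = (j, 0)"
    using tableau_row(2)[OF t a(1)] tableau_row(2)[OF t b(1)] a b ij by auto
  have ab: "snd (t a) = snd (t b)" "a \<noteq> b" using ta ij by auto
  have key: "fst (t (transpose a b x)) = transpose i j (fst (t x))" if x: "x \<in> {1..n}" for x
  proof -
    consider "x = a" | "x = b" "x \<noteq> a" | "x \<noteq> a" "x \<noteq> b" by blast
    then show ?thesis
    proof cases
      case 3
      have "fst (t x) \<noteq> i" "fst (t x) \<noteq> j"
        using 3 tableau_row_eq[OF t ij(1) x a(1) _ a(2)] tableau_row_eq[OF t ij(2) x b(1) _ b(2)] by blast+
      then show ?thesis using 3 by (simp add: transpose_apply_other)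
    qed (use a b in \<open>simp_all\<close>)
  qed
  have eq: "tabloid_of n (t \<circ> iperm (\<pi> \<circ> transpose a b)) = rswap i j \<rho> \<longleftrightarrow> tabloid_of n (t \<circ> iperm \<pi>) = \<rho>"
    if p: "\<pi> \<in> column_group n t" for \<pi>
  proof -
    have pn: "\<pi> \<in> perms n" using p by (simp add: column_group_def)
    have inv: "iperm (\<pi> \<circ> transpose a b) = transpose a b \<circ> iperm \<pi>"
      using swap_column_group(4)[OF t a(1) b(1) ab p] .
    have "tabloid_of n (t \<circ> iperm (\<pi> \<circ> transpose a b)) z = rswap i j (tabloid_of n (t \<circ> iperm \<pi>)) z" for z
    proof (cases "z \<in> {1..n}")
      case True
      then have "iperm \<pi> z \<in> {1..n}" using perms_bounds[OF iperm_perms[OF pn], of z] by simp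
      then show ?thesis using True key by (simp add: inv tabloid_of_def rswap_def)
    next
      case False
      then show ?thesis by (simp del: atLeastAtMost_iff add: tabloid_of_def rswap_def)
    qed
    then have e: "tabloid_of n (t \<circ> iperm (\<pi> \<circ> transpose a b)) = rswap i j (tabloid_of n (t \<circ> iperm \<pi>))" by blast
    have rr: "rswap i j (rswap i j \<sigma>) = \<sigma>" if "\<sigma> \<in> extensional {1..n}" for \<sigma>
      using that by (auto simp: rswap_def fun_eq_iff extensional_def)
    have "tabloid_of n (t \<circ> iperm \<pi>) \<in> extensional {1..n}" by (simp add: tabloid_of_def)
    then show ?thesis unfolding e using rr tab(2) by metis
  qed
  have "Poly_Mapping.lookup (polytabloid n t) (rswap i j \<rho>) =
     (\<Sum>\<pi>\<in>column_group n t. if tabloid_of n (t \<circ> iperm (\<pi> \<circ> transpose a b)) = rswap i j \<rho> then of_int (sign (\<pi> \<circ> transpose a b)) else 0)"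
    unfolding lookup_polytabloid by (rule swap_involution[OF t a(1) b(1) ab])
  also have "\<dots> = (\<Sum>\<pi>\<in>column_group n t. - (if tabloid_of n (t \<circ> iperm \<pi>) = \<rho> then of_int (sign \<pi>) else 0))"
    using eq swap_column_group(3)[OF t a(1) b(1) ab] by (intro sum.cong refl) simp
  finally show ?case by (simp add: lookup_polytabloid sum_negf)
qed (simp_all add: lookup_add)

definition agree :: "(nat \<Rightarrow> nat) \<Rightarrow> (nat \<Rightarrow> nat) \<Rightarrow> bool" where
  "agree \<rho> \<rho>' \<longleftrightarrow> (\<forall>x\<in>{1..n}. \<forall>i\<ge>2. \<rho> x = i \<longleftrightarrow> \<rho>' x = i)"

text \<open>The sum runs over tabloids that differ only in how entries are distributed over rows 0
  and 1. The transposition of the corner entry with the entry below it pairs the terms of a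
  polytabloid with opposite signs. The relation plays the role of a Garnir relation.\<close>

lemma V_zero_sum:
  assumes r: "1 \<le> r"
  shows "x \<in> V \<Longrightarrow> (\<Sum>\<rho>\<in>{\<rho> \<in> TB. agree \<rho> \<rho>0}. Poly_Mapping.lookup x \<rho>) = 0"
proof (induction rule: V_induct)
  case (tab t)
  note t = tab
  have "(0, 0) \<in> t ` {1..n}" using t by (simp add: tableaux_def bij_betw_def diagram_hook)
  then obtain a where a: "a \<in> {1..n}" "t a = (0, 0)"
    by (auto elim!: imageE dest: sym)
  obtain b where b: "b \<in> {1..n}" "fst (t b) = 1" using tableau_row_unique[OF t, of 1] r by auto
  have tb: "t b = (1, 0)" using tableau_row(2)[OF t b(1)] b by auto
  have ab: "snd (t a) = snd (t b)" "a \<noteq> b" using a tb by auto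
  let ?T = "\<lambda>\<pi>. tabloid_of n (t \<circ> iperm \<pi>)"
  have TB: "?T \<pi> \<in> TB" if "\<pi> \<in> column_group n t" for \<pi>
    using that tabloid_TB[OF tableau_comp[OF t iperm_perms]] by (auto simp: column_group_def)
  have agr: "agree (?T (\<pi> \<circ> transpose a b)) \<rho>0 \<longleftrightarrow> agree (?T \<pi>) \<rho>0" if p: "\<pi> \<in> column_group n t" for \<pi>
  proof -
    have inv: "iperm (\<pi> \<circ> transpose a b) = transpose a b \<circ> iperm \<pi>"
      using swap_column_group(4)[OF t a(1) b(1) ab p] .
    have "fst (t (transpose a b y)) = i \<longleftrightarrow> fst (t y) = i" if "2 \<le> i" for y i
      using that a tb by (auto simp: transpose_def)
    then have "?T (\<pi> \<circ> transpose a b) z = i \<longleftrightarrow> ?T \<pi> z = i" if "z \<in> {1..n}" "2 \<le> i" for z i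
      using that by (simp add: inv tabloid_of_def)
    then show ?thesis unfolding agree_def by blast
  qed
  define Z where "Z = (\<Sum>\<pi>\<in>column_group n t. if agree (?T \<pi>) \<rho>0 then of_int (sign \<pi>) else (0 :: rat))"
  have "Z = (\<Sum>\<pi>\<in>column_group n t. if agree (?T (\<pi> \<circ> transpose a b)) \<rho>0 then of_int (sign (\<pi> \<circ> transpose a b)) else 0)"
    unfolding Z_def by (rule swap_involution[OF t a(1) b(1) ab])
  also have "\<dots> = (\<Sum>\<pi>\<in>column_group n t. - (if agree (?T \<pi>) \<rho>0 then of_int (sign \<pi>) else 0))"
    using agr swap_column_group(3)[OF t a(1) b(1) ab] by (intro sum.cong refl) simp
  also have "\<dots> = - Z" by (simp add: Z_def sum_negf)
  finally have Z: "Z = 0" by simp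
  have "(\<Sum>\<rho>\<in>{\<rho> \<in> TB. agree \<rho> \<rho>0}. Poly_Mapping.lookup (polytabloid n t) \<rho>) =
    (\<Sum>\<pi>\<in>column_group n t. \<Sum>\<rho>\<in>{\<rho> \<in> TB. agree \<rho> \<rho>0}. if ?T \<pi> = \<rho> then of_int (sign \<pi>) else 0)"
    unfolding lookup_polytabloid by (rule sum.swap)
  also have "\<dots> = Z"
    unfolding Z_def using TB finite_TB by (intro sum.cong refl) (simp add: sum.delta')
  finally show ?case using Z by simp
next
  case (add x y)
  then show ?case by (simp add: lookup_add sum.distrib)
next
  case (scale c x)
  then show ?case by (simp add: sum_distrib_left[symmetric])
qed simp

lemma TB_leg: "\<rho> \<in> TB \<Longrightarrow> \<rho> 1 = 0 \<Longrightarrow> {x \<in> {1..n}. 1 \<le> \<rho> x} \<in> hooks n r \<and> bij_betw \<rho> {x \<in> {1..n}. 1 \<le> \<rho> x} {1..r}"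
proof -
  assume \<rho>: "\<rho> \<in> TB" and 0: "\<rho> 1 = 0"
  have uniq: "\<And>i. i \<in> {1..r} \<Longrightarrow> \<exists>!x. x \<in> {1..n} \<and> \<rho> x = i" and le: "\<And>x. x \<in> {1..n} \<Longrightarrow> \<rho> x \<le> r"
    using \<rho> by (auto simp: TB_def)
  have bij: "bij_betw \<rho> {x \<in> {1..n}. 1 \<le> \<rho> x} {1..r}"
  proof (rule bij_betw_imageI)
    show "inj_on \<rho> {x \<in> {1..n}. 1 \<le> \<rho> x}"
    proof (rule inj_onI)
      fix x y assume a: "x \<in> {x \<in> {1..n}. 1 \<le> \<rho> x}" "y \<in> {x \<in> {1..n}. 1 \<le> \<rho> x}" "\<rho> x = \<rho> y"
      then show "x = y" using uniq[of "\<rho> x"] le[of x] by auto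
    qed
    show "\<rho> ` {x \<in> {1..n}. 1 \<le> \<rho> x} = {1..r}"
    proof (intro equalityI subsetI)
      fix i assume i: "i \<in> {1..r}"
      then obtain x where "x \<in> {1..n}" "\<rho> x = i" using uniq by blast
      then show "i \<in> \<rho> ` {x \<in> {1..n}. 1 \<le> \<rho> x}" using i by force
    qed (use le in auto)
  qed
  have "x \<in> {2..n}" if "x \<in> {1..n}" "1 \<le> \<rho> x" for x using that 0 by (cases "x = 1") auto
  then show ?thesis using bij bij_betw_same_card[OF bij] by (auto simp: hooks_def)
qed

lemma TB_uniq: "\<rho> \<in> TB \<Longrightarrow> i \<in> {1..r} \<Longrightarrow> x \<in> {1..n} \<Longrightarrow> y \<in> {1..n} \<Longrightarrow> \<rho> x = i \<Longrightarrow> \<rho> y = i \<Longrightarrow> x = y"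
  unfolding TB_def by blast

lemma TB_le: "\<rho> \<in> TB \<Longrightarrow> x \<in> {1..n} \<Longrightarrow> \<rho> x \<le> r"
  unfolding TB_def using PiE_mem by fastforce

text \<open>This takes the place of straightening in the proof that the polytabloids
  \<open>ptab A\<close> span. Alternation reduces tabloids with 1 in row 0 to the
  \<open>stab A\<close>, the zero sum settles those with 1 in row 1, and alternation brings 1 from
  any other leg row to row 1.\<close>

lemma V_zero:
  assumes x: "x \<in> V" and z: "\<And>A. A \<in> hooks n r \<Longrightarrow> Poly_Mapping.lookup x (stab A) = 0"
  shows "x = 0"
proof -
  have perm: "Poly_Mapping.lookup x (restrict (\<sigma> \<circ> \<rho>) {1..n}) = 0"
    if s: "\<sigma> permutes {1..r}" and \<rho>: "\<rho> \<in> extensional {1..n}" "Poly_Mapping.lookup x \<rho> = 0" for \<sigma> \<rho>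
    using s finite_atLeastAtMost
  proof (induction \<sigma> rule: permutes_induct)
    case id
    have "restrict (id \<circ> \<rho>) {1..n} = \<rho>" using \<rho>(1) by (auto simp: fun_eq_iff extensional_def)
    then show ?case using \<rho>(2) by (simp only: id_def)
  next
    case (swap a b p)
    have "restrict (transpose a b \<circ> p \<circ> \<rho>) {1..n} = rswap a b (restrict (p \<circ> \<rho>) {1..n})"
      by (auto simp: rswap_def fun_eq_iff)
    moreover have "Poly_Mapping.lookup x (restrict (p \<circ> \<rho>) {1..n}) = 0" by (rule swap)
    ultimately show ?case using V_alternating[OF swap(1-3) x, of "restrict (p \<circ> \<rho>) {1..n}"] by (simp add: o_def)
  qed
  have base: "Poly_Mapping.lookup x \<rho> = 0" if \<rho>: "\<rho> \<in> TB" "\<rho> 1 = 0" for \<rho>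
  proof -
    define A where "A = {x \<in> {1..n}. 1 \<le> \<rho> x}"
    have A: "A \<in> hooks n r" "bij_betw \<rho> A {1..r}" using TB_leg[OF \<rho>] by (auto simp: A_def)
    have st: "stab A \<in> TB" unfolding stab_def by (rule tabloid_TB[OF std(1)[OF A(1)]])
    have st1: "stab A 1 = 0" using std(2)[OF A(1)] rn by (simp add: stab_def tabloid_of_def)
    have stA: "{x \<in> {1..n}. 1 \<le> stab A x} = A"
      using std_row[OF A(1)] A(1) by (auto simp: stab_def tabloid_of_def hooks_def)
    have bs: "bij_betw (stab A) A {1..r}" using TB_leg[OF st st1] unfolding stA by simp
    \<comment> \<open>Both \<open>\<rho>\<close> and \<open>stab A\<close> number the leg entries
      \<open>A\<close> by rows; this permutation translates one numbering into the other.\<close>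
    define \<sigma> where "\<sigma> i = (if i \<in> {1..r} then \<rho> (inv_into A (stab A) i) else i)" for i
    have "bij_betw \<sigma> {1..r} {1..r}"
      using bij_betw_trans[OF bij_betw_inv_into[OF bs] A(2)]
      by (rule bij_betw_cong[THEN iffD1, rotated]) (simp add: \<sigma>_def)
    then have sp: "\<sigma> permutes {1..r}" by (rule bij_imp_permutes) (simp del: atLeastAtMost_iff add: \<sigma>_def)
    have "restrict (\<sigma> \<circ> stab A) {1..n} = \<rho>"
    proof
      fix y
      show "restrict (\<sigma> \<circ> stab A) {1..n} y = \<rho> y"
      proof (cases "y \<in> {1..n}")
        case True
        show ?thesis
        proof (cases "y \<in> A")
          case yA: True
          then have "inv_into A (stab A) (stab A y) = y" using bs by (simp add: bij_betw_def)
          moreover have "stab A y \<in> {1..r}" using bs yA by (auto simp: bij_betw_def)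
          ultimately show ?thesis using True by (simp add: \<sigma>_def)
        next
          case yA: False
          then have "\<not> 1 \<le> stab A y" "\<not> 1 \<le> \<rho> y" using stA True by (auto simp: A_def)
          then show ?thesis using True by (simp add: \<sigma>_def)
        qed
      next
        case False
        then have "\<rho> y = undefined" using \<rho> by (auto simp: TB_def extensional_def PiE_def)
        then show ?thesis using False by (simp del: atLeastAtMost_iff)
      qed
    qed
    then show ?thesis using perm[OF sp _ z[OF A(1)]] by (simp add: stab_def tabloid_of_def)
  qed
  have one: "Poly_Mapping.lookup x \<rho> = 0" if \<rho>: "\<rho> \<in> TB" "\<rho> 1 = 1" for \<rho>
  proof -
    have r: "1 \<le> r"
    proof -
      have "\<rho> 1 \<le> r" using TB_le[OF \<rho>(1), of 1] rn by simp
      then show ?thesis using \<rho>(2) by simp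
    qed
    \<comment> \<open>Row 1 has a single entry. A tabloid in the zero sum that has 1 there is
      \<open>\<rho>\<close> itself, and all the others have 1 in row 0, where the coefficient is
      already known to vanish.\<close>
    have others: "Poly_Mapping.lookup x \<sigma> = 0" if s: "\<sigma> \<in> {\<sigma> \<in> TB. agree \<sigma> \<rho>}" "\<sigma> \<noteq> \<rho>" for \<sigma>
    proof (cases "\<sigma> 1 = 1")
      case True
      have "\<sigma> y = \<rho> y" for y
      proof (cases "y \<in> {1..n}")
        case yn: True
        have "\<sigma> y = i \<longleftrightarrow> \<rho> y = i" if "2 \<le> i" for i
          using s yn that unfolding agree_def by blast
        then have "\<sigma> y \<ge> 2 \<or> \<rho> y \<ge> 2 \<Longrightarrow> \<sigma> y = \<rho> y" by metis
        moreover have "\<sigma> y = 1 \<Longrightarrow> y = 1" "\<rho> y = 1 \<Longrightarrow> y = 1"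
          using TB_uniq[of \<sigma> 1 y 1] TB_uniq[of \<rho> 1 y 1] s \<rho> True yn r rn by simp_all
        ultimately show ?thesis using True \<rho>(2) by (cases "\<sigma> y \<ge> 2 \<or> \<rho> y \<ge> 2") (auto simp: not_le less_2_cases_iff)
      next
        case False
        then show ?thesis using s \<rho> by (auto simp: TB_def extensional_def PiE_def)
      qed
      then show ?thesis using s(2) by blast
    next
      case False
      have "\<sigma> 1 = \<sigma> 1 \<longleftrightarrow> \<rho> 1 = \<sigma> 1" if "2 \<le> \<sigma> 1"
      proof -
        have "1 \<in> {1..n}" using rn by simp
        then show ?thesis using s(1) that unfolding agree_def by blast
      qed
      then have "\<not> 2 \<le> \<sigma> 1" using \<rho>(2) by auto
      then have "\<sigma> 1 = 0" using False by linarith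
      then show ?thesis using base s by simp
    qed
    have "(\<Sum>\<sigma>\<in>{\<sigma> \<in> TB. agree \<sigma> \<rho>}. Poly_Mapping.lookup x \<sigma>) = Poly_Mapping.lookup x \<rho>"
    proof -
      have m: "\<rho> \<in> {\<sigma> \<in> TB. agree \<sigma> \<rho>}" using \<rho> by (simp add: agree_def)
      have "(\<Sum>\<sigma>\<in>{\<sigma> \<in> TB. agree \<sigma> \<rho>}. Poly_Mapping.lookup x \<sigma>) = (\<Sum>\<sigma>\<in>{\<rho>}. Poly_Mapping.lookup x \<sigma>)"
        by (rule sum.mono_neutral_right) (use m others finite_TB in auto)
      then show ?thesis by simp
    qed
    then show ?thesis using V_zero_sum[OF r x, of \<rho>] by simp
  qed
  show "x = 0"
  proof (rule poly_mapping_eqI)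
    fix \<rho>
    show "Poly_Mapping.lookup x \<rho> = Poly_Mapping.lookup 0 \<rho>"
    proof (cases "\<rho> \<in> TB")
      case T: True
      have ext: "\<rho> \<in> extensional {1..n}" using T by (auto simp: TB_def PiE_def)
      have "\<rho> 1 \<le> r" using TB_le[OF T, of 1] rn by simp
      then consider "\<rho> 1 = 0" | "\<rho> 1 = 1" | "2 \<le> \<rho> 1" "\<rho> 1 \<le> r" by linarith
      then show ?thesis
      proof cases
        case 3
        have in1: "1 \<in> {1..n}" using rn by simp
        \<comment> \<open>Exchanging row 1 with the leg row that contains the entry 1 leads back to
          the case of 1 in row 1.\<close>
        have "rswap 1 (\<rho> 1) \<rho> \<in> TB"
        proof -
          have "\<exists>!y. y \<in> {1..n} \<and> rswap 1 (\<rho> 1) \<rho> y = i" if i: "i \<in> {1..r}" for i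
          proof -
            have "transpose 1 (\<rho> 1) i \<in> {1..r}" using 3 i by (auto simp: transpose_def)
            then have "\<exists>!y. y \<in> {1..n} \<and> \<rho> y = transpose 1 (\<rho> 1) i" using T by (auto simp: TB_def)
            moreover have "transpose 1 (\<rho> 1) z = i \<longleftrightarrow> z = transpose 1 (\<rho> 1) i" for z by (metis transpose_involutory)
            ultimately show ?thesis by (simp add: rswap_def cong: conj_cong)
          qed
          moreover have "rswap 1 (\<rho> 1) \<rho> \<in> {1..n} \<rightarrow>\<^sub>E {..r}"
            using T 3 by (auto simp: TB_def rswap_def transpose_def PiE_def Pi_def)
          ultimately show ?thesis by (simp add: TB_def)
        qed
        moreover have "rswap 1 (\<rho> 1) \<rho> 1 = 1" using in1 by (simp add: rswap_def)
        ultimately have "Poly_Mapping.lookup x (rswap 1 (\<rho> 1) \<rho>) = 0" by (rule one)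
        then show ?thesis using V_alternating[of 1 "\<rho> 1", OF _ _ _ x ext] 3 by simp
      qed (use T base one in auto)
    qed (use V_support[OF x] in simp)
  qed
qed

lemma ptab_inj: "inj_on ptab (hooks n r)"
  by (rule inj_onI) (metis lookup_ptab_stab zero_neq_one)

lemma ptab_comb_lookup:
  assumes "B \<in> hooks n r"
  shows "Poly_Mapping.lookup (\<Sum>v\<in>ptab ` hooks n r. tabloid_scale (g v) v) (stab B) = g (ptab B)"
proof -
  have "(\<Sum>v\<in>ptab ` hooks n r. tabloid_scale (g v) v) = (\<Sum>A\<in>hooks n r. tabloid_scale (g (ptab A)) (ptab A))"
    by (rule sum.reindex_cong[OF ptab_inj]) auto
  then have "Poly_Mapping.lookup (\<Sum>v\<in>ptab ` hooks n r. tabloid_scale (g v) v) (stab B) =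
     (\<Sum>A\<in>hooks n r. if A = B then g (ptab B) else 0)"
    using lookup_ptab_stab[OF _ assms] by (auto simp: lookup_sum intro!: sum.cong)
  then show ?thesis using assms finite_hooks by (simp add: sum.delta)
qed

lemma ptab_basis:
  "finite (ptab ` hooks n r)" "tabloid.independent (ptab ` hooks n r)" "tabloid.span (ptab ` hooks n r) = V"
proof -
  show f: "finite (ptab ` hooks n r)" using finite_hooks by simp
  show "tabloid.independent (ptab ` hooks n r)"
  proof (rule tabloid.independent_if_scalars_zero[OF f])
    fix g v assume z: "(\<Sum>v\<in>ptab ` hooks n r. tabloid_scale (g v) v) = 0" and v: "v \<in> ptab ` hooks n r"
    then obtain B where "B \<in> hooks n r" "v = ptab B" by auto
    then show "g v = 0" using ptab_comb_lookup[of B g] z by simp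
  qed
  show "tabloid.span (ptab ` hooks n r) = V"
  proof
    show "tabloid.span (ptab ` hooks n r) \<subseteq> V"
      using ptab_V unfolding specht_module_def by (intro tabloid.span_minimal) auto
    show "V \<subseteq> tabloid.span (ptab ` hooks n r)"
    proof
      fix x assume x: "x \<in> V"
      define g where "g v = Poly_Mapping.lookup x (stab (inv_into (hooks n r) ptab v))" for v
      define y where "y = (\<Sum>v\<in>ptab ` hooks n r. tabloid_scale (g v) v)"
      have ysp: "y \<in> tabloid.span (ptab ` hooks n r)"
        unfolding y_def by (intro tabloid.span_sum tabloid.span_scale tabloid.span_base)
      then have yV: "y \<in> V" using \<open>tabloid.span (ptab ` hooks n r) \<subseteq> V\<close> by blast
      have "x - y = 0"
      proof (rule V_zero)
        show "x - y \<in> V" using x yV unfolding specht_module_def by (rule tabloid.span_diff)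
        fix A assume A: "A \<in> hooks n r"
        have "g (ptab A) = Poly_Mapping.lookup x (stab A)"
          using inv_into_f_f[OF ptab_inj A] by (simp add: g_def)
        then show "Poly_Mapping.lookup (x - y) (stab A) = 0"
          using ptab_comb_lookup[OF A, of g] by (simp add: lookup_minus y_def)
      qed
      then show "x \<in> tabloid.span (ptab ` hooks n r)" using ysp by simp
    qed
  qed
qed

lemma representation_ptab:
  assumes x: "x \<in> V" and A: "A \<in> hooks n r"
  shows "tabloid.representation (ptab ` hooks n r) x (ptab A) = Poly_Mapping.lookup x (stab A)"
proof -
  have "(\<Sum>v\<in>ptab ` hooks n r. tabloid_scale (tabloid.representation (ptab ` hooks n r) x v) v) = x"
    by (rule tabloid.sum_representation_eq[OF ptab_basis(2) _ ptab_basis(1)]) (use x ptab_basis(3) in auto)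
  then show ?thesis using ptab_comb_lookup[OF A, of "tabloid.representation (ptab ` hooks n r) x"] by simp
qed

lemma sym_char_basis:
  assumes w: "w \<in> perms n"
  shows "sym_char n (hook_shape n r) w = basis_trace (ptab ` hooks n r) (tabloid_act w)"
  unfolding sym_char_def
  by (rule trace_on_basis[OF ptab_basis])
     (use specht_invariant[OF w] tabloid_act_add[OF perms_bij[OF w]] tabloid_act_scale[OF perms_bij[OF w]] in auto)

text \<open>The coordinates in the polytabloid basis are the coefficients at the tabloids
  \<open>stab A\<close>, so the diagonal entries are those given by
  \<open>lookup_ptab\<close>.\<close>

lemma sym_char_hook:
  assumes w: "w \<in> perms n"
  shows "sym_char n (hook_shape n r) w =
    (\<Sum>A\<in>hooks n r. \<Sum>\<tau> | \<tau> permutes insert 1 A \<and> (\<forall>a\<in>A. \<tau> a = iperm w a). of_int (sign \<tau>))"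
proof -
  have "sym_char n (hook_shape n r) w =
     (\<Sum>A\<in>hooks n r. tabloid.representation (ptab ` hooks n r) (tabloid_act w (ptab A)) (ptab A))"
    unfolding sym_char_basis[OF w] basis_trace_def by (rule sum.reindex_cong[OF ptab_inj]) auto
  also have "\<dots> = (\<Sum>A\<in>hooks n r. Poly_Mapping.lookup (ptab A) (stab A \<circ> w))"
    using representation_ptab specht_invariant[OF w ptab_V] lookup_tabloid_act[OF perms_bij[OF w]]
    by (intro sum.cong refl) simp
  also have "\<dots> = (\<Sum>A\<in>hooks n r. \<Sum>\<tau> | \<tau> permutes insert 1 A \<and> (\<forall>a\<in>A. \<tau> a = iperm w a). of_int (sign \<tau>))"
    using lookup_ptab[OF _ w] by (intro sum.cong refl) simp
  finally show ?thesis .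
qed

lemma sym_char_commute:
  assumes v: "v \<in> perms n" and w: "w \<in> perms n"
  shows "sym_char n (hook_shape n r) (v \<circ> w) = sym_char n (hook_shape n r) (w \<circ> v)"
proof -
  have vw: "v \<circ> w \<in> perms n" "w \<circ> v \<in> perms n" using v w permutes_compose by auto
  have "basis_trace (ptab ` hooks n r) (\<lambda>x. tabloid_act v (tabloid_act w x)) =
    basis_trace (ptab ` hooks n r) (\<lambda>x. tabloid_act w (tabloid_act v x))"
    by (rule basis_trace_commute[OF ptab_basis(1,2)])
       (use specht_invariant[OF v] specht_invariant[OF w] ptab_basis(3)
         tabloid_act_add[OF perms_bij[OF v]] tabloid_act_scale[OF perms_bij[OF v]]
         tabloid_act_add[OF perms_bij[OF w]] tabloid_act_scale[OF perms_bij[OF w]] in auto)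
  moreover have "tabloid_act (v \<circ> w) = (\<lambda>x. tabloid_act v (tabloid_act w x))"
    "tabloid_act (w \<circ> v) = (\<lambda>x. tabloid_act w (tabloid_act v x))"
    using tabloid_act_comp perms_bij[OF v] perms_bij[OF w] by auto
  ultimately show ?thesis by (simp add: sym_char_basis[OF vw(1)] sym_char_basis[OF vw(2)])
qed

end


section \<open>Hook characters at \<open>q = 1\<close> and Specht modules\<close>

text \<open>By \<open>sym_char_hook\<close>, \<open>spsum (iperm w) A\<close> is the diagonal matrix entry of \<open>w\<close> at the standard
  polytabloid with leg entries \<open>A\<close>.\<close>

definition spset :: "(nat \<Rightarrow> nat) \<Rightarrow> nat set \<Rightarrow> (nat \<Rightarrow> nat) set" where
  "spset u A = {\<tau>. \<tau> permutes insert 1 A \<and> (\<forall>a\<in>A. \<tau> a = u a)}"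

definition spsum :: "(nat \<Rightarrow> nat) \<Rightarrow> nat set \<Rightarrow> int" where
  "spsum u A = (\<Sum>\<tau>\<in>spset u A. sign \<tau>)"

lemma spsum_cong: "(\<And>a. a \<in> A \<Longrightarrow> u a = v a) \<Longrightarrow> spsum u A = spsum v A"
  unfolding spsum_def spset_def by (intro sum.cong) auto

lemma spsum_fix:
  assumes "u k = k" "k \<notin> insert 1 A"
  shows "spsum u (insert k A) = spsum u A"
proof -
  have "spset u (insert k A) = spset u A"
  proof (intro equalityI subsetI)
    fix \<tau> assume t: "\<tau> \<in> spset u (insert k A)"
    then have p: "\<tau> permutes insert 1 (insert k A)" and k: "\<tau> k = k" using assms by (simp_all add: spset_def)
    have "\<tau> permutes insert 1 A" by (rule permutes_superset[OF p]) (use k in blast)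
    then show "\<tau> \<in> spset u A" using t by (simp add: spset_def)
  next
    fix \<tau> assume t: "\<tau> \<in> spset u A"
    then have p: "\<tau> permutes insert 1 A" by (simp add: spset_def)
    have "\<tau> permutes insert 1 (insert k A)" by (rule permutes_subset[OF p]) blast
    moreover have "\<tau> k = k" by (rule permutes_not_in[OF p assms(2)])
    ultimately show "\<tau> \<in> spset u (insert k A)" using t assms(1) by (simp add: spset_def)
  qed
  then show ?thesis by (simp add: spsum_def)
qed

lemma spsum_zero:
  assumes "a \<in> A" "u a \<notin> insert 1 A"
  shows "spsum u A = 0"
proof -
  have "\<not> (\<tau> permutes insert 1 A \<and> (\<forall>a\<in>A. \<tau> a = u a))" for \<tau>
    using assms permutes_in_image[of \<tau> "insert 1 A" a] by (metis insertCI)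
  then have "spset u A = {}" unfolding spset_def by blast
  then show ?thesis by (simp add: spsum_def)
qed

lemma spsum_swap:
  assumes u: "u k = k" and k: "k \<notin> insert 1 A" and j: "j \<in> insert 1 A" and fin: "finite A"
  shows "spsum (transpose j k \<circ> u) (insert k A) = - spsum u A"
proof -
  let ?t = "transpose j k"
  have jk: "j \<noteq> k" using j k by blast
  have tp: "?t permutes insert 1 (insert k A)" using j by (intro permutes_swap_id) auto
  have mem: "?t \<circ> \<tau> \<in> spset (?t \<circ> u) (insert k A) \<longleftrightarrow> \<tau> \<in> spset u (insert k A)" for \<tau> u
  proof -
    have "?t \<circ> \<tau> permutes insert 1 (insert k A) \<longleftrightarrow> \<tau> permutes insert 1 (insert k A)"
      using permutes_compose[OF _ tp, of \<tau>] permutes_compose[OF _ tp, of "?t \<circ> \<tau>"] by (auto simp: comp_assoc[symmetric])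
    then show ?thesis unfolding spset_def by (simp add: inj_eq)
  qed
  have "spsum (?t \<circ> u) (insert k A) = (\<Sum>\<tau>\<in>spset u (insert k A). sign (?t \<circ> \<tau>))"
    unfolding spsum_def
    by (rule sum.reindex_bij_witness[of _ "\<lambda>\<tau>. ?t \<circ> \<tau>" "\<lambda>\<tau>. ?t \<circ> \<tau>"])
       (use mem mem[where u = "?t \<circ> u"] in \<open>auto simp: comp_assoc[symmetric]\<close>)
  also have "\<dots> = (\<Sum>\<tau>\<in>spset u (insert k A). - sign \<tau>)"
  proof (rule sum.cong[OF refl])
    fix \<tau> assume "\<tau> \<in> spset u (insert k A)"
    then have "permutation \<tau>"
      using fin by (auto simp: spset_def intro!: permutes_imp_permutation[of "insert 1 (insert k A)"])
    then show "sign (?t \<circ> \<tau>) = - sign \<tau>"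
      using jk by (simp add: sign_compose permutation_swap_id sign_swap_id)
  qed
  finally show ?thesis using spsum_fix[of u k A, OF u k] by (simp add: spsum_def sum_negf)
qed

text \<open>The inverse of the increasing product over the letters of \<open>I\<close> up to
  \<open>m\<close> (\<open>usub_word\<close>). The inverse is taken because the character formula
  involves \<open>iperm w\<close>.\<close>

primrec usub :: "nat set \<Rightarrow> nat \<Rightarrow> nat \<Rightarrow> nat" where
  "usub I 0 = id"
| "usub I (Suc m) = (if Suc m \<in> I then adj (Suc m) \<circ> usub I m else usub I m)"

text \<open>The smallest letter of the maximal block of consecutive elements of \<open>I\<close> ending in \<open>m\<close>
  (\<open>Suc m\<close> if \<open>m \<notin> I\<close>); it is where \<open>usub I m\<close> takes its largest value \<open>Suc m\<close>.\<close>

primrec bstart :: "nat set \<Rightarrow> nat \<Rightarrow> nat" where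
  "bstart I 0 = 1"
| "bstart I (Suc m) = (if Suc m \<in> I then bstart I m else Suc (Suc m))"

lemma usub_word: "usub I m = iperm (perm_of_word (subword I (Suc m)))"
proof (induction m)
  case 0
  then show ?case by simp
next
  case (Suc m)
  show ?case
  proof (cases "Suc m \<in> I")
    case True
    then have "subword I (Suc (Suc m)) = subword I (Suc m) @ [Suc m]" by simp
    then show ?thesis using Suc True by (simp add: perm_of_word_inv perm_of_word_Cons)
  next
    case False
    then have "subword I (Suc (Suc m)) = subword I (Suc m)" by simp
    then show ?thesis using Suc False by simp
  qed
qed

lemma usub_perms: "usub I m \<in> perms (Suc m)"
  unfolding usub_word by (rule iperm_perms[OF perm_of_word_perms[OF subword_words]])

lemma usub_fix: "Suc m < k \<Longrightarrow> usub I m k = k"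
  using permutes_not_in[of "usub I m" "{1..Suc m}" k] usub_perms[of I m] by simp

lemma usub_bstart: "usub I m x = Suc m \<longleftrightarrow> x = bstart I m"
proof -
  have "usub I m (bstart I m) = Suc m"
  proof (induction m)
    case (Suc m)
    then show ?case using usub_fix[of m "Suc (Suc m)" I] by simp
  qed simp
  then show ?thesis using inj_eq[OF perms_inj[OF usub_perms[of I m]], of x "bstart I m"] by simp
qed

abbreviation spc :: "nat set \<Rightarrow> nat \<Rightarrow> nat set \<Rightarrow> int" where
  "spc I m A \<equiv> spsum (usub I m) A"

lemma spc_out: "Suc m \<notin> I \<Longrightarrow> spc I (Suc m) A = spc I m A"
  by simp

lemma spc_out_insert:
  "Suc m \<notin> I \<Longrightarrow> A \<subseteq> {2..Suc m} \<Longrightarrow> spc I (Suc m) (insert (Suc (Suc m)) A) = spc I m A"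
  using spsum_fix[of "usub I m" "Suc (Suc m)" A] usub_fix[of m "Suc (Suc m)" I] by force

lemma spc_in:
  assumes I: "Suc m \<in> I" and A: "A \<subseteq> {2..Suc m}"
  shows "spc I (Suc m) A = (if bstart I m \<in> A then 0 else spc I m A)"
proof (cases "bstart I m \<in> A")
  case True
  have "usub I (Suc m) (bstart I m) = Suc (Suc m)" using usub_bstart[of I "Suc m" "bstart I m"] I by simp
  moreover have "Suc (Suc m) \<notin> insert 1 A" using A by auto
  ultimately show ?thesis using spsum_zero[OF True, of "usub I (Suc m)"] True by simp
next
  case False
  have "usub I (Suc m) a = usub I m a" if a: "a \<in> A" for a
  proof -
    have "usub I m a \<noteq> Suc m" using usub_bstart False a by metis
    moreover have "usub I m a \<noteq> Suc (Suc m)" using perms_bounds[OF usub_perms[of I m], of a] a A by auto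
    ultimately show ?thesis using I by simp
  qed
  then show ?thesis using False spsum_cong by metis
qed

lemma spc_in_insert:
  assumes I: "Suc m \<in> I" and A: "A \<subseteq> {2..Suc m}"
  shows "spc I (Suc m) (insert (Suc (Suc m)) A) = (if Suc m \<in> insert 1 A then - spc I m A else 0)"
proof (cases "Suc m \<in> insert 1 A")
  case True
  have "finite A" using A finite_subset by blast
  moreover have "Suc (Suc m) \<notin> insert 1 A" using A by auto
  ultimately show ?thesis
    using spsum_swap[of "usub I m" "Suc (Suc m)" A "Suc m"] True I usub_fix[of m "Suc (Suc m)" I] by simp
next
  case False
  have "usub I (Suc m) (Suc (Suc m)) = Suc m" using I usub_fix[of m "Suc (Suc m)" I] by simp
  moreover have "Suc m \<notin> insert 1 (insert (Suc (Suc m)) A)" using False by simp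
  ultimately show ?thesis
    using spsum_zero[of "Suc (Suc m)" "insert (Suc (Suc m)) A" "usub I (Suc m)"] False by simp
qed

text \<open>The last block is a single cycle of \<open>usub I m\<close>. A permutation of
  \<open>insert 1 A\<close> that agrees with it on \<open>A\<close> can exist only if
  \<open>A\<close> contains all or none of a cycle avoiding 1, so both ends of the block behave
  alike.\<close>

lemma spc_block:
  "A \<subseteq> {2..Suc m} \<Longrightarrow> spc I m A \<noteq> 0 \<Longrightarrow> bstart I m \<noteq> 1 \<Longrightarrow> bstart I m \<in> A \<longleftrightarrow> Suc m \<in> A"
proof (induction m arbitrary: A)
  case (Suc m)
  show ?case
  proof (cases "Suc m \<in> I")
    case True
    show ?thesis
    proof (cases "Suc (Suc m) \<in> A")
      case False
      then have "A \<subseteq> {2..Suc m}" using Suc.prems(1) by (force simp: le_Suc_eq)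
      then show ?thesis using spc_in[OF True, of A] Suc.prems(2) False True by (auto split: if_splits simp del: usub.simps)
    next
      case mem: True
      define B where "B = A - {Suc (Suc m)}"
      have A: "A = insert (Suc (Suc m)) B" using mem by (auto simp: B_def)
      have B: "B \<subseteq> {2..Suc m}" using Suc.prems(1) by (force simp: B_def le_Suc_eq)
      have nz: "Suc m \<in> insert 1 B" "spc I m B \<noteq> 0"
        using spc_in_insert[OF True B] Suc.prems(2) unfolding A by (auto split: if_splits simp del: usub.simps)
      have bs: "bstart I m \<noteq> 1" using Suc.prems(3) True by simp
      then have "m \<noteq> 0" by (cases m) auto
      then have "Suc m \<in> B" using nz by simp
      then show ?thesis using Suc.IH[OF B nz(2) bs] True A by simp
    qed
  qed simp
qed simp

definition SP :: "nat set \<Rightarrow> nat \<Rightarrow> int poly" where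
  "SP I m = (\<Sum>A\<in>Pow {2..Suc m}. monom (spc I m A) (card A))"

text \<open>The part where the end \<open>Suc m\<close> of the last block is a leg entry or the
  corner entry 1; these are the terms that matter when the block grows.\<close>

definition FP :: "nat set \<Rightarrow> nat \<Rightarrow> int poly" where
  "FP I m = (\<Sum>A\<in>Pow {2..Suc m}. if Suc m \<in> insert 1 A then monom (spc I m A) (card A) else 0)"

lemma pCons_0_sum: "pCons 0 (\<Sum>a\<in>S. f a) = (\<Sum>a\<in>S. pCons 0 (f a :: 'a::comm_ring_1 poly))"
proof -
  have "pCons 0 (\<Sum>a\<in>S. f a) = [:0, 1:] * (\<Sum>a\<in>S. f a)" by simp
  also have "\<dots> = (\<Sum>a\<in>S. [:0, 1:] * f a)" by (rule sum_distrib_left)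
  finally show ?thesis by simp
qed

lemma card_insert_top: "A \<in> Pow {2..Suc m} \<Longrightarrow> card (insert (Suc (Suc m)) A) = Suc (card A)"
  using finite_subset[of A "{2..Suc m}"] by (subst card_insert_disjoint) auto

lemma SP_out: "Suc m \<notin> I \<Longrightarrow> SP I (Suc m) = SP I m + pCons 0 (SP I m)"
proof -
  assume I: "Suc m \<notin> I"
  have "SP I (Suc m) = (\<Sum>A\<in>Pow {2..Suc m}. monom (spc I (Suc m) A) (card A)) +
     (\<Sum>A\<in>Pow {2..Suc m}. monom (spc I (Suc m) (insert (Suc (Suc m)) A)) (card (insert (Suc (Suc m)) A)))"
    unfolding SP_def by (rule Pow_Suc_split) simp
  moreover have "monom (spc I (Suc m) (insert (Suc (Suc m)) A)) (card (insert (Suc (Suc m)) A)) = pCons 0 (monom (spc I m A) (card A))"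
    if "A \<in> Pow {2..Suc m}" for A
    using spc_out_insert[OF I, of A] card_insert_top[OF that] that by (simp add: monom_Suc del: usub.simps)
  ultimately show ?thesis by (simp add: SP_def spc_out[OF I] pCons_0_sum del: usub.simps)
qed

lemma FP_out: "Suc m \<notin> I \<Longrightarrow> FP I (Suc m) = pCons 0 (SP I m)"
proof -
  assume I: "Suc m \<notin> I"
  have "(\<Sum>A\<in>Pow {2..Suc m}. if Suc (Suc m) \<in> insert 1 A then monom (spc I (Suc m) A) (card A) else 0) = 0"
    by (rule sum.neutral) auto
  then show ?thesis
    unfolding SP_def FP_def Pow_Suc_split[of "Suc m", simplified] pCons_0_sum
    by (simp add: spc_out_insert[OF I] card_insert_top monom_Suc del: usub.simps)
qed

lemma FP_in: "Suc m \<in> I \<Longrightarrow> FP I (Suc m) = - pCons 0 (FP I m)"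
proof -
  assume I: "Suc m \<in> I"
  have "(\<Sum>A\<in>Pow {2..Suc m}. if Suc (Suc m) \<in> insert 1 A then monom (spc I (Suc m) A) (card A) else 0) = 0"
    by (rule sum.neutral) auto
  moreover have "(\<Sum>A\<in>Pow {2..Suc m}. monom (spc I (Suc m) (insert (Suc (Suc m)) A)) (card (insert (Suc (Suc m)) A))) =
     (\<Sum>A\<in>Pow {2..Suc m}. - pCons 0 (if Suc m \<in> insert 1 A then monom (spc I m A) (card A) else 0))"
  proof (rule sum.cong[OF refl])
    fix A assume "A \<in> Pow {2..Suc m}"
    then show "monom (spc I (Suc m) (insert (Suc (Suc m)) A)) (card (insert (Suc (Suc m)) A)) =
       - pCons 0 (if Suc m \<in> insert 1 A then monom (spc I m A) (card A) else 0)"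
      using spc_in_insert[OF I, of A] card_insert_top[of A m] by (simp add: monom_Suc minus_monom[symmetric] del: usub.simps)
  qed
  ultimately show ?thesis
    unfolding FP_def Pow_Suc_split[of "Suc m", simplified] pCons_0_sum sum_negf by (simp del: usub.simps)
qed

lemma SP_in:
  assumes I: "Suc m \<in> I"
  shows "SP I (Suc m) = SP I m - (if bstart I m = 1 then 0 else FP I m) - pCons 0 (FP I m)"
proof -
  have 1: "(\<Sum>A\<in>Pow {2..Suc m}. monom (spc I (Suc m) (insert (Suc (Suc m)) A)) (card (insert (Suc (Suc m)) A))) =
     FP I (Suc m)"
    unfolding FP_def Pow_Suc_split[of "Suc m", simplified]
    by (subst sum.neutral[of "Pow {2..Suc m}"]) (auto simp del: usub.simps)
  have 2: "(\<Sum>A\<in>Pow {2..Suc m}. monom (spc I (Suc m) A) (card A)) = SP I m - (if bstart I m = 1 then 0 else FP I m)"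
  proof (cases "bstart I m = 1")
    case True
    have "monom (spc I (Suc m) A) (card A) = monom (spc I m A) (card A)" if "A \<in> Pow {2..Suc m}" for A
      using spc_in[OF I, of A] that True by (force simp del: usub.simps)
    then show ?thesis using True by (simp add: SP_def del: usub.simps)
  next
    case False
    then have m: "Suc m \<noteq> 1" by (cases m) auto
    have "monom (spc I (Suc m) A) (card A) = monom (spc I m A) (card A) - (if Suc m \<in> insert 1 A then monom (spc I m A) (card A) else 0)"
      if A: "A \<in> Pow {2..Suc m}" for A
    proof (cases "spc I m A = 0")
      case True
      then have "spc I (Suc m) A = 0" using spc_in[OF I, of A] A by (simp only: Pow_iff if_cancel)
      then show ?thesis using True by (simp del: usub.simps)
    next
      case nz: False
      then have "bstart I m \<in> A \<longleftrightarrow> Suc m \<in> A" using spc_block[of A m I] A False by simp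
      then show ?thesis using spc_in[OF I, of A] A m by (simp del: usub.simps)
    qed
    then have "(\<Sum>A\<in>Pow {2..Suc m}. monom (spc I (Suc m) A) (card A)) = SP I m - FP I m"
      unfolding SP_def FP_def sum_subtractf[symmetric] by (intro sum.cong refl) blast
    then show ?thesis using False by simp
  qed
  have "SP I (Suc m) = (\<Sum>A\<in>Pow {2..Suc m}. monom (spc I (Suc m) A) (card A)) +
     (\<Sum>A\<in>Pow {2..Suc m}. monom (spc I (Suc m) (insert (Suc (Suc m)) A)) (card (insert (Suc (Suc m)) A)))"
    unfolding SP_def[of I "Suc m"] by (rule Pow_Suc_split) simp
  then show ?thesis unfolding 1 2 FP_in[OF I] by simp
qed

text \<open>The generating function of the Specht characters satisfies the recursion of
  \<open>se\<close> at q = 1. The correction term depends on whether the last block contains 1,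
  because 1 never belongs to \<open>A\<close>.\<close>

lemma se_SP:
  "fst (se (1::int) I m) = SP I m \<and>
   snd (se (1::int) I m) = - (if bstart I m = 1 then 0 else FP I m) - pCons 0 (FP I m)"
proof (induction m)
  case 0
  have "{\<tau>. \<tau> permutes {1::nat}} = {id}" by (auto simp: permutes_sing)
  then have "spset id {} = {id}" by (simp add: spset_def)
  then show ?case by (simp add: SP_def FP_def spsum_def sign_id one_pCons[symmetric])
next
  case (Suc m)
  show ?case
  proof (cases "Suc m \<in> I")
    case True
    then show ?thesis using Suc SP_in[OF True] FP_in[OF True] by (simp add: Let_def)
  next
    case False
    then show ?thesis using Suc SP_out[OF False] FP_out[OF False] by (simp add: Let_def)
  qed
qed

context hook
begin

lemma sym_char_subword:
  "sym_char n (hook_shape n r) (perm_of_word (subword I n)) = of_int (coeff (fst (se (1::int) I (n - 1))) r)"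
proof -
  have n: "Suc (n - 1) = n" using rn by simp
  have "coeff (SP I (n - 1)) r = (\<Sum>A\<in>Pow {2..n}. if card A = r then spc I (n - 1) A else 0)"
    unfolding SP_def n coeff_sum coeff_monom ..
  also have "\<dots> = (\<Sum>A\<in>{A \<in> Pow {2..n}. card A = r}. spc I (n - 1) A)"
    by (rule sum.inter_filter[symmetric]) simp
  also have "{A \<in> Pow {2..n}. card A = r} = hooks n r" by (auto simp: hooks_def)
  finally have c: "coeff (SP I (n - 1)) r = (\<Sum>A\<in>hooks n r. spc I (n - 1) A)" .
  have "sym_char n (hook_shape n r) (perm_of_word (subword I n)) = (\<Sum>A\<in>hooks n r. of_int (spc I (n - 1) A))"
    unfolding sym_char_hook[OF perm_of_word_perms[OF subword_words]] spsum_def spset_def usub_word n of_int_sum ..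
  then show ?thesis using c by (simp add: se_SP)
qed

text \<open>At q = 1 both sides are traces of the group algebra. Their difference is determined by
  its values on increasing products, where both are coefficients of \<open>se\<close>.\<close>

lemma eval_hook_char_word:
  assumes u: "u \<in> words n"
  shows "of_int (eval_one (hook_char n r (hecke_class n (mon u)))) = sym_char n (hook_shape n r) (perm_of_word u)"
proof -
  interpret er: laurent_hom "\<lambda>r. rat_of_int (eval_one r)"
    by unfold_locales (simp_all add: eval_one_add eval_one_mult eval_one_1)
  let ?h = "\<lambda>u. hook_char n r (hecke_class n (mon u))"
  let ?s = "\<lambda>u. sym_char n (hook_shape n r) (perm_of_word u)"
  let ?p = "\<lambda>u. rat_of_int (eval_one (?h u)) - ?s u"
  have n: "1 \<le> n" using rn by simp
  have M: "er.submod {0}" by (simp add: er.submod_def)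
  have fh: "frac (?h u) = sn.htrace n r u" if "u \<in> words n" for u
    using frac_hook_char[OF n free_sub_mon[OF that]] by (simp add: sn.htr_mon)
  have h1: "?h (u @ [i, i] @ v) = (qvar - 1) * ?h (u @ [i] @ v) + qvar * ?h (u @ v)"
    if "u \<in> words n" "v \<in> words n" "i \<in> {1..<n}" for u v i
  proof -
    have "u @ [i, i] @ v \<in> words n" "u @ [i] @ v \<in> words n" "u @ v \<in> words n" using that by auto
    then have "frac (?h (u @ [i, i] @ v)) = frac ((qvar - 1) * ?h (u @ [i] @ v) + qvar * ?h (u @ v))"
      using sn.compat_quad[OF sn.htrace_compat[of n n r] that] by (simp only: fh sn.hom_add sn.hom_mult) simp
    then show ?thesis by (simp only: frac_eq_iff)
  qed
  have h2: "?h (u @ [i, Suc i, i] @ v) = ?h (u @ [Suc i, i, Suc i] @ v)"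
    if "u \<in> words n" "v \<in> words n" "1 \<le> i" "Suc i < n" for u v i
  proof -
    have "u @ [i, Suc i, i] @ v \<in> words n" "u @ [Suc i, i, Suc i] @ v \<in> words n" using that by auto
    then have "frac (?h (u @ [i, Suc i, i] @ v)) = frac (?h (u @ [Suc i, i, Suc i] @ v))"
      using sn.compat_braid[OF sn.htrace_compat[of n n r] that] by (simp only: fh) simp
    then show ?thesis by (simp only: frac_eq_iff)
  qed
  have h3: "?h (u @ [i, j] @ v) = ?h (u @ [j, i] @ v)"
    if "u \<in> words n" "v \<in> words n" "i \<in> {1..<n}" "j \<in> {1..<n}" "Suc i < j" for u v i j
  proof -
    have "u @ [i, j] @ v \<in> words n" "u @ [j, i] @ v \<in> words n" using that by auto
    then have "frac (?h (u @ [i, j] @ v)) = frac (?h (u @ [j, i] @ v))"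
      using sn.compat_comm[OF sn.submod_zero sn.htrace_compat[of n n r] that(1-4)] that(5) by (simp only: fh) simp
    then show ?thesis by (simp only: frac_eq_iff)
  qed
  have ht: "?h (u @ v) = ?h (v @ u)" if "u \<in> words n" "v \<in> words n" for u v
  proof -
    have "u @ v \<in> words n" "v @ u \<in> words n" using that by auto
    then have "frac (?h (u @ v)) = frac (?h (v @ u))" using sn.htrace_commute[OF that, of r] by (simp only: fh)
    then show ?thesis by (simp only: frac_eq_iff)
  qed
  have c: "er.hecke_compat n ?p {0}"
  proof (rule er.hecke_compatI)
    fix u v i assume a: "u \<in> words n" "v \<in> words n" "i \<in> {1..<n}"
    have "?s (u @ [i, i] @ v) = ?s (u @ v)"
      by (simp add: perm_of_word_append perm_of_word_Cons comp_assoc[symmetric])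
    then show "?p (u @ [i, i] @ v) - (rat_of_int (eval_one (qvar - 1)) * ?p (u @ [i] @ v) + rat_of_int (eval_one qvar) * ?p (u @ v)) \<in> {0}"
      unfolding h1[OF a] by (simp add: eval_one_add eval_one_mult eval_one_qvar ev.hom_diff eval_one_1)
  next
    fix u v i assume a: "u \<in> words n" "v \<in> words n" "1 \<le> i" "Suc i < n"
    have "?s (u @ [i, Suc i, i] @ v) = ?s (u @ [Suc i, i, Suc i] @ v)"
      using adj_braid[of "perm_of_word u" i] by (simp add: perm_of_word_append perm_of_word_Cons comp_assoc[symmetric])
    then show "?p (u @ [i, Suc i, i] @ v) - ?p (u @ [Suc i, i, Suc i] @ v) \<in> {0}"
      unfolding h2[OF a] by simp
  next
    fix u v i j assume a: "u \<in> words n" "v \<in> words n" "1 \<le> i" "Suc i < j" "j < n"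
    then have ij: "i \<in> {1..<n}" "j \<in> {1..<n}" by auto
    have "?s (u @ [i, j] @ v) = ?s (u @ [j, i] @ v)"
      using adj_comm[OF a(4), of "perm_of_word u"] by (simp add: perm_of_word_append perm_of_word_Cons comp_assoc[symmetric])
    then show "?p (u @ [i, j] @ v) - ?p (u @ [j, i] @ v) \<in> {0}"
      unfolding h3[OF a(1,2) ij a(4)] by simp
  qed
  have "?p (u @ []) \<in> {0}"
  proof (rule er.trace_principle[OF M c _ n order_refl u])
    fix v y assume v: "v \<in> words n" "y \<in> words (n - 1)"
    then have y: "y \<in> words n" using words_mono diff_le_self by blast
    have "?s (v @ y) = ?s (y @ v)"
      unfolding perm_of_word_append by (rule sym_char_commute[OF perm_of_word_perms[OF v(1)] perm_of_word_perms[OF y]])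
    then show "?p (v @ y) - ?p (y @ v) \<in> {0}" using ht[OF v(1) y] by simp
  next
    fix I
    show "?p (subword I n @ []) \<in> {0}"
      using sym_char_subword[of I] eval_hook_char_subword[OF n, of r I] by simp
  qed simp
  then show ?thesis by simp
qed

lemma eval_hook_char:
  assumes v: "v \<in> perms n"
  shows "of_int (eval_one (hook_char n r (T_basis n v))) = sym_char n (hook_shape n r) v"
proof -
  obtain u where u: "reduced_word n v u" using ex_reduced_word[OF v] by blast
  then have "u \<in> words n" "perm_of_word u = v" by (auto simp: reduced_word_def)
  then show ?thesis using eval_hook_char_word[of u] T_basis_reduced[OF u] by simp
qed

end


section \<open>Identification of the hook characters by orthogonality\<close>

section \<open>Orthogonality of irreducible representations\<close>

text \<open>The second congruence is the first one under reversal of words; it is stated because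
  inverses of \<open>w\<close> occur in the orthogonality relation.\<close>

lemma T_right_ascent:
  assumes w: "w \<in> perms n" and i: "i \<in> {1..<n}" and a: "w i < w (Suc i)"
  shows "hcong n (mon (rword n w) * mon [i]) (mon (rword n (w \<circ> adj i)))"
    "hcong n (mon [i] * mon (rword n (iperm w))) (mon (rword n (iperm (w \<circ> adj i))))"
proof -
  have wi: "w \<circ> adj i \<in> perms n" by (rule comp_adj_perms[OF w i])
  have r: "reduced_word n (w \<circ> adj i) (rword n w @ [i])" by (rule reduced_word_snoc[OF rword[OF w] i a])
  have cong: "hcong n (mon u) (mon (rword n v))" if "reduced_word n v u" "v \<in> perms n" for u v
    using matsumoto[OF that(1) rword[OF that(2)]] .
  show "hcong n (mon (rword n w) * mon [i]) (mon (rword n (w \<circ> adj i)))"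
    using cong[OF r wi] by (simp only: mon_append)
  have "hcong n (mon [i] * mon (rev (rword n w))) (mon (rword n (iperm (w \<circ> adj i))))"
    using cong[OF reduced_word_rev[OF r] iperm_perms[OF wi]] by (simp add: mon_append[symmetric])
  moreover have "hcong n (mon [i] * mon (rev (rword n w))) (mon [i] * mon (rword n (iperm w)))"
    by (rule hcong_lmult[OF cong[OF reduced_word_rev[OF rword[OF w]] iperm_perms[OF w]]])
       (use i in \<open>auto intro: free_sub_mon\<close>)
  ultimately show "hcong n (mon [i] * mon (rword n (iperm w))) (mon (rword n (iperm (w \<circ> adj i))))"
    using hcong_trans hcong_sym by blast
qed

lemma T_right_descent:
  assumes w: "w \<in> perms n" and i: "i \<in> {1..<n}" and d: "w (Suc i) < w i"
  shows "hcong n (mon (rword n w) * mon [i])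
      (free_const (qvar - 1) * mon (rword n w) + free_const qvar * mon (rword n (w \<circ> adj i)))"
    "hcong n (mon [i] * mon (rword n (iperm w)))
      (free_const (qvar - 1) * mon (rword n (iperm w)) + free_const qvar * mon (rword n (iperm (w \<circ> adj i))))"
proof -
  let ?v = "w \<circ> adj i"
  have v: "?v \<in> perms n" by (rule comp_adj_perms[OF w i])
  have a: "?v i < ?v (Suc i)" using d by simp
  have vi: "?v \<circ> adj i = w" by simp
  note r = T_right_ascent[OF v i a, unfolded vi]
  have f: "mon (rword n u) \<in> free_sub n" if "u \<in> perms n" for u
    using that by (intro free_sub_mon rword_words)
  have fi: "mon [i] \<in> free_sub n" using i by (auto intro: free_sub_mon)
  have "hcong n (mon (rword n w) * mon [i]) (mon (rword n ?v) * mon [i] * mon [i])"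
    by (rule hcong_rmult[OF hcong_sym[OF r(1)] fi])
  also have "hcong n (mon (rword n ?v) * mon [i] * mon [i]) (mon (rword n ?v) * (free_const (qvar - 1) * mon [i] + free_const qvar))"
    unfolding mult.assoc by (rule hcong_lmult[OF quad_hcong[OF i] f[OF v]])
  also have "mon (rword n ?v) * (free_const (qvar - 1) * mon [i] + free_const qvar) =
      free_const (qvar - 1) * (mon (rword n ?v) * mon [i]) + free_const qvar * mon (rword n ?v)"
    using mult_free_const[of "mon (rword n ?v)" "qvar - 1" "mon [i]"] free_const_central[of qvar "mon (rword n ?v)"]
    by (simp add: distrib_left)
  also have "hcong n (free_const (qvar - 1) * (mon (rword n ?v) * mon [i]) + free_const qvar * mon (rword n ?v))
      (free_const (qvar - 1) * mon (rword n w) + free_const qvar * mon (rword n ?v))"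
    by (intro hcong_add hcong_refl hcong_lmult r free_sub_const)
  finally show "hcong n (mon (rword n w) * mon [i])
      (free_const (qvar - 1) * mon (rword n w) + free_const qvar * mon (rword n ?v))" .
  have "hcong n (mon [i] * mon (rword n (iperm w))) (mon [i] * (mon [i] * mon (rword n (iperm ?v))))"
    by (rule hcong_lmult[OF hcong_sym[OF r(2)] fi])
  also have "hcong n (mon [i] * (mon [i] * mon (rword n (iperm ?v))))
      ((free_const (qvar - 1) * mon [i] + free_const qvar) * mon (rword n (iperm ?v)))"
    unfolding mult.assoc[symmetric] by (rule hcong_rmult[OF quad_hcong[OF i] f[OF iperm_perms[OF v]]])
  also have "(free_const (qvar - 1) * mon [i] + free_const qvar) * mon (rword n (iperm ?v)) =
      free_const (qvar - 1) * (mon [i] * mon (rword n (iperm ?v))) + free_const qvar * mon (rword n (iperm ?v))"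
    by (simp add: distrib_right mult.assoc)
  also have "hcong n (free_const (qvar - 1) * (mon [i] * mon (rword n (iperm ?v))) + free_const qvar * mon (rword n (iperm ?v)))
      (free_const (qvar - 1) * mon (rword n (iperm w)) + free_const qvar * mon (rword n (iperm ?v)))"
    by (intro hcong_add hcong_refl hcong_lmult r free_sub_const)
  finally show "hcong n (mon [i] * mon (rword n (iperm w)))
      (free_const (qvar - 1) * mon (rword n (iperm w)) + free_const qvar * mon (rword n (iperm ?v)))" .
qed

text \<open>The values of a linear functional at T_w T_i in terms of its values \<open>a w\<close>
  at T_w, and likewise with T_i on the left for the inverse of \<open>w\<close>. It is dual to
  \<open>reg_op\<close>, which acts on coefficients.\<close>

definition right_mult :: "nat \<Rightarrow> ((nat \<Rightarrow> nat) \<Rightarrow> laurent fract) \<Rightarrow> (nat \<Rightarrow> nat) \<Rightarrow> laurent fract" where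
  "right_mult i a w = (if w i < w (Suc i) then a (w \<circ> adj i)
     else frac (qvar - 1) * a w + frac qvar * a (w \<circ> adj i))"

text \<open>The elements q^(-l(w)) T_v with v the inverse of w form the basis dual to the T_w under
  the symmetrizing trace of the Hecke algebra.\<close>

definition cweight :: "nat \<Rightarrow> (nat \<Rightarrow> nat) \<Rightarrow> laurent fract" where
  "cweight n w = frac (qhalf (- 2 * int (perm_len n w)))"

lemma cweight_ascent:
  assumes "i \<in> {1..<n}" "w i < w (Suc i)"
  shows "cweight n w = frac qvar * cweight n (w \<circ> adj i)"
proof -
  have "qvar * qhalf (- 2 * int (Suc (perm_len n w))) = qhalf (- 2 * int (perm_len n w))"
    by (simp add: qvar_def qhalf_mult)
  then have "frac (qvar * qhalf (- 2 * int (Suc (perm_len n w)))) = cweight n w"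
    by (simp only: cweight_def)
  then show ?thesis
    unfolding cweight_def perm_len_ascent[OF assms] sn.hom_mult by (rule sym)
qed

text \<open>The weight balances the coefficients 1 and q between \<open>w\<close> and
  \<open>w \<circ> adj i\<close>, so \<open>right_mult\<close> is self-adjoint for it. This replaces
  averaging over a group.\<close>

lemma right_mult_symmetric:
  assumes i: "i \<in> {1..<n}"
  shows "(\<Sum>w\<in>perms n. cweight n w * right_mult i a w * b w) = (\<Sum>w\<in>perms n. cweight n w * a w * right_mult i b w)"
proof -
  define e where "e w = (if w i < w (Suc i) then 1 else frac qvar)" for w :: "nat \<Rightarrow> nat"
  define g where "g w = (if w i < w (Suc i) then 0 else frac (qvar - 1))" for w :: "nat \<Rightarrow> nat"
  have rm: "right_mult i a w = e w * a (w \<circ> adj i) + g w * a w" for a w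
    by (simp add: right_mult_def e_def g_def)
  have ce: "cweight n (w \<circ> adj i) * e (w \<circ> adj i) = cweight n w * e w" if "w \<in> perms n" for w
  proof (cases "w i < w (Suc i)")
    case True
    then show ?thesis using cweight_ascent[OF i True] by (simp add: e_def mult.commute)
  next
    case False
    then have "w (Suc i) < w i" using perms_inj[OF that] by (metis inj_eq n_not_Suc_n linorder_neqE_nat)
    then show ?thesis using cweight_ascent[of i n "w \<circ> adj i"] i False by (simp add: e_def mult.commute)
  qed
  have "(\<Sum>w\<in>perms n. (cweight n w * e w) * (a (w \<circ> adj i) * b w)) =
      (\<Sum>w\<in>perms n. (cweight n (w \<circ> adj i) * e (w \<circ> adj i)) * (a w * b (w \<circ> adj i)))"
    by (rule sum.reindex_bij_witness[of _ "\<lambda>w. w \<circ> adj i" "\<lambda>w. w \<circ> adj i"]) (use comp_adj_perms i in auto)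
  also have "\<dots> = (\<Sum>w\<in>perms n. (cweight n w * e w) * (a w * b (w \<circ> adj i)))"
    using ce by (intro sum.cong refl) metis
  finally show ?thesis unfolding rm by (simp add: algebra_simps sum.distrib)
qed

locale hecke_repr =
  fixes n d :: nat and \<rho> :: "hecke_elt \<Rightarrow> laurent fract mat"
  assumes rep: "is_hecke_rep n d \<rho>"
begin

abbreviation R :: "free_alg \<Rightarrow> laurent fract mat" where "R x \<equiv> \<rho> (hecke_class n x)"

lemma R_hom: "\<rho> \<in> Ring.ring_hom (hecke n) (ring_mat TYPE(laurent fract) d ())"
  using rep by (simp add: is_hecke_rep_def)

lemma R_carrier: "x \<in> free_sub n \<Longrightarrow> R x \<in> carrier_mat d d"
  using ring_hom_closed[OF R_hom hecke_class_carrier] by (simp add: ring_mat_def)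

lemma R_mult: "x \<in> free_sub n \<Longrightarrow> y \<in> free_sub n \<Longrightarrow> R (x * y) = R x * R y"
  using ring_hom_mult[OF R_hom hecke_class_carrier hecke_class_carrier, of x y] by (simp add: hecke_mult ring_mat_def)

lemma R_add: "x \<in> free_sub n \<Longrightarrow> y \<in> free_sub n \<Longrightarrow> R (x + y) = R x + R y"
  using ring_hom_add[OF R_hom hecke_class_carrier hecke_class_carrier, of x y] by (simp add: hecke_add ring_mat_def)

lemma R_one: "R 1 = 1\<^sub>m d"
  using ring_hom_one[OF R_hom] by (simp add: hecke_one ring_mat_def)

lemma R_scale: "x \<in> free_sub n \<Longrightarrow> R (free_const c * x) = frac c \<cdot>\<^sub>m R x"
  using rep hecke_class_carrier[of x n] unfolding is_hecke_rep_def by (simp add: hecke_smult_class[symmetric])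

lemma R_cong: "hcong n x y \<Longrightarrow> R x = R y"
  using hecke_class_eq_iff[of n x y] by simp

lemma R_gen_basis:
  assumes w: "w \<in> perms n" and i: "i \<in> {1..<n}" and ab: "a < d" "b < d"
  shows "(R (mon (rword n w)) * R (mon [i])) $$ (a, b) = right_mult i (\<lambda>w. R (mon (rword n w)) $$ (a, b)) w"
    "(R (mon [i]) * R (mon (rword n (iperm w)))) $$ (a, b) = right_mult i (\<lambda>w. R (mon (rword n (iperm w))) $$ (a, b)) w"
proof -
  have wi: "w \<circ> adj i \<in> perms n" by (rule comp_adj_perms[OF w i])
  have f: "mon (rword n u) \<in> free_sub n" if "u \<in> perms n" for u
    using that by (intro free_sub_mon rword_words)
  have fi: "mon [i] \<in> free_sub n" using i by (auto intro: free_sub_mon)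
  have lin: "R (free_const c * x + free_const c' * y) $$ (a, b) = frac c * R x $$ (a, b) + frac c' * R y $$ (a, b)"
    if "x \<in> free_sub n" "y \<in> free_sub n" for x y c c'
    using R_carrier[OF that(1)] R_carrier[OF that(2)] ab that
    by (simp add: R_add R_scale free_sub_mult free_sub_const)
  have "w i < w (Suc i) \<or> w (Suc i) < w i" using perms_inj[OF w] by (metis inj_eq n_not_Suc_n linorder_neqE_nat)
  then show "(R (mon (rword n w)) * R (mon [i])) $$ (a, b) = right_mult i (\<lambda>w. R (mon (rword n w)) $$ (a, b)) w"
    "(R (mon [i]) * R (mon (rword n (iperm w)))) $$ (a, b) = right_mult i (\<lambda>w. R (mon (rword n (iperm w))) $$ (a, b)) w"
    unfolding R_mult[OF f[OF w] fi, symmetric] R_mult[OF fi f[OF iperm_perms[OF w]], symmetric]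
    using R_cong[OF T_right_ascent(1)[OF w i]] R_cong[OF T_right_ascent(2)[OF w i]]
      R_cong[OF T_right_descent(1)[OF w i]] R_cong[OF T_right_descent(2)[OF w i]]
      lin[OF f[OF w] f[OF wi]] lin[OF f[OF iperm_perms[OF w]] f[OF iperm_perms[OF wi]]]
    by (auto simp: right_mult_def)
qed

end

lemma intertwining_free:
  assumes "hecke_repr n d \<rho>" "hecke_repr n d' \<rho>'" and X: "X \<in> carrier_mat d d'"
    and gen: "\<And>i. i \<in> {1..<n} \<Longrightarrow> \<rho> (hecke_class n (mon [i])) * X = X * \<rho>' (hecke_class n (mon [i]))"
    and x: "x \<in> free_sub n"
  shows "\<rho> (hecke_class n x) * X = X * \<rho>' (hecke_class n x)"
proof -
  interpret a: hecke_repr n d \<rho> by (rule assms(1))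
  interpret b: hecke_repr n d' \<rho>' by (rule assms(2))
  have mon: "a.R (mon u) * X = X * b.R (mon u)" if "u \<in> words n" for u
    using that
  proof (induction u)
    case Nil
    then show ?case using X by (simp add: mon_Nil a.R_one b.R_one)
  next
    case (Cons i u)
    have fi: "mon [i] \<in> free_sub n" and fu: "mon u \<in> free_sub n" and i: "i \<in> {1..<n}"
      using Cons.hyps by (auto intro: free_sub_mon)
    have e: "mon (i # u) = mon [i] * mon u" using mon_append[of "[i]" u] by simp
    note ca = a.R_carrier[OF fi] a.R_carrier[OF fu] and cb = b.R_carrier[OF fi] b.R_carrier[OF fu]
    have "a.R (mon (i # u)) * X = a.R (mon [i]) * (a.R (mon u) * X)"
      unfolding e a.R_mult[OF fi fu] by (rule assoc_mult_mat[OF ca X])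
    also have "\<dots> = a.R (mon [i]) * (X * b.R (mon u))" using Cons by simp
    also have "\<dots> = a.R (mon [i]) * X * b.R (mon u)" by (rule assoc_mult_mat[OF ca(1) X cb(2), symmetric])
    also have "\<dots> = X * b.R (mon [i]) * b.R (mon u)" by (simp only: gen[OF i])
    also have "\<dots> = X * b.R (mon (i # u))"
      unfolding e b.R_mult[OF fi fu] by (rule assoc_mult_mat[OF X cb])
    finally show ?case .
  qed
  have sc: "a.R (free_const r * mon u) * X = X * b.R (free_const r * mon u)" if "u \<in> words n" for r u
  proof -
    have f: "mon u \<in> free_sub n" using that by (rule free_sub_mon)
    show ?thesis
      using mon[OF that] mult_smult_assoc_mat[OF a.R_carrier[OF f] X] mult_smult_distrib[OF X b.R_carrier[OF f]]
      by (simp add: a.R_scale[OF f] b.R_scale[OF f])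
  qed
  show ?thesis
    using x
  proof (induction x rule: free_sub_induct)
    case zero
    then show ?case using sc[of "[]" 0] by simp
  next
    case (scaled r u)
    then show ?case by (rule sc)
  next
    case (add x y)
    then show ?case
      using add_mult_distrib_mat[OF a.R_carrier a.R_carrier X, of x y] mult_add_distrib_mat[OF X b.R_carrier b.R_carrier, of x y]
      by (simp add: a.R_add b.R_add)
  qed
qed

lemma mat_trace_comm:
  assumes "A \<in> carrier_mat d d'" "B \<in> carrier_mat d' d"
  shows "(\<Sum>i<d. (A * B) $$ (i, i)) = (\<Sum>j<d'. (B * A) $$ (j, j :: nat) :: 'a::comm_ring_1)"
proof -
  have "(\<Sum>i<d. (A * B) $$ (i, i)) = (\<Sum>i<d. \<Sum>j<d'. A $$ (i, j) * B $$ (j, i))"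
    using assms by (simp add: scalar_prod_def atLeast0LessThan)
  also have "\<dots> = (\<Sum>j<d'. \<Sum>i<d. B $$ (j, i) * A $$ (i, j))"
    by (subst sum.swap) (simp add: mult.commute)
  also have "\<dots> = (\<Sum>j<d'. (B * A) $$ (j, j))"
    using assms by (simp add: scalar_prod_def atLeast0LessThan)
  finally show ?thesis .
qed

text \<open>Kernel and image of \<open>X\<close> are invariant subspaces, so a nonzero intertwiner
  is invertible and the two representations are conjugate.\<close>

lemma schur_trace:
  assumes irr: "is_irreducible_hecke_rep n d \<rho>" "is_irreducible_hecke_rep n d' \<rho>'"
    and X: "X \<in> carrier_mat d d'" "X \<noteq> 0\<^sub>m d d'"
    and comm: "\<And>h. h \<in> carrier (hecke n) \<Longrightarrow> \<rho> h * X = X * \<rho>' h"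
    and h: "h \<in> carrier (hecke n)"
  shows "(\<Sum>i<d. \<rho> h $$ (i, i)) = (\<Sum>i<d'. \<rho>' h $$ (i, i))"
proof -
  interpret a: hecke_repr n d \<rho> using irr(1) by (simp add: hecke_repr_def is_irreducible_hecke_rep_def)
  interpret b: hecke_repr n d' \<rho>' using irr(2) by (simp add: hecke_repr_def is_irreducible_hecke_rep_def)
  have ca: "\<rho> h \<in> carrier_mat d d" and cb: "\<rho>' h \<in> carrier_mat d' d'" if "h \<in> carrier (hecke n)" for h
    using that a.R_carrier b.R_carrier by (auto simp: hecke_carrier)
  define K where "K = {v \<in> carrier_vec d'. X *\<^sub>v v = 0\<^sub>v d}"
  define I where "I = (\<lambda>v. X *\<^sub>v v) ` carrier_vec d'"
  have "is_subspace d' K"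
    unfolding is_subspace_def K_def
    using X by (auto simp: mult_add_distrib_mat_vec[OF X(1)] mult_mat_vec[OF X(1)])
  moreover have "\<forall>h\<in>carrier (hecke n). \<forall>x\<in>K. \<rho>' h *\<^sub>v x \<in> K"
  proof (intro ballI)
    fix h x assume h: "h \<in> carrier (hecke n)" and x: "x \<in> K"
    have xc: "x \<in> carrier_vec d'" and x0: "X *\<^sub>v x = 0\<^sub>v d" using x by (auto simp: K_def)
    have "X *\<^sub>v (\<rho>' h *\<^sub>v x) = (\<rho> h * X) *\<^sub>v x"
      using assoc_mult_mat_vec[OF X(1) cb[OF h] xc] comm[OF h] by simp
    also have "\<dots> = \<rho> h *\<^sub>v 0\<^sub>v d" using assoc_mult_mat_vec[OF ca[OF h] X(1) xc] x0 by simp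
    also have "\<dots> = 0\<^sub>v d" using ca[OF h] by (intro eq_vecI) auto
    finally show "\<rho>' h *\<^sub>v x \<in> K" using cb[OF h] xc by (auto simp: K_def)
  qed
  ultimately have K: "K = {0\<^sub>v d'} \<or> K = carrier_vec d'"
    using irr(2) unfolding is_irreducible_hecke_rep_def by blast
  have "is_subspace d I"
    unfolding is_subspace_def
  proof (intro conjI ballI allI)
    show "I \<subseteq> carrier_vec d" using X by (auto simp: I_def)
    show "0\<^sub>v d \<in> I" unfolding I_def
      by (rule image_eqI[of _ _ "0\<^sub>v d'"]) (use X in \<open>auto intro!: eq_vecI\<close>)
  next
    fix x y assume "x \<in> I" "y \<in> I"
    then obtain u v where "u \<in> carrier_vec d'" "v \<in> carrier_vec d'" "x = X *\<^sub>v u" "y = X *\<^sub>v v" by (auto simp: I_def)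
    then show "x + y \<in> I" unfolding I_def
      by (intro image_eqI[of _ _ "u + v"]) (auto simp: mult_add_distrib_mat_vec[OF X(1)])
  next
    fix c x assume "x \<in> I"
    then obtain u where "u \<in> carrier_vec d'" "x = X *\<^sub>v u" by (auto simp: I_def)
    then show "c \<cdot>\<^sub>v x \<in> I" unfolding I_def
      by (intro image_eqI[of _ _ "c \<cdot>\<^sub>v u"]) (auto simp: mult_mat_vec[OF X(1)])
  qed
  moreover have "\<forall>h\<in>carrier (hecke n). \<forall>x\<in>I. \<rho> h *\<^sub>v x \<in> I"
  proof (intro ballI)
    fix h x assume h: "h \<in> carrier (hecke n)" and x: "x \<in> I"
    then obtain u where u: "u \<in> carrier_vec d'" "x = X *\<^sub>v u" by (auto simp: I_def)
    have "\<rho> h *\<^sub>v x = X *\<^sub>v (\<rho>' h *\<^sub>v u)"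
      using assoc_mult_mat_vec[OF ca[OF h] X(1) u(1)] assoc_mult_mat_vec[OF X(1) cb[OF h] u(1)] comm[OF h] u(2) by simp
    then show "\<rho> h *\<^sub>v x \<in> I" unfolding I_def using cb[OF h] u(1) by auto
  qed
  ultimately have I: "I = {0\<^sub>v d} \<or> I = carrier_vec d"
    using irr(1) unfolding is_irreducible_hecke_rep_def by blast
  have nz: "\<exists>v\<in>carrier_vec d'. X *\<^sub>v v \<noteq> 0\<^sub>v d"
  proof (rule ccontr)
    assume "\<not> ?thesis"
    then have z: "X *\<^sub>v v = 0\<^sub>v d" if "v \<in> carrier_vec d'" for v using that by blast
    have "X = 0\<^sub>m d d'"
    proof (rule eq_matI)
      fix i j assume ij: "i < dim_row (0\<^sub>m d d')" "j < dim_col (0\<^sub>m d d')"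
      then have "X $$ (i, j) = (X *\<^sub>v unit_vec d' j) $ i" using X(1) by (simp add: scalar_prod_right_unit)
      then show "X $$ (i, j) = 0\<^sub>m d d' $$ (i, j)" using z[of "unit_vec d' j"] ij by simp
    qed (use X in auto)
    then show False using X by simp
  qed
  then have K0: "K = {0\<^sub>v d'}" using K by (auto simp: K_def)
  have If: "I = carrier_vec d" using I nz by (auto simp: I_def)
  have "\<exists>v\<in>carrier_vec d'. X *\<^sub>v v = unit_vec d i" for i
  proof -
    have "unit_vec d i \<in> I" using If by simp
    then show ?thesis unfolding I_def by (metis imageE)
  qed
  then obtain y where y: "\<And>i. y i \<in> carrier_vec d'" "\<And>i. X *\<^sub>v y i = unit_vec d i" by metis
  define Y where "Y = mat d' d (\<lambda>(j, i). y i $ j)"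
  have Yc: "Y \<in> carrier_mat d' d" by (simp add: Y_def)
  have Ycol: "col Y i = y i" if "i < d" for i
    using that y(1)[of i] by (intro eq_vecI) (auto simp: Y_def)
  have XY: "X * Y = 1\<^sub>m d"
  proof (rule eq_matI)
    fix i j assume ij: "i < dim_row (1\<^sub>m d)" "j < dim_col (1\<^sub>m d)"
    then have "(X * Y) $$ (i, j) = (X *\<^sub>v y j) $ i" using X(1) Yc Ycol[of j] by simp
    then show "(X * Y) $$ (i, j) = 1\<^sub>m d $$ (i, j)" using y(2)[of j] ij by auto
  qed (use X Yc in auto)
  have YX: "Y * X = 1\<^sub>m d'"
  proof (rule eq_matI)
    fix i j assume ij: "i < dim_row (1\<^sub>m d')" "j < dim_col (1\<^sub>m d')"
    let ?e = "unit_vec d' j :: laurent fract vec"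
    let ?v = "(Y * X) *\<^sub>v ?e"
    have e: "?e \<in> carrier_vec d'" by simp
    have vc: "?v \<in> carrier_vec d'" using Yc X by (intro mult_mat_vec_carrier[of _ d' d']) auto
    have Xe: "X *\<^sub>v ?e \<in> carrier_vec d" using X(1) by simp
    have "X *\<^sub>v ?v = X *\<^sub>v (Y *\<^sub>v (X *\<^sub>v ?e))" using assoc_mult_mat_vec[OF Yc X(1) e] by simp
    also have "\<dots> = (X * Y) *\<^sub>v (X *\<^sub>v ?e)" by (rule assoc_mult_mat_vec[OF X(1) Yc Xe, symmetric])
    also have "\<dots> = X *\<^sub>v ?e" using Xe by (simp add: XY)
    finally have "X *\<^sub>v (?v - ?e) = 0\<^sub>v d"
      using mult_minus_distrib_mat_vec[OF X(1) vc e] Xe by simp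
    then have "?v - ?e \<in> K" using vc e by (simp add: K_def)
    then have d0: "?v - ?e = 0\<^sub>v d'" using K0 by simp
    have "(?v - ?e) $ i = 0" unfolding d0 using ij by simp
    then have "?v $ i = ?e $ i" using ij vc by simp
    moreover have "X *\<^sub>v ?e = col X j"
      using ij X(1) by (intro eq_vecI) (auto simp: scalar_prod_right_unit)
    then have "?v $ i = (Y * X) $$ (i, j)"
      using ij X(1) Yc by (simp add: scalar_prod_right_unit)
    ultimately show "(Y * X) $$ (i, j) = 1\<^sub>m d' $$ (i, j)" using ij by auto
  qed (use X Yc in auto)
  have "\<rho> h = \<rho> h * X * Y"
    using XY ca[OF h] assoc_mult_mat[OF ca[OF h] X(1) Yc] by simp
  also have "\<dots> = X * (\<rho>' h * Y)"
    using assoc_mult_mat[OF X(1) cb[OF h] Yc] comm[OF h] by simp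
  finally have "(\<Sum>i<d. \<rho> h $$ (i, i)) = (\<Sum>i<d. (X * (\<rho>' h * Y)) $$ (i, i))" by simp
  also have "\<dots> = (\<Sum>j<d'. (\<rho>' h * Y * X) $$ (j, j))"
    by (rule mat_trace_comm[OF X(1)]) (use cb[OF h] Yc in auto)
  also have "\<rho>' h * Y * X = \<rho>' h"
    using assoc_mult_mat[OF cb[OF h] Yc X(1)] YX cb[OF h] by simp
  finally show ?thesis .
qed

text \<open>Irreducible representations with different traces admit only the zero intertwiner. For
  fixed inner indices \<open>j\<close> and \<open>k\<close>, the weighted sum of products of matrix
  entries is an intertwiner in the outer indices \<open>i\<close> and \<open>l\<close>; taking i = j
  and k = l and summing gives the relation for the traces.\<close>

lemma schur_orthogonality:
  assumes irr: "is_irreducible_hecke_rep n d \<rho>" "is_irreducible_hecke_rep n d' \<rho>'"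
    and h: "h \<in> carrier (hecke n)"
    and ne: "(\<Sum>i<d. \<rho> h $$ (i, i)) \<noteq> (\<Sum>i<d'. \<rho>' h $$ (i, i))"
  shows "(\<Sum>w\<in>perms n. cweight n w * (\<Sum>i<d. \<rho> (T_basis n (iperm w)) $$ (i, i)) * (\<Sum>k<d'. \<rho>' (T_basis n w) $$ (k, k))) = 0"
proof -
  have la: "hecke_repr n d \<rho>" and lb: "hecke_repr n d' \<rho>'"
    using irr by (simp_all add: hecke_repr_def is_irreducible_hecke_rep_def)
  interpret a: hecke_repr n d \<rho> by (rule la)
  interpret b: hecke_repr n d' \<rho>' by (rule lb)
  define s where "s i j k l = (\<Sum>w\<in>perms n. cweight n w * a.R (mon (rword n (iperm w))) $$ (i, j) * b.R (mon (rword n w)) $$ (k, l))" for i j k l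
  have f: "mon (rword n u) \<in> free_sub n" if "u \<in> perms n" for u
    using that by (intro free_sub_mon rword_words)
  have s0: "s i j k l = 0" if "i < d" "j < d" "k < d'" "l < d'" for i j k l
  proof -
    define X where "X = mat d d' (\<lambda>(i, l). s i j k l)"
    have X: "X \<in> carrier_mat d d'" by (simp add: X_def)
    have gen: "a.R (mon [m]) * X = X * b.R (mon [m])" if m: "m \<in> {1..<n}" for m
    proof -
      have fm: "mon [m] \<in> free_sub n" using m by (auto intro: free_sub_mon)
      note am = a.R_carrier[OF fm] and bm = b.R_carrier[OF fm]
      show ?thesis
      proof (rule eq_matI)
        fix i l assume "i < dim_row (X * b.R (mon [m]))" "l < dim_col (X * b.R (mon [m]))"
        then have il: "i < d" "l < d'" using X bm by auto
        have "(a.R (mon [m]) * X) $$ (i, l) =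
           (\<Sum>p<d. a.R (mon [m]) $$ (i, p) * s p j k l)"
          using am X il by (simp add: scalar_prod_def atLeast0LessThan X_def)
        also have "\<dots> = (\<Sum>w\<in>perms n. cweight n w * (\<Sum>p<d. a.R (mon [m]) $$ (i, p) * a.R (mon (rword n (iperm w))) $$ (p, j)) * b.R (mon (rword n w)) $$ (k, l))"
          unfolding s_def sum_distrib_left sum_distrib_right
          by (subst sum.swap) (simp add: ac_simps)
        also have "\<dots> = (\<Sum>w\<in>perms n. cweight n w * right_mult m (\<lambda>w. a.R (mon (rword n (iperm w))) $$ (i, j)) w * b.R (mon (rword n w)) $$ (k, l))"
        proof (rule sum.cong[OF refl])
          fix w assume w: "w \<in> perms n"
          have "(\<Sum>p<d. a.R (mon [m]) $$ (i, p) * a.R (mon (rword n (iperm w))) $$ (p, j)) =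
            (a.R (mon [m]) * a.R (mon (rword n (iperm w)))) $$ (i, j)"
            using am a.R_carrier[OF f[OF iperm_perms[OF w]]] il \<open>j < d\<close> by (simp add: scalar_prod_def atLeast0LessThan)
          then show "cweight n w * (\<Sum>p<d. a.R (mon [m]) $$ (i, p) * a.R (mon (rword n (iperm w))) $$ (p, j)) * b.R (mon (rword n w)) $$ (k, l) =
            cweight n w * right_mult m (\<lambda>w. a.R (mon (rword n (iperm w))) $$ (i, j)) w * b.R (mon (rword n w)) $$ (k, l)"
            using a.R_gen_basis(2)[OF w m il(1) \<open>j < d\<close>] by simp
        qed
        also have "\<dots> = (\<Sum>w\<in>perms n. cweight n w * a.R (mon (rword n (iperm w))) $$ (i, j) * right_mult m (\<lambda>w. b.R (mon (rword n w)) $$ (k, l)) w)"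
          by (rule right_mult_symmetric[OF m])
        also have "\<dots> = (\<Sum>w\<in>perms n. cweight n w * a.R (mon (rword n (iperm w))) $$ (i, j) * (\<Sum>p<d'. b.R (mon (rword n w)) $$ (k, p) * b.R (mon [m]) $$ (p, l)))"
        proof (rule sum.cong[OF refl])
          fix w assume w: "w \<in> perms n"
          have "(\<Sum>p<d'. b.R (mon (rword n w)) $$ (k, p) * b.R (mon [m]) $$ (p, l)) = (b.R (mon (rword n w)) * b.R (mon [m])) $$ (k, l)"
            using bm b.R_carrier[OF f[OF w]] il \<open>k < d'\<close> by (simp add: scalar_prod_def atLeast0LessThan)
          then show "cweight n w * a.R (mon (rword n (iperm w))) $$ (i, j) * right_mult m (\<lambda>w. b.R (mon (rword n w)) $$ (k, l)) w =
            cweight n w * a.R (mon (rword n (iperm w))) $$ (i, j) * (\<Sum>p<d'. b.R (mon (rword n w)) $$ (k, p) * b.R (mon [m]) $$ (p, l))"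
            using b.R_gen_basis(1)[OF w m \<open>k < d'\<close> il(2)] by simp
        qed
        also have "\<dots> = (\<Sum>p<d'. s i j k p * b.R (mon [m]) $$ (p, l))"
          unfolding s_def sum_distrib_left sum_distrib_right
          by (subst sum.swap) (simp add: ac_simps)
        also have "\<dots> = (X * b.R (mon [m])) $$ (i, l)"
          using bm X il by (simp add: scalar_prod_def atLeast0LessThan X_def)
        finally show "(a.R (mon [m]) * X) $$ (i, l) = (X * b.R (mon [m])) $$ (i, l)" .
      qed (use am bm X in auto)
    qed
    have "\<rho> h * X = X * \<rho>' h" if "h \<in> carrier (hecke n)" for h
      using intertwining_free[OF la lb X gen] that by (auto simp: hecke_carrier)
    then have "X = 0\<^sub>m d d'" using schur_trace[OF irr X _ _ h] ne by blast
    then have "X $$ (i, l) = 0" using that by simp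
    then show ?thesis using that by (simp add: X_def)
  qed
  have "(\<Sum>w\<in>perms n. cweight n w * (\<Sum>i<d. \<rho> (T_basis n (iperm w)) $$ (i, i)) * (\<Sum>k<d'. \<rho>' (T_basis n w) $$ (k, k))) =
    (\<Sum>w\<in>perms n. \<Sum>i<d. \<Sum>k<d'. cweight n w * a.R (mon (rword n (iperm w))) $$ (i, i) * b.R (mon (rword n w)) $$ (k, k))"
  proof (rule sum.cong[OF refl])
    fix w assume w: "w \<in> perms n"
    show "cweight n w * (\<Sum>i<d. \<rho> (T_basis n (iperm w)) $$ (i, i)) * (\<Sum>k<d'. \<rho>' (T_basis n w) $$ (k, k)) =
      (\<Sum>i<d. \<Sum>k<d'. cweight n w * a.R (mon (rword n (iperm w))) $$ (i, i) * b.R (mon (rword n w)) $$ (k, k))"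
      unfolding T_basis_class[OF w] T_basis_class[OF iperm_perms[OF w]]
      unfolding sum_distrib_left sum_distrib_right by (rule sum.swap)
  qed
  also have "\<dots> = (\<Sum>i<d. \<Sum>w\<in>perms n. \<Sum>k<d'. cweight n w * a.R (mon (rword n (iperm w))) $$ (i, i) * b.R (mon (rword n w)) $$ (k, k))"
    by (rule sum.swap)
  also have "\<dots> = (\<Sum>i<d. \<Sum>k<d'. s i i k k)"
    unfolding s_def by (intro sum.cong refl sum.swap)
  also have "\<dots> = 0" using s0 by simp
  finally show ?thesis .
qed

context hook
begin

lemma n1: "1 \<le> n"
  using rn by simp

lemma hooks_nonempty: "hooks n r \<noteq> {}"
proof -
  have "r \<le> card {2..n}" using rn by simp
  then obtain A where "A \<subseteq> {2..n}" "card A = r" by (metis obtain_subset_with_card_n)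
  then show ?thesis by (auto simp: hooks_def)
qed

lemma sym_char_id: "sym_char n (hook_shape n r) id = of_nat (card (hooks n r))"
proof -
  have id: "id \<in> perms n" by (simp add: permutes_id)
  have "sym_char n (hook_shape n r) id = (\<Sum>A\<in>hooks n r. Poly_Mapping.lookup (ptab A) (stab A \<circ> id))"
    unfolding sym_char_hook[OF id] by (intro sum.cong refl lookup_ptab[OF _ id, symmetric])
  also have "\<dots> = (\<Sum>A\<in>hooks n r. 1)" using lookup_ptab_stab by (intro sum.cong refl) simp
  finally show ?thesis by simp
qed

text \<open>Reversing a reduced word of \<open>w\<close> gives one of its inverse, and the hook
  trace is unchanged under reversal.\<close>

lemma sym_char_inverse:
  assumes w: "w \<in> perms n"
  shows "sym_char n (hook_shape n r) (iperm w) = sym_char n (hook_shape n r) w"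
proof -
  have red: "reduced_word n (iperm w) (rev (rword n w))" by (rule reduced_word_rev[OF rword[OF w]])
  have u: "rword n w \<in> words n" by (rule rword_words[OF w])
  then have ru: "rev (rword n w) \<in> words n" by auto
  have "frac (hook_char n r (hecke_class n (mon (rev (rword n w))))) = frac (hook_char n r (hecke_class n (mon (rword n w))))"
    using frac_hook_char[OF n1 free_sub_mon[OF u]] frac_hook_char[OF n1 free_sub_mon[OF ru]] sn.htrace_rev[OF n1 u]
    by (simp only: sn.htr_mon)
  then have "hook_char n r (hecke_class n (mon (rev (rword n w)))) = hook_char n r (hecke_class n (mon (rword n w)))"
    by (simp only: frac_eq_iff)
  then have "hook_char n r (T_basis n (iperm w)) = hook_char n r (T_basis n w)"
    unfolding T_basis_reduced[OF red] T_basis_class[OF w] .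
  then show ?thesis using eval_hook_char[OF w] eval_hook_char[OF iperm_perms[OF w]] by simp
qed

text \<open>If a candidate differed from the hook character somewhere, the two would be orthogonal.
  Both specialize to the same character of the symmetric group, so at q = 1 a sum of squares would
  vanish, although the value at the identity is the positive number of leg sets.\<close>

theorem hecke_char_hook: "hecke_char n (hook_shape n r) = hook_char n r"
  unfolding hecke_char_def
proof (rule the_equality)
  show "hook_char n r \<in> extensional (carrier (hecke n)) \<and> is_irreducible_hecke_char n (hook_char n r) \<and>
    (\<forall>v. v permutes {1..n} \<longrightarrow> of_int (eval_one (hook_char n r (T_basis n v))) = sym_char n (hook_shape n r) v)"
    using hook_char_irreducible[OF n1 rn] eval_hook_char by (simp add: hook_char_def extensional_def)
next
  fix \<chi> assume a: "\<chi> \<in> extensional (carrier (hecke n)) \<and> is_irreducible_hecke_char n \<chi> \<and>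
    (\<forall>v. v permutes {1..n} \<longrightarrow> of_int (eval_one (\<chi> (T_basis n v))) = sym_char n (hook_shape n r) v)"
  then obtain d \<rho> where irr: "is_irreducible_hecke_rep n d \<rho>"
    and tr: "\<And>h. h \<in> carrier (hecke n) \<Longrightarrow> frac (\<chi> h) = (\<Sum>i<d. \<rho> h $$ (i, i))"
    unfolding is_irreducible_hecke_char_def by blast
  obtain d' \<rho>' where irr': "is_irreducible_hecke_rep n d' \<rho>'"
    and tr': "\<And>h. h \<in> carrier (hecke n) \<Longrightarrow> frac (hook_char n r h) = (\<Sum>i<d'. \<rho>' h $$ (i, i))"
    using hook_char_irreducible[OF n1 rn] unfolding is_irreducible_hecke_char_def by blast
  have T: "T_basis n w \<in> carrier (hecke n)" if "w \<in> perms n" for w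
    unfolding T_basis_class[OF that] by (intro hecke_class_carrier free_sub_mon rword_words that)
  have eq: "\<chi> h = hook_char n r h" if h: "h \<in> carrier (hecke n)" for h
  proof (rule ccontr)
    let ?s = "sym_char n (hook_shape n r)"
    assume "\<chi> h \<noteq> hook_char n r h"
    then have "frac (\<chi> h) \<noteq> frac (hook_char n r h)" by (simp only: frac_eq_iff not_False_eq_True)
    then have ne: "(\<Sum>i<d. \<rho> h $$ (i, i)) \<noteq> (\<Sum>i<d'. \<rho>' h $$ (i, i))" by (simp only: tr[OF h] tr'[OF h] not_False_eq_True)
    define c where "c w = qhalf (- 2 * int (perm_len n w))" for w
    have "(\<Sum>w\<in>perms n. frac (c w * \<chi> (T_basis n (iperm w)) * hook_char n r (T_basis n w))) = 0"
      using schur_orthogonality[OF irr irr' h ne] tr[OF T[OF iperm_perms]] tr'[OF T]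
      by (simp add: cweight_def c_def sn.hom_mult del: mult_fract)
    then have "frac (\<Sum>w\<in>perms n. c w * \<chi> (T_basis n (iperm w)) * hook_char n r (T_basis n w)) = frac 0"
      by (simp only: sn.hom_sum sn.hom_0)
    then have "(\<Sum>w\<in>perms n. c w * \<chi> (T_basis n (iperm w)) * hook_char n r (T_basis n w)) = 0"
      by (simp only: frac_eq_iff)
    then have "eval_one (\<Sum>w\<in>perms n. c w * \<chi> (T_basis n (iperm w)) * hook_char n r (T_basis n w)) = 0"
      by (simp add: ev.hom_0)
    then have "(\<Sum>w\<in>perms n. eval_one (\<chi> (T_basis n (iperm w))) * eval_one (hook_char n r (T_basis n w))) = 0"
      by (simp add: ev.hom_sum ev.hom_mult c_def eval_one_qhalf)
    then have "rat_of_int (\<Sum>w\<in>perms n. eval_one (\<chi> (T_basis n (iperm w))) * eval_one (hook_char n r (T_basis n w))) = 0"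
      by simp
    then have "(\<Sum>w\<in>perms n. rat_of_int (eval_one (\<chi> (T_basis n (iperm w)))) * rat_of_int (eval_one (hook_char n r (T_basis n w)))) = 0"
      by (simp only: of_int_sum of_int_mult)
    moreover have "rat_of_int (eval_one (\<chi> (T_basis n (iperm w)))) * rat_of_int (eval_one (hook_char n r (T_basis n w))) = ?s w * ?s w"
      if w: "w \<in> perms n" for w
      using a iperm_perms[OF w] sym_char_inverse[OF w] eval_hook_char[OF w] by simp
    ultimately have "(\<Sum>w\<in>perms n. ?s w * ?s w) = 0" by simp
    then have "?s id * ?s id = 0"
      using sum_nonneg_eq_0_iff[OF finite_perms, of n "\<lambda>w. ?s w * ?s w"] by (simp add: permutes_id)
    then have "card (hooks n r) = 0" by (simp add: sym_char_id)
    then show False using hooks_nonempty finite_hooks by simp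
  qed
  show "\<chi> = hook_char n r"
  proof
    fix h
    show "\<chi> h = hook_char n r h"
      using eq a by (cases "h \<in> carrier (hecke n)") (auto simp: extensional_def hook_char_def)
  qed
qed

end


section \<open>The power sum trace as an alternating sum over hooks\<close>

section \<open>Kostka numbers of hooks and the inverse Kostka matrix\<close>

lemma diagram_Sigma: "diagram lam = Sigma {..<length lam} (\<lambda>i. {..<lam ! i})"
  by (auto simp: diagram_def)

lemma finite_diagram: "finite (diagram lam)"
  by (simp add: diagram_Sigma)

lemma finite_fillings: "finite (fillings lam \<mu>)"
  by (rule finite_subset[of _ "diagram lam \<rightarrow>\<^sub>E {..<length \<mu>}"])
     (auto simp: fillings_def intro!: finite_PiE finite_diagram)

lemma length_le_sum_list: "0 \<notin> set xs \<Longrightarrow> length xs \<le> sum_list (xs :: nat list)"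
  by (induction xs) (auto simp: Suc_le_eq add_pos_nonneg intro: add_mono)

lemma finite_partitions: "finite (partitions_of n)"
proof (rule finite_subset)
  show "partitions_of n \<subseteq> {xs. set xs \<subseteq> {..n} \<and> length xs \<le> n}"
  proof
    fix xs assume a: "xs \<in> partitions_of n"
    then have "x \<le> n" if "x \<in> set xs" for x using member_le_sum_list[OF that] by (simp add: partitions_of_def)
    then show "xs \<in> {xs. set xs \<subseteq> {..n} \<and> length xs \<le> n}"
      using a length_le_sum_list[of xs] by (auto simp: partitions_of_def)
  qed
qed (simp add: finite_lists_length_le)

lemma partition_length: "\<nu> \<in> partitions_of n \<Longrightarrow> length \<nu> \<le> n"
  using length_le_sum_list[of \<nu>] by (simp add: partitions_of_def)

lemma partition_pos: "\<nu> \<in> partitions_of n \<Longrightarrow> k < length \<nu> \<Longrightarrow> 0 < \<nu> ! k"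
  using nth_mem[of k \<nu>] unfolding partitions_of_def by (metis (mono_tags, lifting) gr0I mem_Collect_eq)

lemma partition_ne: "1 \<le> n \<Longrightarrow> \<nu> \<in> partitions_of n \<Longrightarrow> 1 \<le> length \<nu>"
  by (cases \<nu>) (auto simp: partitions_of_def)

lemma partition_single: "\<nu> \<in> partitions_of n \<Longrightarrow> length \<nu> = 1 \<longleftrightarrow> 1 \<le> n \<and> \<nu> = [n]"
  by (cases \<nu>) (auto simp: partitions_of_def)

lemma hook_partition: "r < n \<Longrightarrow> hook_shape n r \<in> partitions_of n"
  by (auto simp: partitions_of_def hook_shape_def sum_list_replicate sorted_wrt_iff_nth_less nth_Cons split: nat.splits)

text \<open>A semistandard tableau has entries \<open>T (i, j) \<ge> i\<close>, so the sum of all entries exceeds the sum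
  of the row indices of the cells; this grading makes the Kostka matrix unitriangular.\<close>

definition row_weight :: "nat list \<Rightarrow> nat" where
  "row_weight lam = (\<Sum>c\<in>diagram lam. fst c)"

definition ssyt :: "nat list \<Rightarrow> nat list \<Rightarrow> (nat \<times> nat \<Rightarrow> nat) set" where
  "ssyt lam \<mu> = {T \<in> fillings lam \<mu>.
     (\<forall>i j j'. j < j' \<and> (i, j) \<in> diagram lam \<and> (i, j') \<in> diagram lam \<longrightarrow> T (i, j) \<le> T (i, j')) \<and>
     (\<forall>i i' j. i < i' \<and> (i, j) \<in> diagram lam \<and> (i', j) \<in> diagram lam \<longrightarrow> T (i, j) < T (i', j))}"

lemma kostka_ssyt: "kostka lam \<mu> = card (ssyt lam \<mu>)"
  by (simp add: kostka_def ssyt_def)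

lemma finite_ssyt: "finite (ssyt lam \<mu>)"
  by (rule finite_subset[OF _ finite_fillings[of lam \<mu>]]) (auto simp: ssyt_def)

lemma row_card: "k < length \<mu> \<Longrightarrow> card {c \<in> diagram \<mu>. fst c = k} = \<mu> ! k"
proof -
  assume k: "k < length \<mu>"
  then have "{c \<in> diagram \<mu>. fst c = k} = Pair k ` {..<\<mu> ! k}" by (auto simp: diagram_def)
  then show ?thesis by (simp add: card_image inj_on_def)
qed

lemma row_weight_sum: "row_weight \<mu> = (\<Sum>k<length \<mu>. k * \<mu> ! k)"
proof -
  have "row_weight \<mu> = (\<Sum>(k, j)\<in>Sigma {..<length \<mu>} (\<lambda>i. {..<\<mu> ! i}). k)"
    unfolding row_weight_def diagram_Sigma by (intro sum.cong) auto
  also have "\<dots> = (\<Sum>k<length \<mu>. \<Sum>j<\<mu> ! k. k)" by (rule sum.Sigma[symmetric]) auto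
  finally show ?thesis by (simp add: mult.commute)
qed

lemma filling_sum:
  assumes "T \<in> fillings lam \<mu>"
  shows "(\<Sum>c\<in>diagram lam. T c) = row_weight \<mu>"
proof -
  have "(\<Sum>c\<in>diagram lam. T c) = (\<Sum>k<length \<mu>. \<Sum>c | c \<in> diagram lam \<and> T c = k. T c)"
    using assms by (intro sum.group[symmetric] finite_diagram) (auto simp: fillings_def)
  also have "\<dots> = (\<Sum>k<length \<mu>. k * \<mu> ! k)"
    using assms by (intro sum.cong refl) (simp add: fillings_def mult.commute)
  finally show ?thesis by (simp add: row_weight_sum)
qed

lemma ssyt_entry:
  assumes T: "T \<in> ssyt lam \<mu>" and lam: "lam \<in> partitions_of n" and c: "(i, j) \<in> diagram lam"
  shows "i \<le> T (i, j)"
  using c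
proof (induction i)
  case (Suc i)
  have "lam ! Suc i \<le> lam ! i" using Suc.prems lam by (auto simp: diagram_def partitions_of_def sorted_wrt_iff_nth_less)
  then have m: "(i, j) \<in> diagram lam" using Suc.prems by (auto simp: diagram_def)
  have "T (i, j) < T (Suc i, j)" using T Suc.prems m unfolding ssyt_def by blast
  then show ?case using Suc.IH[OF m] by simp
qed simp

text \<open>Each entry is at least its row index, and the hypothesis on the weights forces equality
  in every cell. The content then consists of the row lengths.\<close>

lemma kostka_unitriangular:
  assumes lam: "lam \<in> partitions_of n" and \<mu>: "\<mu> \<in> partitions_of n" and K: "kostka lam \<mu> \<noteq> 0"
    and w: "row_weight \<mu> \<le> row_weight lam"
  shows "lam = \<mu>"
proof -
  obtain T where T: "T \<in> ssyt lam \<mu>" using K unfolding kostka_ssyt by (metis card.empty ex_in_conv)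
  then have f: "T \<in> fillings lam \<mu>" by (simp add: ssyt_def)
  have ge: "fst c \<le> T c" if "c \<in> diagram lam" for c using ssyt_entry[OF T lam] that by (cases c) simp
  have "(\<Sum>c\<in>diagram lam. T c) = (\<Sum>c\<in>diagram lam. fst c)"
  proof (rule antisym)
    show "(\<Sum>c\<in>diagram lam. T c) \<le> (\<Sum>c\<in>diagram lam. fst c)"
      using filling_sum[OF f] w by (simp add: row_weight_def)
  qed (intro sum_mono ge)
  then have "(\<Sum>c\<in>diagram lam. T c - fst c) = 0"
    using ge by (subst sum_subtractf_nat) auto
  then have eq: "T c = fst c" if "c \<in> diagram lam" for c
    using that ge[OF that] finite_diagram by (auto simp: sum_eq_0_iff intro: antisym)
  have row: "card {c \<in> diagram lam. fst c = k} = \<mu> ! k" if "k < length \<mu>" for k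
  proof -
    have "{c \<in> diagram lam. T c = k} = {c \<in> diagram lam. fst c = k}" using eq by auto
    moreover have "card {c \<in> diagram lam. T c = k} = \<mu> ! k" using f that by (simp add: fillings_def)
    ultimately show ?thesis by (simp only:)
  qed
  have l1: "k < length lam" if "k < length \<mu>" for k
  proof -
    have "{c \<in> diagram lam. fst c = k} \<noteq> {}"
      using row[OF that] partition_pos[OF \<mu> that] by (metis card.empty less_irrefl)
    then show ?thesis by (auto simp: diagram_def)
  qed
  have l2: "k < length \<mu>" if "k < length lam" for k
  proof -
    have "(k, 0) \<in> diagram lam" using partition_pos[OF lam that] that by (simp add: diagram_def)
    then have "T (k, 0) < length \<mu>" "T (k, 0) = k"
      using f PiE_mem[of T "diagram lam" "\<lambda>_. {..<length \<mu>}" "(k, 0)"] eq[of "(k, 0)"] by (simp_all add: fillings_def)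
    then show ?thesis by simp
  qed
  have "length lam = length \<mu>" using l1 l2 by (metis linorder_neqE_nat less_irrefl)
  then show ?thesis using row row_card by (intro nth_equalityI) auto
qed

lemma kostka_diagonal: "kostka lam lam \<noteq> 0"
proof -
  have "restrict fst (diagram lam) \<in> ssyt lam lam"
  proof -
    have "{c \<in> diagram lam. restrict fst (diagram lam) c = k} = {c \<in> diagram lam. fst c = k}" for k by auto
    moreover have "restrict fst (diagram lam) \<in> diagram lam \<rightarrow>\<^sub>E {..<length lam}" by (auto simp: diagram_def)
    ultimately show ?thesis using row_card[of _ lam] unfolding ssyt_def fillings_def by auto
  qed
  then show ?thesis using finite_ssyt[of lam lam] unfolding kostka_ssyt by auto
qed

text \<open>Where two solutions differ, take a partition of minimal row weight and test the equation
  there: unitriangularity leaves a single term, with a nonzero diagonal Kostka number.\<close>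

lemma inv_kostka_unique:
  assumes "\<And>\<mu>. \<mu> \<notin> partitions_of n \<Longrightarrow> c \<mu> = (0::int)" "\<And>\<mu>. \<mu> \<notin> partitions_of n \<Longrightarrow> d \<mu> = 0"
    and eq: "\<And>\<nu>. \<nu> \<in> partitions_of n \<Longrightarrow>
      (\<Sum>\<mu>\<in>partitions_of n. c \<mu> * int (kostka \<mu> \<nu>)) = (\<Sum>\<mu>\<in>partitions_of n. d \<mu> * int (kostka \<mu> \<nu>))"
  shows "c = d"
proof (rule ccontr)
  assume "c \<noteq> d"
  then obtain \<mu>1 where "c \<mu>1 \<noteq> d \<mu>1" by blast
  then obtain \<mu>0 where \<mu>0: "c \<mu>0 \<noteq> d \<mu>0" and min: "\<And>\<mu>. c \<mu> \<noteq> d \<mu> \<Longrightarrow> row_weight \<mu>0 \<le> row_weight \<mu>"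
    using ex_has_least_nat[of "\<lambda>\<mu>. c \<mu> \<noteq> d \<mu>" \<mu>1 row_weight] by blast
  have P0: "\<mu>0 \<in> partitions_of n" using \<mu>0 assms(1,2) by force
  have "0 = (\<Sum>\<mu>\<in>partitions_of n. (c \<mu> - d \<mu>) * int (kostka \<mu> \<mu>0))"
    using eq[OF P0] by (simp add: left_diff_distrib sum_subtractf)
  also have "\<dots> = (\<Sum>\<mu>\<in>{\<mu>0}. (c \<mu> - d \<mu>) * int (kostka \<mu> \<mu>0))"
  proof (rule sum.mono_neutral_right[OF finite_partitions])
    show "\<forall>\<mu>\<in>partitions_of n - {\<mu>0}. (c \<mu> - d \<mu>) * int (kostka \<mu> \<mu>0) = 0"
      using kostka_unitriangular[OF _ P0] min by fastforce
  qed (use P0 in simp)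
  finally show False using \<mu>0 kostka_diagonal[of \<mu>0] by simp
qed

text \<open>Turns the content condition on a filling into an equation of multisets, in which the arm
  and the leg of a hook can be separated.\<close>

definition content_mset :: "nat list \<Rightarrow> nat multiset" where
  "content_mset \<nu> = (\<Sum>k<length \<nu>. replicate_mset (\<nu> ! k) k)"

lemma size_mset_sum: "size (\<Sum>k\<in>A. f k :: 'a multiset) = (\<Sum>k\<in>A. size (f k))"
  by (induction A rule: infinite_finite_induct) auto

lemma count_content: "count (content_mset \<nu>) x = (if x < length \<nu> then \<nu> ! x else 0)"
  by (simp add: content_mset_def count_sum sum.delta)

lemma fillings_mset:
  "T \<in> fillings lam \<nu> \<longleftrightarrow> T \<in> extensional (diagram lam) \<and> image_mset T (mset_set (diagram lam)) = content_mset \<nu>"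
proof -
  have cnt: "count (image_mset T (mset_set (diagram lam))) x = card {c \<in> diagram lam. T c = x}" for x
  proof -
    have "{c. c \<in> diagram lam \<and> x = T c} = {c \<in> diagram lam. T c = x}" by auto
    then show ?thesis using finite_diagram[of lam] by (simp add: count_image_mset' cong: conj_cong)
  qed
  show ?thesis
  proof
    assume T: "T \<in> fillings lam \<nu>"
    have "count (image_mset T (mset_set (diagram lam))) x = count (content_mset \<nu>) x" for x
    proof (cases "x < length \<nu>")
      case True
      then show ?thesis using T unfolding cnt count_content by (simp add: fillings_def)
    next
      case False
      then have z: "{c \<in> diagram lam. T c = x} = {}" using T by (auto simp: fillings_def)
      show ?thesis using False unfolding cnt count_content z by simp
    qed
    then show "T \<in> extensional (diagram lam) \<and> image_mset T (mset_set (diagram lam)) = content_mset \<nu>"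
      using T by (auto simp: fillings_def PiE_def intro: multiset_eqI)
  next
    assume T: "T \<in> extensional (diagram lam) \<and> image_mset T (mset_set (diagram lam)) = content_mset \<nu>"
    then have c: "card {c \<in> diagram lam. T c = x} = (if x < length \<nu> then \<nu> ! x else 0)" for x
      using cnt[of x] count_content[of \<nu> x] by simp
    have "T c < length \<nu>" if "c \<in> diagram lam" for c
    proof (rule ccontr)
      assume "\<not> ?thesis"
      then have "card {c' \<in> diagram lam. T c' = T c} = 0" using c[of "T c"] by simp
      then have "{c' \<in> diagram lam. T c' = T c} = {}" using finite_diagram[of lam] by simp
      then show False using that by blast
    qed
    then show "T \<in> fillings lam \<nu>" using T c by (auto simp: fillings_def PiE_def)
  qed
qed

context hook
begin

definition armlist :: "(nat \<times> nat \<Rightarrow> nat) \<Rightarrow> nat list" where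
  "armlist T = map (\<lambda>j. T (0, j)) [0..<n - r]"

definition leglist :: "(nat \<times> nat \<Rightarrow> nat) \<Rightarrow> nat list" where
  "leglist T = map (\<lambda>i. T (Suc i, 0)) [0..<r]"

lemma diagram_cells: "diagram (hook_shape n r) = (\<lambda>j. (0, j)) ` {0..<n - r} \<union> (\<lambda>i. (Suc i, 0)) ` {0..<r}"
  unfolding diagram_hook leg_def arm_def using rn
  by (auto simp: image_iff) (metis Suc_pred atLeastLessThan_iff less_eq_Suc_le not_gr_zero zero_le)

lemma mset_hook: "image_mset T (mset_set (diagram (hook_shape n r))) = mset (armlist T) + mset (leglist T)"
proof -
  have "mset_set (diagram (hook_shape n r)) =
     mset_set ((\<lambda>j. (0, j)) ` {0..<n - r}) + mset_set ((\<lambda>i. (Suc i, 0)) ` {0..<r})"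
    unfolding diagram_cells by (rule mset_set_Union) auto
  also have "\<dots> = image_mset (\<lambda>j. (0, j)) (mset_set {0..<n - r}) + image_mset (\<lambda>i. (Suc i, 0)) (mset_set {0..<r})"
    by (simp add: image_mset_mset_set inj_on_def)
  finally show ?thesis
    by (simp add: armlist_def leglist_def mset_map multiset.map_comp o_def)
qed

lemma ssyt_hook:
  "T \<in> ssyt (hook_shape n r) \<nu> \<longleftrightarrow> T \<in> extensional (diagram (hook_shape n r)) \<and>
     mset (armlist T) + mset (leglist T) = content_mset \<nu> \<and> sorted (armlist T) \<and>
     sorted_wrt (<) (T (0, 0) # leglist T)"
proof -
  have cell: "(i, j) \<in> diagram (hook_shape n r) \<longleftrightarrow> i = 0 \<and> j < n - r \<or> 1 \<le> i \<and> i \<le> r \<and> j = 0" for i j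
    using rn by (auto simp: diagram_hook leg_def arm_def)
  have "(\<forall>i j j'. j < j' \<and> (i, j) \<in> diagram (hook_shape n r) \<and> (i, j') \<in> diagram (hook_shape n r) \<longrightarrow> T (i, j) \<le> T (i, j')) \<longleftrightarrow>
     sorted (armlist T)"
    unfolding cell armlist_def sorted_iff_nth_mono_less by auto
  moreover have "(\<forall>i i' j. i < i' \<and> (i, j) \<in> diagram (hook_shape n r) \<and> (i', j) \<in> diagram (hook_shape n r) \<longrightarrow> T (i, j) < T (i', j)) \<longleftrightarrow>
     sorted_wrt (<) (T (0, 0) # leglist T)"
  proof -
    have e: "T (0, 0) # leglist T = map (\<lambda>i. T (i, 0)) [0..<Suc r]"
      unfolding leglist_def by (simp only: upt_conv_Cons map_Suc_upt[symmetric] list.map map_map o_def zero_less_Suc)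
    have sw: "sorted_wrt (<) (T (0, 0) # leglist T) \<longleftrightarrow> (\<forall>i i'. i < i' \<longrightarrow> i' \<le> r \<longrightarrow> T (i, 0) < T (i', 0))"
      unfolding e sorted_wrt_iff_nth_less by (auto simp del: upt_Suc simp: less_Suc_eq_le)
    show ?thesis
      unfolding sw cell
    proof (intro iffI allI impI)
      fix i i' assume H: "\<forall>i i' j. i < i' \<and> (i = 0 \<and> j < n - r \<or> 1 \<le> i \<and> i \<le> r \<and> j = 0) \<and>
          (i' = 0 \<and> j < n - r \<or> 1 \<le> i' \<and> i' \<le> r \<and> j = 0) \<longrightarrow> T (i, j) < T (i', j)"
        and i: "i < i'" "i' \<le> r"
      show "T (i, 0) < T (i', 0)" using H[rule_format, of i i' 0] i rn by (cases i) auto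
    qed auto
  qed
  ultimately show ?thesis
    unfolding ssyt_def mem_Collect_eq fillings_mset mset_hook by blast
qed

lemma kostka_hook:
  assumes \<nu>: "\<nu> \<in> partitions_of n"
  shows "kostka (hook_shape n r) \<nu> = (length \<nu> - 1) choose r"
proof -
  let ?S = "ssyt (hook_shape n r) \<nu>" and ?L = "{L. L \<subseteq> {1..<length \<nu>} \<and> card L = r}"
  have len: "1 \<le> length \<nu>" using partition_ne[OF _ \<nu>] rn by simp
  have mem: "x \<in># content_mset \<nu> \<longleftrightarrow> x < length \<nu>" for x
    using partition_pos[OF \<nu>] by (simp add: count_content flip: count_greater_zero_iff)
  have hd: "armlist T ! 0 = T (0, 0)" "length (armlist T) = n - r" "armlist T \<noteq> []" for T
    using rn by (simp_all add: armlist_def)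
  have size: "size (content_mset \<nu>) = n"
    using \<nu> by (simp add: content_mset_def size_mset_sum partitions_of_def sum_list_sum_nth atLeast0LessThan)
  have "bij_betw (\<lambda>T. set (leglist T)) ?S ?L"
  proof (rule bij_betw_imageI)
    show "inj_on (\<lambda>T. set (leglist T)) ?S"
    proof (rule inj_onI)
      fix T T' assume T: "T \<in> ?S" and T': "T' \<in> ?S" and e: "set (leglist T) = set (leglist T')"
      have leg: "leglist T = leglist T'"
        using T T' e unfolding ssyt_hook by (intro strict_sorted_equal) (auto simp: sorted_wrt.simps)
      then have "mset (armlist T) = mset (armlist T')" using T T' unfolding ssyt_hook by (metis add_right_imp_eq)
      then have arm: "armlist T = armlist T'"
        using T T' properties_for_sort[of "armlist T'" "armlist T"] sorted_sort_id[of "armlist T"] unfolding ssyt_hook by simp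
      show "T = T'"
      proof
        fix c
        show "T c = T' c"
        proof (cases "c \<in> diagram (hook_shape n r)")
          case True
          then consider j where "j < n - r" "c = (0, j)" | i where "i < r" "c = (Suc i, 0)"
            unfolding diagram_cells by auto
          then show ?thesis
          proof cases
            case 1
            then show ?thesis using arg_cong[OF arm, of "\<lambda>l. l ! j"] by (simp add: armlist_def)
          next
            case 2
            then show ?thesis using arg_cong[OF leg, of "\<lambda>l. l ! i"] by (simp add: leglist_def)
          qed
        next
          case False
          then show ?thesis using T T' extensional_arb[of _ "diagram (hook_shape n r)" c] unfolding ssyt_hook by metis
        qed
      qed
    qed
    show "(\<lambda>T. set (leglist T)) ` ?S = ?L"
    proof (intro equalityI subsetI)
      fix L assume "L \<in> (\<lambda>T. set (leglist T)) ` ?S"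
      then obtain T where T: "T \<in> ?S" "L = set (leglist T)" by blast
      have m: "mset (armlist T) + mset (leglist T) = content_mset \<nu>" and s: "sorted_wrt (<) (T (0, 0) # leglist T)"
        using T unfolding ssyt_hook by auto
      have "x < length \<nu>" if "x \<in> L" for x
        using that T(2) mem[of x] unfolding m[symmetric] by simp
      moreover have "1 \<le> x" if "x \<in> L" for x using that T(2) s by (auto simp: Suc_le_eq)
      moreover have "card L = r"
      proof -
        have "distinct (leglist T)" using s by (simp add: strict_sorted_iff)
        then have "card (set (leglist T)) = length (leglist T)" by (rule distinct_card)
        then show ?thesis by (simp add: T(2) leglist_def)
      qed
      ultimately show "L \<in> ?L" by auto
    next
      fix L assume L: "L \<in> ?L"
      then have fin: "finite L" using finite_subset by auto
      define M where "M = content_mset \<nu> - mset_set L"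
      have sub: "mset_set L \<subseteq># content_mset \<nu>"
      proof (rule mset_subset_eqI)
        fix x
        show "count (mset_set L) x \<le> count (content_mset \<nu>) x"
          using L fin mem[of x] by (cases "x \<in> L") (auto simp: Suc_le_eq)
      qed
      then have M: "M + mset_set L = content_mset \<nu>" by (simp add: M_def)
      have sM: "size M = n - r" using sub L fin by (simp add: M_def size_Diff_submset size)
      define l where "l = sorted_list_of_set L"
      define a where "a = sorted_list_of_multiset M"
      define T where "T = restrict (\<lambda>(i, j). if i = 0 then a ! j else l ! (i - 1)) (diagram (hook_shape n r))"
      have la: "length a = n - r" using sM by (metis a_def mset_sorted_list_of_multiset size_mset)
      have ll: "length l = r" using L fin by (simp add: l_def)
      have arm: "armlist T = a"
        by (rule nth_equalityI) (auto simp: armlist_def T_def la diagram_cells)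
      have leg: "leglist T = l"
        by (rule nth_equalityI) (auto simp: leglist_def T_def ll diagram_cells)
      \<comment> \<open>The entry 0 occurs in the content but not in \<open>L\<close>. It is left
        over for the arm and stands first there, so the leg entries lie strictly above the corner
        entry in value.\<close>
      have a0: "a ! 0 = 0"
      proof -
        have "0 \<in># M" using mem[of 0] len L fin M by (metis union_iff finite_set_mset_mset_set Suc_le_lessD atLeastLessThan_iff mem_Collect_eq not_one_le_zero One_nat_def subsetD)
        then have "0 \<in> set a" unfolding a_def by simp
        then obtain k where "k < length a" "a ! k = 0" by (metis in_set_conv_nth)
        moreover have "sorted a" by (simp add: a_def)
        ultimately show ?thesis using sorted_nth_mono[of a 0 k] by simp
      qed
      have T0: "T (0, 0) = 0" using hd(1)[of T] arm a0 by simp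
      have "T \<in> ?S"
        unfolding ssyt_hook arm leg T0
      proof (intro conjI)
        show "mset a + mset l = content_mset \<nu>" using M by (simp add: a_def l_def flip: sorted_list_of_mset_set)
        show "sorted a" by (simp add: a_def)
        show "sorted_wrt (<) (0 # l)" using L fin by (auto simp: l_def)
      qed (simp add: T_def)
      moreover have "set (leglist T) = L" using leg fin by (simp add: l_def)
      ultimately show "L \<in> (\<lambda>T. set (leglist T)) ` ?S" by blast
    qed
  qed
  then have "card ?S = card ?L" by (rule bij_betw_same_card)
  then show ?thesis by (simp add: kostka_ssyt n_subsets)
qed

end

text \<open>This is the alternating sum of a row of binomial coefficients, padded with zeros since a
  partition of n has at most n parts.\<close>

lemma hook_kostka_sum:
  assumes n: "1 \<le> n" and \<nu>: "\<nu> \<in> partitions_of n"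
  shows "(\<Sum>r<n. (- 1) ^ r * int (kostka (hook_shape n r) \<nu>)) = (if [n] = \<nu> then 1 else 0)"
proof -
  let ?k = "length \<nu> - 1"
  have "(\<Sum>r<n. (- 1) ^ r * int (kostka (hook_shape n r) \<nu>)) = (\<Sum>r<n. (- 1) ^ r * int (?k choose r))"
  proof (rule sum.cong[OF refl])
    fix r assume "r \<in> {..<n}"
    then interpret hook n r by unfold_locales simp
    show "(- 1) ^ r * int (kostka (hook_shape n r) \<nu>) = (- 1) ^ r * int (?k choose r)" using kostka_hook[OF \<nu>] by simp
  qed
  also have "\<dots> = (\<Sum>r\<le>?k. (- 1) ^ r * int (?k choose r))"
    using partition_length[OF \<nu>] n by (intro sum.mono_neutral_right) (auto simp: not_le binomial_eq_0)
  also have "\<dots> = (if ?k = 0 then 1 else 0)"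
    using choose_alternating_sum[of ?k, where ?'a = int] by auto
  also have "\<dots> = (if [n] = \<nu> then 1 else 0)"
    using partition_single[OF \<nu>] partition_ne[OF n \<nu>] n by auto
  finally show ?thesis .
qed

lemma inv_kostka_row:
  assumes n: "1 \<le> n"
  shows "inv_kostka n [n] = (\<lambda>\<mu>. \<Sum>r<n. if hook_shape n r = \<mu> then (- 1) ^ r else 0)"
  unfolding inv_kostka_def
proof (rule the_equality)
  let ?c = "\<lambda>\<mu>. \<Sum>r<n. if hook_shape n r = \<mu> then (- 1) ^ r else (0::int)"
  have off: "?c \<mu> = 0" if "\<mu> \<notin> partitions_of n" for \<mu>
    using that hook_partition by (intro sum.neutral) auto
  have on: "(\<Sum>\<mu>\<in>partitions_of n. ?c \<mu> * int (kostka \<mu> \<nu>)) = (if [n] = \<nu> then 1 else 0)" if \<nu>: "\<nu> \<in> partitions_of n" for \<nu>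
  proof -
    have "(\<Sum>\<mu>\<in>partitions_of n. ?c \<mu> * int (kostka \<mu> \<nu>)) =
       (\<Sum>r<n. \<Sum>\<mu>\<in>partitions_of n. if hook_shape n r = \<mu> then (- 1) ^ r * int (kostka \<mu> \<nu>) else 0)"
      unfolding sum_distrib_right by (subst sum.swap) (intro sum.cong refl, simp)
    also have "\<dots> = (\<Sum>r<n. (- 1) ^ r * int (kostka (hook_shape n r) \<nu>))"
      using hook_partition by (intro sum.cong refl) (simp add: finite_partitions)
    finally show ?thesis using hook_kostka_sum[OF n \<nu>] by simp
  qed
  show *: "(\<forall>\<mu>. \<mu> \<notin> partitions_of n \<longrightarrow> ?c \<mu> = 0) \<and>
    (\<forall>\<nu>\<in>partitions_of n. (\<Sum>\<mu>\<in>partitions_of n. ?c \<mu> * int (kostka \<mu> \<nu>)) = (if [n] = \<nu> then 1 else 0))"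
    using off on by blast
  fix d assume d: "(\<forall>\<mu>. \<mu> \<notin> partitions_of n \<longrightarrow> d \<mu> = 0) \<and>
    (\<forall>\<nu>\<in>partitions_of n. (\<Sum>\<mu>\<in>partitions_of n. d \<mu> * int (kostka \<mu> \<nu>)) = (if [n] = \<nu> then 1 else 0))"
  show "d = ?c" by (rule inv_kostka_unique[of n]) (use d off on in auto)
qed

lemma row_constant_single:
  assumes n: "1 \<le> n" and \<mu>: "\<mu> \<in> partitions_of n"
  shows "row_constant_count [n] \<mu> = (if \<mu> = [n] then 1 else 0)"
proof -
  have D: "diagram [n] = Pair 0 ` {..<n}" by (auto simp: diagram_def)
  let ?R = "{T \<in> fillings [n] \<mu>. \<forall>i j j'. (i, j) \<in> diagram [n] \<and> (i, j') \<in> diagram [n] \<longrightarrow> T (i, j) = T (i, j')}"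
  have const: "T c = T (0, 0)" if "T \<in> ?R" "c \<in> diagram [n]" for T c
    using that n unfolding D by force
  show ?thesis
  proof (cases "\<mu> = [n]")
    case True
    have "?R = {\<lambda>c\<in>diagram [n]. 0}"
    proof (intro equalityI subsetI)
      fix T assume "T \<in> ?R"
      then have "T \<in> diagram [n] \<rightarrow>\<^sub>E {..<1}" using True by (simp add: fillings_def)
      then show "T \<in> {\<lambda>c\<in>diagram [n]. 0}" by (auto simp: fun_eq_iff PiE_def extensional_def Pi_def)
    next
      fix T :: "nat \<times> nat \<Rightarrow> nat" assume "T \<in> {\<lambda>c\<in>diagram [n]. 0}"
      then have T: "T = (\<lambda>c\<in>diagram [n]. 0)" by simp
      have "{c \<in> diagram [n]. T c = 0} = diagram [n]" by (auto simp: T)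
      moreover have "card (diagram [n]) = n" by (simp add: D card_image inj_on_def)
      ultimately have "T \<in> fillings [n] \<mu>" using True by (simp add: fillings_def T)
      then show "T \<in> ?R" by (auto simp: T)
    qed
    then show ?thesis using True by (simp add: row_constant_count_def)
  next
    case False
    have "?R = {}"
    proof (rule ccontr)
      assume "?R \<noteq> {}"
      then obtain T where T: "T \<in> ?R" by blast
      have "k = T (0, 0)" if k: "k < length \<mu>" for k
      proof -
        have "card {c \<in> diagram [n]. T c = k} = \<mu> ! k" using T k by (simp add: fillings_def)
        then have "{c \<in> diagram [n]. T c = k} \<noteq> {}" using partition_pos[OF \<mu> k] by (metis card.empty less_irrefl)
        then obtain c where "c \<in> diagram [n]" "T c = k" by blast
        then show ?thesis using const[OF T] by simp
      qed
      then have "\<not> 1 < length \<mu>" by (metis One_nat_def less_Suc0 less_trans zero_less_one zero_neq_one)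
      then have "length \<mu> = 1" using partition_ne[OF n \<mu>] by simp
      then show False using partition_single[OF \<mu>] False by simp
    qed
    then show ?thesis using False by (simp only: row_constant_count_def card.empty if_False)
  qed
qed

lemma power_sum_trace_hooks:
  assumes n: "1 \<le> n"
  shows "power_sum_trace n [n] h = (\<Sum>r<n. (- 1) ^ r * hook_char n r h)"
proof -
  have P: "[n] \<in> partitions_of n" using hook_partition[of 0 n] n by (simp add: hook_shape_def)
  have "power_sum_trace n [n] h = (\<Sum>\<mu>\<in>partitions_of n. if \<mu> = [n] then monomial_trace n \<mu> h else 0)"
    unfolding power_sum_trace_def using row_constant_single[OF n] by (intro sum.cong refl) simp
  also have "\<dots> = monomial_trace n [n] h" using P finite_partitions by simp
  also have "\<dots> = (\<Sum>\<mu>\<in>partitions_of n. \<Sum>r<n. if hook_shape n r = \<mu> then (- 1) ^ r * hecke_char n \<mu> h else 0)"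
    unfolding monomial_trace_def inv_kostka_row[OF n] of_int_sum sum_distrib_right
    by (intro sum.cong refl) simp
  also have "\<dots> = (\<Sum>r<n. \<Sum>\<mu>\<in>partitions_of n. if hook_shape n r = \<mu> then (- 1) ^ r * hecke_char n \<mu> h else 0)"
    by (rule sum.swap)
  also have "\<dots> = (\<Sum>r<n. (- 1) ^ r * hook_char n r h)"
  proof (rule sum.cong[OF refl])
    fix r assume r: "r \<in> {..<n}"
    then interpret hook n r by unfold_locales simp
    show "(\<Sum>\<mu>\<in>partitions_of n. if hook_shape n r = \<mu> then (- 1) ^ r * hecke_char n \<mu> h else 0) = (- 1) ^ r * hook_char n r h"
      using hook_partition[OF rn] by (simp add: finite_partitions hecke_char_hook)
  qed
  finally show ?thesis .
qed


section \<open>Evaluation of the alternating trace on box sums\<close>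

section \<open>The alternating sum of the hook characters\<close>

text \<open>The value \<open>Suc k\<close> can stand at position \<open>j\<close> only if
  \<open>f j = Suc k\<close>. From there on \<open>f\<close> is constant, so shifting the later
  positions by one costs nothing, and capping at \<open>k\<close> is automatic for the remaining
  values.\<close>

lemma box_cyc:
  assumes f: "hess (Suc k) f" and v: "v \<in> perms k" and j: "j \<in> {1..Suc k}"
  shows "v \<circ> cyc k j \<in> box (Suc k) f \<longleftrightarrow> v \<in> box k (\<lambda>i. min (f i) k) \<and> f j = Suc k"
proof
  have mono: "f i \<le> f i'" if "1 \<le> i" "i \<le> i'" "i' \<le> Suc k" for i i' using f that by (simp add: hess_def)
  have ub: "f i \<le> Suc k" if "i \<in> {1..Suc k}" for i using f that by (simp add: hess_def)
  have vk: "v (Suc k) = Suc k" using v by (simp add: permutes_not_in)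
  have vb: "v i \<le> k" if "i \<in> {1..k}" for i using perms_bounds[OF v, of i] that by simp
  {
    assume b: "v \<circ> cyc k j \<in> box (Suc k) f"
    then have le: "v (cyc k j i) \<le> f i" if "i \<in> {1..Suc k}" for i using that by (simp add: box_def)
    have fj: "f j = Suc k" using le[OF j] vk ub[OF j] by (simp add: cyc_def)
    have "v i \<le> min (f i) k" if i: "i \<in> {1..k}" for i
    proof (cases "i < j")
      case True
      then show ?thesis using le[of i] vb[OF i] i by (simp add: cyc_def)
    next
      case False
      then have "f i = Suc k" using mono[of j i] ub[of i] fj i j by simp
      then show ?thesis using vb[OF i] by simp
    qed
    then show "v \<in> box k (\<lambda>i. min (f i) k) \<and> f j = Suc k" using v fj by (simp add: box_def)
  next
    assume b: "v \<in> box k (\<lambda>i. min (f i) k) \<and> f j = Suc k"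
    have "v (cyc k j i) \<le> f i" if i: "i \<in> {1..Suc k}" for i
    proof (cases "i < j")
      case True
      then have "cyc k j i = i" "i \<in> {1..k}" using i j by (auto simp: cyc_def)
      then show ?thesis using b by (simp add: box_def)
    next
      case False
      then have fi: "f i = Suc k" using mono[of j i] ub[OF i] b i j by simp
      have "v \<circ> cyc k j \<in> perms (Suc k)"
        using bij_betwE[OF cyc_bij[of k]] v j by force
      then show ?thesis using perms_bounds[of "v \<circ> cyc k j" "Suc k" i] i fi by simp
    qed
    moreover have "v \<circ> cyc k j \<in> perms (Suc k)"
      using bij_betwE[OF cyc_bij[of k]] v j by force
    ultimately show "v \<circ> cyc k j \<in> box (Suc k) f" by (simp add: box_def)
  }
qed

lemma box_Suc_sum:
  assumes f: "hess (Suc k) f"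
  shows "(\<Sum>w\<in>box (Suc k) f. F w) =
    (\<Sum>v\<in>box k (\<lambda>i. min (f i) k). \<Sum>j\<in>{j \<in> {1..Suc k}. f j = Suc k}. F (v \<circ> cyc k j))"
proof -
  let ?P = "box k (\<lambda>i. min (f i) k) \<times> {j \<in> {1..Suc k}. f j = Suc k}"
  have sub: "?P \<subseteq> perms k \<times> {1..Suc k}" using box_perms by auto
  have "inj_on (\<lambda>(v, j). v \<circ> cyc k j) ?P"
    using inj_on_subset[OF bij_betw_imp_inj_on[OF cyc_bij] sub] .
  moreover have "(\<lambda>(v, j). v \<circ> cyc k j) ` ?P = box (Suc k) f"
  proof (intro equalityI subsetI)
    fix w assume "w \<in> (\<lambda>(v, j). v \<circ> cyc k j) ` ?P"
    then obtain v j where vj: "(v, j) \<in> ?P" "w = v \<circ> cyc k j" by auto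
    then show "w \<in> box (Suc k) f" using box_cyc[OF f, of v j] sub by blast
  next
    fix w assume w: "w \<in> box (Suc k) f"
    then have "w \<in> perms (Suc k)" using box_perms by blast
    then obtain v j where vj: "v \<in> perms k" "j \<in> {1..Suc k}" "w = v \<circ> cyc k j"
      using bij_betw_imp_surj_on[OF cyc_bij[of k]] by force
    then have "(v, j) \<in> ?P" using box_cyc[OF f vj(1,2)] w by blast
    then show "w \<in> (\<lambda>(v, j). v \<circ> cyc k j) ` ?P" using vj(3) by force
  qed
  ultimately have "(\<Sum>w\<in>box (Suc k) f. F w) = (\<Sum>(v, j)\<in>?P. F (v \<circ> cyc k j))"
    by (subst sum.reindex_cong[of "\<lambda>(v, j). v \<circ> cyc k j" ?P]) (auto simp: case_prod_beta)
  then show ?thesis by (simp add: sum.cartesian_product)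
qed

text \<open>Where \<open>f\<close> is constant every generator acts on the box sum as q, so each
  letter of the run contributes one factor q.\<close>

lemma box_sum_absorb_desc:
  assumes f: "\<And>i. j \<le> i \<Longrightarrow> i < k \<Longrightarrow> f i = f (Suc i)" and j: "1 \<le> j" "j \<le> k"
  shows "hcong k (box_sum k f * mon (rev [j..<k])) (free_const (qvar ^ (k - j)) * box_sum k f)"
  using f j
proof (induction "k - j" arbitrary: j)
  case 0
  then show ?case by (simp add: mon_Nil ideal_zero)
next
  case (Suc m)
  then have j: "j < k" by simp
  have "rev [j..<k] = rev [Suc j..<k] @ [j]" using j by (simp add: upt_conv_Cons)
  then have e: "box_sum k f * mon (rev [j..<k]) = box_sum k f * mon (rev [Suc j..<k]) * mon [j]"
    by (simp only: mon_append mult.assoc)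
  have fj: "mon [j] \<in> free_sub k" using j Suc.prems by (auto intro: free_sub_mon)
  have IH: "hcong k (box_sum k f * mon (rev [Suc j..<k])) (free_const (qvar ^ (k - Suc j)) * box_sum k f)"
    by (rule Suc.hyps(1)) (use Suc j in auto)
  have "hcong k (box_sum k f * mon (rev [j..<k])) (free_const (qvar ^ (k - Suc j)) * box_sum k f * mon [j])"
    unfolding e by (rule hcong_rmult[OF IH fj])
  also have "hcong k (free_const (qvar ^ (k - Suc j)) * box_sum k f * mon [j])
      (free_const (qvar ^ (k - Suc j)) * (free_const qvar * box_sum k f))"
    unfolding mult.assoc using Suc.prems j by (intro hcong_lmult[OF box_sum_absorb] free_sub_const) auto
  also have "free_const (qvar ^ (k - Suc j)) * (free_const qvar * box_sum k f) = free_const (qvar ^ (k - j)) * box_sum k f"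
  proof -
    have "k - j = Suc (k - Suc j)" using j by simp
    then show ?thesis by (simp add: free_const_mult[symmetric] mult.assoc[symmetric] mult.commute)
  qed
  finally show ?case .
qed

context seminormal
begin

lemma br_sum: "br m = (\<Sum>i<m. q ^ i)"
  by (simp add: br_def q_def q_bracket_def hom_sum hom_power)

text \<open>Let \<open>a\<close> be the first position with \<open>f a = Suc k\<close>. The
  geometric sum is [k+1-a], and it supplies the factor missing after the brackets at the positions
  from \<open>a\<close> on are shifted by one. If no position up to \<open>k\<close> qualifies, the
  sum is empty and \<open>f k = k\<close> produces the factor [0] on the right.\<close>

lemma bracket_product:
  assumes f: "hess (Suc k) f" and k: "1 \<le> k"
  shows "(\<Sum>j\<in>{j \<in> {1..k}. f j = Suc k}. q ^ (k - j)) * (\<Prod>j\<in>{1..<k}. br (min (f j) k - j)) =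
    (\<Prod>j\<in>{1..<Suc k}. br (f j - j))"
proof -
  let ?J = "{j \<in> {1..k}. f j = Suc k}"
  have mono: "f i \<le> f i'" if "1 \<le> i" "i \<le> i'" "i' \<le> Suc k" for i i' using f that by (simp add: hess_def)
  have bd: "i \<le> f i" "f i \<le> Suc k" if "i \<in> {1..Suc k}" for i using f that by (simp_all add: hess_def)
  show ?thesis
  proof (cases "?J = {}")
    case True
    then have "f k \<noteq> Suc k" using k by auto
    then have "f k = k" using bd[of k] k by simp
    then have "br (f k - k) = 0" by (simp add: br_sum)
    then have z: "(\<Prod>j\<in>{1..<Suc k}. br (f j - j)) = 0" using k by (intro prod_zero) auto
    show ?thesis unfolding True z by simp
  next
    case False
    define a where "a = Min ?J"
    have a: "a \<in> ?J" unfolding a_def using False by (intro Min_in) auto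
    have amin: "a \<le> j" if "j \<in> ?J" for j unfolding a_def using that by (intro Min_le) auto
    have fa: "f j = Suc k" if "a \<le> j" "j \<le> k" for j using mono[of a j] bd(2)[of j] a that by simp
    have J: "?J = {a..k}" using amin fa a by auto
    have fl: "f j \<le> k" if "1 \<le> j" "j < a" for j
    proof -
      have "j \<notin> ?J" using amin that by fastforce
      then show ?thesis using bd(2)[of j] that a by auto
    qed
    have 1: "(\<Sum>j\<in>?J. q ^ (k - j)) = br (Suc k - a)"
      unfolding J br_sum by (rule sum.reindex_bij_witness[of _ "\<lambda>i. k - i" "\<lambda>j. k - j"]) (use a in auto)
    have s1: "{1..<Suc k} = {1..<a} \<union> {a..k}" and s2: "{1..<k} = {1..<a} \<union> {a..<k}" using a by auto
    have "(\<Prod>j\<in>{a..k}. br (f j - j)) = (\<Prod>j\<in>{a..k}. br (Suc k - j))" using fa by (intro prod.cong) auto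
    also have "\<dots> = br (Suc k - a) * (\<Prod>j\<in>{Suc a..k}. br (Suc k - j))"
      using a by (intro prod.atLeast_Suc_atMost) simp
    also have "(\<Prod>j\<in>{Suc a..k}. br (Suc k - j)) = (\<Prod>j\<in>{a..<k}. br (k - j))"
      by (rule prod.reindex_bij_witness[of _ Suc "\<lambda>j. j - 1"]) auto
    also have "\<dots> = (\<Prod>j\<in>{a..<k}. br (min (f j) k - j))" using fa by (intro prod.cong) auto
    finally have 2: "(\<Prod>j\<in>{a..k}. br (f j - j)) = br (Suc k - a) * (\<Prod>j\<in>{a..<k}. br (min (f j) k - j))" .
    have 3: "(\<Prod>j\<in>{1..<a}. br (f j - j)) = (\<Prod>j\<in>{1..<a}. br (min (f j) k - j))"
      using fl by (intro prod.cong) (auto simp: min_absorb1)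
    have "(\<Prod>j\<in>{1..<Suc k}. br (f j - j)) = (\<Prod>j\<in>{1..<a}. br (f j - j)) * (\<Prod>j\<in>{a..k}. br (f j - j))"
      unfolding s1 by (rule prod.union_disjoint) auto
    also have "\<dots> = br (Suc k - a) * ((\<Prod>j\<in>{1..<a}. br (min (f j) k - j)) * (\<Prod>j\<in>{a..<k}. br (min (f j) k - j)))"
      unfolding 2 3 by (simp only: ac_simps)
    also have "\<dots> = br (Suc k - a) * (\<Prod>j\<in>{1..<k}. br (min (f j) k - j))"
      unfolding s2 by (subst prod.union_disjoint) auto
    finally show ?thesis unfolding 1 by simp
  qed
qed

definition alt_trace :: "nat \<Rightarrow> nat list \<Rightarrow> 'k" where
  "alt_trace n u = (\<Sum>r\<in>{..<n}. (- 1) ^ r * htrace n r u)"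

lemma alt_trace_compat: "hecke_compat m (alt_trace n) {0}"
  unfolding alt_trace_def[abs_def] by (intro hecke_compat_sum htrace_compat)

lemma alt_trace_commute:
  "u \<in> words n \<Longrightarrow> v \<in> words n \<Longrightarrow> alt_trace n (u @ v) = alt_trace n (v @ u)"
  unfolding alt_trace_def by (intro sum.cong refl) (simp only: htrace_commute)

text \<open>Ensures that evaluation at -1 involves no coefficient beyond index \<open>n - 1\<close>,
  the largest leg length.\<close>

lemma degree_se: "degree (fst (se q I m)) \<le> m \<and> degree (snd (se q I m)) \<le> Suc m"
proof (induction m)
  case (Suc m)
  let ?S = "fst (se q I m)" and ?E = "snd (se q I m)"
  have "degree (Polynomial.smult q ?S + ?E) \<le> Suc m"
    using Suc degree_smult_le[of q ?S] by (intro degree_add_le) auto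
  moreover have "degree (pCons 0 ?E) \<le> Suc (Suc m)"
    using Suc degree_pCons_le[of 0 ?E] by simp
  moreover have d: "degree (?S + pCons 0 ?S) \<le> Suc m"
    using Suc degree_pCons_le[of 0 ?S] by (intro degree_add_le) auto
  moreover have "degree (pCons 0 (?S + pCons 0 ?S)) \<le> Suc (Suc m)"
    using d degree_pCons_le[of 0 "?S + pCons 0 ?S"] by simp
  ultimately show ?case
    by (cases "Suc m \<in> I") (simp_all only: se.simps Let_def if_True if_False simp_thms fst_conv snd_conv degree_minus)
qed simp

text \<open>Every missing letter contributes the factor 1 + t, which vanishes at t = -1. Along the
  full product E keeps the value 1, and S follows the recursion [m+2] = q [m+1] + 1.\<close>

lemma se_at_minus_one:
  "poly (fst (se q I m)) (- 1) = (if {1..m} \<subseteq> I then br (Suc m) else 0) \<and>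
   poly (snd (se q I m)) (- 1) = (if {1..m} \<subseteq> I then 1 else 0)"
proof (induction m)
  case (Suc m)
  have e: "{1..Suc m} = insert (Suc m) {1..m}" by auto
  have "{1..Suc m} \<subseteq> I \<longleftrightarrow> {1..m} \<subseteq> I \<and> Suc m \<in> I" unfolding e by blast
  then show ?case using Suc br_Suc[of "Suc m"] by (simp add: Let_def)
qed simp

lemma alt_trace_subword:
  assumes n: "1 \<le> n"
  shows "alt_trace n (subword I n) = (if {1..<n} \<subseteq> I then br n else 0)"
proof -
  let ?p = "fst (se q I (n - 1))"
  have deg: "degree ?p < n" using degree_se[of I "n - 1"] n by linarith
  have "poly ?p (- 1) = (\<Sum>r\<le>degree ?p. coeff ?p r * (- 1) ^ r)" by (rule poly_altdef)
  also have "\<dots> = (\<Sum>r\<in>{..<n}. coeff ?p r * (- 1) ^ r)"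
    using deg by (intro sum.mono_neutral_left) (auto simp: coeff_eq_0)
  also have "\<dots> = alt_trace n (subword I n)"
    unfolding alt_trace_def htrace_subword[OF n] by (simp add: mult.commute)
  finally have e: "poly ?p (- 1) = alt_trace n (subword I n)" .
  have "{1..<n} = {1..n - 1}" "Suc (n - 1) = n" using n by auto
  then show ?thesis using se_at_minus_one[of I "n - 1"] unfolding e by simp
qed

text \<open>Increasing products of generators below \<open>k\<close> omit the letter
  \<open>k\<close>, and the alternating trace vanishes on them.\<close>

lemma alt_trace_parabolic:
  assumes k: "1 \<le> k" and x: "x \<in> words k"
  shows "alt_trace (Suc k) x = 0"
proof -
  have "alt_trace (Suc k) (x @ []) \<in> {0}"
  proof (rule trace_principle[OF submod_zero alt_trace_compat _ k _ x, of "Suc k"])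
    fix v y assume v: "v \<in> words (Suc k)" "y \<in> words (Suc k - 1)"
    then have "y \<in> words (Suc k)" using words_mono diff_le_self by blast
    then show "alt_trace (Suc k) (v @ y) - alt_trace (Suc k) (y @ v) \<in> {0}" using alt_trace_commute[OF v(1)] by simp
  next
    fix I
    have "subword I k = subword (I - {k}) (Suc k)"
      using k by (auto intro: filter_cong)
    moreover have "\<not> {1..<Suc k} \<subseteq> I - {k}" using k by auto
    ultimately show "alt_trace (Suc k) (subword I k @ []) \<in> {0}"
      using alt_trace_subword[of "Suc k" "I - {k}"] by simp
  qed auto
  then show ?thesis by simp
qed

text \<open>It suffices to compare increasing products, where both sides are [k] [k+1] for the full
  product and 0 otherwise.\<close>

lemma alt_trace_snoc:
  assumes k: "1 \<le> k" and x: "x \<in> words k"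
  shows "br k * alt_trace (Suc k) (x @ [k]) = br (Suc k) * alt_trace k x"
proof -
  let ?p = "\<lambda>u. br k * alt_trace (Suc k) ([] @ u @ [k]) + (- br (Suc k)) * alt_trace k u"
  have c: "hecke_compat k ?p {0}"
  proof (intro hecke_compat_lin alt_trace_compat)
    have "hecke_compat (Suc k) (\<lambda>u. alt_trace (Suc k) ([] @ u @ [k])) {0}"
      by (rule compat_context[OF alt_trace_compat]) (use k in auto)
    then show "hecke_compat k (\<lambda>u. alt_trace (Suc k) ([] @ u @ [k])) {0}" by (rule compat_mono) simp
  qed
  have "?p (x @ []) \<in> {0}"
  proof (rule trace_principle[OF submod_zero c _ k order_refl x])
    \<comment> \<open>The letters of \<open>y\<close> are at most k - 2 and commute with T_k, so
      \<open>y\<close> can be moved past it to the end of the word and then to the front by the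
      trace property.\<close>
    fix v y assume v: "v \<in> words k" and y: "y \<in> words (k - 1)"
    have yk: "y \<in> words k" using y words_mono diff_le_self by blast
    have v': "v \<in> words (Suc k)" and y': "y \<in> words (Suc k)" using v yk words_mono lessI less_imp_le_nat by blast+
    have kw: "[k] \<in> words (Suc k)" using k by simp
    have far: "Suc i < j \<or> Suc j < i" if "i \<in> set [k]" "j \<in> set y" for i j
    proof -
      have "j \<in> {1..<k - 1}" using that(2) y by (auto simp: lists_eq_set)
      then have "Suc j < k" by auto
      then show ?thesis using that(1) by simp
    qed
    have "alt_trace (Suc k) (v @ y @ [k] @ []) - alt_trace (Suc k) (v @ [k] @ y @ []) \<in> {0}"
      by (rule comm_words[OF submod_zero alt_trace_compat v' _ kw y' far]) simp
    then have "alt_trace (Suc k) (v @ y @ [k]) = alt_trace (Suc k) ((v @ [k]) @ y)" by simp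
    also have "\<dots> = alt_trace (Suc k) (y @ v @ [k])"
      by (rule alt_trace_commute) (use v' y' kw in auto)
    finally have "alt_trace (Suc k) ((v @ y) @ [k]) = alt_trace (Suc k) ((y @ v) @ [k])" by simp
    then show "?p (v @ y) - ?p (y @ v) \<in> {0}" using alt_trace_commute[OF v yk] by simp
  next
    fix I
    have w: "subword I k @ [k] = subword (insert k I) (Suc k)"
      using k by (auto intro: filter_cong)
    have "{1..<Suc k} \<subseteq> insert k I \<longleftrightarrow> {1..<k} \<subseteq> I" by (auto simp: less_Suc_eq)
    then have "alt_trace (Suc k) (subword I k @ [k]) = (if {1..<k} \<subseteq> I then br (Suc k) else 0)"
      using alt_trace_subword[of "Suc k" "insert k I"] unfolding w by simp
    then show "?p (subword I k @ []) \<in> {0}" using alt_trace_subword[OF k, of I] by simp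
  qed simp
  then show ?thesis by simp
qed

text \<open>The tail of the run after the letter \<open>k\<close> lies in the smaller algebra: the
  trace property moves it to the front, \<open>alt_trace_snoc\<close> removes \<open>k\<close>, and
  the trace property of the smaller algebra moves it back.\<close>

lemma alt_trace_cyc:
  assumes k: "1 \<le> k" and u: "u \<in> words k" and j: "1 \<le> j" "j \<le> k"
  shows "br k * alt_trace (Suc k) (u @ rev [j..<Suc k]) = br (Suc k) * alt_trace k (u @ rev [j..<k])"
proof -
  have d: "rev [j..<k] \<in> words k" using j by (auto simp: lists_eq_set)
  have w: "u \<in> words (Suc k)" "rev [j..<k] \<in> words (Suc k)" "[k] \<in> words (Suc k)"
    using words_mono[OF u, of "Suc k"] words_mono[OF d, of "Suc k"] k by auto
  have "u @ rev [j..<Suc k] = (u @ [k]) @ rev [j..<k]" using j by simp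
  then have "alt_trace (Suc k) (u @ rev [j..<Suc k]) = alt_trace (Suc k) (rev [j..<k] @ u @ [k])"
    using alt_trace_commute[of "u @ [k]" "Suc k" "rev [j..<k]"] w by simp
  then have "br k * alt_trace (Suc k) (u @ rev [j..<Suc k]) = br (Suc k) * alt_trace k (rev [j..<k] @ u)"
    using alt_trace_snoc[OF k, of "rev [j..<k] @ u"] u d by simp
  then show ?thesis using alt_trace_commute[OF u d] by simp
qed

lemma alt_trace_cong: "hcong n x y \<Longrightarrow> lext (alt_trace n) x = lext (alt_trace n) y"
  using lext_ideal[OF submod_zero alt_trace_compat, of "x - y" n n] by (simp add: lext_diff)

lemma alt_trace_rword: "reduced_word n w u \<Longrightarrow> alt_trace n (rword n w) = alt_trace n u"
  using alt_trace_cong[OF matsumoto[OF rword], of w n u] reduced_wordD(4)[of n w u] by (simp add: lext_mon)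

lemma alt_trace_box:
  "1 \<le> n \<Longrightarrow> hess n f \<Longrightarrow> lext (alt_trace n) (box_sum n f) = br n * (\<Prod>j\<in>{1..<n}. br (f j - j))"
proof (induction n arbitrary: f rule: nat_induct_at_least)
  case base
  then have "box 1 f = {id}" by (intro box_trivial) (auto simp: hess_def)
  moreover have "alt_trace 1 (subword {} 1) = br 1" using alt_trace_subword[of 1 "{}"] by simp
  ultimately show ?case by (simp add: box_sum_def rword_id lext_mon)
next
  case (Suc k)
  note k = Suc.hyps and f = Suc.prems
  let ?f = "\<lambda>i. min (f i) k" and ?J = "{j \<in> {1..Suc k}. f j = Suc k}" and ?J' = "{j \<in> {1..k}. f j = Suc k}"
  have ub: "f i \<le> Suc k" if "i \<in> {1..Suc k}" for i using f that by (simp add: hess_def)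
  have mono: "f i \<le> f i'" if "1 \<le> i" "i \<le> i'" "i' \<le> Suc k" for i i' using f that by (simp add: hess_def)
  have f': "hess k ?f"
    unfolding hess_def using f mono by (auto simp: hess_def intro!: min.coboundedI1)
  have top: "f (Suc k) = Suc k" using f by (auto simp: hess_def intro: antisym)
  have J: "?J = insert (Suc k) ?J'" using top by (auto simp: le_Suc_eq)
  \<comment> \<open>The run for \<open>j = Suc k\<close> is empty and contributes 0 by
    \<open>alt_trace_parabolic\<close>. In every other run the letter \<open>k\<close> is traded for
    the two brackets.\<close>
  have step: "br k * (\<Sum>j\<in>?J. alt_trace (Suc k) (rword (Suc k) (v \<circ> cyc k j))) =
      br (Suc k) * (\<Sum>j\<in>?J'. alt_trace k (rword k v @ rev [j..<k]))" if v: "v \<in> box k ?f" for v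
  proof -
    have vp: "v \<in> perms k" using v box_perms by blast
    have u: "rword k v \<in> words k" by (rule rword_words[OF vp])
    have red: "alt_trace (Suc k) (rword (Suc k) (v \<circ> cyc k j)) = alt_trace (Suc k) (rword k v @ rev [j..<Suc k])"
      if "1 \<le> j" "j \<le> Suc k" for j
      by (rule alt_trace_rword[OF reduced_word_cyc[OF rword[OF vp] that]])
    have "(\<Sum>j\<in>?J. alt_trace (Suc k) (rword (Suc k) (v \<circ> cyc k j))) =
       alt_trace (Suc k) (rword (Suc k) (v \<circ> cyc k (Suc k))) + (\<Sum>j\<in>?J'. alt_trace (Suc k) (rword (Suc k) (v \<circ> cyc k j)))"
      unfolding J by (rule sum.insert) auto
    also have "alt_trace (Suc k) (rword (Suc k) (v \<circ> cyc k (Suc k))) = 0"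
      using red[of "Suc k"] alt_trace_parabolic[OF k u] by simp
    finally have "br k * (\<Sum>j\<in>?J. alt_trace (Suc k) (rword (Suc k) (v \<circ> cyc k j))) =
       (\<Sum>j\<in>?J'. br k * alt_trace (Suc k) (rword (Suc k) (v \<circ> cyc k j)))"
      by (simp only: add_0_left sum_distrib_left)
    also have "\<dots> = (\<Sum>j\<in>?J'. br (Suc k) * alt_trace k (rword k v @ rev [j..<k]))"
    proof (rule sum.cong[OF refl])
      fix j assume "j \<in> ?J'"
      then have j: "1 \<le> j" "j \<le> k" by auto
      then show "br k * alt_trace (Suc k) (rword (Suc k) (v \<circ> cyc k j)) = br (Suc k) * alt_trace k (rword k v @ rev [j..<k])"
        using red[of j] alt_trace_cyc[OF k u j] by simp
    qed
    finally show ?thesis by (simp add: sum_distrib_left)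
  qed
  \<comment> \<open>From position \<open>j\<close> to \<open>k\<close> the capped function has the
    constant value \<open>k\<close>, so the smaller box sum absorbs the rest of the run as a power
    of q.\<close>
  have col: "(\<Sum>v\<in>box k ?f. alt_trace k (rword k v @ rev [j..<k])) = q ^ (k - j) * lext (alt_trace k) (box_sum k ?f)"
    if j: "j \<in> ?J'" for j
  proof -
    have "?f i = ?f (Suc i)" if "j \<le> i" "i < k" for i
      using mono[of j i] mono[of j "Suc i"] j that by simp
    then have "hcong k (box_sum k ?f * mon (rev [j..<k])) (free_const (qvar ^ (k - j)) * box_sum k ?f)"
      using j by (intro box_sum_absorb_desc) auto
    then have "lext (alt_trace k) (box_sum k ?f * mon (rev [j..<k])) = lext (alt_trace k) (free_const (qvar ^ (k - j)) * box_sum k ?f)"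
      by (rule alt_trace_cong)
    also have "\<dots> = q ^ (k - j) * lext (alt_trace k) (box_sum k ?f)" by (simp add: lext_const_mult hom_power q_def)
    finally show ?thesis by (simp add: box_sum_def sum_distrib_right mon_append[symmetric] lext_sum lext_mon)
  qed
  have "br k * lext (alt_trace (Suc k)) (box_sum (Suc k) f) =
     (\<Sum>v\<in>box k ?f. br k * (\<Sum>j\<in>?J. alt_trace (Suc k) (rword (Suc k) (v \<circ> cyc k j))))"
    by (simp only: box_sum_def lext_sum lext_mon box_Suc_sum[OF f] sum_distrib_left)
  also have "\<dots> = (\<Sum>v\<in>box k ?f. br (Suc k) * (\<Sum>j\<in>?J'. alt_trace k (rword k v @ rev [j..<k])))"
    using step by (intro sum.cong refl) simp
  also have "\<dots> = br (Suc k) * (\<Sum>j\<in>?J'. \<Sum>v\<in>box k ?f. alt_trace k (rword k v @ rev [j..<k]))"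
    unfolding sum_distrib_left[symmetric] by (subst sum.swap) (rule refl)
  also have "\<dots> = br (Suc k) * (\<Sum>j\<in>?J'. q ^ (k - j) * lext (alt_trace k) (box_sum k ?f))"
    using col by simp
  also have "\<dots> = br (Suc k) * ((\<Sum>j\<in>?J'. q ^ (k - j)) * lext (alt_trace k) (box_sum k ?f))"
    by (simp only: sum_distrib_right)
  also have "\<dots> = br k * (br (Suc k) * ((\<Sum>j\<in>?J'. q ^ (k - j)) * (\<Prod>j\<in>{1..<k}. br (?f j - j))))"
    unfolding Suc.IH[OF f'] by (simp only: ac_simps)
  also have "\<dots> = br k * (br (Suc k) * (\<Prod>j\<in>{1..<Suc k}. br (f j - j)))"
    unfolding bracket_product[OF f k] ..
  finally show ?case using br_nz[OF k] by simp
qed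

end

theorem proposition9p5:
  fixes n :: nat and w f :: "nat \<Rightarrow> nat"
  assumes "n \<ge> 1"
    and "w permutes {1..n}"
    and "avoids_312 n w"
    and "\<And>j. j \<in> {1..n} \<Longrightarrow> f j = Max (w ` {1..j})"
  shows "power_sum_trace n [n]
           (hecke_smult n (qhalf (int (perm_len n w))) (KL_basis n w))
         = q_bracket n * (\<Prod>j\<in>{1..<n}. q_bracket (f j - j))"
proof -
  interpret avoiding n w f by unfold_locales (use assms in auto)
  let ?h = "hecke_class n (box_sum n f)"
  \<comment> \<open>The computation takes place in the fraction field, where the seminormal traces
    live; injectivity of \<open>frac\<close> brings it back at the end.\<close>
  have "frac (power_sum_trace n [n] ?h) = frac (\<Sum>r<n. (- 1) ^ r * hook_char n r ?h)"
    by (simp only: power_sum_trace_hooks[OF assms(1)])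
  also have "\<dots> = (\<Sum>r<n. frac ((- 1) ^ r) * sn.htr n r (box_sum n f))"
    by (simp only: sn.hom_sum sn.hom_mult frac_hook_char[OF assms(1) box_sum_sub])
  also have "\<dots> = (\<Sum>r<n. (- 1) ^ r * sn.htr n r (box_sum n f))"
    by (simp only: sn.hom_power sn.hom_uminus sn.hom_1)
  also have "\<dots> = sn.lext (sn.alt_trace n) (box_sum n f)"
    unfolding sn.alt_trace_def[abs_def] sn.htr_lext sn.lext_def sum_distrib_left
    by (subst sum.swap) (simp only: mult.left_commute)
  also have "\<dots> = sn.br n * (\<Prod>j\<in>{1..<n}. sn.br (f j - j))"
    by (rule sn.alt_trace_box[OF assms(1) hess_f])
  also have "\<dots> = frac (q_bracket n * (\<Prod>j\<in>{1..<n}. q_bracket (f j - j)))"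
  proof -
    have "(\<Prod>j\<in>S. frac (g j)) = frac (\<Prod>j\<in>S. g j)" for S :: "nat set" and g
      by (induction S rule: infinite_finite_induct) (simp_all add: sn.hom_1)
    then show ?thesis unfolding sn.br_def sn.hom_mult by simp
  qed
  finally show ?thesis unfolding KL_basis_box frac_eq_iff .
qed

end
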